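(* Let $\Omega\subset\mathbb R^3$ be an arbitrary (possibly unbounded) open set. Coefficients: let $a_0,a_1\in]0,\infty[$ and $a_{ij}=a_{ji}\in L^\infty(\Omega)$ ($i,j=1,2,3$) satisfy $a_0|\xi|^2\le\sum_{i,j=1}^3a_{ij}(x)\xi_i\xi_j\le a_1|\xi|^2$ for all $\xi\in\mathbb R^3$ and a.e. $x\in\Omega$; put $A(x)=(a_{ij}(x))_{i,j}$. Let $\beta\colon\Omega\to\mathbb R$ be measurable such that (a) for every $\nu>0$ there is $C_\nu>0$ with $\int_\Omega|\beta||u|^2\,dx\le\nu\int_\Omega|\nabla u|^2\,dx+C_\nu\int_\Omega|u|^2\,dx$ for all $u\in H^1_0(\Omega)$; (b) there is $\lambda_1>0$ with $\int_\Omega A\nabla u\cdot\nabla u\,dx+\int_\Omega\beta|u|^2\,dx\ge\lambda_1\int_\Omega|u|^2\,dx$ for all $u\in H^1_0(\Omega)$. Nonlinearity: let $f\colon\Omega\times\mathbb R\to\mathbb R$ be such that $f(\cdot,u)$ is measurable for every $u\in\mathbb R$, $f(\cdot,0)\in L^2(\Omega)$, for a.e. $x\in\Omega$ the function $f(x,\cdot)$ is of class $C^2$, $\partial_uf(\cdot,0)\in L^\infty(\Omega)$, $\partial_{uu}f(\cdot,0)\in L^\infty(\Omega)$, and there is a constant $C>0$ such that $|\partial_{uu}f(x,u_1)-\partial_{uu}f(x,u_2)|\le C|u_1-u_2|$ for a.e. $x\in\Omega$ and all $u_1,u_2\in\mathbb R$. With $F(x,u):=\int_0^uf(x,s)\,ds$,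 assume moreover that there are $\mu>0$ and $c(\cdot)\in L^2(\Omega)$ such that $f(x,u)u-\mu F(x,u)\le c(x)$ and $F(x,u)\le c(x)$ for $(x,u)\in\Omega\times\mathbb R$. For $\epsilon\in]0,1]$ let $\mathcal A_\epsilon\subset H^1_0(\Omega)\times L^2(\Omega)$ be the compact global attractor of the damped wave equation with parameter $\epsilon$, let $\tilde{\mathcal A}\subset D(\mathbf A)$ be the compact global attractor of the limiting parabolic equation, and let $\mathcal A_0:=\{(u,-\mathbf Au+\hat f(u)) : u\in\tilde{\mathcal A}\}$ (all as described in the context). Then the family $(\mathcal A_\epsilon)_{\epsilon\in[0,1]}$ is upper semicontinuous at $\epsilon=0$ with respect to the topology of $H^1_0(\Omega)\times L^2(\Omega)$, i.e. $$\lim_{\epsilon\to0}\ \sup_{y\in\mathcal A_\epsilon}\ \inf_{z\in\mathcal A_0}\|y-z\|_{H^1_0\times L^2}=0.$$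
   Context: Spaces and operators. $H^1_0(\Omega)$ carries the scalar product $\langle u,v\rangle_{H^1_0}=\int_\Omega A\nabla u\cdot\nabla v\,dx+\int_\Omega\beta uv\,dx$ (equivalent to the usual one). $\mathbf A$ is the positive selfadjoint operator on $L^2(\Omega)$ defined by this form (i.e. by $u\mapsto\beta u-\sum_{ij}(a_{ij}u_{x_j})_{x_i}$); $D(\mathbf A)$ carries the norm $\|\mathbf Au\|_{L^2}$. $Z_0=H^1_0(\Omega)\times L^2(\Omega)$; the operator $\mathbf B_{\epsilon,0}(u,v)=(v,-(1/\epsilon)(v+\mathbf Au))$ with domain $D(\mathbf A)\times H^1_0(\Omega)$ generates a $C^0$-semigroup $\mathbf T_{\epsilon,0}(t)$ on $Z_0$. $\hat f(u)(x):=f(x,u(x))$; $\hat f$ maps $H^1_0(\Omega)$ into $L^2(\Omega)$ and is $C^1$. Damped wave equation with parameter $\epsilon\in]0,1]$: $\epsilon u_{tt}+u_t+\beta(x)u-\sum_{ij}(a_{ij}(x)u_{x_j})_{x_i}=f(x,u)$ in $\Omega$, $u=0$ on $\partial\Omega$, in the mild form $(u(t),v(t))=\mathbf T_{\epsilon,0}(t)(u_0,v_0)+\int_0^t\mathbf T_{\epsilon,0}(t-p)(0,(1/\epsilon)\hat f(u(p)))\,dp$ in $Z_0$. Limiting parabolic equation: $u_t+\beta(x)u-\sum_{ij}(a_{ij}(x)u_{x_j})_{x_i}=f(x,u)$ in $\Omega$, $u=0$ on $\partial\Omega$, in the mild form $u(t)=e^{-\mathbf At}u_0+\int_0^te^{-\mathbf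 A(t-s)}\hat f(u(s))\,ds$ in $H^1_0(\Omega)$. Facts recalled from earlier work and taken as given as part of the setting: for every $\epsilon\in]0,1]$ the damped wave equation generates a global semiflow on $H^1_0(\Omega)\times L^2(\Omega)$ possessing a compact global attractor $\mathcal A_\epsilon$, and there is $R>0$ with $\sup_{\epsilon\in]0,1]}\sup\{\|u\|_{H^1_0}^2+\epsilon\|v\|_{L^2}^2 : (u,v)\in\mathcal A_\epsilon\}\le R$; the parabolic equation generates a global semiflow on $H^1_0(\Omega)$ possessing a compact global attractor $\tilde{\mathcal A}$, and $\tilde{\mathcal A}\subset D(\mathbf A)$ is compact in $D(\mathbf A)$. A compact global attractor is a compact set, invariant under the semiflow, that attracts every bounded set of the phase space. *)

theory Defs
  imports "HOL-Analysis.Analysis"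
begin

section \<open>Lebesgue spaces\<close>

definition sq_integrable :: "'a measure \<Rightarrow> ('a \<Rightarrow> real) \<Rightarrow> bool" where
  "sq_integrable M g \<longleftrightarrow> g \<in> borel_measurable M \<and> integrable M (\<lambda>x. (g x)\<^sup>2)"

definition ess_bounded :: "'a measure \<Rightarrow> ('a \<Rightarrow> real) \<Rightarrow> bool" where
  "ess_bounded M g \<longleftrightarrow> g \<in> borel_measurable M \<and> (\<exists>K. AE x in M. \<bar>g x\<bar> \<le> K)"

lemma sq_integrable_mult:
  assumes "sq_integrable M f" "sq_integrable M g"
  shows "integrable M (\<lambda>x. f x * g x)"
proof (rule Bochner_Integration.integrable_bound)
  show "integrable M (\<lambda>x. (f x)\<^sup>2 + (g x)\<^sup>2)"
    using assms by (simp add: sq_integrable_def)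
  show "(\<lambda>x. f x * g x) \<in> borel_measurable M"
    using assms by (auto simp: sq_integrable_def)
  have "\<bar>a * b\<bar> \<le> a\<^sup>2 + b\<^sup>2" for a b :: real
  proof -
    have "2 * (\<bar>a\<bar> * \<bar>b\<bar>) \<le> a\<^sup>2 + b\<^sup>2"
      using sum_squares_bound[of "\<bar>a\<bar>" "\<bar>b\<bar>"] by simp
    moreover have "0 \<le> \<bar>a\<bar> * \<bar>b\<bar>" by simp
    ultimately show ?thesis unfolding abs_mult by linarith
  qed
  then show "AE x in M. norm (f x * g x) \<le> norm ((f x)\<^sup>2 + (g x)\<^sup>2)"
    by simp
qed

lemma sq_integrable_add:
  assumes "sq_integrable M f" "sq_integrable M g"
  shows "sq_integrable M (\<lambda>x. f x + g x)"
  using assms sq_integrable_mult[OF assms]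
  by (auto simp: sq_integrable_def power2_sum mult.assoc)

lemma sq_integrable_cmult: "sq_integrable M f \<Longrightarrow> sq_integrable M (\<lambda>x. c * f x)"
  by (auto simp: sq_integrable_def power_mult_distrib)

lemma sq_integrable_uminus: "sq_integrable M f \<Longrightarrow> sq_integrable M (\<lambda>x. - f x)"
  by (simp add: sq_integrable_def)

lemma sq_integrable_diff:
  assumes "sq_integrable M f" "sq_integrable M g"
  shows "sq_integrable M (\<lambda>x. f x - g x)"
  using sq_integrable_add[OF assms(1) sq_integrable_uminus[OF assms(2)]] by simp

lemma sq_integrable_zero: "sq_integrable M (\<lambda>x. 0)"
  by (simp add: sq_integrable_def)

definition L2_rel :: "(real^3 \<Rightarrow> real) \<Rightarrow> (real^3 \<Rightarrow> real) \<Rightarrow> bool" where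
  "L2_rel f g \<longleftrightarrow> sq_integrable lebesgue f \<and> sq_integrable lebesgue g \<and>
     (AE x in lebesgue. f x = g x)"

text \<open>\<open>L2\<close> is the space of classes of square integrable functions on the whole of
  three-dimensional space. For a function \<open>g\<close> that is not square integrable, \<open>abs_L2 g\<close> has no
  meaning; \<open>rep_L2 u\<close> is some representative of the class \<open>u\<close>.\<close>

quotient_type L2 = "real^3 \<Rightarrow> real" / partial: L2_rel
proof (rule part_equivpI)
  show "\<exists>f. L2_rel f f"
    by (rule exI[of _ "\<lambda>x. 0"]) (simp add: L2_rel_def sq_integrable_zero)
  show "symp L2_rel"
    by (rule sympI) (auto simp: L2_rel_def)
  show "transp L2_rel"
  proof (rule transpI)
    fix f g h assume "L2_rel f g" "L2_rel g h"
    moreover from this have "AE x in lebesgue. f x = g x" "AE x in lebesgue. g x = h x"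
      by (auto simp: L2_rel_def)
    then have "AE x in lebesgue. f x = h x" by eventually_elim simp
    ultimately show "L2_rel f h" by (simp add: L2_rel_def)
  qed
qed

instantiation L2 :: real_inner
begin

lift_definition zero_L2 :: L2 is "\<lambda>x. 0"
  by (simp add: L2_rel_def sq_integrable_zero)

lift_definition plus_L2 :: "L2 \<Rightarrow> L2 \<Rightarrow> L2" is "\<lambda>f g x. f x + g x"
  unfolding L2_rel_def by (auto intro: sq_integrable_add elim!: eventually_elim2)

lift_definition minus_L2 :: "L2 \<Rightarrow> L2 \<Rightarrow> L2" is "\<lambda>f g x. f x - g x"
  unfolding L2_rel_def by (auto intro: sq_integrable_diff elim!: eventually_elim2)

lift_definition uminus_L2 :: "L2 \<Rightarrow> L2" is "\<lambda>f x. - f x"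
  unfolding L2_rel_def by (auto intro: sq_integrable_uminus)

lift_definition scaleR_L2 :: "real \<Rightarrow> L2 \<Rightarrow> L2" is "\<lambda>c f x. c * f x"
  unfolding L2_rel_def by (auto intro: sq_integrable_cmult)

lift_definition inner_L2 :: "L2 \<Rightarrow> L2 \<Rightarrow> real" is "\<lambda>f g. \<integral>x. f x * g x \<partial>lebesgue"
proof -
  fix f f' g g' assume A: "L2_rel f f'" "L2_rel g g'"
  then have "AE x in lebesgue. f x = f' x" "AE x in lebesgue. g x = g' x"
    by (auto simp: L2_rel_def)
  then have "AE x in lebesgue. f x * g x = f' x * g' x"
    by eventually_elim simp
  moreover have "integrable lebesgue (\<lambda>x. f x * g x)" "integrable lebesgue (\<lambda>x. f' x * g' x)"
    using A by (auto simp: L2_rel_def intro: sq_integrable_mult)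
  ultimately show "(\<integral>x. f x * g x \<partial>lebesgue) = (\<integral>x. f' x * g' x \<partial>lebesgue)"
    by (intro integral_cong_AE) auto
qed

definition norm_L2 :: "L2 \<Rightarrow> real" where "norm_L2 u = sqrt (inner u u)"
definition dist_L2 :: "L2 \<Rightarrow> L2 \<Rightarrow> real" where "dist_L2 u v = norm (u - v)"
definition sgn_L2 :: "L2 \<Rightarrow> L2" where "sgn_L2 u = inverse (norm u) *\<^sub>R u"
definition uniformity_L2 :: "(L2 \<times> L2) filter" where
  "uniformity_L2 = (INF e\<in>{0 <..}. principal {(x, y). dist x y < e})"
definition open_L2 :: "L2 set \<Rightarrow> bool" where
  "open_L2 U \<longleftrightarrow> (\<forall>x\<in>U. eventually (\<lambda>(x', y). x' = x \<longrightarrow> y \<in> U) uniformity)"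

instance
proof
  fix u v w :: L2 and a b :: real
  show "u + v + w = u + (v + w)"
    by transfer (simp add: L2_rel_def sq_integrable_add add.assoc)
  show "u + v = v + u"
    by transfer (simp add: L2_rel_def sq_integrable_add add.commute)
  show "0 + u = u"
    by transfer (simp add: L2_rel_def)
  show "- u + u = 0"
    by transfer (simp add: L2_rel_def sq_integrable_zero)
  show "u - v = u + - v"
    by transfer (simp add: L2_rel_def sq_integrable_diff)
  show "a *\<^sub>R (u + v) = a *\<^sub>R u + a *\<^sub>R v"
    by transfer (simp add: L2_rel_def distrib_left sq_integrable_add sq_integrable_cmult)
  show "(a + b) *\<^sub>R u = a *\<^sub>R u + b *\<^sub>R u"
    by transfer (simp add: L2_rel_def distrib_right sq_integrable_add sq_integrable_cmult)
  show "a *\<^sub>R b *\<^sub>R u = (a * b) *\<^sub>R u"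
    by transfer (simp add: L2_rel_def mult.assoc sq_integrable_cmult)
  show "1 *\<^sub>R u = u"
    by transfer (simp add: L2_rel_def)
  show "inner u v = inner v u"
    by transfer (simp add: mult.commute)
  show "inner (u + v) w = inner u w + inner v w"
    by transfer (simp add: L2_rel_def distrib_right sq_integrable_mult)
  show "inner (a *\<^sub>R u) v = a * inner u v"
    by transfer (simp add: mult.assoc)
  show "0 \<le> inner u u"
    by transfer simp
  show "(inner u u = 0) = (u = 0)"
  proof transfer
    fix f assume f: "L2_rel f f"
    then have "((\<integral>x. f x * f x \<partial>lebesgue) = 0) = (AE x in lebesgue. f x * f x = 0)"
      by (intro integral_nonneg_eq_0_iff_AE) (auto simp: L2_rel_def intro: sq_integrable_mult)
    then show "((\<integral>x. f x * f x \<partial>lebesgue) = 0) = L2_rel f (\<lambda>x. 0)"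
      using f by (simp add: L2_rel_def sq_integrable_zero)
  qed
qed (simp_all add: norm_L2_def dist_L2_def sgn_L2_def uniformity_L2_def open_L2_def)

end

lemma rep_L2_sq_integrable: "sq_integrable lebesgue (rep_L2 u)"
  using Quotient3_rep_reflp[OF Quotient3_L2, of u] by (simp add: L2_rel_def)

lemma abs_L2_eq_iff:
  assumes "sq_integrable lebesgue f" "sq_integrable lebesgue g"
  shows "abs_L2 f = abs_L2 g \<longleftrightarrow> (AE x in lebesgue. f x = g x)"
  using Quotient3_rel[OF Quotient3_L2, of f g] assms by (simp add: L2_rel_def)

lemma abs_rep_L2: "abs_L2 (rep_L2 u) = u"
  by (rule Quotient3_abs_rep[OF Quotient3_L2])

lemma rep_abs_L2:
  assumes "sq_integrable lebesgue f"
  shows "AE x in lebesgue. rep_L2 (abs_L2 f) x = f x"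
  using abs_L2_eq_iff[OF rep_L2_sq_integrable[of "abs_L2 f"] assms] by (simp add: abs_rep_L2)

lemma inner_L2_rep: "inner u v = (\<integral>x. rep_L2 u x * rep_L2 v x \<partial>lebesgue)"
  by (simp add: inner_L2_def)

text \<open>The Lebesgue space over \<open>\<Omega>\<close>, identified with a closed subspace of \<^typ>\<open>L2\<close> through
  extension by zero.\<close>

definition L2_on :: "(real^3) set \<Rightarrow> L2 set" where
  "L2_on \<Omega> = {u. AE x in lebesgue. x \<notin> \<Omega> \<longrightarrow> rep_L2 u x = 0}"


section \<open>The Sobolev space of functions vanishing on the boundary\<close>

text \<open>\<open>Ck k \<phi>\<close>: all iterated partial derivatives of \<open>\<phi>\<close> up to order \<open>k\<close> exist and are
  continuous.\<close>

definition partial :: "3 \<Rightarrow> (real^3 \<Rightarrow> real) \<Rightarrow> real^3 \<Rightarrow> real" where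
  "partial i \<phi> x = frechet_derivative \<phi> (at x) (axis i 1)"

primrec Ck :: "nat \<Rightarrow> (real^3 \<Rightarrow> real) \<Rightarrow> bool" where
  "Ck 0 \<phi> \<longleftrightarrow> continuous_on UNIV \<phi>"
| "Ck (Suc k) \<phi> \<longleftrightarrow> \<phi> differentiable_on UNIV \<and> (\<forall>i. Ck k (partial i \<phi>))"

definition test_functions :: "(real^3) set \<Rightarrow> (real^3 \<Rightarrow> real) set" where
  "test_functions \<Omega> = {\<phi>. (\<forall>k. Ck k \<phi>) \<and>
     compact (closure {x. \<phi> x \<noteq> 0}) \<and> closure {x. \<phi> x \<noteq> 0} \<subseteq> \<Omega>}"

text \<open>A Sobolev function \<open>u\<close> is represented by its jet \<open>(u, \<nabla>u)\<close>; the product norm on jets is then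
  the usual Sobolev norm, and \<open>H10 \<Omega>\<close> is the closure of the test functions in that norm. The
  gradient operator on test functions is closable, so the second component of an element of
  \<open>H10 \<Omega>\<close> is determined by the first one.\<close>

type_synonym jet = "L2 \<times> (L2^3)"

definition H10 :: "(real^3) set \<Rightarrow> jet set" where
  "H10 \<Omega> = closure ((\<lambda>\<phi>. (abs_L2 \<phi>, \<chi> i. abs_L2 (partial i \<phi>))) ` test_functions \<Omega>)"

definition val :: "jet \<Rightarrow> real^3 \<Rightarrow> real" where
  "val u = rep_L2 (fst u)"

definition grad :: "jet \<Rightarrow> real^3 \<Rightarrow> real^3" where
  "grad u x = (\<chi> i. rep_L2 (snd u $ i) x)"


section \<open>The elliptic operator\<close>

definition scalar_H10 ::
  "(real^3) set \<Rightarrow> (real^3 \<Rightarrow> real^3^3) \<Rightarrow> (real^3 \<Rightarrow> real) \<Rightarrow> jet \<Rightarrow> jet \<Rightarrow> real" where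
  "scalar_H10 \<Omega> A \<beta> u v =
     (\<integral>x. (A x *v grad u x) \<bullet> grad v x \<partial>lebesgue_on \<Omega>) +
     (\<integral>x. \<beta> x * val u x * val v x \<partial>lebesgue_on \<Omega>)"

definition norm_H10 ::
  "(real^3) set \<Rightarrow> (real^3 \<Rightarrow> real^3^3) \<Rightarrow> (real^3 \<Rightarrow> real) \<Rightarrow> jet \<Rightarrow> real" where
  "norm_H10 \<Omega> A \<beta> u = sqrt (scalar_H10 \<Omega> A \<beta> u u)"

definition dom_op ::
  "(real^3) set \<Rightarrow> (real^3 \<Rightarrow> real^3^3) \<Rightarrow> (real^3 \<Rightarrow> real) \<Rightarrow> jet set" where
  "dom_op \<Omega> A \<beta> = {u \<in> H10 \<Omega>. \<exists>h\<in>L2_on \<Omega>. \<forall>v\<in>H10 \<Omega>. scalar_H10 \<Omega> A \<beta> u v = h \<bullet> fst v}"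

text \<open>The selfadjoint operator defined by the form; \<open>h\<close> is unique because test functions are
  dense in the Lebesgue space over \<open>\<Omega>\<close>. Outside \<open>dom_op\<close> the value is meaningless.\<close>

definition elliptic_op ::
  "(real^3) set \<Rightarrow> (real^3 \<Rightarrow> real^3^3) \<Rightarrow> (real^3 \<Rightarrow> real) \<Rightarrow> jet \<Rightarrow> L2" where
  "elliptic_op \<Omega> A \<beta> u = (THE h. h \<in> L2_on \<Omega> \<and> (\<forall>v\<in>H10 \<Omega>. scalar_H10 \<Omega> A \<beta> u v = h \<bullet> fst v))"

text \<open>The domain of the operator, with the topology of the norm \<open>\<parallel>elliptic_op \<Omega> A \<beta> u\<parallel>\<close>.\<close>

definition dom_topology ::
  "(real^3) set \<Rightarrow> (real^3 \<Rightarrow> real^3^3) \<Rightarrow> (real^3 \<Rightarrow> real) \<Rightarrow> jet topology" where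
  "dom_topology \<Omega> A \<beta> =
     Metric_space.mtopology (dom_op \<Omega> A \<beta>) (\<lambda>u v. norm (elliptic_op \<Omega> A \<beta> u - elliptic_op \<Omega> A \<beta> v))"

definition nemytskii ::
  "(real^3) set \<Rightarrow> (real^3 \<Rightarrow> real \<Rightarrow> real) \<Rightarrow> jet \<Rightarrow> L2" where
  "nemytskii \<Omega> f u = abs_L2 (\<lambda>x. if x \<in> \<Omega> then f x (val u x) else 0)"


section \<open>Semigroups, semiflows and attractors\<close>

text \<open>All notions are relative to a subset \<open>X\<close> of a type; in \<open>C0_semigroup_on\<close> and \<open>generates\<close>
  it is a closed linear subspace.\<close>

definition C0_semigroup_on :: "'a::real_normed_vector set \<Rightarrow> (real \<Rightarrow> 'a \<Rightarrow> 'a) \<Rightarrow> bool" where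
  "C0_semigroup_on X T \<longleftrightarrow>
     (\<forall>t\<ge>0. (\<forall>x\<in>X. T t x \<in> X) \<and>
        (\<forall>x\<in>X. \<forall>y\<in>X. T t (x + y) = T t x + T t y) \<and>
        (\<forall>c. \<forall>x\<in>X. T t (c *\<^sub>R x) = c *\<^sub>R T t x) \<and>
        (\<exists>K. \<forall>x\<in>X. norm (T t x) \<le> K * norm x)) \<and>
     (\<forall>x\<in>X. T 0 x = x) \<and>
     (\<forall>s\<ge>0. \<forall>t\<ge>0. \<forall>x\<in>X. T (s + t) x = T s (T t x)) \<and>
     (\<forall>x\<in>X. ((\<lambda>t. T t x) \<longlongrightarrow> x) (at_right 0))"

text \<open>\<open>generates X G T\<close>: \<open>T\<close> is a strongly continuous semigroup on \<open>X\<close> whose infinitesimal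
  generator is the operator with graph \<open>G\<close>.\<close>

definition generates ::
  "'a::real_normed_vector set \<Rightarrow> ('a \<times> 'a) set \<Rightarrow> (real \<Rightarrow> 'a \<Rightarrow> 'a) \<Rightarrow> bool" where
  "generates X G T \<longleftrightarrow> C0_semigroup_on X T \<and>
     G = {(x, y). x \<in> X \<and> ((\<lambda>t. (1 / t) *\<^sub>R (T t x - x)) \<longlongrightarrow> y) (at_right 0)}"

definition global_semiflow :: "'a::real_normed_vector set \<Rightarrow> (real \<Rightarrow> 'a \<Rightarrow> 'a) \<Rightarrow> bool" where
  "global_semiflow X \<pi> \<longleftrightarrow>
     (\<forall>t\<ge>0. \<forall>x\<in>X. \<pi> t x \<in> X) \<and>
     continuous_on ({0..} \<times> X) (\<lambda>(t, x). \<pi> t x) \<and>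
     (\<forall>x\<in>X. \<pi> 0 x = x) \<and>
     (\<forall>s\<ge>0. \<forall>t\<ge>0. \<forall>x\<in>X. \<pi> (s + t) x = \<pi> s (\<pi> t x))"

text \<open>An evolution equation, given by the relation \<open>sol x w\<close> (\<open>w\<close> is a global solution with
  initial value \<open>x\<close>), generates the semiflow \<open>\<pi>\<close> if it is uniquely solvable for every initial
  value in \<open>X\<close> and \<open>\<pi>\<close> is its solution map.\<close>

definition generates_semiflow ::
  "'a::real_normed_vector set \<Rightarrow> ('a \<Rightarrow> (real \<Rightarrow> 'a) \<Rightarrow> bool) \<Rightarrow> (real \<Rightarrow> 'a \<Rightarrow> 'a) \<Rightarrow> bool" where
  "generates_semiflow X sol \<pi> \<longleftrightarrow> global_semiflow X \<pi> \<and>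
     (\<forall>x\<in>X. \<forall>w. sol x w \<longleftrightarrow> (\<forall>t\<ge>0. w t = \<pi> t x))"

text \<open>Attraction is not phrased with \<^const>\<open>infdist\<close>, which vanishes for the empty set.\<close>

definition compact_global_attractor ::
  "'a::real_normed_vector set \<Rightarrow> (real \<Rightarrow> 'a \<Rightarrow> 'a) \<Rightarrow> 'a set \<Rightarrow> bool" where
  "compact_global_attractor X \<pi> K \<longleftrightarrow>
     K \<subseteq> X \<and> compact K \<and> (\<forall>t\<ge>0. \<pi> t ` K = K) \<and>
     (\<forall>B. B \<subseteq> X \<longrightarrow> bounded B \<longrightarrow>
        (\<forall>\<delta>>0. \<forall>\<^sub>F t in at_top. \<forall>x\<in>B. \<exists>k\<in>K. dist (\<pi> t x) k < \<delta>))"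


section \<open>The two evolution equations\<close>

text \<open>The graph, in the Lebesgue space over \<open>\<Omega>\<close>, of minus the elliptic operator.\<close>

definition parabolic_graph ::
  "(real^3) set \<Rightarrow> (real^3 \<Rightarrow> real^3^3) \<Rightarrow> (real^3 \<Rightarrow> real) \<Rightarrow> (L2 \<times> L2) set" where
  "parabolic_graph \<Omega> A \<beta> = {(fst u, - elliptic_op \<Omega> A \<beta> u) |u. u \<in> dom_op \<Omega> A \<beta>}"

text \<open>The integral is taken in the Lebesgue space; the solution itself is a continuous curve in
  \<open>H10 \<Omega>\<close>. Here and in \<open>wave_mild\<close> below the integrand is continuous, so that
  \<^const>\<open>has_integral\<close> is the ordinary vector-valued integral.\<close>

definition parabolic_mild ::
  "(real^3) set \<Rightarrow> (real^3 \<Rightarrow> real \<Rightarrow> real) \<Rightarrow> (real \<Rightarrow> L2 \<Rightarrow> L2) \<Rightarrow> jet \<Rightarrow> (real \<Rightarrow> jet) \<Rightarrow> bool" where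
  "parabolic_mild \<Omega> f S u0 u \<longleftrightarrow>
     continuous_on {0..} u \<and> (\<forall>t\<ge>0. u t \<in> H10 \<Omega>) \<and>
     (\<forall>t\<ge>0. ((\<lambda>s. S (t - s) (nemytskii \<Omega> f (u s)))
        has_integral (fst (u t) - S t (fst u0))) {0..t})"

definition Z0 :: "(real^3) set \<Rightarrow> (jet \<times> L2) set" where
  "Z0 \<Omega> = H10 \<Omega> \<times> L2_on \<Omega>"

text \<open>The graph of \<open>(u, v) \<mapsto> (v, - (1/\<epsilon>) (v + elliptic_op \<Omega> A \<beta> u))\<close>. As \<open>v\<close> occurs both as an element of the
  Lebesgue space (on the left) and of \<open>H10 \<Omega>\<close> (on the right), it is given by its jet.\<close>

definition wave_graph ::
  "(real^3) set \<Rightarrow> (real^3 \<Rightarrow> real^3^3) \<Rightarrow> (real^3 \<Rightarrow> real) \<Rightarrow> real \<Rightarrow>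
   ((jet \<times> L2) \<times> (jet \<times> L2)) set" where
  "wave_graph \<Omega> A \<beta> \<epsilon> =
     {((u, fst v), (v, - ((1 / \<epsilon>) *\<^sub>R (fst v + elliptic_op \<Omega> A \<beta> u)))) |u v.
        u \<in> dom_op \<Omega> A \<beta> \<and> v \<in> H10 \<Omega>}"

definition wave_mild ::
  "(real^3) set \<Rightarrow> (real^3 \<Rightarrow> real \<Rightarrow> real) \<Rightarrow> real \<Rightarrow> (real \<Rightarrow> jet \<times> L2 \<Rightarrow> jet \<times> L2) \<Rightarrow>
   jet \<times> L2 \<Rightarrow> (real \<Rightarrow> jet \<times> L2) \<Rightarrow> bool" where
  "wave_mild \<Omega> f \<epsilon> T z0 z \<longleftrightarrow>
     continuous_on {0..} z \<and> (\<forall>t\<ge>0. z t \<in> Z0 \<Omega>) \<and>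
     (\<forall>t\<ge>0. ((\<lambda>p. T (t - p) (0, (1 / \<epsilon>) *\<^sub>R nemytskii \<Omega> f (fst (z p))))
        has_integral (z t - T t z0)) {0..t})"

definition norm_Z0 ::
  "(real^3) set \<Rightarrow> (real^3 \<Rightarrow> real^3^3) \<Rightarrow> (real^3 \<Rightarrow> real) \<Rightarrow> jet \<times> L2 \<Rightarrow> real" where
  "norm_Z0 \<Omega> A \<beta> z = sqrt ((norm_H10 \<Omega> A \<beta> (fst z))\<^sup>2 + (norm (snd z))\<^sup>2)"


section \<open>Twice continuously differentiable functions of a real variable\<close>

definition C2 :: "(real \<Rightarrow> real) \<Rightarrow> bool" where
  "C2 g \<longleftrightarrow> (\<forall>u. g field_differentiable at u) \<and> (\<forall>u. deriv g field_differentiable at u) \<and>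
     continuous_on UNIV (deriv (deriv g))"

end

theory Submission
  imports Defs
begin

text \<open>On a complete orbit in the attractor \<open>\<A> \<epsilon>\<close>, the potential energy controls the time integral of
  the squared velocity uniformly in \<open>\<epsilon>\<close>. The time differences of the orbit therefore solve a damped
  wave equation whose damped energy decays up to an integrable forcing, and since the orbit extends
  to the infinite past, its velocity \<open>v\<close> is Lipschitz with constant \<open>O(1 / sqrt \<epsilon>)\<close> and is Hoelder
  continuous with exponent 1/2 uniformly in \<open>\<epsilon>\<close>. Hence \<open>\<epsilon> v\<close> has small time increments, and the
  first component of the orbit follows the parabolic semiflow on every bounded time interval, within
  \<open>O(\<epsilon>)\<close> in the squared energy norm. Starting a long time back, where the parabolic flow has come
  close to \<open>\<A>'\<close>, gives the convergence of the first components.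

  The second component is recovered from difference quotients. The velocity is close to
  \<open>(u(h) - u(0)) / h\<close> by its Hoelder bound, and the parabolic velocity is close to its difference
  quotient uniformly on \<open>\<A>'\<close>, because \<open>\<A>'\<close> is compact in the domain of the operator; for fixed \<open>h\<close>
  the two quotients differ little when \<open>\<epsilon>\<close> is small.\<close>

section \<open>Calculus on the half-line\<close>

text \<open>\<open>\<Omega>\<close> may be unbounded and the nonlinearity has the critical cubic
  growth, so the embedding into the Lebesgue space yields no compactness and no limit of wave orbits
  is extracted as \<epsilon> tends to 0. Every estimate on the wave side is explicit, with constants
  that depend only on the energy bound \<open>R\<close>; the one compactness argument in a phase
  space takes place on \<open>\<A>'\<close>.

  Why the forcing of the time differences p = u(t + h) - u(t) is integrable, and of order h^2: the
  potential bounds the total time integral of |v|^2; the square of |j p| is at most h times the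
  integral of |v|^2 over [t, t + h]; integrating over all t costs another factor h. So the
  differences have size h, as if the equation could be differentiated in time, which mild solutions
  do not allow.

  Why two different moduli for v result: the damped energy contains the kinetic term only with the
  factor \<epsilon>, which gives the Lipschitz constant O(1 / sqrt \<epsilon>), whereas the
  dissipation carries no \<epsilon>. Integrated over a unit of time it gives a square integrable
  acceleration, hence exponent 1/2 uniformly in \<epsilon>.\<close>

lemma has_vector_derivative_iff_quotient:
  fixes \<phi> :: "real \<Rightarrow> 'a::real_normed_vector"
  shows "(\<phi> has_vector_derivative D) (at t within S) \<longleftrightarrow>
    ((\<lambda>s. (1 / (s - t)) *\<^sub>R (\<phi> s - \<phi> t)) \<longlongrightarrow> D) (at t within S)"
proof -
  have "(1 / (s - t)) *\<^sub>R (\<phi> s - \<phi> t) - D = (1 / (s - t)) *\<^sub>R (\<phi> s - (\<phi> t + (s - t) *\<^sub>R D))"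
    if "s \<noteq> t" for s
    using that by (simp only: scaleR_diff_right scaleR_add_right scaleR_scaleR) (simp add: algebra_simps)
  then have "norm ((1 / norm (s - t)) *\<^sub>R (\<phi> s - (\<phi> t + (s - t) *\<^sub>R D))) =
      norm ((1 / (s - t)) *\<^sub>R (\<phi> s - \<phi> t) - D)" if "s \<noteq> t" for s
    using that by simp
  then have "((\<lambda>s. norm ((1 / norm (s - t)) *\<^sub>R (\<phi> s - (\<phi> t + (s - t) *\<^sub>R D)))) \<longlongrightarrow> 0) (at t within S)
      \<longleftrightarrow> ((\<lambda>s. norm ((1 / (s - t)) *\<^sub>R (\<phi> s - \<phi> t) - D)) \<longlongrightarrow> 0) (at t within S)"
    by (intro filterlim_cong refl) (auto simp: eventually_at_filter)
  then show ?thesis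
    unfolding has_vector_derivative_def has_derivative_within
    by (simp add: bounded_linear_scaleR_left tendsto_norm_zero_iff Lim_null[of _ D] del: norm_scaleR)
qed

text \<open>A mean value inequality from right derivatives alone. For a slope \<open>\<eta>'\<close>
  above \<open>\<eta>\<close>, let \<open>s0\<close> be the infimum of the times at which the bound
  fails. By continuity the bound still holds at \<open>s0\<close>, and the right derivative there
  keeps it true for a while, although failures accumulate at \<open>s0\<close> from the right.
  Finally \<open>\<eta>'\<close> decreases to \<open>\<eta>\<close>.\<close>

lemma right_derivative_bound:
  fixes \<phi> :: "real \<Rightarrow> 'a::real_normed_vector"
  assumes "a \<le> b" and cont: "continuous_on {a..b} \<phi>"
    and der: "\<And>s. a \<le> s \<Longrightarrow> s < b \<Longrightarrow> (\<phi> has_vector_derivative d s) (at_right s)"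
    and bd: "\<And>s. a \<le> s \<Longrightarrow> s < b \<Longrightarrow> norm (d s - c) \<le> \<eta>"
  shows "norm (\<phi> b - \<phi> a - (b - a) *\<^sub>R c) \<le> \<eta> * (b - a)"
proof (cases "a = b")
  case False
  then have ab: "a < b" using assms(1) by simp
  define \<psi> where "\<psi> s = \<phi> s - \<phi> a - (s - a) *\<^sub>R c" for s
  have cont\<psi>: "continuous_on {a..b} \<psi>"
    unfolding \<psi>_def by (intro continuous_intros cont)
  have main: "norm (\<psi> b) \<le> \<eta>' * (b - a)" if \<eta>': "\<eta> < \<eta>'" for \<eta>'
  proof (rule ccontr)
    assume neg: "\<not> ?thesis"
    define D where "D = {s \<in> {a..b}. norm (\<psi> s) \<le> \<eta>' * (s - a)}"
    define U where "U = {s \<in> {a..b}. norm (\<psi> s) > \<eta>' * (s - a)}"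
    define s0 where "s0 = Inf U"
    have bU: "b \<in> U" using neg ab by (simp add: U_def)
    have bdd: "bdd_below U" by (rule bdd_belowI[of _ a]) (simp add: U_def)
    have s0: "a \<le> s0" "s0 \<le> b"
      unfolding s0_def using bU bdd by (auto intro!: cInf_greatest cInf_lower simp: U_def)
    have clD: "closed D"
    proof -
      have "continuous_on {a..b} (\<lambda>s. norm (\<psi> s))" "continuous_on {a..b} (\<lambda>s. \<eta>' * (s - a))"
        by (intro continuous_intros cont\<psi>)+
      then show ?thesis unfolding D_def by (intro continuous_on_closed_Collect_le) auto
    qed
    have sub: "{a..<s0} \<subseteq> D"
    proof
      fix s assume "s \<in> {a..<s0}"
      moreover have "s \<notin> U"
      proof
        assume "s \<in> U" then have "s0 \<le> s" unfolding s0_def by (rule cInf_lower[OF _ bdd])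
        with \<open>s \<in> {a..<s0}\<close> show False by simp
      qed
      ultimately show "s \<in> D" using s0 by (auto simp: D_def U_def)
    qed
    have s0D: "s0 \<in> D"
    proof (cases "a = s0")
      case True then show ?thesis using s0 by (simp add: D_def \<psi>_def)
    next
      case False
      then have "a < s0" using s0 by simp
      then have "closure {a..<s0} = {a..s0}" by simp
      then show ?thesis using closure_minimal[OF sub clD] s0 by auto
    qed
    have "s0 < b"
    proof (rule ccontr)
      assume "\<not> s0 < b" then have "s0 = b" using s0 by simp
      with s0D bU show False by (simp add: D_def U_def)
    qed
    have "(\<psi> has_vector_derivative (d s0 - c)) (at_right s0)"
      unfolding \<psi>_def
      by (auto intro!: derivative_eq_intros der \<open>s0 < b\<close> s0)
    then have "((\<lambda>r. (1 / (r - s0)) *\<^sub>R (\<psi> r - \<psi> s0)) \<longlongrightarrow> (d s0 - c)) (at_right s0)"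
      by (simp add: has_vector_derivative_iff_quotient)
    then have "((\<lambda>r. norm ((1 / (r - s0)) *\<^sub>R (\<psi> r - \<psi> s0))) \<longlongrightarrow> norm (d s0 - c)) (at_right s0)"
      by (rule tendsto_norm)
    moreover have "norm (d s0 - c) < \<eta>'" using bd[OF s0(1) \<open>s0 < b\<close>] \<eta>' by simp
    ultimately have "\<forall>\<^sub>F r in at_right s0. norm ((1 / (r - s0)) *\<^sub>R (\<psi> r - \<psi> s0)) < \<eta>'"
      by (rule order_tendstoD(2))
    then obtain e where e: "e > s0" "\<And>r. r > s0 \<Longrightarrow> r < e \<Longrightarrow> norm ((1 / (r - s0)) *\<^sub>R (\<psi> r - \<psi> s0)) < \<eta>'"
      unfolding eventually_at_right_field by blast
    obtain u where u: "u \<in> U" "u < e"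
      using cInf_lessD[of U e] bU e(1) unfolding s0_def by auto
    have "s0 \<le> u" unfolding s0_def by (rule cInf_lower[OF u(1) bdd])
    moreover have "u \<noteq> s0" using u s0D by (auto simp: U_def D_def)
    ultimately have us: "s0 < u" by simp
    have "norm (\<psi> u - \<psi> s0) < \<eta>' * (u - s0)"
    proof -
      have "norm ((1 / (u - s0)) *\<^sub>R (\<psi> u - \<psi> s0)) = norm (\<psi> u - \<psi> s0) / (u - s0)"
        using us by simp
      then show ?thesis using e(2)[OF us u(2)] us by (simp only: pos_divide_less_eq)
    qed
    then have "norm (\<psi> u) < \<eta>' * (u - s0) + norm (\<psi> s0)"
      using norm_triangle_sub[of "\<psi> u" "\<psi> s0"] by linarith
    also have "\<dots> \<le> \<eta>' * (u - a)" using s0D by (simp add: D_def algebra_simps)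
    finally show False using u(1) by (simp add: U_def)
  qed
  have "norm (\<psi> b) / (b - a) \<le> \<eta>"
  proof (rule dense_ge)
    fix \<eta>' assume "\<eta> < \<eta>'"
    from main[OF this] ab show "norm (\<psi> b) / (b - a) \<le> \<eta>'" by (simp add: field_simps)
  qed
  then show ?thesis using ab by (simp add: \<psi>_def field_simps)
qed simp

text \<open>Near \<open>t\<close> the values of \<open>d\<close> are close to \<open>d t\<close>, so
  the mean value bound with the constant slope \<open>d t\<close> applies on the interval between
  \<open>t\<close> and \<open>y\<close>, whichever side \<open>y\<close> lies on. Continuity of
  \<open>d\<close> is what turns one-sided information into a derivative.\<close>

lemma has_vector_derivative_of_right_derivative:
  fixes \<phi> :: "real \<Rightarrow> 'a::real_normed_vector"
  assumes cont: "continuous_on {0..} \<phi>" and contd: "continuous_on {0..} d"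
    and der: "\<And>s. 0 \<le> s \<Longrightarrow> (\<phi> has_vector_derivative d s) (at_right s)"
    and t: "0 \<le> t"
  shows "(\<phi> has_vector_derivative d t) (at t within {0..})"
  unfolding has_vector_derivative_def has_derivative_within_alt
proof (intro conjI allI impI)
  show "bounded_linear (\<lambda>x. x *\<^sub>R d t)" by (rule bounded_linear_scaleR_left)
  fix e :: real assume "0 < e"
  then obtain \<delta> where \<delta>: "\<delta> > 0" "\<And>s. s \<ge> 0 \<Longrightarrow> dist s t < \<delta> \<Longrightarrow> dist (d s) (d t) < e"
    using contd t unfolding continuous_on_iff by (metis atLeast_iff)
  have "norm (\<phi> y - \<phi> t - (y - t) *\<^sub>R d t) \<le> e * norm (y - t)" if "y \<in> {0..}" "norm (y - t) < \<delta>" for y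
  proof (cases "t \<le> y")
    case True
    have "norm (\<phi> y - \<phi> t - (y - t) *\<^sub>R d t) \<le> e * (y - t)"
    proof (rule right_derivative_bound[OF True])
      show "continuous_on {t..y} \<phi>" by (rule continuous_on_subset[OF cont]) (use t in auto)
      fix s assume "t \<le> s" "s < y"
      show "(\<phi> has_vector_derivative d s) (at_right s)" using der \<open>t \<le> s\<close> t by simp
      have "dist s t < \<delta>" using \<open>t \<le> s\<close> \<open>s < y\<close> that by (simp add: dist_real_def)
      then show "norm (d s - d t) \<le> e" using \<delta>(2)[of s] t \<open>t \<le> s\<close> by (simp add: dist_norm)
    qed
    then show ?thesis using True by simp
  next
    case False
    have "norm (\<phi> t - \<phi> y - (t - y) *\<^sub>R d t) \<le> e * (t - y)"
    proof (rule right_derivative_bound)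
      show "y \<le> t" using False by simp
      show "continuous_on {y..t} \<phi>" by (rule continuous_on_subset[OF cont]) (use that in auto)
      fix s assume "y \<le> s" "s < t"
      show "(\<phi> has_vector_derivative d s) (at_right s)" using der \<open>y \<le> s\<close> that by simp
      have "dist s t < \<delta>" using \<open>y \<le> s\<close> \<open>s < t\<close> that by (simp add: dist_real_def)
      then show "norm (d s - d t) \<le> e" using \<delta>(2)[of s] that \<open>y \<le> s\<close> by (simp add: dist_norm)
    qed
    moreover have "\<phi> y - \<phi> t - (y - t) *\<^sub>R d t = - (\<phi> t - \<phi> y - (t - y) *\<^sub>R d t)"
      by (simp add: algebra_simps)
    ultimately show ?thesis using False by (simp only: norm_minus_cancel) (simp add: abs_if)
  qed
  then show "\<exists>\<delta>>0. \<forall>y\<in>{0..}. norm (y - t) < \<delta> \<longrightarrow> norm (\<phi> y - \<phi> t - (y - t) *\<^sub>R d t) \<le> e * norm (y - t)"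
    using \<delta>(1) by blast
qed

lemma nonincreasing_of_derivative:
  fixes X :: "real \<Rightarrow> real"
  assumes der: "\<And>r. s \<le> r \<Longrightarrow> r \<le> t \<Longrightarrow> (X has_real_derivative X' r) (at r within {0..})"
    and nonpos: "\<And>r. s \<le> r \<Longrightarrow> r \<le> t \<Longrightarrow> X' r \<le> 0"
    and "0 \<le> s" "s \<le> t"
  shows "X t \<le> X s"
proof -
  have "\<exists>x\<in>{s..t}. X t - X s = X' x * (t - s)"
    using assms
    by (intro mvt_very_simple)
       (auto intro!: has_field_derivative_subset[THEN has_field_derivative_imp_has_derivative] der)
  then obtain x where "x \<in> {s..t}" "X t - X s = X' x * (t - s)" by blast
  moreover from this have "X' x * (t - s) \<le> 0"
    using nonpos[of x] \<open>s \<le> t\<close> by (intro mult_nonpos_nonneg) auto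
  ultimately show ?thesis by simp
qed

lemma constant_of_derivative:
  fixes X :: "real \<Rightarrow> 'a::real_normed_vector"
  assumes der: "\<And>r. 0 \<le> r \<Longrightarrow> (X has_vector_derivative 0) (at r within {0..})"
    and "0 \<le> t"
  shows "X t = X 0"
proof -
  have "\<exists>c. \<forall>x\<in>{0::real..}. X x = c"
    by (rule has_vector_derivative_zero_constant[of "{0..}" X]) (auto intro: der)
  then show ?thesis using \<open>0 \<le> t\<close> by auto
qed

text \<open>The forcing enters through its primitive: exp (c t) (X - M) is nonincreasing, because
  the additional term - c M has the right sign. So a bound on \<open>M\<close> suffices, and no
  convolution of \<open>M'\<close> with a decaying exponential has to be estimated.\<close>

lemma decay_estimate:
  fixes X M :: "real \<Rightarrow> real"
  assumes X: "\<And>r. 0 \<le> r \<Longrightarrow> (X has_real_derivative X' r) (at r within {0..})"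
    and M: "\<And>r. 0 \<le> r \<Longrightarrow> (M has_real_derivative M' r) (at r within {0..})"
    and le: "\<And>r. 0 \<le> r \<Longrightarrow> X' r \<le> - c * X r + M' r"
    and M0: "\<And>r. 0 \<le> r \<Longrightarrow> 0 \<le> M r" and "c \<ge> 0" "0 \<le> t"
  shows "X t \<le> exp (- c * t) * (X 0 - M 0) + M t"
proof -
  have "exp (c * t) * (X t - M t) \<le> exp (c * 0) * (X 0 - M 0)"
  proof (rule nonincreasing_of_derivative[where X = "\<lambda>t. exp (c * t) * (X t - M t)" and
      X' = "\<lambda>t. exp (c * t) * (X' t - M' t + c * X t - c * M t)"])
    fix r :: real assume r: "0 \<le> r"
    show "((\<lambda>t. exp (c * t) * (X t - M t)) has_real_derivative
        exp (c * r) * (X' r - M' r + c * X r - c * M r)) (at r within {0..})"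
      by (auto intro!: derivative_eq_intros X M r simp: algebra_simps)
    have "0 \<le> c * M r" using M0[OF r] \<open>c \<ge> 0\<close> by simp
    then show "exp (c * r) * (X' r - M' r + c * X r - c * M r) \<le> 0"
      using le[OF r] by (intro mult_nonneg_nonpos) auto
  qed (use assms in auto)
  then have "exp (- c * t) * (exp (c * t) * (X t - M t)) \<le> exp (- c * t) * (X 0 - M 0)"
    by (intro mult_left_mono) auto
  moreover have "exp (- c * t) * (exp (c * t) * (X t - M t)) = X t - M t"
  proof -
    have "exp (- c * t) * exp (c * t) = 1" by (simp add: mult_exp_exp)
    then show ?thesis by (simp only: mult.assoc[symmetric] mult_1)
  qed
  ultimately show ?thesis by linarith
qed

text \<open>\<open>N\<close> need not be differentiable, so the argument runs on the right-hand side
  \<open>P\<close> of the integral inequality. The correction by \<open>\<beta> * t\<close> in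
  \<open>Q\<close> reflects that exp (- \<alpha> t) \<beta> is at most \<beta>, whence the factor
  \<open>N 0 + \<beta> * t\<close>.\<close>

lemma gronwall:
  fixes N :: "real \<Rightarrow> real"
  assumes cont: "continuous_on {0..} N" and "\<alpha> \<ge> 0" "\<beta> \<ge> 0" "0 \<le> L"
    and le: "\<And>t. 0 \<le> t \<Longrightarrow> t \<le> L \<Longrightarrow> N t \<le> N 0 + integral {0..t} (\<lambda>s. \<alpha> * N s + \<beta>)"
    and t: "0 \<le> t" "t \<le> L"
  shows "N t \<le> exp (\<alpha> * t) * (N 0 + \<beta> * t)"
proof -
  define P where "P t = N 0 + integral {0..t} (\<lambda>s. \<alpha> * N s + \<beta>)" for t
  have dP: "(P has_real_derivative (\<alpha> * N r + \<beta>)) (at r within {0..t})" if "0 \<le> r" "r \<le> t" for r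
    unfolding P_def has_real_derivative_iff_has_vector_derivative
    using that
    by (auto intro!: derivative_eq_intros integral_has_vector_derivative continuous_intros
          continuous_on_subset[OF cont])
  define Q where "Q t = exp (- \<alpha> * t) * P t - \<beta> * t" for t
  have dQ: "(Q has_real_derivative (exp (- \<alpha> * r) * (\<alpha> * N r + \<beta> - \<alpha> * P r) - \<beta>)) (at r within {0..t})"
    if "0 \<le> r" "r \<le> t" for r
    unfolding Q_def using that
    by (auto intro!: derivative_eq_intros dP simp: algebra_simps)
  obtain x where x: "x \<in> {0..t}" "Q t - Q 0 = (exp (- \<alpha> * x) * (\<alpha> * N x + \<beta> - \<alpha> * P x) - \<beta>) * (t - 0)"
    using mvt_very_simple[OF t(1), of Q "\<lambda>x h. (exp (- \<alpha> * x) * (\<alpha> * N x + \<beta> - \<alpha> * P x) - \<beta>) * h"]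
      dQ has_field_derivative_imp_has_derivative by blast
  have "\<alpha> * N x \<le> \<alpha> * P x"
    using le[of x] x(1) t \<open>\<alpha> \<ge> 0\<close> by (intro mult_left_mono) (auto simp: P_def)
  then have "exp (- \<alpha> * x) * (\<alpha> * N x + \<beta> - \<alpha> * P x) \<le> 1 * \<beta>"
  proof -
    have "exp (- \<alpha> * x) * (\<alpha> * N x + \<beta> - \<alpha> * P x) \<le> exp (- \<alpha> * x) * \<beta>"
      using \<open>\<alpha> * N x \<le> \<alpha> * P x\<close> by (intro mult_left_mono) auto
    also have "\<dots> \<le> 1 * \<beta>" using x(1) \<open>\<alpha> \<ge> 0\<close> \<open>\<beta> \<ge> 0\<close> by (intro mult_right_mono) auto
    finally show ?thesis .
  qed
  then have "Q t - Q 0 \<le> 0" unfolding x(2) using t by (intro mult_nonpos_nonneg) auto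
  then have "exp (- \<alpha> * t) * P t \<le> N 0 + \<beta> * t" by (simp add: Q_def P_def)
  then have "exp (\<alpha> * t) * (exp (- \<alpha> * t) * P t) \<le> exp (\<alpha> * t) * (N 0 + \<beta> * t)"
    by (intro mult_left_mono) auto
  then have "P t \<le> exp (\<alpha> * t) * (N 0 + \<beta> * t)" by (simp add: exp_minus field_simps)
  then show ?thesis using le[OF t] by (simp add: P_def)
qed

text \<open>The orthogonal projection lets maps that are only linear on a closed subspace be extended
  to bounded linear maps of the whole space.\<close>

lemma closed_subspace_projection:
  fixes X :: "'a::{real_inner, banach} set"
  assumes X: "subspace X" "closed X"
  obtains P where "bounded_linear P" "\<And>x. P x \<in> X" "\<And>x. x \<in> X \<Longrightarrow> P x = x"
    "\<And>x. norm (P x) \<le> norm x"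
proof -
  have ex: "\<exists>y. y \<in> X \<and> (\<forall>w\<in>X. (x - y) \<bullet> w = 0)" for x
  proof -
    define d where "d = infdist x X"
    have ne: "X \<noteq> {}" using subspace_0[OF X(1)] by auto
    have d0: "d \<ge> 0" by (simp add: d_def infdist_nonneg)
    have dle: "d \<le> norm (x - w)" if "w \<in> X" for w
      using infdist_le[OF that, of x] by (simp add: d_def dist_norm)
    have "\<exists>w\<in>X. norm (x - w) < d + 1 / Suc n" for n
    proof (rule ccontr)
      assume "\<not> ?thesis"
      then have "d + 1 / Suc n \<le> infdist x X"
        unfolding infdist_notempty[OF ne] using ne
        by (intro cINF_greatest) (auto simp: dist_norm not_less)
      then show False by (simp add: d_def)
    qed
    then obtain y where y: "\<And>n. y n \<in> X" "\<And>n. norm (x - y n) < d + 1 / Suc n" by metis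
    \<comment> \<open>The midpoint of \<open>a\<close> and \<open>b\<close> lies in the subspace,
      hence at distance at least \<open>d\<close> from \<open>x\<close>. By the parallelogram
      identity two near-minimisers are therefore close to each other.\<close>
    have par: "(norm (a - b))\<^sup>2 \<le> 2 * ((norm (x - a))\<^sup>2 - d\<^sup>2) + 2 * ((norm (x - b))\<^sup>2 - d\<^sup>2)"
      if "a \<in> X" "b \<in> X" for a b
    proof -
      have m: "(1/2) *\<^sub>R (a + b) \<in> X" using X(1) that by (intro subspace_scale subspace_add)
      have "d\<^sup>2 \<le> (norm (x - (1/2) *\<^sub>R (a + b)))\<^sup>2"
        using dle[OF m] d0 by (intro power_mono)
      moreover have "(norm (a - b))\<^sup>2 = 2 * (norm (x - a))\<^sup>2 + 2 * (norm (x - b))\<^sup>2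
          - 4 * (norm (x - (1/2) *\<^sub>R (a + b)))\<^sup>2"
        by (simp add: power2_norm_eq_inner inner_diff inner_add inner_commute algebra_simps)
      ultimately show ?thesis by simp
    qed
    have bnd: "(norm (x - y n))\<^sup>2 - d\<^sup>2 \<le> (2 * d + 1) / Suc n" for n
    proof -
      have "(norm (x - y n))\<^sup>2 \<le> (d + 1 / Suc n)\<^sup>2" using y(2)[of n] by (intro power_mono) auto
      also have "\<dots> = d\<^sup>2 + 2 * d / Suc n + (1 / Suc n) * (1 / Suc n)"
        by (simp add: power2_eq_square algebra_simps)
      also have "(1 / Suc n) * (1 / Suc n) \<le> 1 / Suc n * (1::real)"
        by (intro mult_left_mono) auto
      finally show ?thesis by (simp add: add_divide_distrib)
    qed
    have "Cauchy y"
    proof (rule metric_CauchyI)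
      fix e :: real assume e: "e > 0"
      have "(\<lambda>n. 8 * ((2 * d + 1) / Suc n)) \<longlonglongrightarrow> 8 * 0"
        by (intro tendsto_mult tendsto_const LIMSEQ_Suc lim_const_over_n)
      then have "\<forall>\<^sub>F n in sequentially. 8 * ((2 * d + 1) / Suc n) < e\<^sup>2"
        by (rule order_tendstoD(2)) (use e in simp)
      then obtain N where N: "\<And>n. n \<ge> N \<Longrightarrow> 8 * ((2 * d + 1) / Suc n) < e\<^sup>2"
        unfolding eventually_sequentially by blast
      have "dist (y m) (y n) < e" if "m \<ge> N" "n \<ge> N" for m n
      proof -
        have "(norm (y m - y n))\<^sup>2 < e\<^sup>2"
          using par[OF y(1) y(1), of m n] bnd[of m] bnd[of n] N[OF that(1)] N[OF that(2)] e
          by (smt (verit, best) zero_less_power2)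
        then show ?thesis using e by (simp add: dist_norm power2_less_imp_less)
      qed
      then show "\<exists>M. \<forall>m\<ge>M. \<forall>n\<ge>M. dist (y m) (y n) < e" by blast
    qed
    then obtain l where l: "y \<longlonglongrightarrow> l" using Cauchy_convergent convergent_def by blast
    have lX: "l \<in> X" using X(2) y(1) l closed_sequentially by blast
    have "norm (x - l) \<le> d"
    proof (rule LIMSEQ_le)
      show "(\<lambda>n. norm (x - y n)) \<longlonglongrightarrow> norm (x - l)" by (intro tendsto_intros l)
      have "(\<lambda>n. d + 1 / real (Suc n)) \<longlonglongrightarrow> d + 0"
        by (intro tendsto_intros LIMSEQ_Suc lim_1_over_n)
      then show "(\<lambda>n. d + 1 / real (Suc n)) \<longlonglongrightarrow> d" by simp
    qed (use y(2) less_imp_le in blast)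
    have "(x - l) \<bullet> w = 0" if w: "w \<in> X" for w
    proof (cases "w = 0")
      case False
      define s where "s = ((x - l) \<bullet> w) / (w \<bullet> w)"
      have "l + s *\<^sub>R w \<in> X" using X(1) lX w by (intro subspace_add subspace_scale)
      then have "norm (x - l) \<le> norm (x - (l + s *\<^sub>R w))" using dle \<open>norm (x - l) \<le> d\<close> by force
      then have "(norm (x - l))\<^sup>2 \<le> (norm ((x - l) - s *\<^sub>R w))\<^sup>2"
        by (intro power_mono) (auto simp: algebra_simps)
      also have "\<dots> = (norm (x - l))\<^sup>2 - 2 * s * ((x - l) \<bullet> w) + s * s * (w \<bullet> w)"
        by (simp add: power2_norm_eq_inner inner_diff inner_commute algebra_simps)
      also have "\<dots> = (norm (x - l))\<^sup>2 - ((x - l) \<bullet> w)\<^sup>2 / (w \<bullet> w)"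
        using False by (simp add: s_def power2_eq_square field_simps)
      finally have "((x - l) \<bullet> w)\<^sup>2 / (w \<bullet> w) \<le> 0" by simp
      then show ?thesis using False
        by (metis divide_le_0_iff inner_gt_zero_iff not_less power2_less_eq_zero_iff)
    qed simp
    then show ?thesis using lX by blast
  qed
  then obtain P where P: "\<And>x. P x \<in> X" "\<And>x w. w \<in> X \<Longrightarrow> (x - P x) \<bullet> w = 0" by metis
  \<comment> \<open>Orthogonality of the remainder determines the projection. Linearity follows,
    since sums and multiples of projections satisfy the same condition.\<close>
  have uniq: "P x = y" if "y \<in> X" "\<And>w. w \<in> X \<Longrightarrow> (x - y) \<bullet> w = 0" for x y
  proof -
    have "P x - y \<in> X" using P(1) that(1) X(1) by (intro subspace_diff)
    then have "(x - y) \<bullet> (P x - y) - (x - P x) \<bullet> (P x - y) = 0"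
      using P(2) that(2) by simp
    then have "(P x - y) \<bullet> (P x - y) = 0" by (simp add: inner_diff_left)
    then show ?thesis by simp
  qed
  have nP: "norm (P x) \<le> norm x" for x
  proof -
    have "(norm x)\<^sup>2 = (norm (P x))\<^sup>2 + (norm (x - P x))\<^sup>2"
      using P(2)[OF P(1), of x x]
      by (simp add: power2_norm_eq_inner inner_diff inner_commute algebra_simps)
    then have "(norm (P x))\<^sup>2 \<le> (norm x)\<^sup>2" by simp
    then show ?thesis by (rule power2_le_imp_le) simp
  qed
  show thesis
  proof
    show "bounded_linear P"
    proof (rule bounded_linear_intro[where K = 1])
      show "P (x + y) = P x + P y" for x y
      proof (rule uniq)
        show "P x + P y \<in> X" by (intro subspace_add[OF X(1)] P(1))
        show "(x + y - (P x + P y)) \<bullet> w = 0" if "w \<in> X" for w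
          using P(2)[OF that, of x] P(2)[OF that, of y] by (simp add: inner_diff_left inner_add_left)
      qed
      show "P (r *\<^sub>R x) = r *\<^sub>R P x" for r x
      proof (rule uniq)
        show "r *\<^sub>R P x \<in> X" by (intro subspace_scale[OF X(1)] P(1))
        show "(r *\<^sub>R x - r *\<^sub>R P x) \<bullet> w = 0" if "w \<in> X" for w
          using P(2)[OF that, of x] by (simp add: inner_diff_left)
      qed
    qed (use nP in simp)
    show "P x = x" if "x \<in> X" for x by (rule uniq) (use that in auto)
  qed (use P(1) nP in auto)
qed

section \<open>Semigroups and mild solutions\<close>

lemma integral_derivative_atLeast:
  fixes w :: "real \<Rightarrow> 'a::banach"
  assumes "continuous_on {0..} w" "0 \<le> t"
  shows "((\<lambda>s. integral {0..s} w) has_vector_derivative w t) (at t within {0..})"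
proof -
  \<comment> \<open>The interval extends beyond \<open>t\<close>, so that near \<open>t\<close> it
    coincides with the half-line.\<close>
  have "((\<lambda>s. integral {0..s} w) has_vector_derivative w t) (at t within {0..t+1})"
    using assms by (intro integral_has_vector_derivative continuous_on_subset[OF assms(1)]) auto
  moreover have "at t within {0..t+1} = at t within {0..}"
    using assms by (intro at_within_nhd[of _ "{..<t+1}"]) auto
  ultimately show ?thesis by simp
qed

lemma has_vector_derivative_at_right:
  "(\<phi> has_vector_derivative D) (at t within {0..}) \<Longrightarrow> 0 \<le> t \<Longrightarrow> (\<phi> has_vector_derivative D) (at_right t)"
  by (rule has_vector_derivative_within_subset) auto

text \<open>Baire category: the closed sets \<open>E m\<close> of points with orbit bounded by
  \<open>m\<close> cover the space, so one of them contains a ball of some radius \<open>r\<close>.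
  A vector is a multiple of a difference of two points of that ball; the difference has image of
  norm at most 2 m and the scaling is r / (2 |y|), which gives 4 m / r.\<close>

lemma uniform_boundedness:
  fixes B :: "nat \<Rightarrow> 'a::banach \<Rightarrow> 'b::real_normed_vector"
  assumes B: "\<And>n. bounded_linear (B n)" and pb: "\<And>x. \<exists>K. \<forall>n. norm (B n x) \<le> K"
  obtains K where "\<And>n x. norm (B n x) \<le> K * norm x"
proof -
  define E where "E m = {x. \<forall>n. norm (B n x) \<le> real m}" for m :: nat
  have clE: "closed (E m)" for m
    unfolding E_def Collect_all_eq
    by (intro closed_INT ballI closed_Collect_le continuous_intros
          linear_continuous_on_compose[OF continuous_on_id] bounded_linear.linear B)
       (auto intro!: linear_continuous_on B)
  have "\<Union>(range E) = UNIV"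
  proof (intro set_eqI iffI UNIV_I)
    fix x obtain K where "\<forall>n. norm (B n x) \<le> K" using pb by blast
    moreover obtain m :: nat where "K \<le> real m" using real_arch_simple by blast
    ultimately have "x \<in> E m" unfolding E_def by (auto intro: order_trans)
    then show "x \<in> \<Union>(range E)" by blast
  qed
  then have "interior (\<Union>(range E)) \<noteq> {}" by simp
  then obtain m where "interior (E m) \<noteq> {}"
    using Met_TC.metric_Baire_category_alt[of "range E"] clE
    by (auto simp: Met_TC.mcomplete_def Cauchy_convergent_iff convergent_def)
  then obtain x0 where "x0 \<in> interior (E m)" by blast
  then obtain r where r: "r > 0" "ball x0 r \<subseteq> E m" by (auto simp: mem_interior)
  have "norm (B n y) \<le> 4 * m / r * norm y" for n y
  proof (cases "y = 0")
    case True then show ?thesis by (simp add: linear_0[OF bounded_linear.linear[OF B]])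
  next
    case False
    define s where "s = r / (2 * norm y)"
    have s: "s > 0" using r False by (simp add: s_def)
    have "x0 + s *\<^sub>R y \<in> ball x0 r" "x0 \<in> ball x0 r"
      using r False by (auto simp: dist_norm s_def)
    then have "x0 + s *\<^sub>R y \<in> E m" "x0 \<in> E m" using r(2) by blast+
    then have "norm (B n (x0 + s *\<^sub>R y)) \<le> m" "norm (B n x0) \<le> m"
      by (auto simp: E_def)
    then have "norm (B n (x0 + s *\<^sub>R y) - B n x0) \<le> m + m"
      by (intro norm_triangle_le_diff) simp
    moreover have "B n (x0 + s *\<^sub>R y) - B n x0 = s *\<^sub>R B n y"
      by (simp add: linear_simps[OF B])
    ultimately have "s * norm (B n y) \<le> 2 * m" using s by simp
    then have "norm (B n y) \<le> 2 * m / s" using s by (simp add: field_simps)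
    also have "\<dots> = 4 * m / r * norm y" using False r by (simp add: s_def)
    finally show ?thesis .
  qed
  then show thesis using that by blast
qed

text \<open>A global choice that depends on the set alone, so that all locale instances over the
  same subspace share one projection. Of orthogonality only the consequences listed here are
  kept.\<close>

definition orth_proj :: "'a::{real_inner, banach} set \<Rightarrow> 'a \<Rightarrow> 'a" where
  "orth_proj X = (SOME P. bounded_linear P \<and> (\<forall>x. P x \<in> X) \<and> (\<forall>x\<in>X. P x = x) \<and> (\<forall>x. norm (P x) \<le> norm x))"

locale closed_subspace =
  fixes X :: "'a::{real_inner, banach} set"
  assumes subspace_X: "subspace X" and closed_X: "closed X"
begin

abbreviation "P \<equiv> orth_proj X"

lemma
  shows bounded_linear_P: "bounded_linear P" and P_in: "P x \<in> X"
    and P_id: "x \<in> X \<Longrightarrow> P x = x" and norm_P: "norm (P x) \<le> norm x"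
proof -
  have "\<exists>P. bounded_linear P \<and> (\<forall>x. P x \<in> X) \<and> (\<forall>x\<in>X. P x = x) \<and> (\<forall>x. norm (P x) \<le> norm x)"
    by (rule closed_subspace_projection[OF subspace_X closed_X]) blast
  from someI_ex[OF this]
  have *: "bounded_linear P \<and> (\<forall>x. P x \<in> X) \<and> (\<forall>x\<in>X. P x = x) \<and> (\<forall>x. norm (P x) \<le> norm x)"
    by (simp add: orth_proj_def)
  show "bounded_linear P" "P x \<in> X" "x \<in> X \<Longrightarrow> P x = x" "norm (P x) \<le> norm x"
    using * by auto
qed

text \<open>The projection commutes with the integral and fixes the integrand, so it fixes the
  integral.\<close>

lemma integral_in_subspace:
  fixes w :: "real \<Rightarrow> 'a"
  assumes "continuous_on {a..b} w" "\<And>t. t \<in> {a..b} \<Longrightarrow> w t \<in> X"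
  shows "integral {a..b} w \<in> X"
proof -
  have "integral {a..b} (P \<circ> w) = P (integral {a..b} w)"
    by (intro integral_linear integrable_continuous_interval assms bounded_linear_P)
  moreover have "integral {a..b} (P \<circ> w) = integral {a..b} w"
    by (intro integral_cong) (simp add: P_id assms)
  ultimately show ?thesis using P_in by metis
qed

end

section \<open>Strongly continuous semigroups on a closed subspace\<close>

locale C0_semigroup = closed_subspace X for X :: "'a::{real_inner, banach} set" +
  fixes G :: "('a \<times> 'a) set" and T :: "real \<Rightarrow> 'a \<Rightarrow> 'a"
  assumes gen: "generates X G T"
begin

lemma
  shows T_in: "0 \<le> t \<Longrightarrow> x \<in> X \<Longrightarrow> T t x \<in> X"
    and T_add: "0 \<le> t \<Longrightarrow> x \<in> X \<Longrightarrow> y \<in> X \<Longrightarrow> T t (x + y) = T t x + T t y"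
    and T_scale: "0 \<le> t \<Longrightarrow> x \<in> X \<Longrightarrow> T t (c *\<^sub>R x) = c *\<^sub>R T t x"
    and T_bounded: "0 \<le> t \<Longrightarrow> \<exists>K. \<forall>x\<in>X. norm (T t x) \<le> K * norm x"
    and T_0: "x \<in> X \<Longrightarrow> T 0 x = x"
    and T_plus: "0 \<le> s \<Longrightarrow> 0 \<le> t \<Longrightarrow> x \<in> X \<Longrightarrow> T (s + t) x = T s (T t x)"
    and T_lim: "x \<in> X \<Longrightarrow> ((\<lambda>t. T t x) \<longlongrightarrow> x) (at_right 0)"
    and G_iff: "(x, y) \<in> G \<longleftrightarrow> x \<in> X \<and> ((\<lambda>t. (1 / t) *\<^sub>R (T t x - x)) \<longlongrightarrow> y) (at_right 0)"
  using gen unfolding generates_def C0_semigroup_on_def by (blast, blast, blast, blast, blast, blast, blast, blast)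

lemma T_linear: assumes "0 \<le> t" shows "bounded_linear (\<lambda>x. T t (P x))"
proof -
  obtain K where K: "\<And>x. x \<in> X \<Longrightarrow> norm (T t x) \<le> K * norm x" using T_bounded assms by blast
  show ?thesis
  proof (rule bounded_linear_intro[where K = "\<bar>K\<bar>"])
    show "T t (P (x + y)) = T t (P x) + T t (P y)" for x y
      using assms by (simp add: linear_simps[OF bounded_linear_P] T_add P_in)
    show "T t (P (r *\<^sub>R x)) = r *\<^sub>R T t (P x)" for r x
      using assms by (simp add: linear_simps[OF bounded_linear_P] T_scale P_in)
    show "norm (T t (P x)) \<le> norm x * \<bar>K\<bar>" for x
    proof -
      have "norm (T t (P x)) \<le> K * norm (P x)" by (rule K[OF P_in])
      also have "\<dots> \<le> \<bar>K\<bar> * norm (P x)" by (intro mult_right_mono) auto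
      also have "\<dots> \<le> \<bar>K\<bar> * norm x" by (intro mult_left_mono norm_P) auto
      finally show ?thesis by (simp add: mult.commute)
    qed
  qed
qed

lemma T_diff: "0 \<le> t \<Longrightarrow> x \<in> X \<Longrightarrow> y \<in> X \<Longrightarrow> T t (x - y) = T t x - T t y"
proof -
  assume *: "0 \<le> t" "x \<in> X" "y \<in> X"
  have "T t (P (x - y)) = T t (P x) - T t (P y)"
    by (rule linear_diff[OF bounded_linear.linear[OF T_linear[OF *(1)]]])
  then show ?thesis using P_id[OF *(2)] P_id[OF *(3)] P_id[OF subspace_diff[OF subspace_X *(2,3)]] by simp
qed

text \<open>Otherwise there are times \<open>t n\<close> tending to 0 whose operators have unbounded
  norms, while strong continuity at 0 bounds the values at each single point; this contradicts
  uniform boundedness.\<close>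

lemma T_bounded_near_0:
  obtains \<delta> M where "\<delta> > 0" "M \<ge> 1" "\<And>t x. 0 \<le> t \<Longrightarrow> t \<le> \<delta> \<Longrightarrow> x \<in> X \<Longrightarrow> norm (T t x) \<le> M * norm x"
proof (rule ccontr)
  assume neg: "\<not> thesis"
  have "\<exists>t x. 0 \<le> t \<and> t \<le> 1 / Suc n \<and> x \<in> X \<and> norm (T t x) > Suc n * norm x" for n
    using neg that[of "1 / Suc n" "Suc n"] by (force simp: not_le)
  then obtain t x where tx: "\<And>n. 0 \<le> t n" "\<And>n. t n \<le> 1 / Suc n" "\<And>n. x n \<in> X"
    "\<And>n. norm (T (t n) (x n)) > Suc n * norm (x n)" by metis
  have tpos: "t n > 0" for n
  proof (rule ccontr)
    assume "\<not> t n > 0" then have "t n = 0" using tx(1)[of n] by simp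
    then have "norm (x n) > Suc n * norm (x n)" using tx(4)[of n] T_0[OF tx(3)] by simp
    moreover have "Suc n * norm (x n) \<ge> 1 * norm (x n)" by (intro mult_right_mono) auto
    ultimately show False by simp
  qed
  have "t \<longlonglongrightarrow> 0"
    by (rule tendsto_sandwich[of "\<lambda>_. 0" _ _ "\<lambda>n. 1 / real (Suc n)"])
       (auto intro!: always_eventually tx LIMSEQ_Suc lim_1_over_n simp del: of_nat_Suc)
  then have lim: "filterlim t (at_right 0) sequentially"
    using tpos by (auto simp: filterlim_at intro!: always_eventually) (metis less_irrefl)
  have "\<exists>K. \<forall>n. norm (T (t n) (P y)) \<le> K" for y
  proof -
    have "(\<lambda>n. T (t n) (P y)) \<longlonglongrightarrow> P y"
      using filterlim_compose[OF T_lim[OF P_in] lim] .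
    then have "Bseq (\<lambda>n. T (t n) (P y))" using convergentI convergent_imp_Bseq by blast
    then show ?thesis unfolding Bseq_def by blast
  qed
  then obtain K where K: "\<And>n y. norm (T (t n) (P y)) \<le> K * norm y"
    using uniform_boundedness[of "\<lambda>n y. T (t n) (P y)"] T_linear tx(1) by metis
  obtain n :: nat where n: "K \<le> n" using real_arch_simple by blast
  have "Suc n * norm (x n) < K * norm (x n)" using tx(4)[of n] K[of n "x n"] P_id[OF tx(3)] by simp
  moreover have "K * norm (x n) \<le> Suc n * norm (x n)" using n by (intro mult_right_mono) auto
  ultimately show False by simp
qed

text \<open>Steps of length \<open>\<delta>\<close> are split off one by one;
  \<open>M \<ge> 1\<close> lets the power absorb a shorter last step.\<close>

lemma T_locally_bounded:
  obtains M where "M \<ge> 0" "\<And>t x. 0 \<le> t \<Longrightarrow> t \<le> \<tau> \<Longrightarrow> x \<in> X \<Longrightarrow> norm (T t x) \<le> M * norm x"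
proof -
  obtain \<delta> M where \<delta>: "\<delta> > 0" "M \<ge> 1" and M: "\<And>t x. 0 \<le> t \<Longrightarrow> t \<le> \<delta> \<Longrightarrow> x \<in> X \<Longrightarrow> norm (T t x) \<le> M * norm x"
    using T_bounded_near_0 by blast
  have *: "0 \<le> t \<Longrightarrow> t \<le> n * \<delta> \<Longrightarrow> x \<in> X \<Longrightarrow> norm (T t x) \<le> M ^ n * norm x" for n :: nat and t x
  proof (induction n arbitrary: t)
    case 0 then show ?case by (simp add: T_0)
  next
    case (Suc n)
    show ?case
    proof (cases "t \<le> \<delta>")
      case True
      then have "norm (T t x) \<le> M * norm x" using M Suc by blast
      also have "M * norm x \<le> M ^ Suc n * norm x"
        using \<delta>(2) self_le_power[of M "Suc n"] by (intro mult_right_mono) auto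
      finally show ?thesis .
    next
      case False
      have "T t x = T \<delta> (T (t - \<delta>) x)" using T_plus[of \<delta> "t - \<delta>" x] False \<delta> Suc.prems by simp
      also have "norm \<dots> \<le> M * norm (T (t - \<delta>) x)" using False \<delta> Suc.prems by (intro M T_in) auto
      also have "\<dots> \<le> M * (M ^ n * norm x)"
        using False \<delta> Suc.prems by (intro mult_left_mono Suc.IH) (auto simp: algebra_simps)
      finally show ?thesis by simp
    qed
  qed
  obtain n :: nat where "\<tau> / \<delta> \<le> n" using real_arch_simple by blast
  then have n: "\<tau> \<le> n * \<delta>" using \<delta> by (simp add: field_simps)
  show thesis
    by (rule that[of "M ^ n"]) (use \<delta> n * in \<open>auto intro: order_trans\<close>)
qed

text \<open>Continuity is given only at time 0 from the right. Taking out the operator at the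
  smaller time \<open>a\<close> reduces increments on both sides to \<open>T r x - x\<close>, and
  local boundedness controls that operator, which varies with \<open>s\<close>.\<close>

lemma T_continuous: assumes x: "x \<in> X" shows "continuous_on {0..} (\<lambda>t. T t x)"
  unfolding continuous_on_iff
proof (intro ballI allI impI)
  fix t e :: real assume t: "t \<in> {0..}" and e: "e > 0"
  obtain M where M: "M \<ge> 0" "\<And>s x. 0 \<le> s \<Longrightarrow> s \<le> t + 1 \<Longrightarrow> x \<in> X \<Longrightarrow> norm (T s x) \<le> M * norm x"
    using T_locally_bounded[of "t + 1"] by blast
  have "\<forall>\<^sub>F r in at_right 0. dist (T r x) x < e / (M + 1)"
    using T_lim[OF x] e M by (intro tendstoD) auto
  then obtain d where d: "d > 0" "\<And>r. 0 < r \<Longrightarrow> r < d \<Longrightarrow> dist (T r x) x < e / (M + 1)"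
    unfolding eventually_at_right_field by auto
  have d0: "norm (T r x - x) < e / (M + 1)" if "0 \<le> r" "r < d" for r
    using d(2)[of r] that T_0[OF x] e M by (cases "r = 0") (auto simp: dist_norm)
  have "dist (T s x) (T t x) < e" if s: "s \<in> {0..}" "dist s t < min d 1" for s
  proof -
    define a where "a = min s t"
    define r where "r = \<bar>s - t\<bar>"
    have a: "0 \<le> a" "a \<le> t + 1" "0 \<le> r" "r < d"
      using s t by (auto simp: a_def r_def dist_real_def)
    have "norm (T s x - T t x) = norm (T a (T r x - x))"
    proof (cases "t \<le> s")
      case True
      then have "a = t" "s = t + r" by (auto simp: a_def r_def)
      then show ?thesis using T_plus[of t r x] a t x by (simp add: T_diff T_in)
    next
      case False
      then have "a = s" "t = s + r" by (auto simp: a_def r_def)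
      then show ?thesis using T_plus[of s r x] a s x by (simp add: T_diff T_in norm_minus_commute)
    qed
    also have "\<dots> \<le> M * norm (T r x - x)"
      using a x by (intro M(2) subspace_diff[OF subspace_X] T_in)
    also have "\<dots> \<le> M * (e / (M + 1))" using d0[OF a(3,4)] M by (intro mult_left_mono) auto
    also have "\<dots> < e" using M e by (simp add: field_simps)
    finally show ?thesis by (simp add: dist_norm)
  qed
  then show "\<exists>d>0. \<forall>s\<in>{0..}. dist s t < d \<longrightarrow> dist (T s x) (T t x) < e"
    using d(1) by (intro exI[of _ "min d 1"]) auto
qed

lemma G_invariant:
  assumes "(x, y) \<in> G" "0 \<le> t" shows "(T t x, T t y) \<in> G"
proof -
  have x: "x \<in> X" and lim: "((\<lambda>h. (1 / h) *\<^sub>R (T h x - x)) \<longlongrightarrow> y) (at_right 0)"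
    using assms(1) by (auto simp: G_iff)
  have y: "y \<in> X"
  proof -
    have "\<forall>\<^sub>F h in at_right 0. (1 / h) *\<^sub>R (T h x - x) \<in> X"
      unfolding eventually_at_right_field
      by (intro exI[of _ 1]) (auto intro!: subspace_scale subspace_diff subspace_X T_in x)
    then show ?thesis using Lim_in_closed_set[OF closed_X _ _ lim] by simp
  qed
  have "((\<lambda>h. T t (P ((1 / h) *\<^sub>R (T h x - x)))) \<longlongrightarrow> T t (P y)) (at_right 0)"
    by (rule bounded_linear.tendsto[OF T_linear[OF assms(2)] lim])
  moreover have "T t (P ((1 / h) *\<^sub>R (T h x - x))) = (1 / h) *\<^sub>R (T h (T t x) - T t x)" if "h > 0" for h
    using that assms(2) x T_plus[of t h x] T_plus[of h t x]
    by (simp add: P_id subspace_scale[OF subspace_X] subspace_diff[OF subspace_X] T_in T_scale T_diff add.commute)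
  then have "\<forall>\<^sub>F h in at_right 0. T t (P ((1 / h) *\<^sub>R (T h x - x))) = (1 / h) *\<^sub>R (T h (T t x) - T t x)"
    unfolding eventually_at_right_field by (intro exI[of _ 1]) auto
  ultimately have "((\<lambda>h. (1 / h) *\<^sub>R (T h (T t x) - T t x)) \<longlongrightarrow> T t y) (at_right 0)"
    using Lim_transform_eventually P_id[OF y] by fastforce
  then show ?thesis using T_in assms(2) x by (simp add: G_iff)
qed

lemma T_right_derivative:
  assumes "(x, y) \<in> G" "0 \<le> t" shows "((\<lambda>s. T s x) has_vector_derivative T t y) (at_right t)"
proof -
  have x: "x \<in> X" using assms(1) by (auto simp: G_iff)
  have "((\<lambda>h. (1 / h) *\<^sub>R (T h (T t x) - T t x)) \<longlongrightarrow> T t y) (at_right 0)"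
    using G_invariant[OF assms] by (simp add: G_iff)
  moreover have "\<forall>\<^sub>F h in at_right 0. (1 / h) *\<^sub>R (T h (T t x) - T t x) = (1 / (h + t - t)) *\<^sub>R (T (h + t) x - T t x)"
    unfolding eventually_at_right_field using T_plus[OF _ assms(2) x]
    by (intro exI[of _ 1]) auto
  ultimately have "((\<lambda>h. (1 / (h + t - t)) *\<^sub>R (T (h + t) x - T t x)) \<longlongrightarrow> T t y) (at_right 0)"
    using Lim_transform_eventually by fast
  then show ?thesis
    unfolding has_vector_derivative_iff_quotient filterlim_at_right_to_0[of _ _ t] .
qed

text \<open>The time averages \<open>(1/k) *\<^sub>R I k\<close> of the orbit of \<open>x\<close>
  belong to the domain, with image \<open>(1/k) *\<^sub>R (T k x - x)\<close>, and they converge to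
  \<open>x\<close> as k tends to 0.\<close>

lemma domain_dense: "X \<subseteq> closure (fst ` G)"
proof
  fix x assume x: "x \<in> X"
  define I where "I t = integral {0..t} (\<lambda>s. T s x)" for t
  have dI: "(I has_vector_derivative T t x) (at t within {0..})" if "0 \<le> t" for t
    unfolding I_def by (rule integral_derivative_atLeast[OF T_continuous[OF x] that])
  have I0: "I 0 = 0" by (simp add: I_def)
  have IX: "I t \<in> X" for t
    unfolding I_def
    by (intro integral_in_subspace continuous_on_subset[OF T_continuous[OF x]] T_in x) auto
  \<comment> \<open>The semigroup law in integrated form. As functions of \<open>k\<close> the two
    sides have the same derivative, so their difference is constant.\<close>
  have TI: "T h (I k) = I (h + k) - I h" if "0 \<le> h" "0 \<le> k" for h k
  proof -
    have "(\<lambda>k. T h (P (I k)) - I (h + k)) k = (\<lambda>k. T h (P (I k)) - I (h + k)) 0"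
    proof (rule constant_of_derivative[OF _ that(2)])
      fix r :: real assume r: "0 \<le> r"
      have "((\<lambda>k. T h (P (I k))) has_vector_derivative T h (P (T r x))) (at r within {0..})"
        by (rule bounded_linear.has_vector_derivative[OF T_linear[OF that(1)] dI[OF r]])
      moreover have "((I \<circ> (\<lambda>k. h + k)) has_vector_derivative (1 *\<^sub>R T (h + r) x)) (at r within {0..})"
        using r that by (intro vector_diff_chain_within has_vector_derivative_within_subset[OF dI])
           (auto intro!: derivative_eq_intros)
      ultimately have "((\<lambda>k. T h (P (I k)) - I (h + k)) has_vector_derivative (T h (P (T r x)) - T (h + r) x)) (at r within {0..})"
        by (auto intro!: derivative_eq_intros simp: o_def)
      then show "((\<lambda>k. T h (P (I k)) - I (h + k)) has_vector_derivative 0) (at r within {0..})"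
        using T_plus[OF that(1) r x] P_id[OF T_in[OF r x]] by simp
    qed
    moreover have "P (I k) = I k" for k by (rule P_id[OF IX])
    moreover have "P 0 = 0" by (rule P_id[OF subspace_0[OF subspace_X]])
    moreover have "T h 0 = 0"
      using T_scale[OF that(1) x, of 0] by simp
    ultimately have "T h (I k) - I (h + k) = - I h" using I0 by simp
    then show ?thesis by (simp only: diff_eq_eq) simp
  qed
  have inG: "((1/k) *\<^sub>R I k) \<in> fst ` G" if k: "k > 0" for k
  proof -
    have "((\<lambda>h. (1 / (h - 0)) *\<^sub>R (I h - I 0)) \<longlongrightarrow> T 0 x) (at_right 0)"
      using has_vector_derivative_at_right[OF dI[of 0]] by (simp add: has_vector_derivative_iff_quotient)
    moreover have "((\<lambda>h. (1 / (h + k - k)) *\<^sub>R (I (h + k) - I k)) \<longlongrightarrow> T k x) (at_right 0)"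
      using has_vector_derivative_at_right[OF dI[of k]] k
      unfolding has_vector_derivative_iff_quotient filterlim_at_right_to_0[of _ _ k] by simp
    ultimately have "((\<lambda>h. (1/k) *\<^sub>R ((1 / (h + k - k)) *\<^sub>R (I (h + k) - I k) - (1 / (h - 0)) *\<^sub>R (I h - I 0)))
       \<longlongrightarrow> (1/k) *\<^sub>R (T k x - T 0 x)) (at_right 0)"
      by (intro tendsto_intros)
    moreover have "\<forall>\<^sub>F h in at_right 0. (1/k) *\<^sub>R ((1 / (h + k - k)) *\<^sub>R (I (h + k) - I k) - (1 / (h - 0)) *\<^sub>R (I h - I 0))
        = (1 / h) *\<^sub>R (T h ((1/k) *\<^sub>R I k) - (1/k) *\<^sub>R I k)"
      unfolding eventually_at_right_field
    proof (intro exI[of _ 1] conjI allI impI)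
      fix h :: real assume h: "0 < h" "h < 1"
      have eq: "T h ((1/k) *\<^sub>R I k) = (1/k) *\<^sub>R (I (h + k) - I h)"
        using h k by (simp add: T_scale IX TI)
      show "(1/k) *\<^sub>R ((1 / (h + k - k)) *\<^sub>R (I (h + k) - I k) - (1 / (h - 0)) *\<^sub>R (I h - I 0))
        = (1 / h) *\<^sub>R (T h ((1/k) *\<^sub>R I k) - (1/k) *\<^sub>R I k)"
        unfolding eq using I0 by (simp add: scaleR_diff_right mult.commute)
    qed simp
    ultimately have "((\<lambda>h. (1 / h) *\<^sub>R (T h ((1/k) *\<^sub>R I k) - (1/k) *\<^sub>R I k)) \<longlongrightarrow> (1/k) *\<^sub>R (T k x - T 0 x)) (at_right 0)"
      by (rule Lim_transform_eventually)
    then have "((1/k) *\<^sub>R I k, (1/k) *\<^sub>R (T k x - T 0 x)) \<in> G"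
      using subspace_scale[OF subspace_X IX] by (simp add: G_iff)
    then show ?thesis by force
  qed
  have "((\<lambda>k. (1/k) *\<^sub>R I k) \<longlongrightarrow> x) (at_right 0)"
    using has_vector_derivative_at_right[OF dI[of 0]] T_0[OF x] I0
    by (simp add: has_vector_derivative_iff_quotient)
  then have "(\<lambda>n. (1 / (1 / real (Suc n))) *\<^sub>R I (1 / real (Suc n))) \<longlonglongrightarrow> x"
    by (rule filterlim_compose)
       (auto simp: filterlim_at intro!: LIMSEQ_Suc lim_1_over_n simp del: of_nat_Suc)
  moreover have "(1 / (1 / real (Suc n))) *\<^sub>R I (1 / real (Suc n)) \<in> fst ` G" for n
    by (rule inG) simp
  ultimately show "x \<in> closure (fst ` G)"
    unfolding closure_sequential
    by (intro exI[of _ "\<lambda>n. (1 / (1 / real (Suc n))) *\<^sub>R I (1 / real (Suc n))"] conjI allI)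
qed

text \<open>\<open>m\<close> extends \<open>l\<close> after the generator from the domain to the
  whole space as a bounded map. On the domain the orbit is differentiable and the mean value
  inequality applies; density and local boundedness of the semigroup carry the estimate to every
  \<open>x\<close>, whose own orbit may have no derivative.\<close>

lemma functional_increment:
  fixes l m :: "'a \<Rightarrow> 'b::real_normed_vector"
  assumes l: "bounded_linear l" and m: "bounded_linear m"
    and lm: "\<And>x y. (x, y) \<in> G \<Longrightarrow> l y = m x"
    and x: "x \<in> X" and "0 \<le> k"
    and bd: "\<And>r. 0 \<le> r \<Longrightarrow> r \<le> k \<Longrightarrow> norm (m (T r x) - m x) \<le> \<eta>"
  shows "norm (l (T k x) - l x - k *\<^sub>R m x) \<le> \<eta> * k"
proof -
  obtain M where M: "M \<ge> 0" "\<And>s x. 0 \<le> s \<Longrightarrow> s \<le> k \<Longrightarrow> x \<in> X \<Longrightarrow> norm (T s x) \<le> M * norm x"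
    using T_locally_bounded[of k] by blast
  obtain Cm where Cm: "Cm > 0" "\<And>x. norm (m x) \<le> norm x * Cm"
    using bounded_linear.pos_bounded[OF m] by blast
  obtain w where w: "\<And>n. w n \<in> fst ` G" "w \<longlonglongrightarrow> x"
    using subsetD[OF domain_dense x] unfolding closure_sequential by blast
  have wX: "w n \<in> X" for n using w(1)[of n] by (auto simp: G_iff)
  \<comment> \<open>The modulus \<open>\<eta>\<close> is known only along the orbit of
    \<open>x\<close>. Passing to the orbit of \<open>w n\<close> costs a multiple of
    \<open>norm (w n - x)\<close>, which disappears in the limit.\<close>
  have est: "norm (l (T k (w n)) - l (w n) - k *\<^sub>R m (w n)) \<le> (\<eta> + Cm * (M + 1) * norm (w n - x)) * k" for n
  proof -
    obtain y where y: "(w n, y) \<in> G" using w(1)[of n] by auto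
    have "norm (l (T k (w n)) - l (T 0 (w n)) - (k - 0) *\<^sub>R m (w n)) \<le> (\<eta> + Cm * (M + 1) * norm (w n - x)) * (k - 0)"
    proof (rule right_derivative_bound[OF \<open>0 \<le> k\<close>])
      show "continuous_on {0..k} (\<lambda>t. l (T t (w n)))"
        by (rule bounded_linear.continuous_on[OF l])
           (rule continuous_on_subset[OF T_continuous[OF wX]], auto)
      fix s assume s: "0 \<le> s" "s < k"
      show "((\<lambda>t. l (T t (w n))) has_vector_derivative m (T s (w n))) (at_right s)"
        using bounded_linear.has_vector_derivative[OF l T_right_derivative[OF y s(1)]]
          lm[OF G_invariant[OF y s(1)]] by simp
      have "m (T s (w n)) - m (w n) = m (T s (w n - x)) - m (w n - x) + (m (T s x) - m x)"
        using s x wX by (simp add: T_diff linear_simps[OF m])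
      also have "norm \<dots> \<le> (norm (m (T s (w n - x))) + norm (m (w n - x))) + norm (m (T s x) - m x)"
        by (intro norm_triangle_le add_right_mono norm_triangle_ineq4)
      also have "\<dots> \<le> (M * norm (w n - x) * Cm + norm (w n - x) * Cm) + \<eta>"
      proof (intro add_mono)
        have "norm (m (T s (w n - x))) \<le> norm (T s (w n - x)) * Cm" by (rule Cm)
        also have "\<dots> \<le> M * norm (w n - x) * Cm"
          using s Cm(1) by (intro mult_right_mono M subspace_diff[OF subspace_X] wX x) auto
        finally show "norm (m (T s (w n - x))) \<le> M * norm (w n - x) * Cm" .
      qed (use s Cm bd in auto)
      finally show "norm (m (T s (w n)) - m (w n)) \<le> \<eta> + Cm * (M + 1) * norm (w n - x)"
        by (simp add: algebra_simps)
    qed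
    then show ?thesis using T_0[OF wX] by simp
  qed
  have Tlim: "(\<lambda>n. T k (w n)) \<longlonglongrightarrow> T k x"
    using bounded_linear.tendsto[OF T_linear[OF \<open>0 \<le> k\<close>] w(2)] by (simp add: P_id wX x)
  show ?thesis
  proof (rule LIMSEQ_le)
    show "(\<lambda>n. norm (l (T k (w n)) - l (w n) - k *\<^sub>R m (w n))) \<longlonglongrightarrow> norm (l (T k x) - l x - k *\<^sub>R m x)"
      by (intro tendsto_intros bounded_linear.tendsto[OF l] bounded_linear.tendsto[OF m] Tlim w)
    have "(\<lambda>n. (\<eta> + Cm * (M + 1) * norm (w n - x)) * k) \<longlonglongrightarrow> (\<eta> + Cm * (M + 1) * norm (x - x)) * k"
      by (intro tendsto_intros w)
    then show "(\<lambda>n. (\<eta> + Cm * (M + 1) * norm (w n - x)) * k) \<longlonglongrightarrow> \<eta> * k" by simp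
  qed (use est in blast)
qed

text \<open>The mild solution is restarted at every time, as it is for the solutions of a semiflow. This
  gives right derivatives, which suffice because they are continuous.\<close>

lemma mild_solution_weak:
  fixes l m :: "'a \<Rightarrow> 'b::real_normed_vector"
  assumes l: "bounded_linear l" and m: "bounded_linear m"
    and lm: "\<And>x y. (x, y) \<in> G \<Longrightarrow> l y = m x"
    and z: "continuous_on {0..} z" "\<And>t. 0 \<le> t \<Longrightarrow> z t \<in> X"
    and h: "continuous_on {0..} h" "\<And>t. 0 \<le> t \<Longrightarrow> h t \<in> X"
    and mild: "\<And>t k. 0 \<le> t \<Longrightarrow> 0 \<le> k \<Longrightarrow>
      ((\<lambda>p. T (k - p) (h (t + p))) has_integral (z (t + k) - T k (z t))) {0..k}"
    and t: "0 \<le> t"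
  shows "((\<lambda>s. l (z s)) has_vector_derivative (m (z t) + l (h t))) (at t within {0..})"
proof (rule has_vector_derivative_of_right_derivative[where d = "\<lambda>t. m (z t) + l (h t)", OF _ _ _ t])
  show "continuous_on {0..} (\<lambda>s. l (z s))" by (rule bounded_linear.continuous_on[OF l z(1)])
  show "continuous_on {0..} (\<lambda>t. m (z t) + l (h t))"
    by (intro continuous_intros bounded_linear.continuous_on[OF l] bounded_linear.continuous_on[OF m] z h)
  fix t :: real assume t: "0 \<le> t"
  obtain M where M: "M \<ge> 0" "\<And>s x. 0 \<le> s \<Longrightarrow> s \<le> 1 \<Longrightarrow> x \<in> X \<Longrightarrow> norm (T s x) \<le> M * norm x"
    using T_locally_bounded[of 1] by blast
  obtain Cl where Cl: "Cl > 0" "\<And>x. norm (l x) \<le> norm x * Cl"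
    using bounded_linear.pos_bounded[OF l] by blast
  obtain Cm where Cm: "Cm > 0" "\<And>x. norm (m x) \<le> norm x * Cm"
    using bounded_linear.pos_bounded[OF m] by blast
  show "((\<lambda>s. l (z s)) has_vector_derivative (m (z t) + l (h t))) (at_right t)"
    unfolding has_vector_derivative_iff_quotient
  proof (rule tendstoI)
    fix e :: real assume e: "e > 0"
    \<comment> \<open>\<open>Cm\<close> belongs to the error of the free semigroup part and
      \<open>Cl * (M + 1)\<close> to that of the integral part; the factor 2 makes the final
      inequality strict.\<close>
    define \<eta> where "\<eta> = e / (2 * (Cm + Cl * (M + 1)))"
    have \<eta>: "\<eta> > 0" and \<eta>e: "(Cm + Cl * (M + 1)) * \<eta> < e"
      using e Cl(1) Cm(1) M(1) by (auto simp: \<eta>_def field_simps add_pos_nonneg)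
    have c0: "\<exists>d>0. \<forall>r. 0 \<le> r \<longrightarrow> r < d \<longrightarrow> norm (T r x - x) \<le> \<eta>" if "x \<in> X" for x
    proof -
      have "\<forall>\<^sub>F r in at_right 0. dist (T r x) x < \<eta>" using T_lim[OF that] \<eta> by (rule tendstoD)
      then obtain d where "d > 0" "\<And>r. 0 < r \<Longrightarrow> r < d \<Longrightarrow> norm (T r x - x) < \<eta>"
        unfolding eventually_at_right_field dist_norm by auto
      then have "norm (T r x - x) \<le> \<eta>" if "0 \<le> r" "r < d" for r
        using that T_0[OF \<open>x \<in> X\<close>] \<eta> by (cases "r = 0") (auto intro: less_imp_le)
      then show ?thesis using \<open>d > 0\<close> by blast
    qed
    obtain d1 where d1: "d1 > 0" "\<And>r. 0 \<le> r \<Longrightarrow> r < d1 \<Longrightarrow> norm (T r (z t) - z t) \<le> \<eta>"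
      using c0[OF z(2)[OF t]] by blast
    obtain d2 where d2: "d2 > 0" "\<And>r. 0 \<le> r \<Longrightarrow> r < d2 \<Longrightarrow> norm (T r (h t) - h t) \<le> \<eta>"
      using c0[OF h(2)[OF t]] by blast
    obtain d3 where d3: "d3 > 0" "\<And>s. s \<ge> 0 \<Longrightarrow> dist s t < d3 \<Longrightarrow> dist (h s) (h t) < \<eta>"
      using h(1) t \<eta> unfolding continuous_on_iff by (metis atLeast_iff)
    define d where "d = Min {d1, d2, d3, 1}"
    have d: "d > 0" "d \<le> d1" "d \<le> d2" "d \<le> d3" "d \<le> 1" using d1 d2 d3 by (auto simp: d_def)
    have main: "norm (l (z (t + k)) - l (z t) - k *\<^sub>R (m (z t) + l (h t))) \<le> (Cm + Cl * (M + 1)) * \<eta> * k"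
      if k: "0 < k" "k < d" for k
    proof -
      have 1: "norm (l (T k (z t)) - l (z t) - k *\<^sub>R m (z t)) \<le> (\<eta> * Cm) * k"
      proof (rule functional_increment[OF l m lm z(2)[OF t]])
        fix r assume r: "0 \<le> r" "r \<le> k"
        have "norm (m (T r (z t)) - m (z t)) \<le> norm (T r (z t) - z t) * Cm"
          using Cm(2)[of "T r (z t) - z t"] by (simp add: linear_simps[OF m])
        also have "\<dots> \<le> \<eta> * Cm" using d1(2)[of r] r k d Cm by (intro mult_right_mono) auto
        finally show "norm (m (T r (z t)) - m (z t)) \<le> \<eta> * Cm" .
      qed (use k in auto)
      have "((\<lambda>p. T (k - p) (h (t + p)) - h t) has_integral (z (t + k) - T k (z t) - k *\<^sub>R h t)) (cbox 0 k)"
        using has_integral_diff[OF mild[OF t, of k] has_integral_const_real[of "h t" 0 k]] k by simp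
      then have "norm (z (t + k) - T k (z t) - k *\<^sub>R h t) \<le> ((M + 1) * \<eta>) * measure lborel (cbox 0 k)"
      proof (rule has_integral_bound[rotated])
        fix p assume "p \<in> cbox 0 k"
        then have p: "0 \<le> p" "p \<le> k" by auto
        \<comment> \<open>The forcing is first frozen at time \<open>t\<close>, at the cost of its
          modulus times \<open>M\<close>; then the semigroup acts on a fixed vector and strong
          continuity applies.\<close>
        have "T (k - p) (h (t + p)) - h t = T (k - p) (h (t + p) - h t) + (T (k - p) (h t) - h t)"
          using p t h(2) by (simp add: T_diff)
        also have "norm \<dots> \<le> M * norm (h (t + p) - h t) + norm (T (k - p) (h t) - h t)"
          using p t k d by (intro norm_triangle_le add_right_mono M subspace_diff[OF subspace_X] h) auto
        also have "\<dots> \<le> M * \<eta> + \<eta>"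
          using d2(2)[of "k - p"] d3(2)[of "t + p"] p k d t M(1)
          by (intro add_mono mult_left_mono) (auto simp: dist_norm dist_real_def)
        finally show "norm (T (k - p) (h (t + p)) - h t) \<le> (M + 1) * \<eta>" by (simp add: algebra_simps)
      qed (use M \<eta> in auto)
      then have "norm (z (t + k) - T k (z t) - k *\<^sub>R h t) * Cl \<le> ((M + 1) * \<eta>) * k * Cl"
        using k Cl by (intro mult_right_mono) auto
      then have 2: "norm (l (z (t + k) - T k (z t) - k *\<^sub>R h t)) \<le> ((M + 1) * \<eta>) * k * Cl"
        using Cl(2) order_trans by blast
      have "l (z (t + k)) - l (z t) - k *\<^sub>R (m (z t) + l (h t)) =
          (l (T k (z t)) - l (z t) - k *\<^sub>R m (z t)) + l (z (t + k) - T k (z t) - k *\<^sub>R h t)"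
        by (simp add: linear_simps[OF l] algebra_simps)
      also have "norm \<dots> \<le> (\<eta> * Cm) * k + ((M + 1) * \<eta>) * k * Cl"
        by (intro norm_triangle_le add_mono 1 2)
      finally show ?thesis by (simp add: algebra_simps)
    qed
    show "\<forall>\<^sub>F s in at_right t. dist ((1 / (s - t)) *\<^sub>R (l (z s) - l (z t))) (m (z t) + l (h t)) < e"
      unfolding eventually_at_right_field
    proof (intro exI[of _ "t + d"] conjI allI impI)
      fix s assume "t < s" "s < t + d"
      then have k: "0 < s - t" "s - t < d" by auto
      have "(1 / (s - t)) *\<^sub>R (l (z s) - l (z t)) - (m (z t) + l (h t)) =
          (1 / (s - t)) *\<^sub>R (l (z s) - l (z t) - (s - t) *\<^sub>R (m (z t) + l (h t)))"
        using k by (simp only: scaleR_diff_right scaleR_scaleR) simp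
      also have "norm \<dots> = norm (l (z s) - l (z t) - (s - t) *\<^sub>R (m (z t) + l (h t))) / (s - t)"
        using k by simp
      also have "\<dots> \<le> (Cm + Cl * (M + 1)) * \<eta>"
        using main[OF k] k(1) by (simp add: pos_divide_le_eq)
      finally show "dist ((1 / (s - t)) *\<^sub>R (l (z s) - l (z t))) (m (z t) + l (h t)) < e"
        using \<eta>e by (simp add: dist_norm)
    qed (use d in simp)
  qed
qed

end

section \<open>Weak solutions and Steklov averages\<close>

lemma shifted_derivative:
  assumes "(\<phi> has_vector_derivative D) (at (t + h) within {0..})" "0 \<le> h"
  shows "((\<lambda>s. \<phi> (s + h)) has_vector_derivative D) (at t within {0..})"
proof -
  have "((\<phi> \<circ> (\<lambda>s. s + h)) has_vector_derivative 1 *\<^sub>R D) (at t within {0..})"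
    by (rule vector_diff_chain_within[where f' = 1])
       (use assms in \<open>auto intro!: derivative_eq_intros intro: has_vector_derivative_within_subset\<close>)
  then show ?thesis by (simp add: o_def)
qed

lemma continuous_on_shift:
  assumes "continuous_on {0..} \<phi>" "0 \<le> h"
  shows "continuous_on {0..} (\<lambda>t::real. \<phi> (t + h))"
  by (rule continuous_on_compose2[OF assms(1)]) (use assms(2) in \<open>auto intro!: continuous_intros\<close>)

text \<open>A forward difference quotient. If \<open>W\<close> is a primitive of \<open>w\<close>,
  it is the mean of \<open>w\<close> over an interval of length 1 / (n + 1), that is, a Steklov
  average; looking forward keeps it defined on the half-line.\<close>

definition steklov :: "(real \<Rightarrow> 'a::real_normed_vector) \<Rightarrow> nat \<Rightarrow> real \<Rightarrow> 'a" where
  "steklov W n t = real (Suc n) *\<^sub>R (W (t + 1 / real (Suc n)) - W t)"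

lemma steklov_derivative:
  assumes W: "\<And>t. 0 \<le> t \<Longrightarrow> (W has_vector_derivative w t) (at t within {0..})" and t: "0 \<le> t"
  shows "(steklov W n has_vector_derivative steklov w n t) (at t within {0..})"
proof -
  have "((\<lambda>s. W (s + 1 / real (Suc n))) has_vector_derivative w (t + 1 / real (Suc n))) (at t within {0..})"
    by (rule shifted_derivative[OF W]) (use t in auto)
  from bounded_linear.has_vector_derivative[OF bounded_linear_scaleR_right[of "real (Suc n)"]
      has_vector_derivative_diff[OF this W[OF t]]]
  show ?thesis unfolding steklov_def .
qed

lemma continuous_on_of_derivative:
  assumes "\<And>t. 0 \<le> t \<Longrightarrow> (W has_vector_derivative w t) (at t within {0..})"
  shows "continuous_on {0..} W"
  unfolding continuous_on_eq_continuous_within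
  using assms has_vector_derivative_continuous by fastforce

lemma increment_bound:
  assumes W: "\<And>t. 0 \<le> t \<Longrightarrow> (W has_vector_derivative w t) (at t within {0..})"
    and "0 \<le> s" "s \<le> t" and bd: "\<And>r. s \<le> r \<Longrightarrow> r \<le> t \<Longrightarrow> norm (w r - c) \<le> e"
  shows "norm (W t - W s - (t - s) *\<^sub>R c) \<le> e * (t - s)"
proof (rule right_derivative_bound[where d = w, OF \<open>s \<le> t\<close>])
  show "continuous_on {s..t} W"
    by (rule continuous_on_subset[OF continuous_on_of_derivative[OF W]]) (use assms in auto)
  show "(W has_vector_derivative w r) (at_right r)" if "s \<le> r" "r < t" for r
    by (rule has_vector_derivative_at_right[OF W]) (use that assms in auto)
qed (use bd in auto)

lemma steklov_uniform:
  assumes W: "\<And>t. 0 \<le> t \<Longrightarrow> (W has_vector_derivative w t) (at t within {0..})"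
    and w: "continuous_on {0..} w"
  shows "uniform_limit {0..L} (steklov W) w sequentially"
proof (rule uniform_limitI)
  fix e :: real assume e: "e > 0"
  \<comment> \<open>The averages look ahead by at most 1, hence the longer interval.\<close>
  have "uniformly_continuous_on {0..L+1} w"
    by (intro compact_uniformly_continuous continuous_on_subset[OF w]) auto
  then obtain d where d: "d > 0" "\<And>s t. s \<in> {0..L+1} \<Longrightarrow> t \<in> {0..L+1} \<Longrightarrow> dist s t < d \<Longrightarrow> dist (w s) (w t) < e / 2"
    unfolding uniformly_continuous_on_def using e half_gt_zero[OF e] by metis
  have "\<forall>\<^sub>F n in sequentially. 1 / real (Suc n) < d"
    using order_tendstoD(2)[OF LIMSEQ_Suc[OF lim_1_over_n] d(1)] .
  then show "\<forall>\<^sub>F n in sequentially. \<forall>t\<in>{0..L}. dist (steklov W n t) (w t) < e"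
  proof (rule eventually_mono, intro ballI)
    fix n t assume n: "1 / real (Suc n) < d" and t: "t \<in> {0..L}"
    define \<delta> where "\<delta> = 1 / real (Suc n)"
    have \<delta>: "0 < \<delta>" "\<delta> \<le> 1" "\<delta> < d" and Sn: "real (Suc n) = 1 / \<delta>"
      using n by (auto simp: \<delta>_def)
    have "norm (W (t + \<delta>) - W t - (t + \<delta> - t) *\<^sub>R w t) \<le> e / 2 * (t + \<delta> - t)"
    proof (rule increment_bound[OF W])
      fix r assume "t \<le> r" "r \<le> t + \<delta>"
      then show "norm (w r - w t) \<le> e / 2"
        using d(2)[of r t] t \<delta> by (auto simp: dist_norm dist_real_def)
    qed (use t \<delta> in auto)
    then have "(1 / \<delta>) * norm (W (t + \<delta>) - W t - \<delta> *\<^sub>R w t) \<le> e / 2"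
      using \<delta> by (simp add: field_simps)
    also have "(1 / \<delta>) * norm (W (t + \<delta>) - W t - \<delta> *\<^sub>R w t) = norm ((1 / \<delta>) *\<^sub>R (W (t + \<delta>) - W t - \<delta> *\<^sub>R w t))"
      using \<delta> by simp
    also have "(1 / \<delta>) *\<^sub>R (W (t + \<delta>) - W t - \<delta> *\<^sub>R w t) = steklov W n t - w t"
    proof -
      have "steklov W n t = (1 / \<delta>) *\<^sub>R (W (t + \<delta>) - W t)"
        unfolding steklov_def Sn using \<delta> by simp
      then show ?thesis using \<delta> by (simp add: scaleR_diff_right)
    qed
    finally show "dist (steklov W n t) (w t) < e" using e by (simp add: dist_norm)
  qed
qed

lemma steklov_pointwise:
  assumes "\<And>t. 0 \<le> t \<Longrightarrow> (W has_vector_derivative w t) (at t within {0..})"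
    and "continuous_on {0..} w" "0 \<le> t"
  shows "(\<lambda>n. steklov W n t) \<longlonglongrightarrow> w t"
  using tendsto_uniform_limitI[OF steklov_uniform[OF assms(1,2), of t], of t] assms(3) by simp

lemma bounded_linear_steklov:
  "bounded_linear l \<Longrightarrow> l (steklov W n t) = steklov (\<lambda>s. l (W s)) n t"
  unfolding steklov_def by (simp add: linear_simps)

lemma bounded_image_Icc:
  fixes w :: "real \<Rightarrow> 'a::real_normed_vector"
  assumes "continuous_on {0..} w" "0 \<le> s" shows "bounded (w ` {s..t})"
  by (intro compact_imp_bounded compact_continuous_image continuous_on_subset[OF assms(1)])
     (use assms(2) in auto)

text \<open>\<open>V\<close> stands for the Sobolev space, \<open>j\<close> for its map to the
  Lebesgue space and \<open>a\<close> for the elliptic form. The map stays explicit because a jet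
  and the function it represents have different types.\<close>

locale energy_space = closed_subspace V for V :: "'v::{real_inner, banach} set" +
  fixes j :: "'v \<Rightarrow> 'h::{real_inner, banach}" and a :: "'v \<Rightarrow> 'v \<Rightarrow> real" and c0 :: real
  assumes j: "bounded_linear j" and a: "bounded_bilinear a" and a_sym: "a x y = a y x"
    and c0: "c0 > 0" and coercive: "x \<in> V \<Longrightarrow> c0 * (norm x)\<^sup>2 \<le> a x x"
begin

lemma a_nonneg: "x \<in> V \<Longrightarrow> 0 \<le> a x x"
  using coercive[of x] c0 by (meson mult_nonneg_nonneg less_imp_le order_trans zero_le_power2)

lemma steklov_in_V: "\<lbrakk>\<And>t. 0 \<le> t \<Longrightarrow> u t \<in> V; 0 \<le> t\<rbrakk> \<Longrightarrow> steklov u n t \<in> V"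
  unfolding steklov_def by (intro subspace_scale subspace_diff subspace_X) auto

text \<open>The velocity need not have a time derivative in the Lebesgue space, so only pairings
  with fixed elements of \<open>V\<close> are differentiated, with the inertial and the damping term
  kept together.\<close>

definition weak_wave :: "real \<Rightarrow> (real \<Rightarrow> 'v) \<Rightarrow> (real \<Rightarrow> 'h) \<Rightarrow> (real \<Rightarrow> 'h) \<Rightarrow> bool" where
  "weak_wave \<epsilon> u v g \<longleftrightarrow> continuous_on {0..} u \<and> (\<forall>t\<ge>0. u t \<in> V) \<and>
     continuous_on {0..} v \<and> continuous_on {0..} g \<and>
     (\<forall>t\<ge>0. ((\<lambda>s. j (u s)) has_vector_derivative v t) (at t within {0..})) \<and>
     (\<forall>b\<in>V. \<forall>t\<ge>0. ((\<lambda>s. (\<epsilon> *\<^sub>R v s + j (u s)) \<bullet> j b) has_real_derivative (- a (u t) b + g t \<bullet> j b))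
        (at t within {0..}))"

lemma weak_wave_diff:
  assumes "weak_wave \<epsilon> u v g" "weak_wave \<epsilon> u' v' g'"
  shows "weak_wave \<epsilon> (\<lambda>t. u t - u' t) (\<lambda>t. v t - v' t) (\<lambda>t. g t - g' t)"
proof -
  have "((\<lambda>s. (\<epsilon> *\<^sub>R (v s - v' s) + j (u s - u' s)) \<bullet> j b) has_real_derivative
      (- a (u t - u' t) b + (g t - g' t) \<bullet> j b)) (at t within {0..})" if "b \<in> V" "t \<ge> 0" for b t
  proof -
    have "((\<lambda>s. (\<epsilon> *\<^sub>R v s + j (u s)) \<bullet> j b - (\<epsilon> *\<^sub>R v' s + j (u' s)) \<bullet> j b) has_real_derivative
      ((- a (u t) b + g t \<bullet> j b) - (- a (u' t) b + g' t \<bullet> j b))) (at t within {0..})"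
      using assms that unfolding weak_wave_def by (intro DERIV_diff) auto
    moreover have "(\<lambda>s. (\<epsilon> *\<^sub>R v s + j (u s)) \<bullet> j b - (\<epsilon> *\<^sub>R v' s + j (u' s)) \<bullet> j b)
        = (\<lambda>s. (\<epsilon> *\<^sub>R (v s - v' s) + j (u s - u' s)) \<bullet> j b)"
      by (simp add: linear_simps[OF j] inner_diff_left inner_add_left scaleR_diff_right algebra_simps)
    moreover have "(- a (u t) b + g t \<bullet> j b) - (- a (u' t) b + g' t \<bullet> j b) =
       - a (u t - u' t) b + (g t - g' t) \<bullet> j b"
      by (simp add: bounded_bilinear.diff_left[OF a] inner_diff_left)
    ultimately show ?thesis by simp
  qed
  moreover have "((\<lambda>s. j (u s - u' s)) has_vector_derivative v t - v' t) (at t within {0..})" if "t \<ge> 0" for t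
    using assms that unfolding weak_wave_def linear_simps[OF j]
    by (intro has_vector_derivative_diff) auto
  ultimately show ?thesis
    using assms unfolding weak_wave_def by (auto intro!: continuous_on_diff subspace_diff[OF subspace_X])
qed

lemma weak_wave_shift:
  assumes w: "weak_wave \<epsilon> u v g" and h: "0 \<le> h"
  shows "weak_wave \<epsilon> (\<lambda>t. u (t + h)) (\<lambda>t. v (t + h)) (\<lambda>t. g (t + h))"
  using w h unfolding weak_wave_def
  by (auto simp: has_real_derivative_iff_has_vector_derivative intro!: shifted_derivative continuous_on_shift)

text \<open>In this identity between increments the test element may afterwards be chosen in
  dependence on \<open>s\<close> and \<open>t\<close>, which the differential form, with its fixed
  test elements, does not permit.\<close>

lemma weak_wave_integrated:
  assumes w: "weak_wave \<epsilon> u v g" and b: "b \<in> V"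
    and U: "\<And>t. 0 \<le> t \<Longrightarrow> (U has_vector_derivative u t) (at t within {0..})"
    and \<Gamma>: "\<And>t. 0 \<le> t \<Longrightarrow> (\<Gamma> has_vector_derivative g t) (at t within {0..})"
    and st: "0 \<le> s" "0 \<le> t"
  shows "\<epsilon> * ((v t - v s) \<bullet> j b) + (j (u t) - j (u s)) \<bullet> j b = - a (U t - U s) b + (\<Gamma> t - \<Gamma> s) \<bullet> j b"
proof -
  define Y where "Y r = (\<epsilon> *\<^sub>R v r + j (u r)) \<bullet> j b + a (U r) b - \<Gamma> r \<bullet> j b" for r
  have "Y r = Y 0" if "0 \<le> r" for r
  proof (rule constant_of_derivative[OF _ that])
    fix r :: real assume r: "0 \<le> r"
    have "((\<lambda>s. (\<epsilon> *\<^sub>R v s + j (u s)) \<bullet> j b) has_vector_derivative (- a (u r) b + g r \<bullet> j b)) (at r within {0..})"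
      using w b r by (auto simp: weak_wave_def has_real_derivative_iff_has_vector_derivative)
    moreover have "((\<lambda>r. a (U r) b) has_vector_derivative a (u r) b) (at r within {0..})"
      by (rule bounded_linear.has_vector_derivative[OF bounded_bilinear.bounded_linear_left[OF a] U[OF r]])
    moreover have "((\<lambda>r. \<Gamma> r \<bullet> j b) has_vector_derivative g r \<bullet> j b) (at r within {0..})"
      by (rule bounded_linear.has_vector_derivative[OF bounded_linear_inner_left \<Gamma>[OF r]])
    ultimately have "(Y has_vector_derivative (- a (u r) b + g r \<bullet> j b) + a (u r) b - g r \<bullet> j b) (at r within {0..})"
      unfolding Y_def by (intro has_vector_derivative_diff has_vector_derivative_add)
    then show "(Y has_vector_derivative 0) (at r within {0..})" by simp
  qed
  from this[OF st(1)] this[OF st(2)] have "Y t - Y s = 0" by simp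
  then show ?thesis
    by (simp add: Y_def inner_diff_left inner_add_left bounded_bilinear.diff_left[OF a] algebra_simps)
qed

text \<open>The energy identity holds for the Steklov averages, which are smooth in time.\<close>

lemma energy_identity:
  assumes w: "weak_wave \<epsilon> u v g" and t: "0 \<le> t"
  shows "((\<lambda>s. (a (u s) (u s) + \<epsilon> * (norm (v s))\<^sup>2) / 2) has_real_derivative
     (g t \<bullet> v t - (norm (v t))\<^sup>2)) (at t within {0..})"
proof -
  have u: "continuous_on {0..} u" "\<And>t. 0 \<le> t \<Longrightarrow> u t \<in> V" and v: "continuous_on {0..} v"
    and g: "continuous_on {0..} g"
    and ju: "\<And>t. 0 \<le> t \<Longrightarrow> ((\<lambda>s. j (u s)) has_vector_derivative v t) (at t within {0..})"
    using w by (auto simp: weak_wave_def)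
  define U where "U t = integral {0..t} u" for t
  define \<Gamma> where "\<Gamma> t = integral {0..t} g" for t
  have U: "(U has_vector_derivative u t) (at t within {0..})" if "0 \<le> t" for t
    unfolding U_def by (rule integral_derivative_atLeast[OF u(1) that])
  have \<Gamma>: "(\<Gamma> has_vector_derivative g t) (at t within {0..})" if "0 \<le> t" for t
    unfolding \<Gamma>_def by (rule integral_derivative_atLeast[OF g that])
  define un where "un = steklov U"
  define vn where "vn = steklov (\<lambda>s. j (u s))"
  define gn where "gn = steklov \<Gamma>"
  define X where "X = (\<lambda>t. (a (u t) (u t) + \<epsilon> * (norm (v t))\<^sup>2) / 2)"
  define Xn where "Xn = (\<lambda>n t. (a (un n t) (un n t) + \<epsilon> * (vn n t \<bullet> vn n t)) / 2)"
  define Yn where "Yn = (\<lambda>n t. gn n t \<bullet> vn n t - vn n t \<bullet> vn n t)"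
  define Y where "Y = (\<lambda>t. g t \<bullet> v t - v t \<bullet> v t)"
  have vn_j: "j (steklov u n t) = vn n t" for n t
    unfolding vn_def by (rule bounded_linear_steklov[OF j])
  have dXn: "(Xn n has_vector_derivative Yn n t) (at t within {0..})" if t: "0 \<le> t" for n t
  proof -
    \<comment> \<open>\<open>b\<close> is the time derivative of \<open>un\<close>, and
      \<open>j b\<close> is \<open>vn\<close>: with this test element the form and the kinetic term
      both become exact derivatives.\<close>
    define b where "b = steklov u n t"
    have bV: "b \<in> V" unfolding b_def by (rule steklov_in_V[OF u(2) t])
    have d1: "((\<lambda>s. a (un n s) (un n s)) has_vector_derivative (a (un n t) b + a b (un n t))) (at t within {0..})"
      unfolding b_def un_def
      by (rule bounded_bilinear.has_vector_derivative[OF a steklov_derivative[OF U t] steklov_derivative[OF U t]])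
    have d2: "((\<lambda>s. vn n s \<bullet> vn n s) has_vector_derivative (vn n t \<bullet> steklov v n t + steklov v n t \<bullet> vn n t)) (at t within {0..})"
      unfolding vn_def
      by (rule bounded_bilinear.has_vector_derivative[OF bounded_bilinear_inner steklov_derivative[OF ju t] steklov_derivative[OF ju t]])
    have "\<epsilon> * (steklov v n t \<bullet> j b) + vn n t \<bullet> j b = - a (un n t) b + gn n t \<bullet> j b"
    proof -
      have "real (Suc n) * (\<epsilon> * ((v (t + 1 / real (Suc n)) - v t) \<bullet> j b) + (j (u (t + 1 / real (Suc n))) - j (u t)) \<bullet> j b)
        = real (Suc n) * (- a (U (t + 1 / real (Suc n)) - U t) b + (\<Gamma> (t + 1 / real (Suc n)) - \<Gamma> t) \<bullet> j b)"
        by (subst weak_wave_integrated[OF w bV U \<Gamma>]) (use t in auto)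
      then show ?thesis
        unfolding vn_def un_def gn_def steklov_def inner_scaleR_left bounded_bilinear.scaleR_left[OF a] real_scaleR_def
        by (simp only: distrib_left mult_minus_right mult.left_commute[of "real (Suc n)" \<epsilon>])
    qed
    then have key: "a (un n t) b + \<epsilon> * (steklov v n t \<bullet> vn n t) = gn n t \<bullet> vn n t - vn n t \<bullet> vn n t"
      using vn_j[of n t] by (simp add: b_def)
    have "(Xn n has_vector_derivative (a (un n t) b + a b (un n t) + \<epsilon> * (vn n t \<bullet> steklov v n t + steklov v n t \<bullet> vn n t)) / 2) (at t within {0..})"
      unfolding Xn_def using d1 d2
      by (auto intro!: derivative_eq_intros simp: has_real_derivative_iff_has_vector_derivative[symmetric])
    moreover have "(a (un n t) b + a b (un n t) + \<epsilon> * (vn n t \<bullet> steklov v n t + steklov v n t \<bullet> vn n t)) / 2 = Yn n t"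
      using key unfolding Yn_def by (simp add: a_sym[of b] inner_commute[of "vn n t" "steklov v n t"])
    ultimately show ?thesis by simp
  qed
  have Xlim: "(\<lambda>n. Xn n t) \<longlonglongrightarrow> X t" if "0 \<le> t" for t
    unfolding Xn_def X_def power2_norm_eq_inner un_def vn_def
    by (intro tendsto_intros bounded_bilinear.tendsto[OF a] steklov_pointwise[OF U u(1) that] steklov_pointwise[OF ju v that]) auto
  \<comment> \<open>The energies converge pointwise and their derivatives converge uniformly on
    bounded intervals, so the fundamental theorem passes to the limit.\<close>
  have Ylim: "uniform_limit {0..t} Yn Y sequentially" if "0 \<le> t" for t
    unfolding Yn_def Y_def vn_def gn_def
    by (intro uniform_limit_intros steklov_uniform ju v \<Gamma> g bounded_image_Icc) (auto simp: image_def)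
  have Ycont: "continuous_on {0..} Y" unfolding Y_def by (intro continuous_intros g v)
  have XY: "X t - X 0 = integral {0..t} Y" if t: "0 \<le> t" for t
  proof -
    have cont: "continuous_on {0..t} (Yn n)" for n
    proof -
      have "continuous_on {0..} (Yn n)"
        unfolding Yn_def vn_def gn_def
        by (intro continuous_intros continuous_on_of_derivative[OF steklov_derivative[OF ju]]
            continuous_on_of_derivative[OF steklov_derivative[OF \<Gamma>]])
      then show ?thesis by (rule continuous_on_subset) auto
    qed
    obtain I J where IJ: "\<And>n. (Yn n has_integral I n) {0..t}" "(Y has_integral J) {0..t}" "I \<longlonglongrightarrow> J"
      using uniform_limit_integral[OF Ylim[OF t] cont] by auto
    have "(Yn n has_integral (Xn n t - Xn n 0)) {0..t}" for n
      by (intro fundamental_theorem_of_calculus has_vector_derivative_within_subset[OF dXn] t) auto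
    then have "I n = Xn n t - Xn n 0" for n using IJ(1) has_integral_unique by blast
    moreover have "(\<lambda>n. Xn n t - Xn n 0) \<longlonglongrightarrow> X t - X 0" by (intro tendsto_diff Xlim) (use t in auto)
    ultimately have "J = X t - X 0" using IJ(3) LIMSEQ_unique by (metis (no_types, lifting) ext)
    then show ?thesis using IJ(2) by (simp add: integral_unique)
  qed
  have "((\<lambda>s. X 0 + integral {0..s} Y) has_vector_derivative 0 + Y t) (at t within {0..})"
    by (intro has_vector_derivative_add has_vector_derivative_const integral_derivative_atLeast Ycont t)
  then have "((\<lambda>s. X 0 + integral {0..s} Y) has_vector_derivative Y t) (at t within {0..})" by simp
  moreover have "t \<in> {0..}" using t by simp
  moreover have "X s = X 0 + integral {0..s} Y" if "s \<in> {0..}" for s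
    using XY[of s] that by (simp add: diff_eq_eq)
  ultimately have "(X has_vector_derivative Y t) (at t within {0..})"
    by (rule has_vector_derivative_transform[rotated 2])
  then show ?thesis
    by (simp add: X_def Y_def power2_norm_eq_inner has_real_derivative_iff_has_vector_derivative)
qed

text \<open>Here the test element is the solution itself, which lies in \<open>V\<close>, so no time
  averages are needed: the integrated equation is tested with \<open>u s\<close> at the moving
  endpoint, and continuity of \<open>u\<close> gives the limit of the difference quotient.\<close>

lemma cross_identity:
  assumes w: "weak_wave \<epsilon> u v g" and t: "0 \<le> t"
  shows "((\<lambda>s. \<epsilon> * (v s \<bullet> j (u s)) + (norm (j (u s)))\<^sup>2 / 2) has_real_derivative
     (\<epsilon> * (norm (v t))\<^sup>2 - a (u t) (u t) + g t \<bullet> j (u t))) (at t within {0..})"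
proof -
  have u: "continuous_on {0..} u" "\<And>t. 0 \<le> t \<Longrightarrow> u t \<in> V" and g: "continuous_on {0..} g"
    and ju: "\<And>t. 0 \<le> t \<Longrightarrow> ((\<lambda>s. j (u s)) has_vector_derivative v t) (at t within {0..})"
    using w by (auto simp: weak_wave_def)
  define U where "U t = integral {0..t} u" for t
  define \<Gamma> where "\<Gamma> t = integral {0..t} g" for t
  have U: "(U has_vector_derivative u t) (at t within {0..})" if "0 \<le> t" for t
    unfolding U_def by (rule integral_derivative_atLeast[OF u(1) that])
  have \<Gamma>: "(\<Gamma> has_vector_derivative g t) (at t within {0..})" if "0 \<le> t" for t
    unfolding \<Gamma>_def by (rule integral_derivative_atLeast[OF g that])
  have ulim: "(u \<longlongrightarrow> u t) (at t within {0..})"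
    using u(1) t by (auto simp: continuous_on_def)
  have julim: "((\<lambda>s. j (u s)) \<longlongrightarrow> j (u t)) (at t within {0..})"
    by (rule bounded_linear.tendsto[OF j ulim])
  have "((\<lambda>s. (1 / (s - t)) *\<^sub>R (\<epsilon> * (v s \<bullet> j (u s)) - \<epsilon> * (v t \<bullet> j (u t)))) \<longlongrightarrow>
     (- (v t \<bullet> j (u t)) - a (u t) (u t) + g t \<bullet> j (u t) + \<epsilon> * (v t \<bullet> v t))) (at t within {0..})"
  proof (rule Lim_transform_eventually)
    show "((\<lambda>s. - ((1 / (s - t)) *\<^sub>R (j (u s) - j (u t)) \<bullet> j (u s)) - a ((1 / (s - t)) *\<^sub>R (U s - U t)) (u s)
       + (1 / (s - t)) *\<^sub>R (\<Gamma> s - \<Gamma> t) \<bullet> j (u s) + \<epsilon> * (v t \<bullet> ((1 / (s - t)) *\<^sub>R (j (u s) - j (u t)))))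
      \<longlongrightarrow> - (v t \<bullet> j (u t)) - a (u t) (u t) + g t \<bullet> j (u t) + \<epsilon> * (v t \<bullet> v t)) (at t within {0..})"
      using ju[OF t] U[OF t] \<Gamma>[OF t] unfolding has_vector_derivative_iff_quotient
      by (intro tendsto_intros bounded_bilinear.tendsto[OF a] ulim julim)
    show "\<forall>\<^sub>F s in at t within {0..}. - ((1 / (s - t)) *\<^sub>R (j (u s) - j (u t)) \<bullet> j (u s)) - a ((1 / (s - t)) *\<^sub>R (U s - U t)) (u s)
       + (1 / (s - t)) *\<^sub>R (\<Gamma> s - \<Gamma> t) \<bullet> j (u s) + \<epsilon> * (v t \<bullet> ((1 / (s - t)) *\<^sub>R (j (u s) - j (u t))))
       = (1 / (s - t)) *\<^sub>R (\<epsilon> * (v s \<bullet> j (u s)) - \<epsilon> * (v t \<bullet> j (u t)))"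
      unfolding eventually_at_filter
    proof (intro always_eventually allI impI)
      fix s assume "s \<noteq> t" and s: "s \<in> {0..}"
      \<comment> \<open>The part of the product rule that would need a derivative of
        \<open>v\<close>; the integrated equation replaces the increment of \<open>v\<close> by
        increments of differentiable quantities.\<close>
      have e: "\<epsilon> * ((v s - v t) \<bullet> j (u s)) = - ((j (u s) - j (u t)) \<bullet> j (u s)) - a (U s - U t) (u s) + (\<Gamma> s - \<Gamma> t) \<bullet> j (u s)"
        using weak_wave_integrated[OF w u(2) U \<Gamma> t, of s s] s by (simp add: algebra_simps)
      have "(1 / (s - t)) *\<^sub>R (\<epsilon> * (v s \<bullet> j (u s)) - \<epsilon> * (v t \<bullet> j (u t))) =
         (1 / (s - t)) * (\<epsilon> * ((v s - v t) \<bullet> j (u s))) + (1 / (s - t)) * (\<epsilon> * (v t \<bullet> (j (u s) - j (u t))))"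
        by (simp add: inner_diff_left inner_diff_right algebra_simps)
      then show "- ((1 / (s - t)) *\<^sub>R (j (u s) - j (u t)) \<bullet> j (u s)) - a ((1 / (s - t)) *\<^sub>R (U s - U t)) (u s)
       + (1 / (s - t)) *\<^sub>R (\<Gamma> s - \<Gamma> t) \<bullet> j (u s) + \<epsilon> * (v t \<bullet> ((1 / (s - t)) *\<^sub>R (j (u s) - j (u t))))
       = (1 / (s - t)) *\<^sub>R (\<epsilon> * (v s \<bullet> j (u s)) - \<epsilon> * (v t \<bullet> j (u t)))"
        unfolding e inner_scaleR_left inner_scaleR_right bounded_bilinear.scaleR_left[OF a]
        by (simp only: real_scaleR_def distrib_left right_diff_distrib mult_minus_right mult.left_commute[of _ \<epsilon>])
    qed
  qed
  then have 1: "((\<lambda>s. \<epsilon> * (v s \<bullet> j (u s))) has_vector_derivative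
     (- (v t \<bullet> j (u t)) - a (u t) (u t) + g t \<bullet> j (u t) + \<epsilon> * (v t \<bullet> v t))) (at t within {0..})"
    unfolding has_vector_derivative_iff_quotient .
  have 2: "((\<lambda>s. j (u s) \<bullet> j (u s)) has_vector_derivative (j (u t) \<bullet> v t + v t \<bullet> j (u t))) (at t within {0..})"
    by (rule bounded_bilinear.has_vector_derivative[OF bounded_bilinear_inner ju[OF t] ju[OF t]])
  have "((\<lambda>s. \<epsilon> * (v s \<bullet> j (u s)) + (j (u s) \<bullet> j (u s)) * (1 / 2)) has_vector_derivative
      ((- (v t \<bullet> j (u t)) - a (u t) (u t) + g t \<bullet> j (u t) + \<epsilon> * (v t \<bullet> v t))
        + (j (u t) \<bullet> v t + v t \<bullet> j (u t)) * (1 / 2))) (at t within {0..})"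
    by (intro has_vector_derivative_add 1 bounded_linear.has_vector_derivative[OF bounded_linear_mult_left 2])
  moreover have "(- (v t \<bullet> j (u t)) - a (u t) (u t) + g t \<bullet> j (u t) + \<epsilon> * (v t \<bullet> v t))
        + (j (u t) \<bullet> v t + v t \<bullet> j (u t)) * (1 / 2)
      = \<epsilon> * (norm (v t))\<^sup>2 - a (u t) (u t) + g t \<bullet> j (u t)"
    by (simp add: inner_commute[of "j (u t)" "v t"] power2_norm_eq_inner)
  ultimately show ?thesis
    by (simp only: has_real_derivative_iff_has_vector_derivative power2_norm_eq_inner) simp
qed

lemma parabolic_inequality:
  assumes z: "continuous_on {0..} z" "\<And>t. 0 \<le> t \<Longrightarrow> z t \<in> V"
    and g: "continuous_on {0..} g"
    and weak: "\<And>b t. b \<in> V \<Longrightarrow> 0 \<le> t \<Longrightarrow>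
       ((\<lambda>s. (w s + j (z s)) \<bullet> j b) has_real_derivative (- a (z t) b + g t \<bullet> j b)) (at t within {0..})"
    and w: "\<And>s t. 0 \<le> s \<Longrightarrow> s \<le> t \<Longrightarrow> norm (w t - w s) \<le> \<kappa> * (t - s)"
    and t: "0 \<le> t"
  shows "a (z t) (z t) \<le> a (z 0) (z 0) + integral {0..t} (\<lambda>s. (norm (g s))\<^sup>2 + \<kappa>\<^sup>2)"
proof -
  define U where "U t = integral {0..t} z" for t
  define \<Gamma> where "\<Gamma> t = integral {0..t} g" for t
  have U: "(U has_vector_derivative z t) (at t within {0..})" if "0 \<le> t" for t
    unfolding U_def by (rule integral_derivative_atLeast[OF z(1) that])
  have \<Gamma>: "(\<Gamma> has_vector_derivative g t) (at t within {0..})" if "0 \<le> t" for t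
    unfolding \<Gamma>_def by (rule integral_derivative_atLeast[OF g that])
  have integrated: "(w t - w s) \<bullet> j b + (j (z t) - j (z s)) \<bullet> j b = - a (U t - U s) b + (\<Gamma> t - \<Gamma> s) \<bullet> j b"
    if b: "b \<in> V" and st: "0 \<le> s" "0 \<le> t" for b s t
  proof -
    define Y where "Y r = (w r + j (z r)) \<bullet> j b + a (U r) b - \<Gamma> r \<bullet> j b" for r
    have "Y r = Y 0" if "0 \<le> r" for r
    proof (rule constant_of_derivative[OF _ that])
      fix r :: real assume r: "0 \<le> r"
      have "((\<lambda>r. a (U r) b) has_vector_derivative a (z r) b) (at r within {0..})"
        by (rule bounded_linear.has_vector_derivative[OF bounded_bilinear.bounded_linear_left[OF a] U[OF r]])
      moreover have "((\<lambda>r. \<Gamma> r \<bullet> j b) has_vector_derivative g r \<bullet> j b) (at r within {0..})"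
        by (rule bounded_linear.has_vector_derivative[OF bounded_linear_inner_left \<Gamma>[OF r]])
      ultimately have "(Y has_vector_derivative (- a (z r) b + g r \<bullet> j b) + a (z r) b - g r \<bullet> j b) (at r within {0..})"
        unfolding Y_def using weak[OF b r] unfolding has_real_derivative_iff_has_vector_derivative
        by (intro has_vector_derivative_diff has_vector_derivative_add)
      then show "(Y has_vector_derivative 0) (at r within {0..})" by simp
    qed
    from this[OF st(1)] this[OF st(2)] have "Y t - Y s = 0" by simp
    then show ?thesis
      by (simp add: Y_def inner_diff_left inner_add_left bounded_bilinear.diff_left[OF a] algebra_simps)
  qed
  define zn where "zn = steklov U"
  define gn where "gn = steklov \<Gamma>"
  have gn_cont: "continuous_on {0..} (gn n)" for n
    unfolding gn_def by (rule continuous_on_of_derivative[OF steklov_derivative[OF \<Gamma>]])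
  have gn2_cont: "continuous_on {0..} (\<lambda>s. (norm (gn n s))\<^sup>2 + \<kappa>\<^sup>2)" for n
    by (intro continuous_intros gn_cont)
  have est: "a (zn n t) (zn n t) \<le> a (zn n 0) (zn n 0) + integral {0..t} (\<lambda>s. (norm (gn n s))\<^sup>2 + \<kappa>\<^sup>2)" for n
  proof -
    define X where "X r = a (zn n r) (zn n r) - integral {0..r} (\<lambda>s. (norm (gn n s))\<^sup>2 + \<kappa>\<^sup>2)" for r
    have "X t \<le> X 0"
    proof (rule nonincreasing_of_derivative[OF _ _ _ t])
      fix r :: real assume r: "0 \<le> r"
      define b where "b = steklov z n r"
      have bV: "b \<in> V" unfolding b_def by (rule steklov_in_V[OF z(2) r])
      have "((\<lambda>s. a (zn n s) (zn n s)) has_vector_derivative (a (zn n r) b + a b (zn n r))) (at r within {0..})"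
        unfolding b_def zn_def
        by (rule bounded_bilinear.has_vector_derivative[OF a steklov_derivative[OF U r] steklov_derivative[OF U r]])
      from has_vector_derivative_diff[OF this integral_derivative_atLeast[OF gn2_cont[of n] r]]
      show "(X has_real_derivative (a (zn n r) b + a b (zn n r) - ((norm (gn n r))\<^sup>2 + \<kappa>\<^sup>2))) (at r within {0..})"
        unfolding X_def has_real_derivative_iff_has_vector_derivative .
      have jb: "j b = steklov (\<lambda>s. j (z s)) n r" unfolding b_def by (rule bounded_linear_steklov[OF j])
      have key: "steklov w n r \<bullet> j b + j b \<bullet> j b = - a (zn n r) b + gn n r \<bullet> j b"
      proof -
        have "real (Suc n) * ((w (r + 1 / real (Suc n)) - w r) \<bullet> j b + (j (z (r + 1 / real (Suc n))) - j (z r)) \<bullet> j b)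
          = real (Suc n) * (- a (U (r + 1 / real (Suc n)) - U r) b + (\<Gamma> (r + 1 / real (Suc n)) - \<Gamma> r) \<bullet> j b)"
          by (subst integrated[OF bV]) (use r in auto)
        then have "steklov w n r \<bullet> j b + steklov (\<lambda>s. j (z s)) n r \<bullet> j b = - a (zn n r) b + gn n r \<bullet> j b"
          unfolding zn_def gn_def steklov_def inner_scaleR_left bounded_bilinear.scaleR_left[OF a] real_scaleR_def
          by (simp only: distrib_left mult_minus_right)
        then show ?thesis by (simp add: jb)
      qed
      have "norm (steklov w n r) \<le> \<kappa>"
      proof -
        have "norm (steklov w n r) = real (Suc n) * norm (w (r + 1 / real (Suc n)) - w r)"
          unfolding steklov_def norm_scaleR by simp
        also have "\<dots> \<le> real (Suc n) * (\<kappa> * (1 / real (Suc n)))"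
          using w[OF r, of "r + 1 / real (Suc n)"] by (intro mult_left_mono) auto
        finally show ?thesis by simp
      qed
      then have wk: "(norm (steklov w n r))\<^sup>2 \<le> \<kappa>\<^sup>2" by (intro power_mono) auto
      \<comment> \<open>Completing the square removes \<open>j b\<close>: the form is at most x . x
        / 4, and x . x is at most twice the sum of the two squares. Doubling, since the form has two
        equal slots, leaves exactly the square of \<open>gn\<close> plus that of
        \<open>\<kappa>\<close>.\<close>
      define x where "x = gn n r - steklov w n r"
      have "a (zn n r) b = x \<bullet> j b - j b \<bullet> j b" using key by (simp add: x_def inner_diff_left)
      moreover have "x \<bullet> j b - j b \<bullet> j b \<le> (x \<bullet> x) / 4"
        using inner_ge_zero[of "(1/2) *\<^sub>R x - j b"] by (simp add: inner_diff inner_commute algebra_simps)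
      moreover have "x \<bullet> x \<le> 2 * (norm (gn n r))\<^sup>2 + 2 * (norm (steklov w n r))\<^sup>2"
        using inner_ge_zero[of "gn n r + steklov w n r"]
        by (simp add: x_def power2_norm_eq_inner inner_diff inner_add inner_commute algebra_simps)
      ultimately show "a (zn n r) b + a b (zn n r) - ((norm (gn n r))\<^sup>2 + \<kappa>\<^sup>2) \<le> 0"
        using wk by (simp add: a_sym[of b])
    qed simp
    then show ?thesis by (simp add: X_def)
  qed
  have lim: "uniform_limit {0..t} (\<lambda>n s. gn n s \<bullet> gn n s + \<kappa>\<^sup>2) (\<lambda>s. g s \<bullet> g s + \<kappa>\<^sup>2) sequentially"
    unfolding gn_def
    by (intro uniform_limit_intros steklov_uniform \<Gamma> g bounded_image_Icc) (auto simp: image_def)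
  obtain I J where IJ: "\<And>n. ((\<lambda>s. gn n s \<bullet> gn n s + \<kappa>\<^sup>2) has_integral I n) {0..t}"
      "((\<lambda>s. g s \<bullet> g s + \<kappa>\<^sup>2) has_integral J) {0..t}" "I \<longlonglongrightarrow> J"
    by (rule uniform_limit_integral[OF lim])
       (auto simp: power2_norm_eq_inner[symmetric] intro!: continuous_on_subset[OF gn2_cont])
  have "I = (\<lambda>n. integral {0..t} (\<lambda>s. (norm (gn n s))\<^sup>2 + \<kappa>\<^sup>2))" "J = integral {0..t} (\<lambda>s. (norm (g s))\<^sup>2 + \<kappa>\<^sup>2)"
    using integral_unique[OF IJ(1)] integral_unique[OF IJ(2)] by (auto simp: power2_norm_eq_inner)
  then have ilim: "(\<lambda>n. integral {0..t} (\<lambda>s. (norm (gn n s))\<^sup>2 + \<kappa>\<^sup>2)) \<longlonglongrightarrow> integral {0..t} (\<lambda>s. (norm (g s))\<^sup>2 + \<kappa>\<^sup>2)"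
    using IJ(3) by simp
  have zlim: "(\<lambda>n. zn n s) \<longlonglongrightarrow> z s" if "0 \<le> s" for s
    unfolding zn_def by (rule steklov_pointwise[OF U z(1) that])
  show ?thesis
    by (rule LIMSEQ_le[OF _ _ exI[of _ 0], of "\<lambda>n. a (zn n t) (zn n t)" _
          "\<lambda>n. a (zn n 0) (zn n 0) + integral {0..t} (\<lambda>s. (norm (gn n s))\<^sup>2 + \<kappa>\<^sup>2)"])
       (use est t in \<open>auto intro!: tendsto_intros ilim bounded_bilinear.tendsto[OF a] zlim\<close>)
qed

end

section \<open>Complete orbits of damped gradient systems\<close>

text \<open>For a time difference (p, q) with forcing g, \<open>X\<close>, \<open>Y\<close>,
  \<open>Z\<close> are the energy norm of p, |q| and |j p|, while \<open>c\<close>,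
  \<open>d\<close>, \<open>e\<close> are the products g . q, g . j p and q . j p. The left side is
  the derivative of the damped energy. The value of \<open>\<kappa>\<close> makes \<kappa> l^2 =
  1/2, so that the forcing in \<open>c\<close> uses up only X^2 / 4 and half of the damping; the
  bound on \<epsilon> lets the damping absorb \<epsilon> Y^2 from the cross term. Only
  \<open>Z\<close> is left as a source.\<close>

lemma damped_form_inequality:
  fixes X Y Z l \<epsilon> \<kappa> c d e :: real
  assumes l: "l \<ge> 1" and \<kappa>: "\<kappa> = 1 / (2 * l\<^sup>2)" and \<epsilon>: "0 < \<epsilon>" "\<epsilon> \<le> \<kappa> / 4"
    and c: "c \<le> l * X * Y" and d: "d \<le> l * X * Z" and e: "e \<le> Y * Z"
  shows "\<kappa> * (c - Y\<^sup>2) + (\<epsilon> * Y\<^sup>2 - X\<^sup>2 + d)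
    \<le> - (1/2) * (\<kappa> * ((X\<^sup>2 + \<epsilon> * Y\<^sup>2) / 2) + (\<epsilon> * e + Z\<^sup>2 / 2)) - \<kappa> / 8 * Y\<^sup>2 + (l\<^sup>2 + 1) * Z\<^sup>2"
proof -
  have l2: "l\<^sup>2 \<ge> 1" using l by simp
  have \<kappa>0: "0 < \<kappa>" "\<kappa> \<le> 1/2" using l2 by (auto simp: \<kappa> divide_simps)
  have \<kappa>l: "\<kappa> * l\<^sup>2 = 1/2" using l by (simp add: \<kappa>)
  have "2 * (l * X) * Y \<le> (l * X)\<^sup>2 + Y\<^sup>2" by (rule sum_squares_bound)
  then have "c \<le> l\<^sup>2 * X\<^sup>2 / 2 + Y\<^sup>2 / 2" using c by (simp add: power_mult_distrib)
  then have "\<kappa> * c \<le> \<kappa> * (l\<^sup>2 * X\<^sup>2 / 2 + Y\<^sup>2 / 2)" using \<kappa>0 by (intro mult_left_mono) auto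
  also have "\<dots> = (\<kappa> * l\<^sup>2) * X\<^sup>2 / 2 + \<kappa> * Y\<^sup>2 / 2" by (simp add: algebra_simps)
  finally have 1: "\<kappa> * c \<le> X\<^sup>2 / 4 + \<kappa> * Y\<^sup>2 / 2" by (simp add: \<kappa>l)
  have "2 * (X / 2) * (l * Z) \<le> (X / 2)\<^sup>2 + (l * Z)\<^sup>2" by (rule sum_squares_bound)
  then have 2: "d \<le> X\<^sup>2 / 4 + l\<^sup>2 * Z\<^sup>2" using d by (simp add: power_mult_distrib power_divide algebra_simps)
  have "2 * (\<epsilon> * Y) * Z \<le> (\<epsilon> * Y)\<^sup>2 + Z\<^sup>2" by (rule sum_squares_bound)
  moreover have "\<epsilon> * e \<le> \<epsilon> * (Y * Z)" using e \<epsilon> by (intro mult_left_mono) auto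
  ultimately have "\<epsilon> * e \<le> \<epsilon> * \<epsilon> * Y\<^sup>2 / 2 + Z\<^sup>2 / 2"
    by (simp add: power_mult_distrib power2_eq_square[of \<epsilon>] algebra_simps)
  moreover have "\<epsilon> * \<epsilon> \<le> (1/8) * \<epsilon>" using \<epsilon> \<kappa>0 by (intro mult_right_mono) auto
  then have "\<epsilon> * \<epsilon> * Y\<^sup>2 \<le> (1/8) * \<epsilon> * Y\<^sup>2" by (rule mult_right_mono) simp
  ultimately have 3: "\<epsilon> * e \<le> \<epsilon> * Y\<^sup>2 / 16 + Z\<^sup>2 / 2" by linarith
  have 4: "\<epsilon> * Y\<^sup>2 \<le> \<kappa> / 4 * Y\<^sup>2" using \<epsilon> by (intro mult_right_mono) auto
  have "\<kappa> * X\<^sup>2 \<le> (1/2) * X\<^sup>2" "\<kappa> * (\<epsilon> * Y\<^sup>2) \<le> (1/2) * (\<epsilon> * Y\<^sup>2)"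
    using \<kappa>0 \<epsilon> by (intro mult_right_mono; simp)+
  moreover define x y z where "x = X\<^sup>2" and "y = Y\<^sup>2" and "z = Z\<^sup>2"
  moreover have "0 \<le> z" "0 \<le> x" "0 \<le> \<kappa> * y" using \<kappa>0 by (auto simp: x_def y_def z_def)
  ultimately show ?thesis using 1 2 3 4
    unfolding x_def[symmetric] y_def[symmetric] z_def[symmetric]
    by (simp add: algebra_simps add_divide_distrib diff_divide_distrib)
qed

text \<open>The product \<epsilon> e loses at most Z^2 / 2, which the last summand supplies, and
  \<epsilon>^2 Y^2 / 2, which is a small part of the kinetic energy because \<epsilon> is at most
  \<kappa> / 4.\<close>

lemma damped_form_lower_bound:
  fixes X Y Z \<epsilon> \<kappa> e :: real
  assumes \<kappa>: "0 < \<kappa>" and \<epsilon>: "0 < \<epsilon>" "\<epsilon> \<le> \<kappa> / 4" and e: "\<bar>e\<bar> \<le> Y * Z"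
  shows "\<kappa> / 4 * (X\<^sup>2 + \<epsilon> * Y\<^sup>2) \<le> \<kappa> * ((X\<^sup>2 + \<epsilon> * Y\<^sup>2) / 2) + (\<epsilon> * e + Z\<^sup>2 / 2)"
proof -
  have "2 * (\<epsilon> * Y) * Z \<le> (\<epsilon> * Y)\<^sup>2 + Z\<^sup>2" by (rule sum_squares_bound)
  moreover have "\<epsilon> * (- e) \<le> \<epsilon> * (Y * Z)" using e \<epsilon> by (intro mult_left_mono) auto
  ultimately have "- (\<epsilon> * e) \<le> \<epsilon> * \<epsilon> * Y\<^sup>2 / 2 + Z\<^sup>2 / 2"
    by (simp add: power_mult_distrib power2_eq_square[of \<epsilon>] algebra_simps)
  moreover have "\<epsilon> * \<epsilon> \<le> (\<kappa> / 4) * \<epsilon>" using \<epsilon> by (intro mult_right_mono) auto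
  then have "\<epsilon> * \<epsilon> * Y\<^sup>2 \<le> (\<kappa> / 4) * \<epsilon> * Y\<^sup>2" by (rule mult_right_mono) simp
  moreover define x y z where "x = X\<^sup>2" and "y = Y\<^sup>2" and "z = Z\<^sup>2"
  moreover have "0 \<le> \<kappa> * x" "0 \<le> \<kappa> * (\<epsilon> * y)" using \<kappa> \<epsilon> by (auto simp: x_def y_def)
  ultimately show ?thesis
    unfolding x_def[symmetric] y_def[symmetric] z_def[symmetric]
    by (simp add: algebra_simps add_divide_distrib diff_divide_distrib)
qed

text \<open>Young's inequality for w . \<phi>, integrated in time. With \<phi> the increment of
  \<open>W\<close> itself and \<open>\<theta>\<close> = t - s it is the Cauchy-Schwarz inequality in
  time; other weights serve when \<open>N\<close> is of a different order than the
  increment.\<close>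

lemma mean_square_increment:
  fixes W :: "real \<Rightarrow> 'a::real_inner"
  assumes W: "\<And>t. 0 \<le> t \<Longrightarrow> (W has_vector_derivative w t) (at t within {0..})"
    and N: "\<And>t. 0 \<le> t \<Longrightarrow> (N has_real_derivative (norm (w t))\<^sup>2) (at t within {0..})"
    and "0 \<le> s" "s \<le> t" "0 < \<theta>"
  shows "(W t - W s) \<bullet> \<phi> \<le> \<theta> / 2 * (N t - N s) + (t - s) * (norm \<phi>)\<^sup>2 / (2 * \<theta>)"
proof -
  define X where "X r = W r \<bullet> \<phi> - \<theta> / 2 * N r - r * ((norm \<phi>)\<^sup>2 / (2 * \<theta>))" for r
  have "X t \<le> X s"
  proof (rule nonincreasing_of_derivative[OF _ _ \<open>0 \<le> s\<close> \<open>s \<le> t\<close>])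
    fix r assume "s \<le> r" "r \<le> t"
    then have r: "0 \<le> r" using assms by simp
    have "((\<lambda>r. W r \<bullet> \<phi>) has_real_derivative (w r \<bullet> \<phi>)) (at r within {0..})"
      unfolding has_real_derivative_iff_has_vector_derivative
      by (rule bounded_linear.has_vector_derivative[OF bounded_linear_inner_left W[OF r]])
    then show "(X has_real_derivative (w r \<bullet> \<phi> - \<theta> / 2 * (norm (w r))\<^sup>2 - (norm \<phi>)\<^sup>2 / (2 * \<theta>))) (at r within {0..})"
      unfolding X_def using \<open>0 < \<theta>\<close> by (auto intro!: derivative_eq_intros N[OF r])
    have "w r \<bullet> \<phi> \<le> \<theta> / 2 * (norm (w r))\<^sup>2 + (norm \<phi>)\<^sup>2 / (2 * \<theta>)"
      using inner_ge_zero[of "\<theta> *\<^sub>R w r - \<phi>"] \<open>0 < \<theta>\<close>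
      unfolding power2_norm_eq_inner by (simp add: inner_diff inner_commute field_simps)
    then show "w r \<bullet> \<phi> - \<theta> / 2 * (norm (w r))\<^sup>2 - (norm \<phi>)\<^sup>2 / (2 * \<theta>) \<le> 0" by simp
  qed
  then show ?thesis by (simp add: X_def inner_diff_left algebra_simps diff_divide_distrib)
qed

text \<open>The remainder in \<open>\<Phi>_derivative\<close> mixes two norms on purpose: along an
  orbit the increment in \<open>V\<close> merely tends to 0, while its image under \<open>j\<close>
  is of order |s - t|. The product is o(|s - t|), so \<open>\<Phi>\<close> is differentiable along
  orbits that are only continuous in \<open>V\<close>.\<close>

locale gradient_system = energy_space V j a c0
  for V :: "'v::{real_inner, banach} set" and j :: "'v \<Rightarrow> 'h::{real_inner, banach}" and a c0 +
  fixes f :: "'v \<Rightarrow> 'h" and \<Phi> :: "'v \<Rightarrow> real"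
  assumes f_Lipschitz: "\<exists>l. \<forall>p\<in>V. \<forall>q\<in>V. a p p \<le> M \<longrightarrow> a q q \<le> M \<longrightarrow>
      (norm (f p - f q))\<^sup>2 \<le> l * a (p - q) (p - q)"
    and \<Phi>_bounded: "\<exists>K. \<forall>p\<in>V. a p p \<le> M \<longrightarrow> \<bar>\<Phi> p\<bar> \<le> K"
    and \<Phi>_derivative: "\<exists>K. \<forall>p\<in>V. \<forall>q\<in>V. a p p \<le> M \<longrightarrow> a q q \<le> M \<longrightarrow>
      \<bar>\<Phi> p - \<Phi> q - f q \<bullet> (j p - j q)\<bar> \<le> K * norm (p - q) * norm (j p - j q)"
begin

lemma f_Lipschitz': obtains l where "l \<ge> 1"
  "\<And>p q. p \<in> V \<Longrightarrow> q \<in> V \<Longrightarrow> a p p \<le> M \<Longrightarrow> a q q \<le> M \<Longrightarrow> (norm (f p - f q))\<^sup>2 \<le> l\<^sup>2 * a (p - q) (p - q)"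
proof -
  obtain l where l: "\<And>p q. p \<in> V \<Longrightarrow> q \<in> V \<Longrightarrow> a p p \<le> M \<Longrightarrow> a q q \<le> M \<Longrightarrow>
      (norm (f p - f q))\<^sup>2 \<le> l * a (p - q) (p - q)" using f_Lipschitz[of M] by blast
  define l' where "l' = \<bar>l\<bar> + 1"
  have "l \<le> l'\<^sup>2" using self_le_power[of l' 2] by (simp add: l'_def)
  show thesis
  proof (rule that[of l'])
    fix p q assume pq: "p \<in> V" "q \<in> V" "a p p \<le> M" "a q q \<le> M"
    have "l * a (p - q) (p - q) \<le> l'\<^sup>2 * a (p - q) (p - q)"
      using \<open>l \<le> l'\<^sup>2\<close> pq by (intro mult_right_mono a_nonneg subspace_diff[OF subspace_X])
    then show "(norm (f p - f q))\<^sup>2 \<le> l'\<^sup>2 * a (p - q) (p - q)" using l[OF pq] by linarith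
  qed (simp add: l'_def)
qed

lemma f_continuous: "continuous_on V f"
  unfolding continuous_on_def
proof
  fix q assume q: "q \<in> V"
  define M where "M = a q q + 1"
  obtain l where l: "l \<ge> 1" "\<And>p q. p \<in> V \<Longrightarrow> q \<in> V \<Longrightarrow> a p p \<le> M \<Longrightarrow> a q q \<le> M \<Longrightarrow>
      (norm (f p - f q))\<^sup>2 \<le> l\<^sup>2 * a (p - q) (p - q)" using f_Lipschitz' by blast
  have lim: "((\<lambda>p. p) \<longlongrightarrow> q) (at q within V)" by (rule tendsto_ident_at)
  have "((\<lambda>p. a p p) \<longlongrightarrow> a q q) (at q within V)" by (intro bounded_bilinear.tendsto[OF a] lim)
  then have "\<forall>\<^sub>F p in at q within V. a p p < M" by (rule order_tendstoD(2)) (simp add: M_def)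
  moreover have "\<forall>\<^sub>F p in at q within V. p \<in> V" by (simp add: eventually_at_filter)
  ultimately have "\<forall>\<^sub>F p in at q within V. norm (f p - f q) \<le> sqrt (l\<^sup>2 * a (p - q) (p - q))"
  proof eventually_elim
    case (elim p)
    then show ?case using l(2)[of p q] q by (intro real_le_rsqrt) (auto simp: M_def)
  qed
  moreover have "((\<lambda>p. sqrt (l\<^sup>2 * a (p - q) (p - q))) \<longlongrightarrow> sqrt (l\<^sup>2 * a (q - q) (q - q))) (at q within V)"
    by (intro tendsto_intros bounded_bilinear.tendsto[OF a] lim)
  then have "((\<lambda>p. sqrt (l\<^sup>2 * a (p - q) (p - q))) \<longlongrightarrow> 0) (at q within V)"
    by (simp add: bounded_bilinear.zero_left[OF a])
  ultimately have "((\<lambda>p. f p - f q) \<longlongrightarrow> 0) (at q within V)"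
    by (rule Lim_null_comparison)
  then show "(f \<longlongrightarrow> f q) (at q within V)" by (simp only: Lim_null[symmetric])
qed

lemma f_curve_continuous:
  "continuous_on {0..} u \<Longrightarrow> (\<And>t::real. 0 \<le> t \<Longrightarrow> u t \<in> V) \<Longrightarrow> continuous_on {0..} (\<lambda>t. f (u t))"
  by (rule continuous_on_compose2[OF f_continuous]) auto

lemma potential_derivative:
  assumes u: "continuous_on {0..} u" "\<And>t. 0 \<le> t \<Longrightarrow> u t \<in> V"
    and ju: "((\<lambda>s. j (u s)) has_vector_derivative v) (at t within {0..})"
    and bd: "\<And>t. 0 \<le> t \<Longrightarrow> a (u t) (u t) \<le> M" and t: "0 \<le> t"
  shows "((\<lambda>s. \<Phi> (u s)) has_real_derivative (f (u t) \<bullet> v)) (at t within {0..})"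
proof -
  obtain K where K: "\<And>p q. p \<in> V \<Longrightarrow> q \<in> V \<Longrightarrow> a p p \<le> M \<Longrightarrow> a q q \<le> M \<Longrightarrow>
      \<bar>\<Phi> p - \<Phi> q - f q \<bullet> (j p - j q)\<bar> \<le> K * norm (p - q) * norm (j p - j q)"
    using \<Phi>_derivative[of M] by blast
  have q: "((\<lambda>s. (1 / (s - t)) *\<^sub>R (j (u s) - j (u t))) \<longlongrightarrow> v) (at t within {0..})"
    using ju by (simp add: has_vector_derivative_iff_quotient)
  have ulim: "(u \<longlongrightarrow> u t) (at t within {0..})" using u(1) t by (auto simp: continuous_on_def)
  have "((\<lambda>s. K * norm (u s - u t) * norm ((1 / (s - t)) *\<^sub>R (j (u s) - j (u t)))) \<longlongrightarrow> K * norm (u t - u t) * norm v) (at t within {0..})"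
    by (intro tendsto_intros ulim q)
  then have lim0: "((\<lambda>s. K * norm (u s - u t) * norm ((1 / (s - t)) *\<^sub>R (j (u s) - j (u t)))) \<longlongrightarrow> 0) (at t within {0..})"
    by simp
  have "\<forall>\<^sub>F s in at t within {0..}. norm ((1 / (s - t)) *\<^sub>R (\<Phi> (u s) - \<Phi> (u t)) - f (u t) \<bullet> ((1 / (s - t)) *\<^sub>R (j (u s) - j (u t))))
     \<le> K * norm (u s - u t) * norm ((1 / (s - t)) *\<^sub>R (j (u s) - j (u t)))"
    unfolding eventually_at_filter
  proof (intro always_eventually allI impI)
    fix s assume s: "s \<noteq> t" "s \<in> {0..}"
    have "(1 / (s - t)) *\<^sub>R (\<Phi> (u s) - \<Phi> (u t)) - f (u t) \<bullet> ((1 / (s - t)) *\<^sub>R (j (u s) - j (u t))) =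
        (1 / (s - t)) * (\<Phi> (u s) - \<Phi> (u t) - f (u t) \<bullet> (j (u s) - j (u t)))"
      by (simp add: right_diff_distrib)
    then have "norm ((1 / (s - t)) *\<^sub>R (\<Phi> (u s) - \<Phi> (u t)) - f (u t) \<bullet> ((1 / (s - t)) *\<^sub>R (j (u s) - j (u t)))) =
        \<bar>1 / (s - t)\<bar> * \<bar>\<Phi> (u s) - \<Phi> (u t) - f (u t) \<bullet> (j (u s) - j (u t))\<bar>"
      by (simp only: real_norm_def abs_mult)
    also have "\<dots> \<le> \<bar>1 / (s - t)\<bar> * (K * norm (u s - u t) * norm (j (u s) - j (u t)))"
      using s t by (intro mult_left_mono K u bd) auto
    finally show "norm ((1 / (s - t)) *\<^sub>R (\<Phi> (u s) - \<Phi> (u t)) - f (u t) \<bullet> ((1 / (s - t)) *\<^sub>R (j (u s) - j (u t))))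
     \<le> K * norm (u s - u t) * norm ((1 / (s - t)) *\<^sub>R (j (u s) - j (u t)))"
      by (simp add: mult_ac)
  qed
  from Lim_null_comparison[OF this lim0]
  have "((\<lambda>s. (1 / (s - t)) *\<^sub>R (\<Phi> (u s) - \<Phi> (u t)) - f (u t) \<bullet> ((1 / (s - t)) *\<^sub>R (j (u s) - j (u t)))) \<longlongrightarrow> 0) (at t within {0..})" .
  from tendsto_add[OF this tendsto_inner[OF tendsto_const[of "f (u t)"] q]]
  show ?thesis unfolding has_real_derivative_iff_has_vector_derivative has_vector_derivative_iff_quotient by simp
qed

text \<open>The quadratic energy minus the potential plus the accumulated dissipation is conserved.
  Nonnegativity of the final quadratic energy leaves R / 2 from the initial one and at most K from
  the potential at each end.\<close>

lemma dissipation_bound: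
  assumes "\<And>p. p \<in> V \<Longrightarrow> a p p \<le> R \<Longrightarrow> \<bar>\<Phi> p\<bar> \<le> K"
    and w: "weak_wave \<epsilon> u v (\<lambda>t. f (u t))" and "0 \<le> \<epsilon>"
    and bd: "\<And>t. 0 \<le> t \<Longrightarrow> a (u t) (u t) + \<epsilon> * (norm (v t))\<^sup>2 \<le> R"
    and N: "\<And>t. 0 \<le> t \<Longrightarrow> (N has_real_derivative (norm (v t))\<^sup>2) (at t within {0..})"
    and t: "0 \<le> t"
  shows "N t - N 0 \<le> R / 2 + 2 * K"
proof -
  have u: "continuous_on {0..} u" "\<And>t. 0 \<le> t \<Longrightarrow> u t \<in> V"
    and ju: "\<And>t. 0 \<le> t \<Longrightarrow> ((\<lambda>s. j (u s)) has_vector_derivative v t) (at t within {0..})"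
    using w by (auto simp: weak_wave_def)
  have aR: "a (u t) (u t) \<le> R" if "0 \<le> t" for t
    using bd[OF that] \<open>0 \<le> \<epsilon>\<close> by (smt (verit) mult_nonneg_nonneg zero_le_power2)
  define X where "X s = (a (u s) (u s) + \<epsilon> * (norm (v s))\<^sup>2) / 2 - \<Phi> (u s) + N s" for s
  have "X t \<le> X 0"
  proof (rule nonincreasing_of_derivative[OF _ _ order_refl t])
    fix r :: real assume r: "0 \<le> r"
    show "(X has_real_derivative ((f (u r) \<bullet> v r - (norm (v r))\<^sup>2) - f (u r) \<bullet> v r + (norm (v r))\<^sup>2)) (at r within {0..})"
      unfolding X_def
      by (intro DERIV_add DERIV_diff energy_identity[OF w r] potential_derivative[OF u ju[OF r] aR r] N[OF r])
  qed simp
  moreover have "\<Phi> (u t) \<le> K" "- K \<le> \<Phi> (u 0)"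
    using assms(1)[OF u(2)[OF t] aR[OF t]] assms(1)[OF u(2)[OF order_refl] aR[OF order_refl]] by linarith+
  moreover have "0 \<le> a (u t) (u t) + \<epsilon> * (norm (v t))\<^sup>2"
    using a_nonneg[OF u(2)[OF t]] \<open>0 \<le> \<epsilon>\<close> by simp
  moreover have "n - m \<le> R / 2 + 2 * K"
    if "x / 2 - p + n \<le> y / 2 - q + m" "p \<le> K" "- K \<le> q" "0 \<le> x" "y \<le> R" for x y p q m n :: real
    using that by linarith
  ultimately show ?thesis using bd[OF order_refl] unfolding X_def by blast
qed

text \<open>\<open>complete_orbits \<epsilon> R Orb\<close> abstracts the orbits in an attractor: each one extends arbitrarily far
  into the past without leaving the bounded set.\<close>

definition complete_orbits :: "real \<Rightarrow> real \<Rightarrow> ((real \<Rightarrow> 'v) \<times> (real \<Rightarrow> 'h)) set \<Rightarrow> bool" where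
  "complete_orbits \<epsilon> R Orb \<longleftrightarrow> (\<forall>(u, v)\<in>Orb. weak_wave \<epsilon> u v (\<lambda>t. f (u t)) \<and>
     (\<forall>t\<ge>0. a (u t) (u t) + \<epsilon> * (norm (v t))\<^sup>2 \<le> R) \<and>
     (\<forall>\<tau>\<ge>0. \<exists>(u', v')\<in>Orb. \<forall>t\<ge>0. u' (\<tau> + t) = u t \<and> v' (\<tau> + t) = v t))"

lemma a_diff_le: assumes "p \<in> V" "q \<in> V" shows "a (p - q) (p - q) \<le> 2 * a p p + 2 * a q q"
proof -
  have "0 \<le> a (p + q) (p + q)" using assms by (intro a_nonneg subspace_add[OF subspace_X])
  then show ?thesis
    by (simp add: bounded_bilinear.diff_left[OF a] bounded_bilinear.diff_right[OF a]
        bounded_bilinear.add_left[OF a] bounded_bilinear.add_right[OF a] a_sym[of q p])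
qed

lemma j_bound: obtains Cj where "Cj \<ge> 0" "\<And>p. p \<in> V \<Longrightarrow> (norm (j p))\<^sup>2 \<le> Cj * a p p"
proof -
  obtain K where K: "K > 0" "\<And>x. norm (j x) \<le> norm x * K" using bounded_linear.pos_bounded[OF j] by blast
  show thesis
  proof (rule that[of "K\<^sup>2 / c0"])
    fix p assume p: "p \<in> V"
    have "(norm (j p))\<^sup>2 \<le> (norm p * K)\<^sup>2" using K by (intro power_mono) auto
    also have "\<dots> = K\<^sup>2 / c0 * (c0 * (norm p)\<^sup>2)" using c0 by (simp add: power_mult_distrib)
    also have "\<dots> \<le> K\<^sup>2 / c0 * a p p" using c0 p by (intro mult_left_mono coercive) auto
    finally show "(norm (j p))\<^sup>2 \<le> K\<^sup>2 / c0 * a p p" .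
  qed (use c0 in auto)
qed

text \<open>The time differences \<open>p\<close>, \<open>q\<close> of an orbit solve a linear damped wave equation, whose forcing is
  controlled by \<open>p\<close>. A damped energy of \<open>(p, q)\<close> decays up to a multiple of the squared norm of
  \<open>j p\<close>, and this has a finite time integral because the energy of the orbit is bounded.
  Starting from arbitrarily far in the past removes the dependence on the initial energy.\<close>

lemma orbit_differences:
  assumes l: "l \<ge> 1" "\<And>p q. p \<in> V \<Longrightarrow> q \<in> V \<Longrightarrow> a p p \<le> R \<Longrightarrow> a q q \<le> R \<Longrightarrow> (norm (f p - f q))\<^sup>2 \<le> l\<^sup>2 * a (p - q) (p - q)"
    and K: "\<And>p. p \<in> V \<Longrightarrow> a p p \<le> R \<Longrightarrow> \<bar>\<Phi> p\<bar> \<le> K"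
    and \<kappa>: "\<kappa> = 1 / (2 * l\<^sup>2)" and \<epsilon>: "0 < \<epsilon>" "\<epsilon> \<le> \<kappa> / 4" and "R > 0"
    and C1: "C1 = (l\<^sup>2 + 1) * (R / 2 + 2 * K)"
    and orb: "complete_orbits \<epsilon> R Orb" "(u, v) \<in> Orb" and t: "0 \<le> t" and h: "0 < h"
  shows "\<kappa> / 4 * (\<epsilon> * (norm (v (t + h) - v t))\<^sup>2) \<le> C1 * h\<^sup>2"
    and "\<And>Q. (\<And>s. 0 \<le> s \<Longrightarrow> (Q has_real_derivative (norm (v (s + h) - v s))\<^sup>2) (at s within {0..})) \<Longrightarrow>
       \<kappa> / 8 * (Q (t + 1) - Q t) \<le> 2 * C1 * h\<^sup>2"
proof -
  have \<kappa>0: "0 < \<kappa>" using l by (auto simp: \<kappa>)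
  have K0: "K \<ge> 0" using K[of 0] subspace_0[OF subspace_X] \<open>R > 0\<close> by (auto simp: bounded_bilinear.zero_left[OF a])
  obtain Cj where Cj: "Cj \<ge> 0" "\<And>p. p \<in> V \<Longrightarrow> (norm (j p))\<^sup>2 \<le> Cj * a p p" using j_bound by blast
  define \<Psi> where "\<Psi> u v t = \<kappa> * ((a (u (t + h) - u t) (u (t + h) - u t) + \<epsilon> * (norm (v (t + h) - v t))\<^sup>2) / 2)
      + (\<epsilon> * ((v (t + h) - v t) \<bullet> j (u (t + h) - u t)) + (norm (j (u (t + h) - u t)))\<^sup>2 / 2)"
    for u :: "real \<Rightarrow> 'v" and v :: "real \<Rightarrow> 'h" and t
  \<comment> \<open>A crude bound for the damped energy at time 0. It may be generous, since it will
    carry the factor exp (- (\<tau> + s) / 2) with \<tau> arbitrarily large.\<close>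
  define B where "B = (2 * \<kappa> + 4 * (1 + Cj) + 2) * (4 * R) * (1 + \<epsilon>)"
  have main: "\<exists>\<Psi>' M M'. (\<forall>s\<ge>0. (\<Psi> u v has_real_derivative \<Psi>' s) (at s within {0..}) \<and>
      (M has_real_derivative M' s) (at s within {0..}) \<and>
      \<Psi>' s \<le> - (1/2) * \<Psi> u v s - \<kappa> / 8 * (norm (v (s + h) - v s))\<^sup>2 + M' s \<and>
      \<kappa> / 4 * (\<epsilon> * (norm (v (s + h) - v s))\<^sup>2) \<le> \<Psi> u v s \<and> 0 \<le> \<Psi> u v s \<and> 0 \<le> M s \<and> M s \<le> C1 * h\<^sup>2) \<and>
      \<Psi> u v 0 \<le> B" if "(u, v) \<in> Orb" for u v
  proof -
    have w: "weak_wave \<epsilon> u v (\<lambda>t. f (u t))" and bd: "\<And>t. 0 \<le> t \<Longrightarrow> a (u t) (u t) + \<epsilon> * (norm (v t))\<^sup>2 \<le> R"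
      using orb(1) that by (auto simp: complete_orbits_def)
    have u: "\<And>t. 0 \<le> t \<Longrightarrow> u t \<in> V" and vc: "continuous_on {0..} v"
      and ju: "\<And>t. 0 \<le> t \<Longrightarrow> ((\<lambda>s. j (u s)) has_vector_derivative v t) (at t within {0..})"
      using w by (auto simp: weak_wave_def)
    have aR: "a (u t) (u t) \<le> R" if "0 \<le> t" for t
      using bd[OF that] \<epsilon> by (smt (verit) mult_nonneg_nonneg zero_le_power2)
    have vR: "\<epsilon> * (norm (v t))\<^sup>2 \<le> R" if "0 \<le> t" for t
      using bd[OF that] a_nonneg[OF u[OF that]] by linarith
    define p where "p t = u (t + h) - u t" for t
    define q where "q t = v (t + h) - v t" for t
    define g where "g t = f (u (t + h)) - f (u t)" for t
    have pw: "weak_wave \<epsilon> p q g"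
      unfolding p_def q_def g_def using h by (intro weak_wave_diff weak_wave_shift w) auto
    have pV: "p t \<in> V" if "0 \<le> t" for t
      unfolding p_def using that h by (intro subspace_diff[OF subspace_X] u) auto
    have \<Psi>_eq: "\<Psi> u v s = \<kappa> * ((a (p s) (p s) + \<epsilon> * (norm (q s))\<^sup>2) / 2) + (\<epsilon> * (q s \<bullet> j (p s)) + (norm (j (p s)))\<^sup>2 / 2)" for s
      by (simp add: \<Psi>_def p_def q_def)
    define N where "N t = integral {0..t} (\<lambda>s. (norm (v s))\<^sup>2)" for t
    have N: "(N has_real_derivative (norm (v t))\<^sup>2) (at t within {0..})" if "0 \<le> t" for t
      unfolding N_def has_real_derivative_iff_has_vector_derivative
      by (intro integral_derivative_atLeast continuous_intros vc that)
    have N0: "N 0 = 0" by (simp add: N_def)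
    have NK: "N t \<le> R / 2 + 2 * K" if "0 \<le> t" for t
      using dissipation_bound[OF K w _ bd N that] \<epsilon> N0 by simp
    have Nmono: "N s \<le> N t" if "0 \<le> s" "s \<le> t" for s t
    proof -
      have "(\<lambda>s. - N s) t \<le> (\<lambda>s. - N s) s"
        by (rule nonincreasing_of_derivative[OF _ _ that, where X' = "\<lambda>r. - ((norm (v r))\<^sup>2)"])
           (use that in \<open>auto intro!: derivative_eq_intros N\<close>)
      then show ?thesis by simp
    qed
    have Nnn: "0 \<le> N t" if "0 \<le> t" for t using Nmono[OF order_refl that] N0 by simp
    have Nc: "continuous_on {0..} N"
      using continuous_on_of_derivative[of N "\<lambda>t. (norm (v t))\<^sup>2"] N
      by (simp add: has_real_derivative_iff_has_vector_derivative)
    define P where "P t = integral {0..t} N" for t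
    have P: "(P has_real_derivative N t) (at t within {0..})" if "0 \<le> t" for t
      unfolding P_def has_real_derivative_iff_has_vector_derivative
      by (intro integral_derivative_atLeast Nc that)
    have Ph: "((\<lambda>t. P (t + h)) has_real_derivative N (t + h)) (at t within {0..})" if "0 \<le> t" for t
      unfolding has_real_derivative_iff_has_vector_derivative
      by (rule shifted_derivative) (use P[of "t + h"] that h in \<open>auto simp: has_real_derivative_iff_has_vector_derivative\<close>)
    have PK: "P (t + h) - P t \<le> (R / 2 + 2 * K) * h" if "0 \<le> t" for t
    proof -
      have "(\<lambda>s. P s - (R / 2 + 2 * K) * s) (t + h) \<le> (\<lambda>s. P s - (R / 2 + 2 * K) * s) t"
        by (rule nonincreasing_of_derivative[OF _ _ that, where X' = "\<lambda>r. N r - (R / 2 + 2 * K)"])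
           (use that h NK in \<open>auto intro!: derivative_eq_intros P\<close>)
      then show ?thesis by (simp add: algebra_simps add_divide_distrib)
    qed
    \<comment> \<open>The primitive, vanishing at 0, of the forcing \<open>M'\<close>. A difference
      of \<open>P\<close> over a time \<open>h\<close> is at most \<open>h\<close> times the total
      dissipation, which together with the explicit factor \<open>h\<close> makes \<open>M\<close>
      of order h^2 for all times.\<close>
    define M where "M t = (l\<^sup>2 + 1) * h * (P (t + h) - P t - (P h - P 0))" for t
    define M' where "M' t = (l\<^sup>2 + 1) * h * (N (t + h) - N t)" for t
    have M: "(M has_real_derivative M' t) (at t within {0..})" if "0 \<le> t" for t
      unfolding M_def M'_def using that by (auto intro!: derivative_eq_intros P Ph)
    have M'0: "0 \<le> M' t" if "0 \<le> t" for t
      unfolding M'_def using h Nmono[of t "t + h"] that by (intro mult_nonneg_nonneg) auto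
    have M0: "0 \<le> M t" if "0 \<le> t" for t
    proof -
      have "(\<lambda>s. - M s) t \<le> (\<lambda>s. - M s) 0"
        by (rule nonincreasing_of_derivative[OF _ _ _ that, where X' = "\<lambda>r. - M' r"])
           (use that M'0 in \<open>auto intro!: derivative_eq_intros M\<close>)
      then show ?thesis by (simp add: M_def)
    qed
    have MC: "M t \<le> C1 * h\<^sup>2" if "0 \<le> t" for t
    proof -
      have "(\<lambda>s. - P s) h \<le> (\<lambda>s. - P s) 0"
        by (rule nonincreasing_of_derivative[where X = "\<lambda>s. - P s" and s = 0 and t = h and X' = "\<lambda>r. - N r"])
           (use h Nnn in \<open>auto intro!: derivative_eq_intros P\<close>)
      then have "P (t + h) - P t - (P h - P 0) \<le> (R / 2 + 2 * K) * h" using PK[OF that] by simp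
      then have "M t \<le> (l\<^sup>2 + 1) * h * ((R / 2 + 2 * K) * h)"
        unfolding M_def using h by (intro mult_left_mono) auto
      then show ?thesis by (simp add: C1 power2_eq_square mult_ac)
    qed
    define \<Psi>' where "\<Psi>' s = \<kappa> * (g s \<bullet> q s - (norm (q s))\<^sup>2) + (\<epsilon> * (norm (q s))\<^sup>2 - a (p s) (p s) + g s \<bullet> j (p s))" for s
    have d\<Psi>: "(\<Psi> u v has_real_derivative \<Psi>' s) (at s within {0..})" if s: "0 \<le> s" for s
    proof -
      have "((\<lambda>s. \<kappa> * ((a (p s) (p s) + \<epsilon> * (norm (q s))\<^sup>2) / 2) + (\<epsilon> * (q s \<bullet> j (p s)) + (norm (j (p s)))\<^sup>2 / 2))
        has_real_derivative \<Psi>' s) (at s within {0..})"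
        unfolding \<Psi>'_def by (intro DERIV_add DERIV_cmult energy_identity[OF pw s] cross_identity[OF pw s])
      then show ?thesis unfolding \<Psi>_eq[symmetric] .
    qed
    have sq: "(sqrt (a (p s) (p s)))\<^sup>2 = a (p s) (p s)" "0 \<le> sqrt (a (p s) (p s))" if "0 \<le> s" for s
      using a_nonneg[OF pV[OF that]] by simp_all
    have gl: "norm (g s) \<le> l * sqrt (a (p s) (p s))" if s: "0 \<le> s" for s
    proof (rule power2_le_imp_le)
      show "(norm (g s))\<^sup>2 \<le> (l * sqrt (a (p s) (p s)))\<^sup>2"
        unfolding power_mult_distrib sq(1)[OF s] unfolding g_def p_def using s h by (intro l u aR) auto
      show "0 \<le> l * sqrt (a (p s) (p s))" using l sq[OF s] by simp
    qed
    have cs: "g s \<bullet> x \<le> l * sqrt (a (p s) (p s)) * norm x" if s: "0 \<le> s" for s x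
      using norm_cauchy_schwarz[of "g s" x] mult_right_mono[OF gl[OF s] norm_ge_zero[of x]] by linarith
    have incr: "(norm (j (p s)))\<^sup>2 \<le> h * (N (s + h) - N s)" if s: "0 \<le> s" for s
    proof -
      \<comment> \<open>The weight is \<open>h\<close>, so the last term is half of the left-hand
        side and can be absorbed.\<close>
      have "(j (u (s + h)) - j (u s)) \<bullet> j (p s) \<le> h / 2 * (N (s + h) - N s) + (s + h - s) * (norm (j (p s)))\<^sup>2 / (2 * h)"
        by (rule mean_square_increment[OF ju N s]) (use h in auto)
      then show ?thesis using h
        by (simp add: p_def linear_simps[OF j] power2_norm_eq_inner)
    qed
    have e1: "\<Psi>' s \<le> - (1/2) * \<Psi> u v s - \<kappa> / 8 * (norm (v (s + h) - v s))\<^sup>2 + M' s" if s: "0 \<le> s" for s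
    proof -
      have "\<Psi>' s \<le> - (1/2) * \<Psi> u v s - \<kappa> / 8 * (norm (q s))\<^sup>2 + (l\<^sup>2 + 1) * (norm (j (p s)))\<^sup>2"
        using damped_form_inequality[OF l(1) \<kappa> \<epsilon> cs[OF s] cs[OF s] norm_cauchy_schwarz, of "q s" "j (p s)"]
        unfolding sq[OF s] \<Psi>'_def \<Psi>_eq .
      moreover have "(l\<^sup>2 + 1) * (norm (j (p s)))\<^sup>2 \<le> (l\<^sup>2 + 1) * (h * (N (s + h) - N s))"
        by (intro mult_left_mono incr s) auto
      ultimately show ?thesis by (simp add: M'_def q_def mult.assoc)
    qed
    have lower: "\<kappa> / 4 * (a (p s) (p s) + \<epsilon> * (norm (q s))\<^sup>2) \<le> \<Psi> u v s" if s: "0 \<le> s" for s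
      using damped_form_lower_bound[OF \<kappa>0 \<epsilon> Cauchy_Schwarz_ineq2, of "sqrt (a (p s) (p s))" "q s" "j (p s)"]
      unfolding sq[OF s] \<Psi>_eq .
    have e2: "\<kappa> / 4 * (\<epsilon> * (norm (v (s + h) - v s))\<^sup>2) \<le> \<Psi> u v s" if s: "0 \<le> s" for s
    proof -
      have "\<kappa> / 4 * (\<epsilon> * (norm (q s))\<^sup>2) \<le> \<kappa> / 4 * (a (p s) (p s) + \<epsilon> * (norm (q s))\<^sup>2)"
        using \<kappa>0 a_nonneg[OF pV[OF s]] by (intro mult_left_mono) auto
      then show ?thesis using lower[OF s] by (simp add: q_def)
    qed
    have e3: "0 \<le> \<Psi> u v s" if s: "0 \<le> s" for s
    proof -
      have "0 \<le> \<kappa> / 4 * (a (p s) (p s) + \<epsilon> * (norm (q s))\<^sup>2)"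
        using \<kappa>0 \<epsilon> a_nonneg[OF pV[OF s]] by (intro mult_nonneg_nonneg add_nonneg_nonneg) auto
      then show ?thesis using lower[OF s] by linarith
    qed
    have e4: "\<Psi> u v 0 \<le> B"
    proof -
      have 1: "a (p 0) (p 0) \<le> 4 * R"
        unfolding p_def using a_diff_le[OF u u, of "0 + h" 0] aR[of "0 + h"] aR[of 0] h by simp
      have "(norm (q 0))\<^sup>2 \<le> 2 * (norm (v h))\<^sup>2 + 2 * (norm (v 0))\<^sup>2"
        using inner_ge_zero[of "v h + v 0"]
        by (simp add: q_def power2_norm_eq_inner inner_diff inner_add inner_commute)
      then have "\<epsilon> * (norm (q 0))\<^sup>2 \<le> \<epsilon> * (2 * (norm (v h))\<^sup>2 + 2 * (norm (v 0))\<^sup>2)"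
        using \<epsilon> by (intro mult_left_mono) auto
      then have 2: "\<epsilon> * (norm (q 0))\<^sup>2 \<le> 4 * R"
        using vR[of h] vR[of 0] h by (simp add: distrib_left)
      have "(norm (j (p 0)))\<^sup>2 \<le> Cj * a (p 0) (p 0)" by (rule Cj(2)[OF pV]) simp
      also have "\<dots> \<le> Cj * (4 * R)" using 1 Cj by (intro mult_left_mono)
      finally have 3: "(norm (j (p 0)))\<^sup>2 \<le> Cj * (4 * R)" .
      have "2 * (norm (q 0) * norm (j (p 0))) \<le> (norm (q 0))\<^sup>2 + (norm (j (p 0)))\<^sup>2"
        using sum_squares_bound[of "norm (q 0)" "norm (j (p 0))"] by simp
      then have "q 0 \<bullet> j (p 0) \<le> (norm (q 0))\<^sup>2 + (norm (j (p 0)))\<^sup>2"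
        using norm_cauchy_schwarz[of "q 0" "j (p 0)"] zero_le_power2[of "norm (q 0)"] zero_le_power2[of "norm (j (p 0))"] by linarith
      then have "\<epsilon> * (q 0 \<bullet> j (p 0)) \<le> \<epsilon> * ((norm (q 0))\<^sup>2 + (norm (j (p 0)))\<^sup>2)"
        using \<epsilon> by (intro mult_left_mono) auto
      also have "\<dots> \<le> 4 * R + \<epsilon> * (Cj * (4 * R))"
        using 2 mult_left_mono[OF 3 less_imp_le[OF \<epsilon>(1)]] by (simp add: distrib_left)
      finally have 4: "\<epsilon> * (q 0 \<bullet> j (p 0)) \<le> 4 * R + \<epsilon> * (Cj * (4 * R))" .
      have "\<kappa> * ((a (p 0) (p 0) + \<epsilon> * (norm (q 0))\<^sup>2) / 2) \<le> \<kappa> * (4 * R)"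
        using 1 2 \<kappa>0 by (intro mult_left_mono) auto
      then have "\<Psi> u v 0 \<le> \<kappa> * (4 * R) + (4 * R + \<epsilon> * (Cj * (4 * R)) + Cj * (4 * R) / 2)"
        unfolding \<Psi>_eq using 3 4 by linarith
      also have "\<dots> \<le> B"
      proof -
        have "0 \<le> \<kappa> * R" "0 \<le> \<epsilon> * R" "0 \<le> Cj * R" "0 \<le> \<epsilon> * (Cj * R)" "0 \<le> \<epsilon> * (\<kappa> * R)"
          using \<kappa>0 \<epsilon> \<open>R > 0\<close> Cj by auto
        then show ?thesis using \<open>R > 0\<close> unfolding B_def by (simp add: algebra_simps)
      qed
      finally show ?thesis .
    qed
    show ?thesis
      by (intro exI[of _ \<Psi>'] exI[of _ M] exI[of _ M'] conjI allI impI)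
         (erule d\<Psi> M e1 e2 e3 M0 MC | rule e4)+
  qed
  have decay: "\<Psi> u v s \<le> C1 * h\<^sup>2" if s: "0 \<le> s" for s
  proof -
    \<comment> \<open>The same state is reached by an orbit of the family that started
      \<open>\<tau>\<close> earlier, and there the decay has acted for the time \<tau> + s.\<close>
    have est: "\<Psi> u v s \<le> exp (- (1/2) * (\<tau> + s)) * B + C1 * h\<^sup>2" if \<tau>: "0 \<le> \<tau>" for \<tau>
    proof -
      obtain u' v' where uv: "(u', v') \<in> Orb" "\<And>t. 0 \<le> t \<Longrightarrow> u' (\<tau> + t) = u t \<and> v' (\<tau> + t) = v t"
        using orb \<tau> unfolding complete_orbits_def by blast
      obtain \<Psi>' M M' where *: "\<And>s. 0 \<le> s \<Longrightarrow> (\<Psi> u' v' has_real_derivative \<Psi>' s) (at s within {0..})"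
        "\<And>s. 0 \<le> s \<Longrightarrow> (M has_real_derivative M' s) (at s within {0..})"
        "\<And>s. 0 \<le> s \<Longrightarrow> \<Psi>' s \<le> - (1/2) * \<Psi> u' v' s - \<kappa> / 8 * (norm (v' (s + h) - v' s))\<^sup>2 + M' s"
        "\<And>s. 0 \<le> s \<Longrightarrow> 0 \<le> M s" "\<And>s. 0 \<le> s \<Longrightarrow> M s \<le> C1 * h\<^sup>2" "\<Psi> u' v' 0 \<le> B"
        using main[OF uv(1)] by blast
      have "\<Psi> u v s = \<Psi> u' v' (\<tau> + s)"
        using uv(2)[of s] uv(2)[of "s + h"] s h by (simp add: \<Psi>_def add.assoc)
      also have "\<dots> \<le> exp (- (1/2) * (\<tau> + s)) * (\<Psi> u' v' 0 - M 0) + M (\<tau> + s)"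
      proof (rule decay_estimate[OF *(1,2) _ *(4)])
        fix r :: real assume r: "0 \<le> r"
        have "0 \<le> \<kappa> / 8 * (norm (v' (r + h) - v' r))\<^sup>2" using \<kappa>0 by simp
        then show "\<Psi>' r \<le> - (1 / 2) * \<Psi> u' v' r + M' r" using *(3)[OF r] by linarith
      qed (use s \<tau> in auto)
      also have "\<dots> \<le> exp (- (1/2) * (\<tau> + s)) * B + C1 * h\<^sup>2"
        using *(4)[of 0] *(6) s \<tau> by (intro add_mono mult_left_mono *(5)) auto
      finally show ?thesis .
    qed
    have "filterlim (\<lambda>\<tau>. \<tau> + s) at_top at_top"
      by (rule filterlim_at_top_mono[OF filterlim_ident]) (use s in simp)
    then have "filterlim (\<lambda>\<tau>. - (1/2) * (\<tau> + s)) at_bot at_top"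
      by (intro filterlim_tendsto_neg_mult_at_bot[OF tendsto_const]) auto
    then have "((\<lambda>\<tau>. exp (- (1/2) * (\<tau> + s)) * B + C1 * h\<^sup>2) \<longlongrightarrow> 0 * B + C1 * h\<^sup>2) at_top"
      by (intro tendsto_intros filterlim_compose[OF exp_at_bot])
    then have "\<Psi> u v s \<le> 0 * B + C1 * h\<^sup>2"
      by (rule tendsto_lowerbound) (use est in \<open>auto simp del: minus_mult_left simp: eventually_at_top_linorder intro!: exI[of _ 0]\<close>)
    then show ?thesis by simp
  qed
  obtain \<Psi>' M M' where *: "\<And>s. 0 \<le> s \<Longrightarrow> (\<Psi> u v has_real_derivative \<Psi>' s) (at s within {0..})"
        "\<And>s. 0 \<le> s \<Longrightarrow> (M has_real_derivative M' s) (at s within {0..})"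
        "\<And>s. 0 \<le> s \<Longrightarrow> \<Psi>' s \<le> - (1/2) * \<Psi> u v s - \<kappa> / 8 * (norm (v (s + h) - v s))\<^sup>2 + M' s"
        "\<And>s. 0 \<le> s \<Longrightarrow> \<kappa> / 4 * (\<epsilon> * (norm (v (s + h) - v s))\<^sup>2) \<le> \<Psi> u v s"
        "\<And>s. 0 \<le> s \<Longrightarrow> 0 \<le> \<Psi> u v s"
        "\<And>s. 0 \<le> s \<Longrightarrow> 0 \<le> M s" "\<And>s. 0 \<le> s \<Longrightarrow> M s \<le> C1 * h\<^sup>2"
    using main[OF orb(2)] by blast
  show "\<kappa> / 4 * (\<epsilon> * (norm (v (t + h) - v t))\<^sup>2) \<le> C1 * h\<^sup>2" using *(4)[OF t] decay[OF t] by linarith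
  fix Q assume Q: "\<And>s. 0 \<le> s \<Longrightarrow> (Q has_real_derivative (norm (v (s + h) - v s))\<^sup>2) (at s within {0..})"
  \<comment> \<open>Once the damped energy is known to be of order h^2, the dissipation term,
    dropped in the decay argument, is integrated over a unit of time.\<close>
  have "(\<lambda>s. \<Psi> u v s + \<kappa> / 8 * Q s - M s) (t + 1) \<le> (\<lambda>s. \<Psi> u v s + \<kappa> / 8 * Q s - M s) t"
  proof (rule nonincreasing_of_derivative[OF _ _ t, where X' = "\<lambda>s. \<Psi>' s + \<kappa> / 8 * (norm (v (s + h) - v s))\<^sup>2 - M' s"])
    fix r assume "t \<le> r" then have r: "0 \<le> r" using t by simp
    show "((\<lambda>s. \<Psi> u v s + \<kappa> / 8 * Q s - M s) has_real_derivative \<Psi>' r + \<kappa> / 8 * (norm (v (r + h) - v r))\<^sup>2 - M' r) (at r within {0..})"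
      by (intro DERIV_add DERIV_diff DERIV_cmult * Q r)
    show "\<Psi>' r + \<kappa> / 8 * (norm (v (r + h) - v r))\<^sup>2 - M' r \<le> 0" using *(3)[OF r] *(5)[OF r] by linarith
  qed simp
  moreover have "0 \<le> \<Psi> u v (t + 1)" "\<Psi> u v t \<le> C1 * h\<^sup>2" "M (t + 1) \<le> C1 * h\<^sup>2" "0 \<le> M t"
    using t by (auto intro: * decay)
  ultimately show "\<kappa> / 8 * (Q (t + 1) - Q t) \<le> 2 * C1 * h\<^sup>2" by (simp add: right_diff_distrib)
qed

text \<open>The bound of order k^2 for the mean square of v(s + k) - v(s) over unit time means that
  v has a square integrable derivative, hence a Hoelder exponent 1/2. As that derivative is not
  constructed, the inequality is proved for the difference quotients of j u with step k, and then k
  tends to 0. The condition \<open>h \<le> 1\<close> keeps [t, t + h] inside the unit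
  interval.\<close>

lemma orbit_Holder:
  assumes l: "l \<ge> 1" "\<And>p q. p \<in> V \<Longrightarrow> q \<in> V \<Longrightarrow> a p p \<le> R \<Longrightarrow> a q q \<le> R \<Longrightarrow> (norm (f p - f q))\<^sup>2 \<le> l\<^sup>2 * a (p - q) (p - q)"
    and K: "\<And>p. p \<in> V \<Longrightarrow> a p p \<le> R \<Longrightarrow> \<bar>\<Phi> p\<bar> \<le> K"
    and \<kappa>: "\<kappa> = 1 / (2 * l\<^sup>2)" and \<epsilon>: "0 < \<epsilon>" "\<epsilon> \<le> \<kappa> / 4" and "R > 0"
    and C1: "C1 = (l\<^sup>2 + 1) * (R / 2 + 2 * K)"
    and orb: "complete_orbits \<epsilon> R Orb" "(u, v) \<in> Orb" and t: "0 \<le> t" and h: "0 < h" "h \<le> 1"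
  shows "(norm (v (t + h) - v t))\<^sup>2 \<le> 16 * C1 / \<kappa> * h"
proof -
  have \<kappa>0: "0 < \<kappa>" using l by (auto simp: \<kappa>)
  have w: "weak_wave \<epsilon> u v (\<lambda>t. f (u t))" using orb by (auto simp: complete_orbits_def)
  have vc: "continuous_on {0..} v"
    and ju: "\<And>t. 0 \<le> t \<Longrightarrow> ((\<lambda>s. j (u s)) has_vector_derivative v t) (at t within {0..})"
    using w by (auto simp: weak_wave_def)
  define \<phi> where "\<phi> = v (t + h) - v t"
  define C2 where "C2 = 16 * C1 / \<kappa>"
  have est: "(steklov (\<lambda>s. j (u s)) n (t + h) - steklov (\<lambda>s. j (u s)) n t) \<bullet> \<phi> \<le> h * C2 / 2 + (norm \<phi>)\<^sup>2 / 2" for n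
  proof -
    define k where "k = 1 / real (Suc n)"
    have k: "k > 0" by (simp add: k_def)
    \<comment> \<open>This is k times the Steklov quotient of j u, so its derivative is precisely
      the velocity difference whose mean square is controlled.\<close>
    define W where "W s = j (u (s + k)) - j (u s)" for s
    define Q where "Q s = integral {0..s} (\<lambda>r. (norm (v (r + k) - v r))\<^sup>2)" for s
    have W: "(W has_vector_derivative (v (s + k) - v s)) (at s within {0..})" if "0 \<le> s" for s
      unfolding W_def using that k by (intro has_vector_derivative_diff ju shifted_derivative) auto
    have Q: "(Q has_real_derivative (norm (v (s + k) - v s))\<^sup>2) (at s within {0..})" if "0 \<le> s" for s
      unfolding Q_def has_real_derivative_iff_has_vector_derivative using k
      by (intro integral_derivative_atLeast continuous_intros vc that continuous_on_shift) auto
    have "(\<lambda>s. - Q s) (t + 1) \<le> (\<lambda>s. - Q s) (t + h)"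
      by (rule nonincreasing_of_derivative[where X = "\<lambda>s. - Q s" and s = "t + h" and t = "t + 1" and
            X' = "\<lambda>r. - ((norm (v (r + k) - v r))\<^sup>2)"])
         (use t h in \<open>auto intro!: derivative_eq_intros Q\<close>)
    moreover have "\<kappa> / 8 * (Q (t + 1) - Q t) \<le> 2 * C1 * k\<^sup>2"
      by (rule orbit_differences(2)[OF l K \<kappa> \<epsilon> \<open>R > 0\<close> C1 orb t k Q])
    then have "Q (t + 1) - Q t \<le> C2 * k\<^sup>2" using \<kappa>0 by (simp add: C2_def field_simps)
    ultimately have QC: "Q (t + h) - Q t \<le> C2 * k\<^sup>2" by simp
    \<comment> \<open>\<open>Q\<close> is of order k^2. The weight h / k makes both summands
      proportional to k, which is divided out afterwards, and leaves the square of
      \<open>norm \<phi>\<close> with the factor 1/2.\<close>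
    have "(W (t + h) - W t) \<bullet> \<phi> \<le> (h / k) / 2 * (Q (t + h) - Q t) + (t + h - t) * (norm \<phi>)\<^sup>2 / (2 * (h / k))"
      by (rule mean_square_increment[OF W Q t]) (use h k in auto)
    also have "\<dots> \<le> (h / k) / 2 * (C2 * k\<^sup>2) + (t + h - t) * (norm \<phi>)\<^sup>2 / (2 * (h / k))"
      using h k by (intro add_right_mono mult_left_mono QC) auto
    also have "\<dots> = k * (h * C2 / 2 + (norm \<phi>)\<^sup>2 / 2)"
      using h k by (simp add: field_simps power2_eq_square)
    finally have "(1 / k) * ((W (t + h) - W t) \<bullet> \<phi>) \<le> (1 / k) * (k * (h * C2 / 2 + (norm \<phi>)\<^sup>2 / 2))"
      using k by (intro mult_left_mono) auto
    moreover have "steklov (\<lambda>s. j (u s)) n (t + h) - steklov (\<lambda>s. j (u s)) n t = (1 / k) *\<^sub>R (W (t + h) - W t)"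
      unfolding steklov_def W_def k_def by (simp only: scaleR_diff_right) simp
    ultimately show ?thesis using k by simp
  qed
  have "(\<lambda>n. (steklov (\<lambda>s. j (u s)) n (t + h) - steklov (\<lambda>s. j (u s)) n t) \<bullet> \<phi>) \<longlonglongrightarrow> (v (t + h) - v t) \<bullet> \<phi>"
    by (intro tendsto_intros steklov_pointwise[OF ju vc]) (use t h in auto)
  then have "(v (t + h) - v t) \<bullet> \<phi> \<le> h * C2 / 2 + (norm \<phi>)\<^sup>2 / 2"
    by (rule LIMSEQ_le_const2) (use est in blast)
  then show ?thesis by (simp add: \<phi>_def C2_def power2_norm_eq_inner)
qed

text \<open>The Lipschitz constant and the bound on the potential are those of the energy ball of
  level \<open>R\<close>; hence the threshold and the constant serve all \<epsilon> and all families
  of orbits at once.\<close>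

lemma orbit_regularity:
  assumes "R > 0"
  obtains \<epsilon>0 K where "\<epsilon>0 > 0" "K \<ge> 0"
    "\<And>\<epsilon> Orb u v t h. 0 < \<epsilon> \<Longrightarrow> \<epsilon> \<le> \<epsilon>0 \<Longrightarrow> complete_orbits \<epsilon> R Orb \<Longrightarrow> (u, v) \<in> Orb \<Longrightarrow> 0 \<le> t \<Longrightarrow> 0 \<le> h \<Longrightarrow>
       \<epsilon> * (norm (v (t + h) - v t))\<^sup>2 \<le> K * h\<^sup>2"
    "\<And>\<epsilon> Orb u v t h. 0 < \<epsilon> \<Longrightarrow> \<epsilon> \<le> \<epsilon>0 \<Longrightarrow> complete_orbits \<epsilon> R Orb \<Longrightarrow> (u, v) \<in> Orb \<Longrightarrow> 0 \<le> t \<Longrightarrow> 0 \<le> h \<Longrightarrow> h \<le> 1 \<Longrightarrow>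
       (norm (v (t + h) - v t))\<^sup>2 \<le> K * h"
proof -
  obtain l where l: "l \<ge> 1" "\<And>p q. p \<in> V \<Longrightarrow> q \<in> V \<Longrightarrow> a p p \<le> R \<Longrightarrow> a q q \<le> R \<Longrightarrow>
      (norm (f p - f q))\<^sup>2 \<le> l\<^sup>2 * a (p - q) (p - q)" using f_Lipschitz' by blast
  obtain K where K: "\<And>p. p \<in> V \<Longrightarrow> a p p \<le> R \<Longrightarrow> \<bar>\<Phi> p\<bar> \<le> K" using \<Phi>_bounded[of R] by blast
  define \<kappa> where "\<kappa> = 1 / (2 * l\<^sup>2)"
  define C1 where "C1 = (l\<^sup>2 + 1) * (R / 2 + 2 * K)"
  have \<kappa>0: "0 < \<kappa>" using l by (auto simp: \<kappa>_def)
  have K0: "K \<ge> 0" using K[of 0] subspace_0[OF subspace_X] \<open>R > 0\<close> by (auto simp: bounded_bilinear.zero_left[OF a])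
  have C1nn: "0 \<le> C1" using K0 \<open>R > 0\<close> by (simp add: C1_def)
  show thesis
  proof (rule that[of "\<kappa> / 4" "16 * C1 / \<kappa>"])
    fix \<epsilon> Orb u v and t h :: real
    assume *: "0 < \<epsilon>" "\<epsilon> \<le> \<kappa> / 4" "complete_orbits \<epsilon> R Orb" "(u, v) \<in> Orb" "0 \<le> t" "0 \<le> h"
    show "\<epsilon> * (norm (v (t + h) - v t))\<^sup>2 \<le> 16 * C1 / \<kappa> * h\<^sup>2"
    proof (cases "h = 0")
      case False
      have "\<kappa> / 4 * (\<epsilon> * (norm (v (t + h) - v t))\<^sup>2) \<le> C1 * h\<^sup>2"
        by (rule orbit_differences(1)[OF l K \<kappa>_def *(1,2) \<open>R > 0\<close> C1_def *(3,4,5)]) (use False *(6) in auto)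
      then have "\<epsilon> * (norm (v (t + h) - v t))\<^sup>2 \<le> 4 * C1 / \<kappa> * h\<^sup>2" using \<kappa>0 by (simp add: field_simps)
      also have "\<dots> \<le> 16 * C1 / \<kappa> * h\<^sup>2"
        using C1nn \<kappa>0 by (intro mult_right_mono divide_right_mono) auto
      finally show ?thesis .
    qed simp
    show "(norm (v (t + h) - v t))\<^sup>2 \<le> 16 * C1 / \<kappa> * h" if "h \<le> 1"
    proof (cases "h = 0")
      case False
      show ?thesis
        by (rule orbit_Holder[OF l K \<kappa>_def *(1,2) \<open>R > 0\<close> C1_def *(3,4,5) _ that]) (use False *(6) in auto)
    qed simp
  qed (use \<kappa>0 C1nn in auto)
qed

text \<open>The case \<epsilon> = 0 of the weak equation. No velocity is supplied: the curve j u is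
  assumed differentiable only against fixed elements of \<open>V\<close>.\<close>

definition weak_parabolic :: "(real \<Rightarrow> 'v) \<Rightarrow> bool" where
  "weak_parabolic u \<longleftrightarrow> continuous_on {0..} u \<and> (\<forall>t\<ge>0. u t \<in> V) \<and>
     (\<forall>b\<in>V. \<forall>t\<ge>0. ((\<lambda>s. j (u s) \<bullet> j b) has_real_derivative (- a (u t) b + f (u t) \<bullet> j b)) (at t within {0..}))"

text \<open>The parabolic orbit is not known to be bounded in advance. As long as it stays within
  distance 1 of the orbit of the wave equation, a fixed Lipschitz constant is available, and the
  resulting estimate prevents it from ever leaving that neighbourhood on the time interval.\<close>

lemma comparison:
  assumes "L \<ge> 0"
  obtains \<Lambda> where "\<Lambda> \<ge> 1"
    "\<And>\<epsilon> \<kappa> u v u' t. weak_wave \<epsilon> u v (\<lambda>t. f (u t)) \<Longrightarrow> (\<And>t. 0 \<le> t \<Longrightarrow> a (u t) (u t) \<le> R) \<Longrightarrow>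
       (\<And>s t. 0 \<le> s \<Longrightarrow> s \<le> t \<Longrightarrow> norm (\<epsilon> *\<^sub>R v t - \<epsilon> *\<^sub>R v s) \<le> \<kappa> * (t - s)) \<Longrightarrow> weak_parabolic u' \<Longrightarrow>
       \<Lambda> * (a (u 0 - u' 0) (u 0 - u' 0) + \<kappa>\<^sup>2) < 1 \<Longrightarrow> 0 \<le> t \<Longrightarrow> t \<le> L \<Longrightarrow>
       a (u t - u' t) (u t - u' t) \<le> \<Lambda> * (a (u 0 - u' 0) (u 0 - u' 0) + \<kappa>\<^sup>2)"
proof -
  \<comment> \<open>The energy level reached by the parabolic orbit while the difference has energy
    at most 1, that is, twice R plus twice 1.\<close>
  define M where "M = 2 * R + 2"
  obtain l where l: "l \<ge> 1" "\<And>p q. p \<in> V \<Longrightarrow> q \<in> V \<Longrightarrow> a p p \<le> M \<Longrightarrow> a q q \<le> M \<Longrightarrow>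
      (norm (f p - f q))\<^sup>2 \<le> l\<^sup>2 * a (p - q) (p - q)" using f_Lipschitz' by blast
  \<comment> \<open>The Gronwall factor on [0, L]; 1 + L collects the initial energy and the
    constant source that acts for a time at most L.\<close>
  define \<Lambda> where "\<Lambda> = exp (l\<^sup>2 * L) * (1 + L)"
  have \<Lambda>1: "\<Lambda> \<ge> 1"
    unfolding \<Lambda>_def using \<open>L \<ge> 0\<close> mult_mono[of 1 "exp (l\<^sup>2 * L)" 1 "1 + L"] by simp
  show thesis
  proof (rule that[OF \<Lambda>1])
    fix \<epsilon> \<kappa> u v u' t
    assume w: "weak_wave \<epsilon> u v (\<lambda>t. f (u t))" and aR: "\<And>t. 0 \<le> t \<Longrightarrow> a (u t) (u t) \<le> R"
      and \<kappa>: "\<And>s t. 0 \<le> s \<Longrightarrow> s \<le> t \<Longrightarrow> norm (\<epsilon> *\<^sub>R v t - \<epsilon> *\<^sub>R v s) \<le> \<kappa> * (t - s)"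
      and par: "weak_parabolic u'" and small: "\<Lambda> * (a (u 0 - u' 0) (u 0 - u' 0) + \<kappa>\<^sup>2) < 1"
      and t: "0 \<le> t" "t \<le> L"
    define z where "z t = u t - u' t" for t
    define S where "S = \<Lambda> * (a (z 0) (z 0) + \<kappa>\<^sup>2)"
    have S1: "S < 1" using small by (simp add: S_def z_def)
    have u: "continuous_on {0..} u" "\<And>t. 0 \<le> t \<Longrightarrow> u t \<in> V" using w by (auto simp: weak_wave_def)
    have u': "continuous_on {0..} u'" "\<And>t. 0 \<le> t \<Longrightarrow> u' t \<in> V" using par by (auto simp: weak_parabolic_def)
    have zc: "continuous_on {0..} z" unfolding z_def by (intro continuous_intros u u')
    have zV: "z t \<in> V" if "0 \<le> t" for t unfolding z_def by (intro subspace_diff[OF subspace_X] u u' that)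
    have azc: "continuous_on {0..} (\<lambda>t. a (z t) (z t))" by (intro bounded_bilinear.continuous_on[OF a] zc)
    define g where "g t = f (u t) - f (u' t)" for t
    have gc: "continuous_on {0..} g"
      unfolding g_def by (intro continuous_intros f_curve_continuous u u')
    have weak: "((\<lambda>s. (\<epsilon> *\<^sub>R v s + j (z s)) \<bullet> j b) has_real_derivative (- a (z t) b + g t \<bullet> j b)) (at t within {0..})"
      if "b \<in> V" "0 \<le> t" for b t
    proof -
      have "((\<lambda>s. (\<epsilon> *\<^sub>R v s + j (u s)) \<bullet> j b - j (u' s) \<bullet> j b) has_real_derivative
        ((- a (u t) b + f (u t) \<bullet> j b) - (- a (u' t) b + f (u' t) \<bullet> j b))) (at t within {0..})"
        using w par that unfolding weak_wave_def weak_parabolic_def by (intro DERIV_diff) auto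
      moreover have "(\<lambda>s. (\<epsilon> *\<^sub>R v s + j (u s)) \<bullet> j b - j (u' s) \<bullet> j b) = (\<lambda>s. (\<epsilon> *\<^sub>R v s + j (z s)) \<bullet> j b)"
        by (simp add: z_def linear_simps[OF j] inner_diff_left inner_add_left add_diff_eq)
      moreover have "(- a (u t) b + f (u t) \<bullet> j b) - (- a (u' t) b + f (u' t) \<bullet> j b) = - a (z t) b + g t \<bullet> j b"
        by (simp add: z_def g_def bounded_bilinear.diff_left[OF a] inner_diff_left)
      ultimately show ?thesis by simp
    qed
    have near: "a (z t) (z t) \<le> S" if t: "0 \<le> t" "t \<le> L" and le1: "\<And>s. 0 \<le> s \<Longrightarrow> s \<le> t \<Longrightarrow> a (z s) (z s) \<le> 1" for t
    proof -
      have gl: "(norm (g s))\<^sup>2 \<le> l\<^sup>2 * a (z s) (z s)" if s: "0 \<le> s" "s \<le> t" for s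
      proof -
        have "a (u' s) (u' s) \<le> 2 * a (u s) (u s) + 2 * a (z s) (z s)"
          using a_diff_le[OF u(2) zV, of s s] s by (simp add: z_def)
        then have "a (u' s) (u' s) \<le> M" "a (u s) (u s) \<le> M"
          using aR[OF s(1)] le1[OF s] a_nonneg[OF u(2)[OF s(1)]] by (auto simp: M_def)
        then show ?thesis unfolding g_def z_def using s by (intro l u u') auto
      qed
      have "a (z t) (z t) \<le> exp (l\<^sup>2 * t) * (a (z 0) (z 0) + \<kappa>\<^sup>2 * t)"
      proof (rule gronwall[where L = t and N = "\<lambda>t. a (z t) (z t)", OF azc])
        fix r assume r: "0 \<le> r" "r \<le> t"
        have "a (z r) (z r) \<le> a (z 0) (z 0) + integral {0..r} (\<lambda>s. (norm (g s))\<^sup>2 + \<kappa>\<^sup>2)"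
          by (rule parabolic_inequality[OF zc zV gc weak \<kappa> r(1)])
        also have "integral {0..r} (\<lambda>s. (norm (g s))\<^sup>2 + \<kappa>\<^sup>2) \<le> integral {0..r} (\<lambda>s. l\<^sup>2 * a (z s) (z s) + \<kappa>\<^sup>2)"
          using r gl
          by (intro integral_le integrable_continuous_interval continuous_intros
                continuous_on_subset[OF gc] continuous_on_subset[OF azc]) auto
        finally show "a (z r) (z r) \<le> a (z 0) (z 0) + integral {0..r} (\<lambda>s. l\<^sup>2 * a (z s) (z s) + \<kappa>\<^sup>2)" by simp
      qed (use t in auto)
      also have "\<dots> \<le> exp (l\<^sup>2 * L) * ((1 + L) * (a (z 0) (z 0) + \<kappa>\<^sup>2))"
      proof (intro mult_mono)
        have "a (z 0) (z 0) + \<kappa>\<^sup>2 * t \<le> a (z 0) (z 0) + \<kappa>\<^sup>2 * L" using t by (intro add_left_mono mult_left_mono) auto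
        also have "\<dots> \<le> (1 + L) * (a (z 0) (z 0) + \<kappa>\<^sup>2)"
          using a_nonneg[OF zV[OF order_refl]] \<open>L \<ge> 0\<close> by (simp add: algebra_simps)
        finally show "a (z 0) (z 0) + \<kappa>\<^sup>2 * t \<le> (1 + L) * (a (z 0) (z 0) + \<kappa>\<^sup>2)" .
      qed (use t a_nonneg[OF zV[OF order_refl]] in \<open>auto intro: mult_left_mono\<close>)
      finally show ?thesis by (simp add: S_def \<Lambda>_def mult_ac)
    qed
    have all1: "a (z s) (z s) < 1" if s: "0 \<le> s" "s \<le> L" for s
    proof (rule ccontr)
      assume neg: "\<not> a (z s) (z s) < 1"
      define E where "E = {s \<in> {0..L}. 1 \<le> a (z s) (z s)}"
      have clE: "closed E"
        unfolding E_def
        by (intro continuous_on_closed_Collect_le continuous_intros continuous_on_subset[OF azc]) auto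
      have sE: "s \<in> E" using s neg by (simp add: E_def)
      have bdd: "bdd_below E" by (rule bdd_belowI[of _ 0]) (simp add: E_def)
      have t1: "Inf E \<in> E" by (rule closed_contains_Inf[OF _ bdd clE]) (use sE in auto)
      define t1 where "t1 = Inf E"
      have t1E: "0 \<le> t1" "t1 \<le> L" "1 \<le> a (z t1) (z t1)" using t1 by (auto simp: E_def t1_def)
      have before: "a (z r) (z r) < 1" if "0 \<le> r" "r < t1" for r
      proof (rule ccontr)
        assume "\<not> ?thesis"
        then have "r \<in> E" using that t1E by (simp add: E_def)
        then have "t1 \<le> r" unfolding t1_def by (rule cInf_lower[OF _ bdd])
        then show False using that by simp
      qed
      have z0: "a (z 0) (z 0) < 1"
      proof -
        have "a (z 0) (z 0) \<le> a (z 0) (z 0) + \<kappa>\<^sup>2" by simp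
        also have "\<dots> = 1 * (a (z 0) (z 0) + \<kappa>\<^sup>2)" by simp
        also have "\<dots> \<le> S" unfolding S_def using \<Lambda>1 a_nonneg[OF zV[OF order_refl]] by (intro mult_right_mono) auto
        finally show ?thesis using S1 by simp
      qed
      have t1pos: "0 < t1" using t1E z0 by (cases "t1 = 0") auto
      \<comment> \<open>The estimate up to \<open>t1\<close> needs the bound 1 at \<open>t1\<close>
        too, where minimality says nothing; it comes from the earlier times by continuity.\<close>
      have at1: "a (z t1) (z t1) \<le> 1"
      proof -
        define D where "D = {s \<in> {0..L}. a (z s) (z s) \<le> 1}"
        have "closed D" unfolding D_def
          by (intro continuous_on_closed_Collect_le continuous_intros continuous_on_subset[OF azc]) auto
        moreover have "{0..<t1} \<subseteq> D" using before t1E by (auto simp: D_def less_imp_le)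
        ultimately have "closure {0..<t1} \<subseteq> D" by (rule closure_minimal[rotated])
        then have "{0..t1} \<subseteq> D" using t1pos by simp
        moreover have "t1 \<in> {0..t1}" using t1pos by simp
        ultimately have "t1 \<in> D" by blast
        then show ?thesis by (simp add: D_def)
      qed
      have "a (z t1) (z t1) \<le> S"
      proof (rule near[OF t1E(1,2)])
        fix s assume "0 \<le> s" "s \<le> t1"
        then show "a (z s) (z s) \<le> 1" using at1 less_imp_le[OF before] by (cases "s = t1") auto
      qed
      then show False using t1E S1 by simp
    qed
    show "a (u t - u' t) (u t - u' t) \<le> \<Lambda> * (a (u 0 - u' 0) (u 0 - u' 0) + \<kappa>\<^sup>2)"
      using near[OF t] all1 t by (simp add: z_def S_def less_imp_le)
  qed
qed

end

section \<open>Square integrable functions\<close>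

lemma rep_L2_measurable [measurable]: "rep_L2 u \<in> borel_measurable lebesgue"
  using rep_L2_sq_integrable[of u] by (simp add: sq_integrable_def)

lemma rep_L2_square_integrable: "integrable lebesgue (\<lambda>x. (rep_L2 u x)\<^sup>2)"
  using rep_L2_sq_integrable[of u] by (simp add: sq_integrable_def)

lemma rep_L2_add: "AE x in lebesgue. rep_L2 (u + v) x = rep_L2 u x + rep_L2 v x"
  using rep_abs_L2[OF sq_integrable_add[OF rep_L2_sq_integrable[of u] rep_L2_sq_integrable[of v]]]
  by (simp add: plus_L2_def)

lemma rep_L2_diff: "AE x in lebesgue. rep_L2 (u - v) x = rep_L2 u x - rep_L2 v x"
  using rep_abs_L2[OF sq_integrable_diff[OF rep_L2_sq_integrable[of u] rep_L2_sq_integrable[of v]]]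
  by (simp add: minus_L2_def)

lemma rep_L2_scaleR: "AE x in lebesgue. rep_L2 (c *\<^sub>R u) x = c * rep_L2 u x"
  using rep_abs_L2[OF sq_integrable_cmult[OF rep_L2_sq_integrable[of u], of c]]
  by (simp add: scaleR_L2_def)

lemma rep_L2_zero: "AE x in lebesgue. rep_L2 0 x = 0"
  using rep_abs_L2[OF sq_integrable_zero] by (simp add: zero_L2_def)

lemma norm_L2_square: "(norm u)\<^sup>2 = (\<integral>x. (rep_L2 u x)\<^sup>2 \<partial>lebesgue)"
  by (simp add: power2_norm_eq_inner inner_L2_rep power2_eq_square[of "rep_L2 u _"])

lemma norm_L2_diff: "(norm (u - v))\<^sup>2 = (\<integral>x. (rep_L2 u x - rep_L2 v x)\<^sup>2 \<partial>lebesgue)"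
  unfolding norm_L2_square using rep_L2_diff[of u v]
  by (intro integral_cong_AE) (auto elim!: eventually_mono)

lemma diff_square_integrable: "integrable lebesgue (\<lambda>x. (rep_L2 u x - rep_L2 v x)\<^sup>2)"
  using sq_integrable_diff[OF rep_L2_sq_integrable[of u] rep_L2_sq_integrable[of v]]
  by (simp add: sq_integrable_def)

lemma norm_L2_diff_nn: "(\<integral>\<^sup>+x. ennreal ((rep_L2 u x - rep_L2 v x)\<^sup>2) \<partial>lebesgue) = ennreal ((norm (u - v))\<^sup>2)"
  unfolding norm_L2_diff by (rule nn_integral_eq_integral[OF diff_square_integrable]) simp

lemma norm_abs_L2:
  assumes "sq_integrable lebesgue g" shows "(norm (abs_L2 g))\<^sup>2 = (\<integral>x. (g x)\<^sup>2 \<partial>lebesgue)"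
  unfolding norm_L2_square using rep_abs_L2[OF assms] assms
  by (intro integral_cong_AE) (auto elim!: eventually_mono simp: sq_integrable_def)

section \<open>Completeness of the Lebesgue space\<close>

lemma summable_of_weighted_squares:
  fixes d :: "nat \<Rightarrow> real"
  assumes "summable (\<lambda>n. 2 ^ n * (d n)\<^sup>2)" shows "summable d"
proof (rule summable_comparison_test')
  show "summable (\<lambda>n. 2 ^ n * (d n)\<^sup>2 + (1/2) ^ n)"
    by (intro summable_add assms summable_geometric) simp
  show "norm (d n) \<le> 2 ^ n * (d n)\<^sup>2 + (1/2) ^ n" for n
  proof -
    define s where "s = sqrt (2 ^ n)"
    have s: "s > 0" "s\<^sup>2 = 2 ^ n" by (auto simp: s_def)
    have "2 * (s * \<bar>d n\<bar>) * (1 / s) \<le> (s * \<bar>d n\<bar>)\<^sup>2 + (1 / s)\<^sup>2" by (rule sum_squares_bound)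
    then have "2 * \<bar>d n\<bar> \<le> 2 ^ n * (d n)\<^sup>2 + (1/2) ^ n"
      using s by (simp add: power_mult_distrib power_divide power_one_over)
    then show ?thesis by simp
  qed
qed

text \<open>The Riesz-Fischer argument along a rapidly convergent subsequence. Only squared
  increments are integrable over the whole space, so they are weighted by 2^n: the weighted series
  still has a finite integral, and its pointwise finiteness makes the increments themselves
  summable. Fatou's lemma then identifies the pointwise limit as the limit in norm.\<close>

instance L2 :: complete_space
proof
  fix X :: "nat \<Rightarrow> L2" assume X: "Cauchy X"
  have "\<exists>r. \<forall>n. (\<forall>m\<ge>r n. norm (X m - X (r n)) < (1/2) ^ n) \<and> r n < r (Suc n)"
  proof (rule dependent_nat_choice)
    show "\<exists>x. \<forall>m\<ge>x. norm (X m - X x) < (1/2) ^ 0"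
      using metric_CauchyD[OF X, of 1] by (auto simp: dist_norm)
    fix x n
    obtain M where M: "\<And>k m. k \<ge> M \<Longrightarrow> m \<ge> M \<Longrightarrow> norm (X k - X m) < (1/2) ^ Suc n"
      using metric_CauchyD[OF X, of "(1/2) ^ Suc n"] by (auto simp: dist_norm)
    show "\<exists>y. (\<forall>m\<ge>y. norm (X m - X y) < (1/2) ^ Suc n) \<and> x < y"
      by (intro exI[of _ "max M (Suc x)"] conjI allI impI M) auto
  qed
  then obtain r where r: "\<And>n m. m \<ge> r n \<Longrightarrow> norm (X m - X (r n)) < (1/2) ^ n" "\<And>n. r n < r (Suc n)"
    by blast
  have rmono: "strict_mono r" using r(2) by (simp add: strict_mono_Suc_iff)
  define F where "F n = rep_L2 (X (r n))" for n
  define D where "D n x = F (Suc n) x - F n x" for n x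
  have F_meas [measurable]: "F n \<in> borel_measurable lebesgue" for n by (simp add: F_def)
  have D_meas [measurable]: "D n \<in> borel_measurable lebesgue" for n unfolding D_def by measurable
  \<comment> \<open>The squared increments integrate to at most (1/4)^n, so the weight 2^n leaves
    (1/2)^n.\<close>
  have Dn: "(\<integral>\<^sup>+x. ennreal (2 ^ n * (D n x)\<^sup>2) \<partial>lebesgue) \<le> ennreal ((1/2) ^ n)" for n
  proof -
    have "(\<integral>\<^sup>+x. ennreal (2 ^ n * (D n x)\<^sup>2) \<partial>lebesgue) = ennreal (2 ^ n) * (\<integral>\<^sup>+x. ennreal ((D n x)\<^sup>2) \<partial>lebesgue)"
      by (subst nn_integral_cmult[symmetric]) (auto simp: ennreal_mult')
    also have "\<dots> = ennreal (2 ^ n * (norm (X (r (Suc n)) - X (r n)))\<^sup>2)"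
      unfolding D_def F_def norm_L2_diff_nn by (simp add: ennreal_mult')
    also have "\<dots> \<le> ennreal (2 ^ n * ((1/2) ^ n)\<^sup>2)"
      using r(1)[of n "r (Suc n)"] r(2)[of n]
      by (intro ennreal_leI mult_left_mono power_mono) (auto simp: less_imp_le)
    also have "2 ^ n * ((1/2) ^ n)\<^sup>2 = ((1/2) ^ n :: real)"
      by (simp add: power_one_over power2_eq_square field_simps)
    finally show ?thesis .
  qed
  have "(\<integral>\<^sup>+x. (\<Sum>n. ennreal (2 ^ n * (D n x)\<^sup>2)) \<partial>lebesgue) = (\<Sum>n. \<integral>\<^sup>+x. ennreal (2 ^ n * (D n x)\<^sup>2) \<partial>lebesgue)"
    by (rule nn_integral_suminf) measurable
  also have "\<dots> \<le> (\<Sum>n. ennreal ((1/2) ^ n))" by (intro suminf_le Dn) auto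
  also have "\<dots> = ennreal (\<Sum>n. (1/2) ^ n)" by (intro suminf_ennreal2 summable_geometric) auto
  also have "\<dots> < \<infinity>" by simp
  finally have "AE x in lebesgue. (\<Sum>n. ennreal (2 ^ n * (D n x)\<^sup>2)) \<noteq> \<infinity>"
    by (intro nn_integral_PInf_AE) auto
  then have conv: "AE x in lebesgue. (\<lambda>n. F n x) \<longlonglongrightarrow> lim (\<lambda>n. F n x)"
  proof eventually_elim
    case (elim x)
    have "summable (\<lambda>n. 2 ^ n * (D n x)\<^sup>2)" by (rule summable_suminf_not_top) (use elim in auto)
    then have "summable (\<lambda>n. D n x)" by (rule summable_of_weighted_squares)
    then have "convergent (\<lambda>n. \<Sum>i<n. D i x)" by (simp add: summable_iff_convergent)
    then have "convergent (\<lambda>n. (\<Sum>i<n. D i x) + F 0 x)" by (intro convergent_add convergent_const)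
    moreover have "(\<Sum>i<n. D i x) + F 0 x = F n x" for n
      unfolding D_def using sum_lessThan_telescope[of "\<lambda>i. F i x" n] by simp
    ultimately show ?case by (simp add: convergent_LIMSEQ_iff)
  qed
  \<comment> \<open>Off the set of convergence \<open>lim\<close> is an arbitrary value; the
    function is nevertheless measurable, and that set has full measure.\<close>
  define g where "g x = lim (\<lambda>n. F n x)" for x
  have g_meas [measurable]: "g \<in> borel_measurable lebesgue" unfolding g_def by measurable
  have fatou: "(\<integral>\<^sup>+x. ennreal ((g x - F m x)\<^sup>2) \<partial>lebesgue) \<le> ennreal (((1/2) ^ m)\<^sup>2)" for m
  proof -
    have "(\<integral>\<^sup>+x. ennreal ((g x - F m x)\<^sup>2) \<partial>lebesgue) \<le> (\<integral>\<^sup>+x. liminf (\<lambda>n. ennreal ((F n x - F m x)\<^sup>2)) \<partial>lebesgue)"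
    proof (rule nn_integral_mono_AE)
      show "AE x in lebesgue. ennreal ((g x - F m x)\<^sup>2) \<le> liminf (\<lambda>n. ennreal ((F n x - F m x)\<^sup>2))"
        using conv
      proof eventually_elim
        case (elim x)
        then have "(\<lambda>n. ennreal ((F n x - F m x)\<^sup>2)) \<longlonglongrightarrow> ennreal ((g x - F m x)\<^sup>2)"
          unfolding g_def by (intro tendsto_intros)
        from lim_imp_Liminf[OF _ this] show ?case by simp
      qed
    qed
    also have "\<dots> \<le> liminf (\<lambda>n. \<integral>\<^sup>+x. ennreal ((F n x - F m x)\<^sup>2) \<partial>lebesgue)"
      by (rule nn_integral_liminf) measurable
    also have "\<dots> \<le> ennreal (((1/2) ^ m)\<^sup>2)"
    proof (rule Liminf_le[OF sequentially_bot], rule eventually_sequentiallyI[of m])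
      fix n assume "m \<le> n"
      then have "r m \<le> r n" using strict_mono_less_eq[OF rmono] by simp
      then show "(\<integral>\<^sup>+x. ennreal ((F n x - F m x)\<^sup>2) \<partial>lebesgue) \<le> ennreal (((1/2) ^ m)\<^sup>2)"
        unfolding F_def norm_L2_diff_nn using r(1)[of m "r n"]
        by (intro ennreal_leI power_mono) (auto simp: less_imp_le)
    qed
    finally show ?thesis .
  qed
  have gF: "sq_integrable lebesgue (\<lambda>x. g x - F m x)" for m
    unfolding sq_integrable_def using fatou[of m]
    by (auto intro!: integrableI_bounded simp: order.strict_trans1)
  have g: "sq_integrable lebesgue g"
    using sq_integrable_add[OF gF[of 0] rep_L2_sq_integrable[of "X (r 0)"]] by (simp add: F_def)
  have est: "norm (abs_L2 g - X (r m)) \<le> (1/2) ^ m" for m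
  proof (rule power2_le_imp_le)
    have "abs_L2 g - X (r m) = abs_L2 (\<lambda>x. g x - F m x)"
    proof -
      have "AE x in lebesgue. rep_L2 (abs_L2 g) x - rep_L2 (X (r m)) x = g x - F m x"
        using rep_abs_L2[OF g] by (auto simp: F_def elim!: eventually_mono)
      then show ?thesis
        unfolding minus_L2_def map_fun_apply
        by (subst abs_L2_eq_iff) (auto intro!: sq_integrable_diff rep_L2_sq_integrable gF)
    qed
    then have "ennreal ((norm (abs_L2 g - X (r m)))\<^sup>2) = (\<integral>\<^sup>+x. ennreal ((g x - F m x)\<^sup>2) \<partial>lebesgue)"
      using gF[of m] by (simp add: norm_abs_L2 nn_integral_eq_integral sq_integrable_def)
    also have "\<dots> \<le> ennreal (((1/2) ^ m)\<^sup>2)" by (rule fatou)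
    finally show "(norm (abs_L2 g - X (r m)))\<^sup>2 \<le> ((1/2) ^ m)\<^sup>2" by (simp add: ennreal_le_iff)
  qed simp
  have "(\<lambda>m. abs_L2 g - X (r m)) \<longlonglongrightarrow> 0"
    by (rule Lim_null_comparison[OF always_eventually[OF allI[OF est]]]) (intro LIMSEQ_power_zero, simp)
  then have "(X \<circ> r) \<longlonglongrightarrow> abs_L2 g"
    using tendsto_diff[OF tendsto_const[of "abs_L2 g"], of _ 0] by (fastforce simp: o_def)
  then show "convergent X"
    using Cauchy_converges_subseq[OF X rmono] convergent_def by blast
qed

instance L2 :: banach ..

lemma L2_limit_AE_subseq:
  fixes X :: "nat \<Rightarrow> L2"
  assumes "X \<longlonglongrightarrow> l"
  obtains r :: "nat \<Rightarrow> nat" where "strict_mono r" "AE x in lebesgue. (\<lambda>n. rep_L2 (X (r n)) x) \<longlonglongrightarrow> rep_L2 l x"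
proof -
  have "(\<lambda>n. (norm (X n - l))\<^sup>2) \<longlonglongrightarrow> 0\<^sup>2"
    using tendsto_power[OF tendsto_norm_zero[OF LIM_zero[OF assms]]] by blast
  then have "(\<lambda>n. \<integral>x. norm ((rep_L2 (X n) x - rep_L2 l x)\<^sup>2) \<partial>lebesgue) \<longlonglongrightarrow> 0"
    by (simp add: norm_L2_diff)
  from tendsto_L1_AE_subseq[OF diff_square_integrable this]
  obtain r where r: "strict_mono r" "AE x in lebesgue. (\<lambda>n. (rep_L2 (X (r n)) x - rep_L2 l x)\<^sup>2) \<longlonglongrightarrow> 0"
    by blast
  have "AE x in lebesgue. (\<lambda>n. rep_L2 (X (r n)) x) \<longlonglongrightarrow> rep_L2 l x"
    using r(2)
  proof eventually_elim
    case (elim x)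
    then have "(\<lambda>n. sqrt ((rep_L2 (X (r n)) x - rep_L2 l x)\<^sup>2)) \<longlonglongrightarrow> sqrt 0" by (intro tendsto_intros)
    then have "(\<lambda>n. rep_L2 (X (r n)) x - rep_L2 l x) \<longlonglongrightarrow> 0" by (simp add: tendsto_rabs_zero_iff)
    then show ?case by (simp add: LIM_zero_iff)
  qed
  then show thesis using r(1) that by blast
qed

section \<open>Closed subspaces of functions on the domain\<close>

lemma subspace_L2_on: "subspace (L2_on \<Omega>)"
  unfolding subspace_def L2_on_def
proof (intro conjI ballI allI)
  show "0 \<in> {u. AE x in lebesgue. x \<notin> \<Omega> \<longrightarrow> rep_L2 u x = 0}"
    using rep_L2_zero by (auto elim!: eventually_mono)
  fix u v assume "u \<in> {u. AE x in lebesgue. x \<notin> \<Omega> \<longrightarrow> rep_L2 u x = 0}"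
  then have u: "AE x in lebesgue. x \<notin> \<Omega> \<longrightarrow> rep_L2 u x = 0" by simp
  { assume "v \<in> {u. AE x in lebesgue. x \<notin> \<Omega> \<longrightarrow> rep_L2 u x = 0}"
    then have v: "AE x in lebesgue. x \<notin> \<Omega> \<longrightarrow> rep_L2 v x = 0" by simp
    show "u + v \<in> {u. AE x in lebesgue. x \<notin> \<Omega> \<longrightarrow> rep_L2 u x = 0}"
      using u v rep_L2_add[of u v] by (simp, eventually_elim, simp) }
  show "c *\<^sub>R u \<in> {u. AE x in lebesgue. x \<notin> \<Omega> \<longrightarrow> rep_L2 u x = 0}" for c
    using u rep_L2_scaleR[of c u] by (simp, eventually_elim, simp)
qed

lemma closed_L2_on: "closed (L2_on \<Omega>)"
  unfolding closed_sequential_limits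
proof (intro allI impI, elim conjE)
  fix X l assume X: "\<forall>n. X n \<in> L2_on \<Omega>" and lim: "X \<longlonglongrightarrow> l"
  obtain r :: "nat \<Rightarrow> nat" where r: "AE x in lebesgue. (\<lambda>n. rep_L2 (X (r n)) x) \<longlonglongrightarrow> rep_L2 l x"
    using L2_limit_AE_subseq[OF lim] by blast
  have "AE x in lebesgue. \<forall>n. x \<notin> \<Omega> \<longrightarrow> rep_L2 (X (r n)) x = 0"
    using X by (subst AE_all_countable) (auto simp: L2_on_def)
  with r have "AE x in lebesgue. x \<notin> \<Omega> \<longrightarrow> rep_L2 l x = 0"
  proof eventually_elim
    case (elim x)
    show ?case
    proof
      assume "x \<notin> \<Omega>"
      then have "(\<lambda>n. 0) \<longlonglongrightarrow> rep_L2 l x" using elim by simp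
      then show "rep_L2 l x = 0" by (simp add: LIMSEQ_const_iff)
    qed
  qed
  then show "l \<in> L2_on \<Omega>" by (simp add: L2_on_def)
qed

lemma subspace_closure:
  fixes S :: "'a::real_normed_vector set" assumes "subspace S" shows "subspace (closure S)"
  unfolding subspace_def
proof (intro conjI ballI allI)
  show "0 \<in> closure S" using subspace_0[OF assms] closure_subset by blast
  fix x y assume "x \<in> closure S"
  then obtain X where X: "\<And>n. X n \<in> S" "X \<longlonglongrightarrow> x" unfolding closure_sequential by blast
  { assume "y \<in> closure S"
    then obtain Y where Y: "\<And>n. Y n \<in> S" "Y \<longlonglongrightarrow> y" unfolding closure_sequential by blast
    show "x + y \<in> closure S" unfolding closure_sequential
      by (intro exI[of _ "\<lambda>n. X n + Y n"] conjI allI subspace_add[OF assms] tendsto_intros X Y) }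
  show "c *\<^sub>R x \<in> closure S" for c unfolding closure_sequential
    by (intro exI[of _ "\<lambda>n. c *\<^sub>R X n"] conjI allI subspace_scale[OF assms] tendsto_intros X)
qed

lemma frechet_derivative_has_derivative:
  "\<phi> differentiable_on UNIV \<Longrightarrow> (\<phi> has_derivative frechet_derivative \<phi> (at x)) (at x)"
  by (simp add: differentiable_on_def frechet_derivative_works)

lemma partial_add:
  assumes "\<phi> differentiable_on UNIV" "\<psi> differentiable_on UNIV"
  shows "partial i (\<lambda>x. \<phi> x + \<psi> x) = (\<lambda>x. partial i \<phi> x + partial i \<psi> x)"
  unfolding partial_def
  by (subst frechet_derivative_at[symmetric, OF has_derivative_add[OF
        frechet_derivative_has_derivative[OF assms(1)] frechet_derivative_has_derivative[OF assms(2)]]]) simp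

lemma partial_cmult:
  assumes "\<phi> differentiable_on UNIV"
  shows "partial i (\<lambda>x. c * \<phi> x) = (\<lambda>x. c * partial i \<phi> x)"
  unfolding partial_def
  by (subst frechet_derivative_at[symmetric, OF has_derivative_mult_right[OF
        frechet_derivative_has_derivative[OF assms(1)]]]) simp

lemma Ck_add: "Ck k \<phi> \<Longrightarrow> Ck k \<psi> \<Longrightarrow> Ck k (\<lambda>x. \<phi> x + \<psi> x)"
  by (induction k arbitrary: \<phi> \<psi>) (auto intro!: continuous_intros differentiable_on_add simp: partial_add)

lemma Ck_cmult: "Ck k \<phi> \<Longrightarrow> Ck k (\<lambda>x. c * \<phi> x)"
  by (induction k arbitrary: \<phi>) (auto intro!: continuous_intros differentiable_on_mult simp: partial_cmult)

lemma test_functionsD: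
  assumes "\<phi> \<in> test_functions \<Omega>"
  shows "\<phi> differentiable_on UNIV" "continuous_on UNIV \<phi>" "continuous_on UNIV (partial i \<phi>)"
    "compact (closure {x. \<phi> x \<noteq> 0})" "closure {x. \<phi> x \<noteq> 0} \<subseteq> \<Omega>"
    "x \<notin> closure {x. \<phi> x \<noteq> 0} \<Longrightarrow> \<phi> x = 0" "x \<notin> closure {x. \<phi> x \<noteq> 0} \<Longrightarrow> partial i \<phi> x = 0"
proof -
  have Ck: "Ck 0 \<phi>" "Ck (Suc 0) \<phi>" using assms by (auto simp: test_functions_def simp del: Ck.simps)
  show "\<phi> differentiable_on UNIV" "continuous_on UNIV \<phi>" "continuous_on UNIV (partial i \<phi>)"
    using Ck by auto
  show "compact (closure {x. \<phi> x \<noteq> 0})" "closure {x. \<phi> x \<noteq> 0} \<subseteq> \<Omega>"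
    using assms by (auto simp: test_functions_def)
  assume x: "x \<notin> closure {x. \<phi> x \<noteq> 0}"
  then show "\<phi> x = 0" using closure_subset[of "{x. \<phi> x \<noteq> 0}"] by auto
  have "(\<phi> has_derivative (\<lambda>h. 0)) (at x)"
  proof (rule has_derivative_transform_within_open[where f = "\<lambda>x. 0" and s = "- closure {x. \<phi> x \<noteq> 0}"])
    show "0 = \<phi> y" if "y \<in> - closure {x. \<phi> x \<noteq> 0}" for y
      using that closure_subset[of "{x. \<phi> x \<noteq> 0}"] by auto
  qed (use x in auto)
  then have "frechet_derivative \<phi> (at x) = (\<lambda>h. 0)" by (rule frechet_derivative_at[symmetric])
  then show "partial i \<phi> x = 0" unfolding partial_def by simp
qed

lemma sq_integrable_compact_support:
  assumes "continuous_on UNIV g" "compact K" "\<And>x. x \<notin> K \<Longrightarrow> g x = 0"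
  shows "sq_integrable lebesgue (g :: real^3 \<Rightarrow> real)"
proof -
  have g: "g \<in> borel_measurable lborel" using borel_measurable_continuous_onI[OF assms(1)] by simp
  have "integrable lborel (\<lambda>x. indicator K x *\<^sub>R (g x)\<^sup>2)"
    by (intro borel_integrable_compact assms continuous_intros continuous_on_subset[OF assms(1)]) auto
  moreover have "(\<lambda>x. indicator K x *\<^sub>R (g x)\<^sup>2) = (\<lambda>x. (g x)\<^sup>2)"
  proof
    show "indicator K x *\<^sub>R (g x)\<^sup>2 = (g x)\<^sup>2" for x by (cases "x \<in> K") (auto simp: assms(3))
  qed
  ultimately have "integrable lborel (\<lambda>x. (g x)\<^sup>2)" by simp
  then show ?thesis
    using g by (simp add: sq_integrable_def integrable_completion measurable_completion)
qed

lemma test_functions_sq_integrable: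
  assumes "\<phi> \<in> test_functions \<Omega>"
  shows "sq_integrable lebesgue \<phi>" "sq_integrable lebesgue (partial i \<phi>)"
proof -
  note D = test_functionsD[OF assms]
  show "sq_integrable lebesgue \<phi>" by (rule sq_integrable_compact_support[OF D(2,4,6)])
  show "sq_integrable lebesgue (partial i \<phi>)" by (rule sq_integrable_compact_support[OF D(3,4,7)])
qed

lemma abs_L2_in_L2_on:
  assumes "sq_integrable lebesgue g" "\<And>x. x \<notin> \<Omega> \<Longrightarrow> g x = 0" shows "abs_L2 g \<in> L2_on \<Omega>"
  using rep_abs_L2[OF assms(1)] assms(2) by (auto simp: L2_on_def elim!: eventually_mono)

abbreviation jet_of :: "(real^3 \<Rightarrow> real) \<Rightarrow> jet" where
  "jet_of \<phi> \<equiv> (abs_L2 \<phi>, \<chi> i. abs_L2 (partial i \<phi>))"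

lemma abs_L2_add:
  assumes "sq_integrable lebesgue f" "sq_integrable lebesgue g"
  shows "abs_L2 (\<lambda>x. f x + g x) = abs_L2 f + abs_L2 g"
proof -
  have "AE x in lebesgue. f x + g x = rep_L2 (abs_L2 f) x + rep_L2 (abs_L2 g) x"
    using rep_abs_L2[OF assms(1)] rep_abs_L2[OF assms(2)] by eventually_elim simp
  then show ?thesis
    unfolding plus_L2_def map_fun_apply
    by (subst abs_L2_eq_iff) (auto intro!: sq_integrable_add rep_L2_sq_integrable assms)
qed

lemma abs_L2_cmult:
  assumes "sq_integrable lebesgue f" shows "abs_L2 (\<lambda>x. c * f x) = c *\<^sub>R abs_L2 f"
proof -
  have "AE x in lebesgue. c * f x = c * rep_L2 (abs_L2 f) x"
    using rep_abs_L2[OF assms(1)] by eventually_elim simp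
  then show ?thesis
    unfolding scaleR_L2_def map_fun_apply id_apply
    by (subst abs_L2_eq_iff) (auto intro!: sq_integrable_cmult rep_L2_sq_integrable assms)
qed

lemma subspace_H10: "subspace (H10 \<Omega>)"
  unfolding H10_def
proof (rule subspace_closure, unfold subspace_def, intro conjI ballI allI)
  show "0 \<in> jet_of ` test_functions \<Omega>"
  proof
    have z: "partial i (\<lambda>x. 0) = (\<lambda>x. 0)" for i unfolding partial_def by (simp add: frechet_derivative_const)
    have "Ck k (\<lambda>x. 0)" for k by (induction k) (auto simp: z)
    then show "(\<lambda>x. 0) \<in> test_functions \<Omega>" by (simp add: test_functions_def)
    show "0 = jet_of (\<lambda>x. 0)" unfolding z by (simp add: zero_L2_def[symmetric] zero_prod_def zero_vec_def)
  qed
  fix u v assume "u \<in> jet_of ` test_functions \<Omega>"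
  then obtain \<phi> where \<phi>: "\<phi> \<in> test_functions \<Omega>" "u = jet_of \<phi>" by blast
  note \<phi>D = test_functionsD[OF \<phi>(1)] test_functions_sq_integrable[OF \<phi>(1)]
  { assume "v \<in> jet_of ` test_functions \<Omega>"
    then obtain \<psi> where \<psi>: "\<psi> \<in> test_functions \<Omega>" "v = jet_of \<psi>" by blast
    note \<psi>D = test_functionsD[OF \<psi>(1)] test_functions_sq_integrable[OF \<psi>(1)]
    show "u + v \<in> jet_of ` test_functions \<Omega>"
    proof
      have sub: "closure {x. \<phi> x + \<psi> x \<noteq> 0} \<subseteq> closure {x. \<phi> x \<noteq> 0} \<union> closure {x. \<psi> x \<noteq> 0}"
        unfolding closure_Un[symmetric] by (rule closure_mono) auto
      moreover have "compact (closure {x. \<phi> x + \<psi> x \<noteq> 0})"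
        using compact_Int_closed[OF compact_Un[OF \<phi>D(4) \<psi>D(4)], of "closure {x. \<phi> x + \<psi> x \<noteq> 0}"] sub
        by (simp add: inf_absorb2)
      ultimately show "(\<lambda>x. \<phi> x + \<psi> x) \<in> test_functions \<Omega>"
        using \<phi>(1) \<psi>(1) unfolding test_functions_def by (auto intro!: Ck_add)
      show "u + v = jet_of (\<lambda>x. \<phi> x + \<psi> x)"
        unfolding \<phi>(2) \<psi>(2)
        by (simp add: partial_add[OF \<phi>D(1) \<psi>D(1)] abs_L2_add[OF \<phi>D(8) \<psi>D(8)]
            abs_L2_add[OF \<phi>D(9) \<psi>D(9)] vec_eq_iff)
    qed }
  show "c *\<^sub>R u \<in> jet_of ` test_functions \<Omega>" for c
  proof
    have sub: "closure {x. c * \<phi> x \<noteq> 0} \<subseteq> closure {x. \<phi> x \<noteq> 0}" by (rule closure_mono) auto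
    moreover have "compact (closure {x. c * \<phi> x \<noteq> 0})"
      using compact_Int_closed[OF \<phi>D(4), of "closure {x. c * \<phi> x \<noteq> 0}"] sub by (simp add: inf_absorb2)
    ultimately show "(\<lambda>x. c * \<phi> x) \<in> test_functions \<Omega>"
      using \<phi>(1) unfolding test_functions_def by (auto intro!: Ck_cmult)
    show "c *\<^sub>R u = jet_of (\<lambda>x. c * \<phi> x)"
      unfolding \<phi>(2) by (simp add: partial_cmult[OF \<phi>D(1)] abs_L2_cmult[OF \<phi>D(8)] abs_L2_cmult[OF \<phi>D(9)] vec_eq_iff)
  qed
qed

lemma closed_H10: "closed (H10 \<Omega>)" by (simp add: H10_def)

lemma H10_in_L2_on:
  assumes "u \<in> H10 \<Omega>" shows "fst u \<in> L2_on \<Omega>" "snd u $ i \<in> L2_on \<Omega>"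
proof -
  have "H10 \<Omega> \<subseteq> {u. fst u \<in> L2_on \<Omega> \<and> snd u $ i \<in> L2_on \<Omega>}"
    unfolding H10_def
  proof (rule closure_minimal)
    show "jet_of ` test_functions \<Omega> \<subseteq> {u. fst u \<in> L2_on \<Omega> \<and> snd u $ i \<in> L2_on \<Omega>}"
    proof safe
      fix \<phi> assume \<phi>: "\<phi> \<in> test_functions \<Omega>"
      note \<phi>D = test_functionsD[OF this] test_functions_sq_integrable[OF this]
      have "\<phi> x = 0" "partial i \<phi> x = 0" if "x \<notin> \<Omega>" for x
        using \<phi>D(5) \<phi>D(6)[of x] \<phi>D(7)[of x i] that by blast+
      then show "fst (jet_of \<phi>) \<in> L2_on \<Omega>" "snd (jet_of \<phi>) $ i \<in> L2_on \<Omega>"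
        using abs_L2_in_L2_on[OF \<phi>D(8)] abs_L2_in_L2_on[OF \<phi>D(9)] by auto
    qed
    have "{u. fst u \<in> L2_on \<Omega> \<and> snd u $ i \<in> L2_on \<Omega>} = fst -` L2_on \<Omega> \<inter> (\<lambda>u. snd u $ i) -` L2_on \<Omega>"
      by auto
    then show "closed {u. fst u \<in> L2_on \<Omega> \<and> snd u $ i \<in> L2_on \<Omega>}"
      by (auto intro!: closed_Int closed_vimage closed_L2_on continuous_intros)
  qed
  then show "fst u \<in> L2_on \<Omega>" "snd u $ i \<in> L2_on \<Omega>" using assms by auto
qed

section \<open>The Sobolev inequality\<close>

definition vec3 :: "real \<Rightarrow> real \<Rightarrow> real \<Rightarrow> real^3" where
  "vec3 a b c = a *\<^sub>R axis 1 1 + b *\<^sub>R axis 2 1 + c *\<^sub>R axis 3 1"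

lemma vec3_nth [simp]: "vec3 a b c $ 1 = a" "vec3 a b c $ 2 = b" "vec3 a b c $ 3 = c"
  by (auto simp: vec3_def axis_def)

lemma vec3_shift:
  "vec3 0 b c + a *\<^sub>R axis 1 1 = vec3 a b c" "vec3 a 0 c + b *\<^sub>R axis 2 1 = vec3 a b c"
  "vec3 a b 0 + c *\<^sub>R axis 3 1 = vec3 a b c"
  by (auto simp: vec3_def)

lemma vec3_measurable [measurable]:
  "(\<lambda>(a, b, c). vec3 a b c) \<in> borel_measurable borel"
  unfolding vec3_def case_prod_beta by (intro borel_measurable_continuous_onI continuous_intros)

lemma borel_measurable_compose_continuous:
  "F \<in> borel_measurable borel \<Longrightarrow> continuous_on UNIV g \<Longrightarrow> (\<lambda>p. F (g p)) \<in> borel_measurable borel"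
  by (rule measurable_compose[OF borel_measurable_continuous_onI])

lemma emeasure_lborel_Times:
  fixes A :: "'a::euclidean_space set" and B :: "'b::euclidean_space set"
  assumes "A \<in> sets borel" "B \<in> sets borel"
  shows "emeasure lborel (A \<times> B) = emeasure lborel A * emeasure lborel B"
  by (subst lborel_prod[symmetric], subst lborel.emeasure_pair_measure_Times) (use assms in auto)

text \<open>Lebesgue measure is determined by its values on boxes, and boxes correspond to products
  of intervals. This brings iterated integration to the vector type, which is not a product
  type.\<close>

lemma lborel_vec3: "lborel = distr (lborel :: (real \<times> real \<times> real) measure) borel (\<lambda>(a, b, c). vec3 a b c)"
proof (rule lborel_eqI)
  fix l u :: "real^3" assume le: "\<And>b. b \<in> Basis \<Longrightarrow> l \<bullet> b \<le> u \<bullet> b"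
  have le': "l $ i \<le> u $ i" for i
    using le[of "axis i 1"] by (simp add: inner_axis)
  have pre: "(\<lambda>(a, b, c). vec3 a b c) -` box l u = {l $ 1 <..< u $ 1} \<times> {l $ 2 <..< u $ 2} \<times> {l $ 3 <..< u $ 3}"
    by (auto simp: mem_box_cart forall_3)
  have B: "(Basis :: (real^3) set) = {axis 1 1, axis 2 1, axis 3 1}"
    by (auto simp: Basis_vec_def UNIV_3)
  have "emeasure (distr (lborel :: (real \<times> real \<times> real) measure) borel (\<lambda>(a, b, c). vec3 a b c)) (box l u)
      = emeasure lborel ({l $ 1 <..< u $ 1} \<times> {l $ 2 <..< u $ 2} \<times> {l $ 3 <..< u $ 3})"
    by (subst emeasure_distr) (auto simp: pre)
  also have "\<dots> = emeasure lborel {l $ 1 <..< u $ 1} * (emeasure lborel {l $ 2 <..< u $ 2} * emeasure lborel {l $ 3 <..< u $ 3})"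
    by (subst emeasure_lborel_Times, simp, intro borel_open open_Times open_greaterThanLessThan,
        subst emeasure_lborel_Times) simp_all
  also have "\<dots> = ennreal ((u $ 1 - l $ 1) * ((u $ 2 - l $ 2) * (u $ 3 - l $ 3)))"
    using le' by (simp add: ennreal_mult)
  also have "(u $ 1 - l $ 1) * ((u $ 2 - l $ 2) * (u $ 3 - l $ 3)) = (\<Prod>b\<in>Basis. (u - l) \<bullet> b)"
    unfolding B by (simp add: axis_eq_axis inner_axis)
  finally show "emeasure (distr (lborel :: (real \<times> real \<times> real) measure) borel (\<lambda>(a, b, c). vec3 a b c)) (box l u)
      = ennreal (\<Prod>b\<in>Basis. (u - l) \<bullet> b)" .
qed simp

lemma nn_integral_vec3:
  assumes F [measurable]: "F \<in> borel_measurable borel"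
  shows "(\<integral>\<^sup>+x. F x \<partial>lborel) = (\<integral>\<^sup>+a. \<integral>\<^sup>+b. \<integral>\<^sup>+c. F (vec3 a b c) \<partial>lborel \<partial>lborel \<partial>lborel)"
proof -
  have "(\<integral>\<^sup>+x. F x \<partial>lborel) = (\<integral>\<^sup>+p. F ((\<lambda>(a, b, c). vec3 a b c) p) \<partial>(lborel \<Otimes>\<^sub>M lborel \<Otimes>\<^sub>M lborel))"
    unfolding lborel_prod by (subst lborel_vec3, subst nn_integral_distr) auto
  also have "\<dots> = (\<integral>\<^sup>+a. \<integral>\<^sup>+p. F ((\<lambda>(a, b, c). vec3 a b c) (a, p)) \<partial>(lborel \<Otimes>\<^sub>M lborel) \<partial>lborel)"
    by (subst sigma_finite_measure.nn_integral_fst[symmetric])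
       (auto simp: lborel_prod sigma_finite_lborel)
  also have "\<dots> = (\<integral>\<^sup>+a. \<integral>\<^sup>+b. \<integral>\<^sup>+c. F (vec3 a b c) \<partial>lborel \<partial>lborel \<partial>lborel)"
  proof (rule nn_integral_cong)
    fix a :: real
    have "(\<lambda>p. F (vec3 a (fst p) (snd p))) \<in> borel_measurable borel"
      unfolding vec3_def by (intro borel_measurable_compose_continuous[OF F] continuous_intros)
    then show "(\<integral>\<^sup>+p. F ((\<lambda>(a, b, c). vec3 a b c) (a, p)) \<partial>(lborel \<Otimes>\<^sub>M lborel)) = (\<integral>\<^sup>+b. \<integral>\<^sup>+c. F (vec3 a b c) \<partial>lborel \<partial>lborel)"
      by (subst lborel.nn_integral_fst[symmetric]) (auto simp: case_prod_beta' lborel_prod)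
  qed
  finally show ?thesis .
qed

section \<open>Cauchy-Schwarz and Loomis-Whitney inequalities\<close>

definition ennreal_sqrt :: "ennreal \<Rightarrow> ennreal" where
  "ennreal_sqrt p = (if p = top then top else ennreal (sqrt (enn2real p)))"

lemma ennreal_sqrt_measurable [measurable]: "ennreal_sqrt \<in> borel_measurable borel"
  unfolding ennreal_sqrt_def by measurable

lemma ennreal_sqrt_square: "(ennreal_sqrt p)\<^sup>2 = p"
  by (cases p) (auto simp: ennreal_sqrt_def ennreal_power power2_eq_square top_unique ennreal_mult'[symmetric] ennreal_top_mult)

lemma ennreal_square_le_imp_le: "x \<le> y" if "x\<^sup>2 \<le> y\<^sup>2" for x y :: ennreal
proof (cases y)
  case (real r)
  then have "x\<^sup>2 < top" using that by (simp add: ennreal_power order.strict_trans1)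
  then obtain s where s: "x = ennreal s" "0 \<le> s" by (cases x) (auto simp: power2_eq_square ennreal_top_mult)
  then have "s\<^sup>2 \<le> r\<^sup>2" using that real by (simp add: ennreal_power)
  then have "s \<le> r" by (rule power2_le_imp_le) (use real in simp)
  then show ?thesis using s real by (simp add: ennreal_leI)
qed simp

text \<open>In this form the inequality can be iterated: the conclusion for one variable is a bound
  on a square by a product, which is the hypothesis for the next variable. Roots of extended values
  are confined to the proof.\<close>

lemma Cauchy_Schwarz_of_square_le:
  assumes [measurable]: "p \<in> borel_measurable M" "q \<in> borel_measurable M"
    and le: "\<And>x. (w x)\<^sup>2 \<le> p x * q x"
  shows "(\<integral>\<^sup>+x. w x \<partial>M)\<^sup>2 \<le> (\<integral>\<^sup>+x. p x \<partial>M) * (\<integral>\<^sup>+x. q x \<partial>M)"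
proof -
  have "w x \<le> ennreal_sqrt (p x) * ennreal_sqrt (q x)" for x
    by (rule ennreal_square_le_imp_le) (simp add: power_mult_distrib ennreal_sqrt_square le)
  then have "(\<integral>\<^sup>+x. w x \<partial>M)\<^sup>2 \<le> (\<integral>\<^sup>+x. ennreal_sqrt (p x) * ennreal_sqrt (q x) \<partial>M)\<^sup>2"
    by (intro power_mono nn_integral_mono) auto
  also have "\<dots> \<le> (\<integral>\<^sup>+x. (ennreal_sqrt (p x))\<^sup>2 \<partial>M) * (\<integral>\<^sup>+x. (ennreal_sqrt (q x))\<^sup>2 \<partial>M)"
    by (rule Cauchy_Schwarz_nn_integral) measurable
  finally show ?thesis by (simp add: ennreal_sqrt_square)
qed

text \<open>Integrate out one variable after the other.\<close>

lemma Loomis_Whitney: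
  fixes W :: "real \<Rightarrow> real \<Rightarrow> real \<Rightarrow> ennreal" and G1 G2 G3 :: "real \<times> real \<Rightarrow> ennreal"
  assumes [measurable]: "G1 \<in> borel_measurable borel" "G2 \<in> borel_measurable borel" "G3 \<in> borel_measurable borel"
    and W: "\<And>a b c. (W a b c)\<^sup>2 \<le> G1 (b, c) * G2 (a, c) * G3 (a, b)"
  shows "(\<integral>\<^sup>+a. \<integral>\<^sup>+b. \<integral>\<^sup>+c. W a b c \<partial>lborel \<partial>lborel \<partial>lborel)\<^sup>2 \<le>
    (\<integral>\<^sup>+b. \<integral>\<^sup>+c. G1 (b, c) \<partial>lborel \<partial>lborel) * (\<integral>\<^sup>+a. \<integral>\<^sup>+c. G2 (a, c) \<partial>lborel \<partial>lborel) *
    (\<integral>\<^sup>+a. \<integral>\<^sup>+b. G3 (a, b) \<partial>lborel \<partial>lborel)"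
proof -
  have [measurable]: "G1 \<in> borel_measurable (lborel \<Otimes>\<^sub>M lborel)" "G2 \<in> borel_measurable (lborel \<Otimes>\<^sub>M lborel)"
    "G3 \<in> borel_measurable (lborel \<Otimes>\<^sub>M lborel)"
    by (simp_all add: lborel_prod assms)
  define H1 where "H1 b = (\<integral>\<^sup>+c. G1 (b, c) \<partial>lborel)" for b
  define H2 where "H2 a = (\<integral>\<^sup>+c. G2 (a, c) \<partial>lborel)" for a
  define K3 where "K3 a = (\<integral>\<^sup>+b. G3 (a, b) \<partial>lborel)" for a
  have [measurable]: "H1 \<in> borel_measurable lborel" "H2 \<in> borel_measurable lborel" "K3 \<in> borel_measurable lborel"
    unfolding H1_def H2_def K3_def by measurable
  have 1: "(\<integral>\<^sup>+c. W a b c \<partial>lborel)\<^sup>2 \<le> (H2 a * G3 (a, b)) * H1 b" for a b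
  proof -
    have "(\<integral>\<^sup>+c. W a b c \<partial>lborel)\<^sup>2 \<le> (\<integral>\<^sup>+c. G3 (a, b) * G1 (b, c) \<partial>lborel) * (\<integral>\<^sup>+c. G2 (a, c) \<partial>lborel)"
      by (rule Cauchy_Schwarz_of_square_le) (use W in \<open>auto simp: mult_ac\<close>)
    also have "(\<integral>\<^sup>+c. G3 (a, b) * G1 (b, c) \<partial>lborel) = G3 (a, b) * H1 b"
      unfolding H1_def by (rule nn_integral_cmult) measurable
    finally show ?thesis unfolding H2_def by (simp add: mult_ac)
  qed
  have 2: "(\<integral>\<^sup>+b. \<integral>\<^sup>+c. W a b c \<partial>lborel \<partial>lborel)\<^sup>2 \<le> H2 a * (K3 a * (\<integral>\<^sup>+b. H1 b \<partial>lborel))" for a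
  proof -
    have "(\<integral>\<^sup>+b. \<integral>\<^sup>+c. W a b c \<partial>lborel \<partial>lborel)\<^sup>2 \<le> (\<integral>\<^sup>+b. H2 a * G3 (a, b) \<partial>lborel) * (\<integral>\<^sup>+b. H1 b \<partial>lborel)"
      by (rule Cauchy_Schwarz_of_square_le[OF _ _ 1]) measurable
    also have "(\<integral>\<^sup>+b. H2 a * G3 (a, b) \<partial>lborel) = H2 a * K3 a"
      unfolding K3_def by (rule nn_integral_cmult) measurable
    finally show ?thesis by (simp add: mult.assoc)
  qed
  have "(\<integral>\<^sup>+a. \<integral>\<^sup>+b. \<integral>\<^sup>+c. W a b c \<partial>lborel \<partial>lborel \<partial>lborel)\<^sup>2 \<le>
      (\<integral>\<^sup>+a. H2 a \<partial>lborel) * (\<integral>\<^sup>+a. K3 a * (\<integral>\<^sup>+b. H1 b \<partial>lborel) \<partial>lborel)"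
    by (rule Cauchy_Schwarz_of_square_le[OF _ _ 2]) measurable
  also have "(\<integral>\<^sup>+a. K3 a * (\<integral>\<^sup>+b. H1 b \<partial>lborel) \<partial>lborel) = (\<integral>\<^sup>+a. K3 a \<partial>lborel) * (\<integral>\<^sup>+b. H1 b \<partial>lborel)"
    by (rule nn_integral_multc) measurable
  finally show ?thesis by (simp add: H1_def H2_def K3_def mult_ac)
qed

text \<open>The fundamental theorem for the fourth power of \<open>g\<close>, starting at - N, where
  \<open>g\<close> vanishes. With the fourth power, Cauchy-Schwarz later splits the integrand into
  the sixth power of \<open>g\<close> and the square of \<open>g'\<close>.\<close>

lemma fourth_power_le_line_integral:
  fixes g g' :: "real \<Rightarrow> real"
  assumes g: "\<And>s. (g has_real_derivative g' s) (at s)" and g': "continuous_on UNIV g'"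
    and supp: "\<And>s. N \<le> \<bar>s\<bar> \<Longrightarrow> g s = 0"
  shows "ennreal ((g t) ^ 4) \<le> (\<integral>\<^sup>+s. ennreal (4 * \<bar>g s\<bar> ^ 3 * \<bar>g' s\<bar>) \<partial>lborel)"
proof (cases "N \<le> \<bar>t\<bar>")
  case False
  then have t: "- N \<le> t" by simp
  have gc: "isCont g s" for s using g DERIV_isCont by blast
  have g'c: "isCont g' s" for s using g' by (simp add: continuous_on_eq_continuous_at)
  have "has_bochner_integral lborel (\<lambda>s. (4 * g s ^ 3 * g' s) * indicator {- N..t} s) (g t ^ 4 - g (- N) ^ 4)"
    using t by (intro has_bochner_integral_FTC_Icc_real)
      (auto intro!: derivative_eq_intros g continuous_intros gc g'c)
  then have i: "integrable lborel (\<lambda>s. (4 * g s ^ 3 * g' s) * indicator {- N..t} s)"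
    "(\<integral>s. (4 * g s ^ 3 * g' s) * indicator {- N..t} s \<partial>lborel) = g t ^ 4"
    using supp[of "- N"] by (auto simp: has_bochner_integral_iff)
  have "ennreal (g t ^ 4) \<le> ennreal (norm (\<integral>s. (4 * g s ^ 3 * g' s) * indicator {- N..t} s \<partial>lborel))"
    unfolding i(2) by simp
  also have "\<dots> \<le> (\<integral>\<^sup>+s. norm ((4 * g s ^ 3 * g' s) * indicator {- N..t} s) \<partial>lborel)"
    by (rule integral_norm_bound_ennreal[OF i(1)])
  also have "\<dots> \<le> (\<integral>\<^sup>+s. ennreal (4 * \<bar>g s\<bar> ^ 3 * \<bar>g' s\<bar>) \<partial>lborel)"
    by (intro nn_integral_mono ennreal_leI) (auto simp: abs_mult power_abs indicator_def)
  finally show ?thesis .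
qed (simp add: supp)

lemma test_function_line_bound:
  assumes \<phi>: "\<phi> \<in> test_functions \<Omega>" and p: "p $ i = 0"
  shows "ennreal ((\<phi> (p + t *\<^sub>R axis i 1)) ^ 4) \<le>
    (\<integral>\<^sup>+s. ennreal (4 * \<bar>\<phi> (p + s *\<^sub>R axis i 1)\<bar> ^ 3 * \<bar>partial i \<phi> (p + s *\<^sub>R axis i 1)\<bar>) \<partial>lborel)"
proof -
  note D = test_functionsD[OF \<phi>]
  obtain N where N: "\<And>x. x \<in> closure {x. \<phi> x \<noteq> 0} \<Longrightarrow> norm x \<le> N"
    using compact_imp_bounded[OF D(4)] by (auto simp: bounded_iff)
  show ?thesis
  \<comment> \<open>The support lies in the closed ball of radius N; one more unit puts the points
    strictly outside.\<close>
  proof (rule fourth_power_le_line_integral[where N = "N + 1"])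
    fix s :: real
    have d: "((\<lambda>s. p + s *\<^sub>R axis i 1) has_derivative (\<lambda>h. h *\<^sub>R axis i 1)) (at s)"
      by (auto intro!: derivative_eq_intros)
    have "((\<lambda>s. \<phi> (p + s *\<^sub>R axis i 1)) has_derivative
        (\<lambda>h. frechet_derivative \<phi> (at (p + s *\<^sub>R axis i 1)) (h *\<^sub>R axis i 1))) (at s)"
      using diff_chain_at[OF d frechet_derivative_has_derivative[OF D(1)]] by (simp add: o_def)
    moreover have "frechet_derivative \<phi> (at x) (h *\<^sub>R axis i 1) = h * partial i \<phi> x" for h x
      unfolding partial_def
      using linear_scale[OF has_derivative_linear[OF frechet_derivative_has_derivative[OF D(1)]]] by simp
    ultimately show "((\<lambda>s. \<phi> (p + s *\<^sub>R axis i 1)) has_real_derivative partial i \<phi> (p + s *\<^sub>R axis i 1)) (at s)"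
      unfolding has_field_derivative_def by (elim has_derivative_eq_rhs) (auto simp: mult.commute)
    assume s: "N + 1 \<le> \<bar>s\<bar>"
    have "\<bar>s\<bar> = \<bar>(p + s *\<^sub>R axis i 1) $ i\<bar>" using p by simp
    also have "\<dots> \<le> norm (p + s *\<^sub>R axis i 1)" by (rule component_le_norm_cart)
    finally have "p + s *\<^sub>R axis i 1 \<notin> closure {x. \<phi> x \<noteq> 0}" using N s by force
    then show "\<phi> (p + s *\<^sub>R axis i 1) = 0" by (rule D(6))
  next
    show "continuous_on UNIV (\<lambda>s. partial i \<phi> (p + s *\<^sub>R axis i 1))"
      by (rule continuous_on_compose2[OF D(3)]) (auto intro!: continuous_intros)
  qed
qed

text \<open>The argument of Gagliardo and Nirenberg. The fourth power of \<phi> is bounded by a line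
  integral in each of the three directions, so its twelfth power is bounded by three factors, each
  independent of one coordinate. With \<open>X\<close> the integral of the sixth power,
  Loomis-Whitney gives X^2 at most I 1 * I 2 * I 3, and Cauchy-Schwarz bounds the square of I i by
  16 X Dd i. Squaring the first inequality yields X^4 at most 16^3 X^3 times the product of the Dd
  i, and 16^3 = 4096.\<close>

lemma Sobolev_test_function:
  assumes \<phi>: "\<phi> \<in> test_functions \<Omega>"
  shows "(\<integral>\<^sup>+x. ennreal ((\<phi> x) ^ 6) \<partial>lborel) \<le> 4096 * (\<Prod>i\<in>UNIV. \<integral>\<^sup>+x. ennreal ((partial i \<phi> x)\<^sup>2) \<partial>lborel)"
    and "(\<integral>\<^sup>+x. ennreal ((\<phi> x) ^ 6) \<partial>lborel) < \<infinity>"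
proof -
  note D = test_functionsD[OF \<phi>]
  define H where "H i x = ennreal (4 * \<bar>\<phi> x\<bar> ^ 3 * \<bar>partial i \<phi> x\<bar>)" for i x
  have [measurable]: "\<phi> \<in> borel_measurable borel" "\<And>i. partial i \<phi> \<in> borel_measurable borel"
    using D(2,3) by (auto intro: borel_measurable_continuous_onI)
  have H_meas [measurable]: "H i \<in> borel_measurable borel" for i unfolding H_def by measurable
  have vm [measurable]: "(\<lambda>p. vec3 (fst p) (fst (snd p)) (snd (snd p))) \<in> borel_measurable (borel :: (real \<times> real \<times> real) measure)"
    using vec3_measurable by (simp add: case_prod_beta')
  define X where "X = (\<integral>\<^sup>+x. ennreal ((\<phi> x) ^ 6) \<partial>lborel)"
  define Dd where "Dd i = (\<integral>\<^sup>+x. ennreal ((partial i \<phi> x)\<^sup>2) \<partial>lborel)" for i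
  define I where "I i = (\<integral>\<^sup>+x. H i x \<partial>lborel)" for i
  define G1 where "G1 = (\<lambda>(b, c). \<integral>\<^sup>+s. H 1 (vec3 s b c) \<partial>lborel)"
  define G2 where "G2 = (\<lambda>(a, c). \<integral>\<^sup>+s. H 2 (vec3 a s c) \<partial>lborel)"
  define G3 where "G3 = (\<lambda>(a, b). \<integral>\<^sup>+s. H 3 (vec3 a b s) \<partial>lborel)"
  have m1 [measurable]: "(\<lambda>p. H 1 (vec3 (snd p) (fst (fst p)) (snd (fst p)))) \<in> borel_measurable (borel :: ((real \<times> real) \<times> real) measure)"
   and m2 [measurable]: "(\<lambda>p. H 2 (vec3 (fst (fst p)) (snd p) (snd (fst p)))) \<in> borel_measurable (borel :: ((real \<times> real) \<times> real) measure)"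
   and m3 [measurable]: "(\<lambda>p. H 3 (vec3 (fst (fst p)) (snd (fst p)) (snd p))) \<in> borel_measurable (borel :: ((real \<times> real) \<times> real) measure)"
    unfolding vec3_def by (rule borel_measurable_compose_continuous[OF H_meas], intro continuous_intros)+
  have G_meas: "G1 \<in> borel_measurable borel" "G2 \<in> borel_measurable borel" "G3 \<in> borel_measurable borel"
    unfolding G1_def G2_def G3_def case_prod_beta'
    using lborel.borel_measurable_nn_integral_fst[of _ "borel :: (real \<times> real) measure"] m1 m2 m3
    by (auto intro!: lborel.borel_measurable_nn_integral simp: case_prod_beta' borel_prod measurable_lborel1
        measurable_cong_sets[OF sets_pair_measure_cong[OF refl sets_lborel] refl])
  have W: "(ennreal ((\<phi> (vec3 a b c)) ^ 6))\<^sup>2 \<le> G1 (b, c) * G2 (a, c) * G3 (a, b)" for a b c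
  proof -
    have "ennreal (\<phi> (vec3 a b c) ^ 4) \<le> G1 (b, c)"
      using test_function_line_bound[OF \<phi> vec3_nth(1)[of 0 b c], of a]
      by (simp add: G1_def H_def vec3_shift)
    moreover have "ennreal (\<phi> (vec3 a b c) ^ 4) \<le> G2 (a, c)"
      using test_function_line_bound[OF \<phi> vec3_nth(2)[of a 0 c], of b]
      by (simp add: G2_def H_def vec3_shift)
    moreover have "ennreal (\<phi> (vec3 a b c) ^ 4) \<le> G3 (a, b)"
      using test_function_line_bound[OF \<phi> vec3_nth(3)[of a b 0], of c]
      by (simp add: G3_def H_def vec3_shift)
    ultimately have "ennreal (\<phi> (vec3 a b c) ^ 4) * ennreal (\<phi> (vec3 a b c) ^ 4) * ennreal (\<phi> (vec3 a b c) ^ 4)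
        \<le> G1 (b, c) * G2 (a, c) * G3 (a, b)"
      by (intro mult_mono) auto
    moreover have "(ennreal (\<phi> (vec3 a b c) ^ 6))\<^sup>2 = ennreal (\<phi> (vec3 a b c) ^ 4) * ennreal (\<phi> (vec3 a b c) ^ 4) * ennreal (\<phi> (vec3 a b c) ^ 4)"
      by (simp add: ennreal_mult'[symmetric] ennreal_power power_mult[symmetric] power_add[symmetric])
    ultimately show ?thesis by simp
  qed
  have "X\<^sup>2 \<le> (\<integral>\<^sup>+b. \<integral>\<^sup>+c. G1 (b, c) \<partial>lborel \<partial>lborel) * (\<integral>\<^sup>+a. \<integral>\<^sup>+c. G2 (a, c) \<partial>lborel \<partial>lborel) *
    (\<integral>\<^sup>+a. \<integral>\<^sup>+b. G3 (a, b) \<partial>lborel \<partial>lborel)"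
    unfolding X_def by (subst nn_integral_vec3, measurable) (rule Loomis_Whitney[OF G_meas W])
  also have "(\<integral>\<^sup>+a. \<integral>\<^sup>+b. G3 (a, b) \<partial>lborel \<partial>lborel) = I 3"
    unfolding I_def G3_def by (subst nn_integral_vec3) auto
  also have "(\<integral>\<^sup>+a. \<integral>\<^sup>+c. G2 (a, c) \<partial>lborel \<partial>lborel) = I 2"
  proof -
    \<comment> \<open>The line variable is integrated innermost here but second in
      \<open>nn_integral_vec3\<close>, so one exchange is needed; for \<open>G1\<close> it has to
      move past two variables.\<close>
    have "(\<integral>\<^sup>+c. \<integral>\<^sup>+s. H 2 (vec3 a s c) \<partial>lborel \<partial>lborel) = (\<integral>\<^sup>+s. \<integral>\<^sup>+c. H 2 (vec3 a s c) \<partial>lborel \<partial>lborel)" for a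
    proof (rule lborel_pair.Fubini')
      have "(\<lambda>p. H 2 (vec3 a (fst p) (snd p))) \<in> borel_measurable (borel :: (real \<times> real) measure)"
        unfolding vec3_def by (rule borel_measurable_compose_continuous[OF H_meas], intro continuous_intros)
      then show "(\<lambda>(x, y). H 2 (vec3 a x y)) \<in> borel_measurable (lborel \<Otimes>\<^sub>M lborel)"
        by (simp add: lborel_prod case_prod_beta')
    qed
    then show ?thesis unfolding I_def G2_def by (subst nn_integral_vec3) auto
  qed
  also have "(\<integral>\<^sup>+b. \<integral>\<^sup>+c. G1 (b, c) \<partial>lborel \<partial>lborel) = I 1"
  proof -
    have Hm: "(\<lambda>p. H 1 (vec3 (fst p) b (snd p))) \<in> borel_measurable (borel :: (real \<times> real) measure)" for b
      unfolding vec3_def by (rule borel_measurable_compose_continuous[OF H_meas], intro continuous_intros)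
    have "(\<integral>\<^sup>+c. \<integral>\<^sup>+s. H 1 (vec3 s b c) \<partial>lborel \<partial>lborel) = (\<integral>\<^sup>+s. \<integral>\<^sup>+c. H 1 (vec3 s b c) \<partial>lborel \<partial>lborel)" for b
      by (rule lborel_pair.Fubini') (use Hm[of b] in \<open>simp add: lborel_prod case_prod_beta'\<close>)
    then have "(\<integral>\<^sup>+b. \<integral>\<^sup>+c. G1 (b, c) \<partial>lborel \<partial>lborel) = (\<integral>\<^sup>+b. \<integral>\<^sup>+s. \<integral>\<^sup>+c. H 1 (vec3 s b c) \<partial>lborel \<partial>lborel \<partial>lborel)"
      by (simp add: G1_def)
    also have "\<dots> = (\<integral>\<^sup>+s. \<integral>\<^sup>+b. \<integral>\<^sup>+c. H 1 (vec3 s b c) \<partial>lborel \<partial>lborel \<partial>lborel)"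
    proof (rule lborel_pair.Fubini')
      have "(\<lambda>p. H 1 (vec3 (fst (fst p)) (snd (fst p)) (snd p))) \<in> borel_measurable (borel :: ((real \<times> real) \<times> real) measure)"
        unfolding vec3_def by (rule borel_measurable_compose_continuous[OF H_meas], intro continuous_intros)
      then have "(\<lambda>p. \<integral>\<^sup>+c. H 1 (vec3 (fst p) (snd p) c) \<partial>lborel) \<in> borel_measurable (borel :: (real \<times> real) measure)"
        by (auto intro!: lborel.borel_measurable_nn_integral simp: case_prod_beta' borel_prod measurable_lborel1
            measurable_cong_sets[OF sets_pair_measure_cong[OF refl sets_lborel] refl])
      then show "(\<lambda>(s, b). \<integral>\<^sup>+c. H 1 (vec3 s b c) \<partial>lborel) \<in> borel_measurable (lborel \<Otimes>\<^sub>M lborel)"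
        by (simp add: lborel_prod case_prod_beta')
    qed
    finally show ?thesis unfolding I_def by (subst nn_integral_vec3) auto
  qed
  finally have X2: "X\<^sup>2 \<le> I 1 * I 2 * I 3" .
  have I2: "(I i)\<^sup>2 \<le> 16 * (X * Dd i)" for i
  proof -
    have "(I i)\<^sup>2 \<le> (\<integral>\<^sup>+x. 16 * ennreal ((\<phi> x) ^ 6) \<partial>lborel) * Dd i"
      unfolding I_def Dd_def
    proof (rule Cauchy_Schwarz_of_square_le)
      fix x
      have "(4 * \<bar>\<phi> x\<bar> ^ 3 * \<bar>partial i \<phi> x\<bar>)\<^sup>2 = 16 * (\<phi> x) ^ 6 * (partial i \<phi> x)\<^sup>2"
        by (simp add: power_mult_distrib power_mult[symmetric])
      moreover have "(H i x)\<^sup>2 = ennreal ((4 * \<bar>\<phi> x\<bar> ^ 3 * \<bar>partial i \<phi> x\<bar>)\<^sup>2)"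
        unfolding H_def by (rule ennreal_power) simp
      moreover have "ennreal (16 * (\<phi> x) ^ 6 * (partial i \<phi> x)\<^sup>2) = 16 * ennreal (\<phi> x ^ 6) * ennreal ((partial i \<phi> x)\<^sup>2)"
        by (simp add: ennreal_mult)
      ultimately show "(H i x)\<^sup>2 \<le> 16 * ennreal (\<phi> x ^ 6) * ennreal ((partial i \<phi> x)\<^sup>2)" by simp
    qed measurable
    also have "(\<integral>\<^sup>+x. 16 * ennreal ((\<phi> x) ^ 6) \<partial>lborel) = 16 * X"
      unfolding X_def by (rule nn_integral_cmult) measurable
    finally show ?thesis by (simp add: mult.assoc)
  qed
  have X_fin: "X < \<infinity>"
  proof -
    have "integrable lborel (\<lambda>x. indicator (closure {x. \<phi> x \<noteq> 0}) x *\<^sub>R (\<phi> x) ^ 6)"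
      by (intro borel_integrable_compact D continuous_intros continuous_on_subset[OF D(2)]) auto
    moreover have "indicator (closure {x. \<phi> x \<noteq> 0}) x *\<^sub>R (\<phi> x) ^ 6 = (\<phi> x) ^ 6" for x
      using D(6)[of x] by (cases "x \<in> closure {x. \<phi> x \<noteq> 0}") auto
    ultimately have "integrable lborel (\<lambda>x. (\<phi> x) ^ 6)" by (simp only:)
    then show ?thesis unfolding X_def by (simp add: integrable_iff_bounded)
  qed
  then show "(\<integral>\<^sup>+x. ennreal ((\<phi> x) ^ 6) \<partial>lborel) < \<infinity>" by (simp add: X_def)
  have "X ^ 4 \<le> (I 1 * I 2 * I 3)\<^sup>2"
    using power_mono[OF X2, of 2] by (simp add: power_mult[symmetric])
  also have "\<dots> = (I 1)\<^sup>2 * (I 2)\<^sup>2 * (I 3)\<^sup>2" by (simp add: power_mult_distrib)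
  also have "\<dots> \<le> (16 * (X * Dd 1)) * (16 * (X * Dd 2)) * (16 * (X * Dd 3))"
    by (intro mult_mono I2) auto
  also have "\<dots> = X ^ 3 * ((16 * 16 * 16) * (Dd 1 * Dd 2 * Dd 3))"
    unfolding power3_eq_cube by (simp only: mult_ac)
  also have "Dd 1 * Dd 2 * Dd 3 = (\<Prod>i\<in>UNIV. Dd i)" unfolding UNIV_3 by (simp add: mult.assoc)
  also have "(16 * 16 * 16 :: ennreal) = 4096" by simp
  also have "X ^ 4 = X ^ 3 * X" using power_Suc2[of X 3] by simp
  finally have fin: "X ^ 3 * X \<le> X ^ 3 * (4096 * (\<Prod>i\<in>UNIV. Dd i))" .
  then show "(\<integral>\<^sup>+x. ennreal ((\<phi> x) ^ 6) \<partial>lborel) \<le> 4096 * (\<Prod>i\<in>UNIV. \<integral>\<^sup>+x. ennreal ((partial i \<phi> x)\<^sup>2) \<partial>lborel)"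
    unfolding X_def[symmetric] Dd_def[symmetric]
  proof (cases "X = 0")
    case False
    \<comment> \<open>Compact support enters here: X is finite, so a nonzero X^3 may be cancelled
      among extended reals.\<close>
    then have "X ^ 3 \<noteq> 0" "X ^ 3 \<noteq> top" using X_fin by (auto simp: power_eq_top_ennreal)
    then show "X \<le> 4096 * (\<Prod>i\<in>UNIV. Dd i)"
      using fin by (simp add: ennreal_mult_le_mult_iff)
  qed simp
qed

section \<open>The elliptic form\<close>

text \<open>The inequality for test functions passes to the closure by Fatou's lemma along an almost
  everywhere convergent subsequence. Each of the three directional norms is bounded by the jet norm,
  hence the sixth power. Everything is extended by zero to the whole space, so the shape of
  \<open>\<Omega>\<close> does not affect the constant.\<close>

lemma Sobolev_H10:
  assumes "u \<in> H10 \<Omega>"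
  shows "(\<integral>\<^sup>+x. ennreal ((val u x) ^ 6) \<partial>lebesgue) \<le> ennreal (4096 * (norm u) ^ 6)"
proof -
  obtain w where w: "\<And>n. w n \<in> jet_of ` test_functions \<Omega>" "w \<longlonglongrightarrow> u"
    using assms unfolding H10_def closure_sequential by blast
  have est: "(\<integral>\<^sup>+x. ennreal ((val (w n) x) ^ 6) \<partial>lebesgue) \<le> ennreal (4096 * (norm (w n)) ^ 6)" for n
  proof -
    obtain \<phi> where \<phi>: "\<phi> \<in> test_functions \<Omega>" "w n = jet_of \<phi>" using w(1) by blast
    note D = test_functionsD[OF \<phi>(1)] and sq = test_functions_sq_integrable[OF \<phi>(1)]
    have partial_le: "(\<integral>\<^sup>+x. ennreal ((partial i \<phi> x)\<^sup>2) \<partial>lborel) \<le> ennreal ((norm (w n))\<^sup>2)" for i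
    proof -
      have "(\<integral>\<^sup>+x. ennreal ((partial i \<phi> x)\<^sup>2) \<partial>lborel) = (\<integral>\<^sup>+x. ennreal ((partial i \<phi> x)\<^sup>2) \<partial>lebesgue)"
        by (rule nn_integral_completion[symmetric])
      also have "\<dots> = ennreal ((norm (abs_L2 (partial i \<phi>)))\<^sup>2)"
        using sq(2)[of i] by (simp add: norm_abs_L2 nn_integral_eq_integral sq_integrable_def)
      also have "norm (abs_L2 (partial i \<phi>)) = norm (snd (w n) $ i)" by (simp add: \<phi>(2))
      also have "ennreal ((norm (snd (w n) $ i))\<^sup>2) \<le> ennreal ((norm (w n))\<^sup>2)"
      proof (intro ennreal_leI power_mono)
        have "norm (snd (w n) $ i) \<le> norm (snd (w n))" by (rule Finite_Cartesian_Product.norm_nth_le)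
        also have "\<dots> \<le> norm (w n)" using norm_snd_le[of "snd (w n)" "fst (w n)"] by simp
        finally show "norm (snd (w n) $ i) \<le> norm (w n)" .
      qed simp
      finally show "(\<integral>\<^sup>+x. ennreal ((partial i \<phi> x)\<^sup>2) \<partial>lborel) \<le> ennreal ((norm (w n))\<^sup>2)" .
    qed
    have "(\<integral>\<^sup>+x. ennreal ((val (w n) x) ^ 6) \<partial>lebesgue) = (\<integral>\<^sup>+x. ennreal ((\<phi> x) ^ 6) \<partial>lebesgue)"
      unfolding \<phi>(2) val_def fst_conv using rep_abs_L2[OF sq(1)]
      by (intro nn_integral_cong_AE) (auto elim!: eventually_mono)
    also have "\<dots> = (\<integral>\<^sup>+x. ennreal ((\<phi> x) ^ 6) \<partial>lborel)" by (rule nn_integral_completion)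
    also have "\<dots> \<le> 4096 * (\<Prod>i\<in>UNIV. \<integral>\<^sup>+x. ennreal ((partial i \<phi> x)\<^sup>2) \<partial>lborel)"
      by (rule Sobolev_test_function(1)[OF \<phi>(1)])
    also have "\<dots> \<le> 4096 * (\<Prod>i\<in>(UNIV::3 set). ennreal ((norm (w n))\<^sup>2))"
      unfolding UNIV_3 using partial_le by (auto intro!: mult_left_mono mult_mono)
    also have "\<dots> = ennreal (4096 * (norm (w n)) ^ 6)"
    proof -
      have "(\<Prod>i\<in>(UNIV::3 set). ennreal ((norm (w n))\<^sup>2)) = ennreal ((norm (w n)) ^ 6)"
        by (simp add: ennreal_power power_mult[symmetric])
      then show ?thesis by (simp add: ennreal_mult)
    qed
    finally show ?thesis .
  qed
  have "(\<lambda>n. fst (w n)) \<longlonglongrightarrow> fst u" by (intro tendsto_intros w)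
  then obtain r :: "nat \<Rightarrow> nat" where r: "strict_mono r" "AE x in lebesgue. (\<lambda>n. rep_L2 (fst (w (r n))) x) \<longlonglongrightarrow> rep_L2 (fst u) x"
    using L2_limit_AE_subseq by blast
  have "(\<integral>\<^sup>+x. ennreal ((val u x) ^ 6) \<partial>lebesgue) \<le> (\<integral>\<^sup>+x. liminf (\<lambda>n. ennreal ((val (w (r n)) x) ^ 6)) \<partial>lebesgue)"
  proof (rule nn_integral_mono_AE)
    show "AE x in lebesgue. ennreal ((val u x) ^ 6) \<le> liminf (\<lambda>n. ennreal ((val (w (r n)) x) ^ 6))"
      using r(2)
    proof eventually_elim
      case (elim x)
      then have "(\<lambda>n. ennreal ((val (w (r n)) x) ^ 6)) \<longlonglongrightarrow> ennreal ((val u x) ^ 6)"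
        unfolding val_def by (intro tendsto_intros)
      from lim_imp_Liminf[OF _ this] show ?case by simp
    qed
  qed
  also have "\<dots> \<le> liminf (\<lambda>n. \<integral>\<^sup>+x. ennreal ((val (w (r n)) x) ^ 6) \<partial>lebesgue)"
    unfolding val_def by (rule nn_integral_liminf) measurable
  also have "\<dots> \<le> liminf (\<lambda>n. ennreal (4096 * (norm (w (r n))) ^ 6))"
    by (intro Liminf_mono always_eventually allI est)
  also have "\<dots> = ennreal (4096 * (norm u) ^ 6)"
  proof (rule lim_imp_Liminf)
    have "(\<lambda>n. w (r n)) \<longlonglongrightarrow> u" using LIMSEQ_subseq_LIMSEQ[OF w(2) r(1)] by (simp add: o_def)
    then show "(\<lambda>n. ennreal (4096 * (norm (w (r n))) ^ 6)) \<longlonglongrightarrow> ennreal (4096 * (norm u) ^ 6)"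
      by (intro tendsto_intros)
  qed simp
  finally show ?thesis .
qed

section \<open>Bilinearity, boundedness and coercivity of the form\<close>

lemma measurable_lebesgue_on [measurable (raw)]:
  "f \<in> borel_measurable lebesgue \<Longrightarrow> f \<in> borel_measurable (lebesgue_on S)"
  by (rule measurable_restrict_space1)

lemma AE_lebesgue_on: "S \<in> sets lebesgue \<Longrightarrow> AE x in lebesgue. P x \<Longrightarrow> AE x in lebesgue_on S. P x"
  by (subst AE_restrict_space_iff) (auto elim!: eventually_mono)

lemma integrable_lebesgue_on:
  fixes f :: "'a::euclidean_space \<Rightarrow> real"
  shows "S \<in> sets lebesgue \<Longrightarrow> integrable lebesgue f \<Longrightarrow> integrable (lebesgue_on S) f"
  using integrable_mult_indicator[of S lebesgue f] by (simp add: integrable_restrict_space)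

lemma sq_integrable_lebesgue_on:
  "S \<in> sets lebesgue \<Longrightarrow> sq_integrable lebesgue f \<Longrightarrow> sq_integrable (lebesgue_on S) f"
  unfolding sq_integrable_def by (auto intro: integrable_lebesgue_on measurable_lebesgue_on)

lemma norm_L2_on:
  assumes "S \<in> sets lebesgue" "u \<in> L2_on S"
  shows "(\<integral>x. (rep_L2 u x)\<^sup>2 \<partial>lebesgue_on S) = (norm u)\<^sup>2"
proof -
  have "(\<integral>x. (rep_L2 u x)\<^sup>2 \<partial>lebesgue_on S) = (\<integral>x. indicator S x *\<^sub>R (rep_L2 u x)\<^sup>2 \<partial>lebesgue)"
    using assms(1) by (intro integral_restrict_space) auto
  also have "\<dots> = (\<integral>x. (rep_L2 u x)\<^sup>2 \<partial>lebesgue)"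
  proof (rule integral_cong_AE)
    show "AE x in lebesgue. indicator S x *\<^sub>R (rep_L2 u x)\<^sup>2 = (rep_L2 u x)\<^sup>2"
      using assms(2) unfolding L2_on_def by (auto simp: indicator_def elim!: eventually_mono)
  qed (use assms(1) in measurable)
  finally show ?thesis by (simp add: norm_L2_square)
qed

lemma quadratic_form_inner:
  fixes B :: "real^3^3"
  shows "(B *v \<xi>) \<bullet> \<eta> = (\<Sum>i\<in>UNIV. \<Sum>j\<in>UNIV. B $ i $ j * \<xi> $ j * \<eta> $ i)"
  by (simp add: inner_vec_def matrix_vector_mult_def sum_distrib_right)

lemma Sobolev_jet_norm: fixes u :: jet shows "(norm u)\<^sup>2 = (norm (fst u))\<^sup>2 + (\<Sum>i\<in>UNIV. (norm (snd u $ i))\<^sup>2)"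
  by (cases u) (simp add: norm_Pair norm_vec_def L2_set_def sum_nonneg)

locale elliptic_form =
  fixes \<Omega> :: "(real^3) set" and A :: "real^3 \<Rightarrow> real^3^3" and a0 a1 :: real
    and \<beta> :: "real^3 \<Rightarrow> real" and lam1 :: real
  assumes open_\<Omega>: "open \<Omega>" and a0: "a0 > 0" and a1: "a1 > 0"
    and A_bounded: "\<And>i j. ess_bounded (lebesgue_on \<Omega>) (\<lambda>x. A x $ i $ j)"
    and A_sym: "\<And>i j. AE x in lebesgue_on \<Omega>. A x $ i $ j = A x $ j $ i"
    and A_elliptic: "AE x in lebesgue_on \<Omega>. \<forall>\<xi>::real^3.
           a0 * (norm \<xi>)\<^sup>2 \<le> (\<Sum>i\<in>UNIV. \<Sum>j\<in>UNIV. A x $ i $ j * \<xi> $ i * \<xi> $ j) \<and>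
           (\<Sum>i\<in>UNIV. \<Sum>j\<in>UNIV. A x $ i $ j * \<xi> $ i * \<xi> $ j) \<le> a1 * (norm \<xi>)\<^sup>2"
    and \<beta>_meas [measurable]: "\<beta> \<in> borel_measurable (lebesgue_on \<Omega>)"
    and \<beta>_bound: "\<And>\<nu>. \<nu> > 0 \<Longrightarrow> \<exists>C\<^sub>\<nu>>0. \<forall>u\<in>H10 \<Omega>.
           (\<integral>\<^sup>+x. ennreal (\<bar>\<beta> x\<bar> * (val u x)\<^sup>2) \<partial>lebesgue_on \<Omega>) \<le>
           ennreal (\<nu> * (\<integral>x. (norm (grad u x))\<^sup>2 \<partial>lebesgue_on \<Omega>) +
                    C\<^sub>\<nu> * (\<integral>x. (val u x)\<^sup>2 \<partial>lebesgue_on \<Omega>))"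
    and lam1: "lam1 > 0"
    and lower: "\<And>u. u \<in> H10 \<Omega> \<Longrightarrow>
           (\<integral>x. (A x *v grad u x) \<bullet> grad u x \<partial>lebesgue_on \<Omega>) +
           (\<integral>x. \<beta> x * (val u x)\<^sup>2 \<partial>lebesgue_on \<Omega>) \<ge>
           lam1 * (\<integral>x. (val u x)\<^sup>2 \<partial>lebesgue_on \<Omega>)"
begin

abbreviation "V \<equiv> H10 \<Omega>"
abbreviation "M \<equiv> lebesgue_on \<Omega>"
abbreviation "scal \<equiv> scalar_H10 \<Omega> A \<beta>"

sublocale V: closed_subspace V
  by unfold_locales (rule subspace_H10 closed_H10)+

lemma \<Omega>_sets: "\<Omega> \<in> sets lebesgue" using open_\<Omega> by (simp add: borel_open)

lemma val_meas [measurable]: "val u \<in> borel_measurable M"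
  unfolding val_def by (intro measurable_lebesgue_on) simp

lemma grad_meas [measurable]: "(\<lambda>x. grad u x $ i) \<in> borel_measurable M"
  unfolding grad_def by (simp add: measurable_lebesgue_on)

lemma val_square_integrable: "integrable M (\<lambda>x. (val u x)\<^sup>2)"
  unfolding val_def by (intro integrable_lebesgue_on \<Omega>_sets rep_L2_square_integrable)

lemma integral_val_square: "u \<in> V \<Longrightarrow> (\<integral>x. (val u x)\<^sup>2 \<partial>M) = (norm (fst u))\<^sup>2"
  unfolding val_def by (intro norm_L2_on \<Omega>_sets H10_in_L2_on)

lemma norm_grad_square: "(norm (grad u x))\<^sup>2 = (\<Sum>i\<in>UNIV. (rep_L2 (snd u $ i) x)\<^sup>2)"
  by (simp add: grad_def norm_vec_def L2_set_def sum_nonneg)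

lemma grad_square_integrable: "integrable M (\<lambda>x. (norm (grad u x))\<^sup>2)"
  unfolding norm_grad_square by (intro Bochner_Integration.integrable_sum integrable_lebesgue_on \<Omega>_sets rep_L2_square_integrable)

lemma integral_grad_square: "u \<in> V \<Longrightarrow> (\<integral>x. (norm (grad u x))\<^sup>2 \<partial>M) = (\<Sum>i\<in>UNIV. (norm (snd u $ i))\<^sup>2)"
  unfolding norm_grad_square
  by (subst Bochner_Integration.integral_sum) (auto intro!: sum.cong integrable_lebesgue_on \<Omega>_sets rep_L2_square_integrable norm_L2_on H10_in_L2_on)

lemma norm_jet_square:
  "u \<in> V \<Longrightarrow> (norm u)\<^sup>2 = (\<integral>x. (val u x)\<^sup>2 \<partial>M) + (\<integral>x. (norm (grad u x))\<^sup>2 \<partial>M)"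
  by (simp add: Sobolev_jet_norm integral_val_square integral_grad_square)

lemma A_part_integrable: "integrable M (\<lambda>x. (A x *v grad u x) \<bullet> grad v x)"
  unfolding quadratic_form_inner
proof (intro Bochner_Integration.integrable_sum)
  fix i j :: 3
  obtain K where K: "AE x in M. \<bar>A x $ i $ j\<bar> \<le> K" and [measurable]: "(\<lambda>x. A x $ i $ j) \<in> borel_measurable M"
    using A_bounded[of i j] by (auto simp: ess_bounded_def)
  have i: "integrable M (\<lambda>x. grad u x $ j * grad v x $ i)"
    unfolding grad_def
    by (simp, intro sq_integrable_mult sq_integrable_lebesgue_on \<Omega>_sets rep_L2_sq_integrable)
  show "integrable M (\<lambda>x. A x $ i $ j * grad u x $ j * grad v x $ i)"
  proof (rule Bochner_Integration.integrable_bound)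
    show "integrable M (\<lambda>x. K * (grad u x $ j * grad v x $ i))" using i by simp
    show "AE x in M. norm (A x $ i $ j * grad u x $ j * grad v x $ i) \<le> norm (K * (grad u x $ j * grad v x $ i))"
      using K
    proof eventually_elim
      case (elim x)
      then have "\<bar>A x $ i $ j\<bar> * \<bar>grad u x $ j * grad v x $ i\<bar> \<le> \<bar>K\<bar> * \<bar>grad u x $ j * grad v x $ i\<bar>"
        by (intro mult_right_mono) auto
      then show ?case by (simp add: abs_mult mult.assoc)
    qed
  qed measurable
qed

text \<open>The assumption on \<open>\<beta>\<close> bounds an extended nonnegative integral by a
  real number. It therefore asserts finiteness, which is where integrability against squares of
  Sobolev functions comes from.\<close>

lemma abs_\<beta>_integrable: "u \<in> V \<Longrightarrow> integrable M (\<lambda>x. \<bar>\<beta> x\<bar> * (val u x)\<^sup>2)"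
proof -
  assume u: "u \<in> V"
  obtain C where "(\<integral>\<^sup>+x. ennreal (\<bar>\<beta> x\<bar> * (val u x)\<^sup>2) \<partial>M) \<le> ennreal (1 * (\<integral>x. (norm (grad u x))\<^sup>2 \<partial>M) + C * (\<integral>x. (val u x)\<^sup>2 \<partial>M))"
    using \<beta>_bound[of 1] u by auto
  then have "(\<integral>\<^sup>+x. ennreal (\<bar>\<beta> x\<bar> * (val u x)\<^sup>2) \<partial>M) < \<infinity>" by (rule order.strict_trans1) simp
  then show ?thesis by (intro integrableI_bounded) (auto simp: abs_mult)
qed

lemma \<beta>_part_integrable: "u \<in> V \<Longrightarrow> v \<in> V \<Longrightarrow> integrable M (\<lambda>x. \<beta> x * val u x * val v x)"
proof (rule Bochner_Integration.integrable_bound)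
  assume uv: "u \<in> V" "v \<in> V"
  show "integrable M (\<lambda>x. \<bar>\<beta> x\<bar> * (val u x)\<^sup>2 + \<bar>\<beta> x\<bar> * (val v x)\<^sup>2)"
    using uv by (intro Bochner_Integration.integrable_add abs_\<beta>_integrable)
  have "norm (b * s * t) \<le> norm (\<bar>b\<bar> * s\<^sup>2 + \<bar>b\<bar> * t\<^sup>2)" for b s t :: real
  proof -
    have "2 * \<bar>s\<bar> * \<bar>t\<bar> \<le> \<bar>s\<bar>\<^sup>2 + \<bar>t\<bar>\<^sup>2" by (rule sum_squares_bound)
    moreover have "0 \<le> \<bar>s\<bar> * \<bar>t\<bar>" by simp
    ultimately have "\<bar>s\<bar> * \<bar>t\<bar> \<le> s\<^sup>2 + t\<^sup>2" unfolding power2_abs by linarith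
    then have "\<bar>b\<bar> * (\<bar>s\<bar> * \<bar>t\<bar>) \<le> \<bar>b\<bar> * (s\<^sup>2 + t\<^sup>2)" by (intro mult_left_mono) auto
    then show ?thesis by (simp add: abs_mult distrib_left mult.assoc)
  qed
  then show "AE x in M. norm (\<beta> x * val u x * val v x) \<le> norm (\<bar>\<beta> x\<bar> * (val u x)\<^sup>2 + \<bar>\<beta> x\<bar> * (val v x)\<^sup>2)"
    by simp
qed measurable

lemma scal_eq:
  assumes "u \<in> V" "v \<in> V"
  shows "scal u v = (\<integral>x. (A x *v grad u x) \<bullet> grad v x + \<beta> x * val u x * val v x \<partial>M)"
  unfolding scalar_H10_def
  by (subst Bochner_Integration.integral_add) (auto intro: A_part_integrable \<beta>_part_integrable assms)

lemma scal_integrable: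
  "u \<in> V \<Longrightarrow> v \<in> V \<Longrightarrow> integrable M (\<lambda>x. (A x *v grad u x) \<bullet> grad v x + \<beta> x * val u x * val v x)"
  by (intro Bochner_Integration.integrable_add A_part_integrable \<beta>_part_integrable)

lemma scal_sym: assumes "u \<in> V" "v \<in> V" shows "scal u v = scal v u"
  unfolding scal_eq[OF assms] scal_eq[OF assms(2,1)]
proof (rule integral_cong_AE)
  have "AE x in M. \<forall>i j. A x $ i $ j = A x $ j $ i" using A_sym by (simp add: AE_all_countable)
  then show "AE x in M. (A x *v grad u x) \<bullet> grad v x + \<beta> x * val u x * val v x =
      (A x *v grad v x) \<bullet> grad u x + \<beta> x * val v x * val u x"
  proof eventually_elim
    case (elim x)
    have "(A x *v grad u x) \<bullet> grad v x = (\<Sum>j\<in>UNIV. \<Sum>i\<in>UNIV. A x $ i $ j * grad u x $ j * grad v x $ i)"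
      unfolding quadratic_form_inner by (rule sum.swap)
    also have "\<dots> = (A x *v grad v x) \<bullet> grad u x"
      unfolding quadratic_form_inner
    proof (intro sum.cong refl)
      fix i j show "A x $ j $ i * grad u x $ i * grad v x $ j = A x $ i $ j * grad v x $ j * grad u x $ i"
        using elim by (metis mult.assoc mult.commute)
    qed
    finally show ?case by (simp add: mult_ac)
  qed
qed (use scal_integrable assms in \<open>auto intro: borel_measurable_integrable\<close>)

lemma jet_AE_add: "AE x in M. val (u + v) x = val u x + val v x \<and> grad (u + v) x = grad u x + grad v x"
proof -
  have "AE x in lebesgue. \<forall>i. rep_L2 (snd u $ i + snd v $ i) x = rep_L2 (snd u $ i) x + rep_L2 (snd v $ i) x"
    by (simp add: AE_all_countable rep_L2_add)
  moreover have "AE x in lebesgue. rep_L2 (fst u + fst v) x = rep_L2 (fst u) x + rep_L2 (fst v) x"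
    by (rule rep_L2_add)
  ultimately have "AE x in lebesgue. val (u + v) x = val u x + val v x \<and> grad (u + v) x = grad u x + grad v x"
    by eventually_elim (auto simp: val_def grad_def vec_eq_iff)
  then show ?thesis by (rule AE_lebesgue_on[OF \<Omega>_sets])
qed

lemma jet_AE_scaleR: "AE x in M. val (c *\<^sub>R u) x = c * val u x \<and> grad (c *\<^sub>R u) x = c *\<^sub>R grad u x"
proof -
  have "AE x in lebesgue. \<forall>i. rep_L2 (c *\<^sub>R snd u $ i) x = c * rep_L2 (snd u $ i) x"
    by (simp add: AE_all_countable rep_L2_scaleR)
  moreover have "AE x in lebesgue. rep_L2 (c *\<^sub>R fst u) x = c * rep_L2 (fst u) x"
    by (rule rep_L2_scaleR)
  ultimately have "AE x in lebesgue. val (c *\<^sub>R u) x = c * val u x \<and> grad (c *\<^sub>R u) x = c *\<^sub>R grad u x"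
    by eventually_elim (auto simp: val_def grad_def vec_eq_iff)
  then show ?thesis by (rule AE_lebesgue_on[OF \<Omega>_sets])
qed

lemma scal_add: assumes "u \<in> V" "u' \<in> V" "v \<in> V" shows "scal (u + u') v = scal u v + scal u' v"
proof -
  have V: "u + u' \<in> V" using assms by (intro subspace_add[OF subspace_H10])
  have "scal (u + u') v = (\<integral>x. ((A x *v grad u x) \<bullet> grad v x + \<beta> x * val u x * val v x)
      + ((A x *v grad u' x) \<bullet> grad v x + \<beta> x * val u' x * val v x) \<partial>M)"
    unfolding scal_eq[OF V assms(3)]
  proof (rule integral_cong_AE)
    show "AE x in M. (A x *v grad (u + u') x) \<bullet> grad v x + \<beta> x * val (u + u') x * val v x =
      ((A x *v grad u x) \<bullet> grad v x + \<beta> x * val u x * val v x)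
      + ((A x *v grad u' x) \<bullet> grad v x + \<beta> x * val u' x * val v x)"
      using jet_AE_add[of u u']
      by eventually_elim (simp add: matrix_vector_right_distrib inner_add_left algebra_simps)
  qed (use scal_integrable V assms in \<open>auto intro!: borel_measurable_integrable Bochner_Integration.integrable_add\<close>)
  also have "\<dots> = scal u v + scal u' v"
    unfolding scal_eq[OF assms(1,3)] scal_eq[OF assms(2,3)]
    by (rule Bochner_Integration.integral_add) (intro scal_integrable assms)+
  finally show ?thesis .
qed

lemma scal_scaleR: assumes "u \<in> V" "v \<in> V" shows "scal (c *\<^sub>R u) v = c * scal u v"
proof -
  have V: "c *\<^sub>R u \<in> V" using assms by (intro subspace_scale[OF subspace_H10])
  have "scal (c *\<^sub>R u) v = (\<integral>x. c * ((A x *v grad u x) \<bullet> grad v x + \<beta> x * val u x * val v x) \<partial>M)"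
    unfolding scal_eq[OF V assms(2)]
  proof (rule integral_cong_AE)
    show "AE x in M. (A x *v grad (c *\<^sub>R u) x) \<bullet> grad v x + \<beta> x * val (c *\<^sub>R u) x * val v x =
      c * ((A x *v grad u x) \<bullet> grad v x + \<beta> x * val u x * val v x)"
      using jet_AE_scaleR[of c u]
      by eventually_elim (simp add: matrix_vector_mult_scaleR algebra_simps)
  qed (use scal_integrable V assms in \<open>auto intro!: borel_measurable_integrable integrable_mult_right\<close>)
  also have "\<dots> = c * scal u v" unfolding scal_eq[OF assms] by simp
  finally show ?thesis .
qed

lemma A_part_bounds:
  "a0 * (\<integral>x. (norm (grad u x))\<^sup>2 \<partial>M) \<le> (\<integral>x. (A x *v grad u x) \<bullet> grad u x \<partial>M)"
  "(\<integral>x. (A x *v grad u x) \<bullet> grad u x \<partial>M) \<le> a1 * (\<integral>x. (norm (grad u x))\<^sup>2 \<partial>M)"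
proof -
  have q: "(A x *v \<xi>) \<bullet> \<xi> = (\<Sum>i\<in>UNIV. \<Sum>j\<in>UNIV. A x $ i $ j * \<xi> $ i * \<xi> $ j)" for x \<xi>
    unfolding quadratic_form_inner by (intro sum.cong refl) (simp add: mult_ac)
  have AE: "AE x in M. a0 * (norm (grad u x))\<^sup>2 \<le> (A x *v grad u x) \<bullet> grad u x \<and>
      (A x *v grad u x) \<bullet> grad u x \<le> a1 * (norm (grad u x))\<^sup>2"
    using A_elliptic by eventually_elim (simp add: q)
  have "(\<integral>x. a0 * (norm (grad u x))\<^sup>2 \<partial>M) \<le> (\<integral>x. (A x *v grad u x) \<bullet> grad u x \<partial>M)"
    using AE by (intro integral_mono_AE A_part_integrable integrable_mult_right grad_square_integrable) (auto elim!: eventually_mono)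
  then show "a0 * (\<integral>x. (norm (grad u x))\<^sup>2 \<partial>M) \<le> (\<integral>x. (A x *v grad u x) \<bullet> grad u x \<partial>M)" by simp
  have "(\<integral>x. (A x *v grad u x) \<bullet> grad u x \<partial>M) \<le> (\<integral>x. a1 * (norm (grad u x))\<^sup>2 \<partial>M)"
    using AE by (intro integral_mono_AE A_part_integrable integrable_mult_right grad_square_integrable) (auto elim!: eventually_mono)
  then show "(\<integral>x. (A x *v grad u x) \<bullet> grad u x \<partial>M) \<le> a1 * (\<integral>x. (norm (grad u x))\<^sup>2 \<partial>M)" by simp
qed

lemma \<beta>_part_bound:
  assumes "\<nu> > 0"
  obtains C where "C > 0" "\<And>u. u \<in> V \<Longrightarrow> \<bar>\<integral>x. \<beta> x * val u x * val u x \<partial>M\<bar> \<le>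
      \<nu> * (\<integral>x. (norm (grad u x))\<^sup>2 \<partial>M) + C * (\<integral>x. (val u x)\<^sup>2 \<partial>M)"
proof -
  obtain C where C: "C > 0" "\<And>u. u \<in> V \<Longrightarrow> (\<integral>\<^sup>+x. ennreal (\<bar>\<beta> x\<bar> * (val u x)\<^sup>2) \<partial>M) \<le>
      ennreal (\<nu> * (\<integral>x. (norm (grad u x))\<^sup>2 \<partial>M) + C * (\<integral>x. (val u x)\<^sup>2 \<partial>M))"
    using \<beta>_bound[OF assms] by blast
  show thesis
  proof (rule that[OF C(1)])
    fix u assume u: "u \<in> V"
    have nn: "0 \<le> \<nu> * (\<integral>x. (norm (grad u x))\<^sup>2 \<partial>M) + C * (\<integral>x. (val u x)\<^sup>2 \<partial>M)"
      using assms C(1) by (intro add_nonneg_nonneg mult_nonneg_nonneg integral_nonneg) auto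
    have "\<bar>\<integral>x. \<beta> x * val u x * val u x \<partial>M\<bar> \<le> (\<integral>x. \<bar>\<beta> x * val u x * val u x\<bar> \<partial>M)"
      by (rule integral_abs_bound)
    also have "\<dots> = (\<integral>x. \<bar>\<beta> x\<bar> * (val u x)\<^sup>2 \<partial>M)"
      by (intro Bochner_Integration.integral_cong refl) (simp add: abs_mult power2_eq_square)
    also have "ennreal \<dots> \<le> ennreal (\<nu> * (\<integral>x. (norm (grad u x))\<^sup>2 \<partial>M) + C * (\<integral>x. (val u x)\<^sup>2 \<partial>M))"
      using C(2)[OF u] nn_integral_eq_integral[OF abs_\<beta>_integrable[OF u]] by simp
    then have "(\<integral>x. \<bar>\<beta> x\<bar> * (val u x)\<^sup>2 \<partial>M) \<le> \<nu> * (\<integral>x. (norm (grad u x))\<^sup>2 \<partial>M) + C * (\<integral>x. (val u x)\<^sup>2 \<partial>M)"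
      using nn by (simp add: ennreal_le_iff)
    finally show "\<bar>\<integral>x. \<beta> x * val u x * val u x \<partial>M\<bar> \<le>
      \<nu> * (\<integral>x. (norm (grad u x))\<^sup>2 \<partial>M) + C * (\<integral>x. (val u x)\<^sup>2 \<partial>M)" .
  qed
qed

lemma scal_upper: obtains K where "K \<ge> 0" "\<And>u. u \<in> V \<Longrightarrow> scal u u \<le> K * (norm u)\<^sup>2"
proof -
  obtain C where C: "C > 0" "\<And>u. u \<in> V \<Longrightarrow> \<bar>\<integral>x. \<beta> x * val u x * val u x \<partial>M\<bar> \<le>
      1 * (\<integral>x. (norm (grad u x))\<^sup>2 \<partial>M) + C * (\<integral>x. (val u x)\<^sup>2 \<partial>M)" using \<beta>_part_bound[of 1] by auto
  show thesis
  proof (rule that[of "a1 + 1 + C"])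
    fix u assume u: "u \<in> V"
    define g w where "g = (\<integral>x. (norm (grad u x))\<^sup>2 \<partial>M)" and "w = (\<integral>x. (val u x)\<^sup>2 \<partial>M)"
    have nn: "0 \<le> g" "0 \<le> w" by (auto simp: g_def w_def)
    have "scal u u \<le> a1 * g + (1 * g + C * w)"
      using A_part_bounds(2)[of u] C(2)[OF u] by (simp add: scalar_H10_def g_def w_def)
    also have "\<dots> \<le> (a1 + 1 + C) * (w + g)"
      using nn a1 C(1) by (simp add: algebra_simps)
    finally show "scal u u \<le> (a1 + 1 + C) * (norm u)\<^sup>2" by (simp add: norm_jet_square[OF u] g_def w_def)
  qed (use a1 C in auto)
qed

text \<open>The relative bound for \<open>\<beta>\<close> is used with a0 / 2, so half of the
  ellipticity survives; the remaining multiple of the squared Lebesgue norm is paid for by the lower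
  bound \<open>lam1\<close>.\<close>

lemma scal_coercive: obtains c0 where "c0 > 0" "\<And>u. u \<in> V \<Longrightarrow> c0 * (norm u)\<^sup>2 \<le> scal u u"
proof -
  obtain C where C: "C > 0" "\<And>u. u \<in> V \<Longrightarrow> \<bar>\<integral>x. \<beta> x * val u x * val u x \<partial>M\<bar> \<le>
      (a0 / 2) * (\<integral>x. (norm (grad u x))\<^sup>2 \<partial>M) + C * (\<integral>x. (val u x)\<^sup>2 \<partial>M)"
    using \<beta>_part_bound[of "a0 / 2"] a0 by auto
  define k where "k = 1 / lam1 + 2 * (1 + C / lam1) / a0"
  have k: "k > 0" using lam1 a0 C by (auto simp: k_def intro!: add_pos_pos divide_pos_pos)
  show thesis
  proof (rule that[of "1 / k"])
    fix u assume u: "u \<in> V"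
    define g w where "g = (\<integral>x. (norm (grad u x))\<^sup>2 \<partial>M)" and "w = (\<integral>x. (val u x)\<^sup>2 \<partial>M)"
    have 1: "lam1 * w \<le> scal u u"
      using lower[OF u] by (simp add: scalar_H10_def w_def power2_eq_square mult.assoc)
    then have w: "w \<le> scal u u / lam1" using lam1 by (simp add: field_simps)
    have "(a0 / 2) * g \<le> scal u u + C * w"
      using A_part_bounds(1)[of u] C(2)[OF u] by (simp add: scalar_H10_def g_def w_def)
    also have "\<dots> \<le> scal u u + C * (scal u u / lam1)" using w C(1) by (intro add_left_mono mult_left_mono) auto
    finally have "g \<le> 2 * (1 + C / lam1) / a0 * scal u u" using a0 by (simp add: field_simps)
    with w have "w + g \<le> k * scal u u" by (simp add: k_def algebra_simps)
    then show "1 / k * (norm u)\<^sup>2 \<le> scal u u" using k by (simp add: norm_jet_square[OF u] g_def w_def field_simps)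
  qed (use k in simp)
qed

text \<open>\<open>scal\<close> is bilinear only on the Sobolev space, since elsewhere the integral
  with \<open>\<beta>\<close> may fail to exist. Projecting first makes it a bilinear map on all
  jets.\<close>

definition form :: "jet \<Rightarrow> jet \<Rightarrow> real" where "form u v = scal (V.P u) (V.P v)"

lemma form_eq: "u \<in> V \<Longrightarrow> v \<in> V \<Longrightarrow> form u v = scal u v"
  by (simp add: form_def V.P_id)

lemma form_sym: "form u v = form v u"
  unfolding form_def by (intro scal_sym V.P_in)

text \<open>Boundedness on pairs is deduced from the diagonal. By polarisation four times the form
  of a pair is a difference of two nonnegative diagonal values, and for unit vectors the
  parallelogram identity bounds their sum by 4 K.\<close>

lemma bounded_bilinear_form: "bounded_bilinear form"
proof -
  note linP = linear_simps[OF V.bounded_linear_P]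
  have add_left: "form (u + u') v = form u v + form u' v" for u u' v
    unfolding form_def linP by (intro scal_add V.P_in)
  have scale_left: "form (c *\<^sub>R u) v = c * form u v" for c u v
    unfolding form_def linP by (intro scal_scaleR V.P_in)
  have add_right: "form v (u + u') = form v u + form v u'" for u u' v
    using add_left form_sym by metis
  have scale_right: "form v (c *\<^sub>R u) = c * form v u" for c u v
    using scale_left form_sym by metis
  obtain c0 where c0: "c0 > 0" "\<And>u. u \<in> V \<Longrightarrow> c0 * (norm u)\<^sup>2 \<le> scal u u" using scal_coercive by blast
  obtain K where K: "K \<ge> 0" "\<And>u. u \<in> V \<Longrightarrow> scal u u \<le> K * (norm u)\<^sup>2" using scal_upper by blast
  have q: "0 \<le> form u u" "form u u \<le> K * (norm u)\<^sup>2" for u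
  proof -
    have "0 \<le> c0 * (norm (V.P u))\<^sup>2" using c0 by simp
    then show "0 \<le> form u u" using c0(2)[OF V.P_in[of u]] by (simp add: form_def)
    have "form u u \<le> K * (norm (V.P u))\<^sup>2" unfolding form_def by (rule K(2)[OF V.P_in])
    also have "\<dots> \<le> K * (norm u)\<^sup>2" using K(1) V.norm_P by (intro mult_left_mono power_mono) auto
    finally show "form u u \<le> K * (norm u)\<^sup>2" .
  qed
  have unit: "\<bar>form u v\<bar> \<le> K" if "norm u = 1" "norm v = 1" for u v
  proof -
    have minus: "u - v = u + (-1) *\<^sub>R v" by simp
    have e: "form (u + v) (u + v) = form u u + 2 * form u v + form v v"
      by (simp add: add_left add_right form_sym[of v u])
    have e': "form (u - v) (u - v) = form u u - 2 * form u v + form v v"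
      unfolding minus add_left add_right scale_left scale_right by (simp add: form_sym[of v u])
    have "(norm (u + v))\<^sup>2 + (norm (u - v))\<^sup>2 = 2 * (norm u)\<^sup>2 + 2 * (norm v)\<^sup>2"
      by (simp add: power2_norm_eq_inner inner_add inner_diff inner_commute)
    then have par: "(norm (u + v))\<^sup>2 + (norm (u - v))\<^sup>2 = 4" using that by simp
    have "4 * form u v = form (u + v) (u + v) - form (u - v) (u - v)" using e e' by simp
    moreover have "form (u + v) (u + v) + form (u - v) (u - v) \<le> K * ((norm (u + v))\<^sup>2 + (norm (u - v))\<^sup>2)"
      using q(2)[of "u + v"] q(2)[of "u - v"] by (simp add: distrib_left)
    ultimately show ?thesis using q(1)[of "u + v"] q(1)[of "u - v"] unfolding par by linarith
  qed
  show ?thesis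
  proof (rule bounded_bilinear.intro)
    have "norm (form u v) \<le> norm u * norm v * K" for u v
    proof (cases "u = 0 \<or> v = 0")
      case True
      then show ?thesis using scale_left[of 0 u v] scale_right[of u 0 v] by auto
    next
      case False
      have "form u v = norm u * norm v * form ((1 / norm u) *\<^sub>R u) ((1 / norm v) *\<^sub>R v)"
        using False by (simp add: scale_left scale_right)
      moreover have "\<bar>form ((1 / norm u) *\<^sub>R u) ((1 / norm v) *\<^sub>R v)\<bar> \<le> K"
        using False by (intro unit) auto
      ultimately show ?thesis by (simp add: abs_mult mult_left_mono)
    qed
    then show "\<exists>K. \<forall>u v. norm (form u v) \<le> norm u * norm v * K" by blast
  qed (simp_all add: add_left add_right scale_left scale_right)
qed

lemma norm_H10_form: "u \<in> V \<Longrightarrow> (norm_H10 \<Omega> A \<beta> u)\<^sup>2 = form u u"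
proof -
  assume u: "u \<in> V"
  obtain c0 where c0: "c0 > 0" "\<And>u. u \<in> V \<Longrightarrow> c0 * (norm u)\<^sup>2 \<le> scal u u" using scal_coercive by blast
  have "0 \<le> c0 * (norm u)\<^sup>2" using c0 by simp
  then have "0 \<le> scal u u" using c0(2)[OF u] by linarith
  then show ?thesis using u by (simp add: norm_H10_def form_eq)
qed

end

section \<open>The superposition operator\<close>

text \<open>Completeness of Lebesgue measure, transferred to a subset through extension by
  zero.\<close>

lemma borel_measurable_AE_lebesgue_on:
  fixes f g :: "'a::euclidean_space \<Rightarrow> real"
  assumes S: "S \<in> sets lebesgue" and f: "f \<in> borel_measurable (lebesgue_on S)"
    and eq: "AE x in lebesgue_on S. f x = g x"
  shows "g \<in> borel_measurable (lebesgue_on S)"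
proof -
  have iff: "h \<in> borel_measurable (lebesgue_on S) \<longleftrightarrow> (\<lambda>x. if x \<in> S then h x else 0) \<in> borel_measurable lebesgue"
    for h :: "'a \<Rightarrow> real"
    using S by (intro measurable_restrict_space_iff) auto
  have "AE x in lebesgue. (if x \<in> S then f x else 0) = (if x \<in> S then g x else 0)"
    using eq S by (subst (asm) AE_restrict_space_iff) (auto elim!: eventually_mono)
  from borel_measurable_AE[OF iff[THEN iffD1, OF f] this] show ?thesis by (rule iff[THEN iffD2])
qed

lemma borel_measurable_AE_limit:
  fixes h :: "nat \<Rightarrow> 'a::euclidean_space \<Rightarrow> real"
  assumes S: "S \<in> sets lebesgue" and [measurable]: "\<And>n. h n \<in> borel_measurable (lebesgue_on S)"
    and lim: "AE x in lebesgue_on S. (\<lambda>n. h n x) \<longlonglongrightarrow> g x"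
  shows "g \<in> borel_measurable (lebesgue_on S)"
proof (rule borel_measurable_AE_lebesgue_on[OF S])
  show "(\<lambda>x. lim (\<lambda>n. h n x)) \<in> borel_measurable (lebesgue_on S)" by measurable
  show "AE x in lebesgue_on S. lim (\<lambda>n. h n x) = g x" using lim by eventually_elim (rule limI)
qed

text \<open>\<open>w\<close> is rounded down to multiples of 1 / (n + 1). The rounded function takes
  countably many values, where measurability in \<open>x\<close> for fixed second argument suffices;
  continuity in that argument then gives the limit almost everywhere.\<close>

lemma Caratheodory_measurable:
  fixes h :: "'a::euclidean_space \<Rightarrow> real \<Rightarrow> real"
  assumes S: "S \<in> sets lebesgue" and h: "\<And>s. (\<lambda>x. h x s) \<in> borel_measurable (lebesgue_on S)"
    and cont: "AE x in lebesgue_on S. continuous_on UNIV (h x)"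
    and [measurable]: "w \<in> borel_measurable (lebesgue_on S)"
  shows "(\<lambda>x. h x (w x)) \<in> borel_measurable (lebesgue_on S)"
proof (rule borel_measurable_AE_limit[OF S])
  show "(\<lambda>x. h x (real_of_int \<lfloor>real (Suc n) * w x\<rfloor> / real (Suc n))) \<in> borel_measurable (lebesgue_on S)" for n
    by (rule measurable_compose_countable[where f = "\<lambda>i x. h x (real_of_int i / real (Suc n))"])
       (rule h, measurable)
  show "AE x in lebesgue_on S. (\<lambda>n. h x (real_of_int \<lfloor>real (Suc n) * w x\<rfloor> / real (Suc n))) \<longlonglongrightarrow> h x (w x)"
    using cont
  proof eventually_elim
    case (elim x)
    have "(\<lambda>n. real_of_int \<lfloor>real (Suc n) * w x\<rfloor> / real (Suc n)) \<longlonglongrightarrow> w x"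
    proof (rule LIM_zero_cancel, rule Lim_null_comparison)
      show "\<forall>\<^sub>F n in sequentially. norm (real_of_int \<lfloor>real (Suc n) * w x\<rfloor> / real (Suc n) - w x) \<le> 1 / real (Suc n)"
      proof (intro always_eventually allI)
        fix n
        have "real_of_int \<lfloor>real (Suc n) * w x\<rfloor> / real (Suc n) - w x = (real_of_int \<lfloor>real (Suc n) * w x\<rfloor> - real (Suc n) * w x) / real (Suc n)"
          by (simp add: diff_divide_distrib)
        moreover have "\<bar>real_of_int \<lfloor>real (Suc n) * w x\<rfloor> - real (Suc n) * w x\<bar> \<le> 1"
          by linarith
        ultimately show "norm (real_of_int \<lfloor>real (Suc n) * w x\<rfloor> / real (Suc n) - w x) \<le> 1 / real (Suc n)"
          by (simp only: real_norm_def abs_divide abs_of_nat divide_right_mono of_nat_0_le_iff)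
      qed
      show "(\<lambda>n. 1 / real (Suc n)) \<longlonglongrightarrow> 0" by (rule LIMSEQ_Suc[OF lim_1_over_n])
    qed
    then show ?case
      using elim by (intro isCont_tendsto_compose[where g = "h x"]) (auto simp: continuous_on_eq_continuous_at)
  qed
qed

lemma Cauchy_Schwarz_integral:
  assumes "sq_integrable M f" "sq_integrable M g"
  shows "(\<integral>x. \<bar>f x * g x\<bar> \<partial>M) \<le> sqrt (\<integral>x. (f x)\<^sup>2 \<partial>M) * sqrt (\<integral>x. (g x)\<^sup>2 \<partial>M)"
proof -
  have [measurable]: "f \<in> borel_measurable M" "g \<in> borel_measurable M"
    and i: "integrable M (\<lambda>x. (f x)\<^sup>2)" "integrable M (\<lambda>x. (g x)\<^sup>2)" "integrable M (\<lambda>x. \<bar>f x * g x\<bar>)"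
    using assms sq_integrable_mult[OF assms] by (auto simp: sq_integrable_def)
  define I where "I = (\<integral>x. \<bar>f x * g x\<bar> \<partial>M)"
  have "(ennreal I)\<^sup>2 = (\<integral>\<^sup>+x. ennreal \<bar>f x\<bar> * ennreal \<bar>g x\<bar> \<partial>M)\<^sup>2"
    unfolding I_def by (subst nn_integral_eq_integral[OF i(3), symmetric]) (auto simp: abs_mult ennreal_mult)
  also have "\<dots> \<le> (\<integral>\<^sup>+x. (ennreal \<bar>f x\<bar>)\<^sup>2 \<partial>M) * (\<integral>\<^sup>+x. (ennreal \<bar>g x\<bar>)\<^sup>2 \<partial>M)"
    by (rule Cauchy_Schwarz_nn_integral) measurable
  also have "\<dots> = ennreal (\<integral>x. (f x)\<^sup>2 \<partial>M) * ennreal (\<integral>x. (g x)\<^sup>2 \<partial>M)"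
    using nn_integral_eq_integral[OF i(1)] nn_integral_eq_integral[OF i(2)] by (simp add: ennreal_power)
  also have "\<dots> = ennreal ((\<integral>x. (f x)\<^sup>2 \<partial>M) * (\<integral>x. (g x)\<^sup>2 \<partial>M))" by (simp add: ennreal_mult)
  finally have "I\<^sup>2 \<le> (\<integral>x. (f x)\<^sup>2 \<partial>M) * (\<integral>x. (g x)\<^sup>2 \<partial>M)"
    by (subst (asm) ennreal_power) (auto simp: I_def ennreal_le_iff)
  then have "I \<le> sqrt ((\<integral>x. (f x)\<^sup>2 \<partial>M) * (\<integral>x. (g x)\<^sup>2 \<partial>M))" by (rule real_le_rsqrt)
  then show ?thesis by (simp add: I_def real_sqrt_mult)
qed

lemma inner_L2_on:
  assumes "S \<in> sets lebesgue" "u \<in> L2_on S"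
  shows "u \<bullet> v = (\<integral>x. rep_L2 u x * rep_L2 v x \<partial>lebesgue_on S)"
proof -
  have "(\<integral>x. rep_L2 u x * rep_L2 v x \<partial>lebesgue_on S) = (\<integral>x. indicator S x *\<^sub>R (rep_L2 u x * rep_L2 v x) \<partial>lebesgue)"
    using assms(1) by (intro integral_restrict_space) auto
  also have "\<dots> = (\<integral>x. rep_L2 u x * rep_L2 v x \<partial>lebesgue)"
  proof (rule integral_cong_AE)
    show "AE x in lebesgue. indicator S x *\<^sub>R (rep_L2 u x * rep_L2 v x) = rep_L2 u x * rep_L2 v x"
      using assms(2) unfolding L2_on_def by (auto simp: indicator_def elim!: eventually_mono)
  qed (use assms(1) in measurable)
  finally show ?thesis by (simp add: inner_L2_rep)
qed

lemma sq_integrable_extend: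
  fixes g :: "real^3 \<Rightarrow> real"
  assumes S: "S \<in> sets lebesgue" and g: "sq_integrable (lebesgue_on S) g"
  shows "sq_integrable lebesgue (\<lambda>x. if x \<in> S then g x else 0)"
proof -
  have "integrable lebesgue (\<lambda>x. indicator S x *\<^sub>R (g x)\<^sup>2)"
    using g S by (auto simp: sq_integrable_def integrable_restrict_space)
  moreover have "(\<lambda>x. indicator S x *\<^sub>R (g x)\<^sup>2) = (\<lambda>x. (if x \<in> S then g x else 0)\<^sup>2)"
    by (auto simp: indicator_def)
  moreover have "(\<lambda>x. if x \<in> S then g x else 0) \<in> borel_measurable lebesgue"
    using g S by (subst measurable_restrict_space_iff[symmetric]) (auto simp: sq_integrable_def)
  ultimately show ?thesis by (simp add: sq_integrable_def)
qed

section \<open>Pointwise growth estimates for the nonlinearity\<close>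

lemma square_between: fixes s :: real assumes "s \<in> closed_segment p q" shows "s\<^sup>2 \<le> p\<^sup>2 + q\<^sup>2"
proof -
  have "\<bar>s\<bar> \<le> max \<bar>p\<bar> \<bar>q\<bar>" using assms by (auto simp: closed_segment_eq_real_ivl split: if_splits)
  then have "\<bar>s\<bar>\<^sup>2 \<le> (max \<bar>p\<bar> \<bar>q\<bar>)\<^sup>2" by (intro power_mono) auto
  also have "\<dots> \<le> p\<^sup>2 + q\<^sup>2" by (auto simp: max_def)
  finally show ?thesis by simp
qed

lemma derivative_bound_segment:
  fixes g g' :: "real \<Rightarrow> real"
  assumes "\<And>s. (g has_real_derivative g' s) (at s)" "\<And>s. s \<in> closed_segment p q \<Longrightarrow> \<bar>g' s\<bar> \<le> B"
  shows "\<bar>g p - g q\<bar> \<le> B * \<bar>p - q\<bar>"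
  using field_differentiable_bound[of "closed_segment p q" g g' B p q] assms
  by (auto intro: has_field_derivative_at_within)

text \<open>A Lipschitz second derivative grows linearly, so the first derivative grows
  quadratically and the function itself cubically. This is the growth that the sixth power in the
  Sobolev inequality just permits.\<close>

lemma derivative_growth:
  fixes g :: "real \<Rightarrow> real"
  assumes g: "C2 g" and b1: "\<bar>deriv g 0\<bar> \<le> b1" and b2: "\<bar>deriv (deriv g) 0\<bar> \<le> b2"
    and C: "\<And>u1 u2. \<bar>deriv (deriv g) u1 - deriv (deriv g) u2\<bar> \<le> C * \<bar>u1 - u2\<bar>" "C \<ge> 0"
  shows "\<bar>deriv g s\<bar> \<le> (b1 + b2 + C) * (1 + s\<^sup>2)"
proof -
  have d: "(deriv g has_real_derivative deriv (deriv g) s) (at s)" for s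
    using g by (auto simp: C2_def DERIV_deriv_iff_field_differentiable)
  have "\<bar>deriv g s - deriv g 0\<bar> \<le> (b2 + C * \<bar>s\<bar>) * \<bar>s - 0\<bar>"
  proof (rule derivative_bound_segment[OF d])
    fix r assume "r \<in> closed_segment s 0"
    then have "\<bar>r\<bar> \<le> \<bar>s\<bar>" by (auto simp: closed_segment_eq_real_ivl split: if_splits)
    then have "C * \<bar>r - 0\<bar> \<le> C * \<bar>s\<bar>" using C(2) by (intro mult_left_mono) auto
    then show "\<bar>deriv (deriv g) r\<bar> \<le> b2 + C * \<bar>s\<bar>" using C(1)[of r 0] b2 by linarith
  qed
  then have 1: "\<bar>deriv g s\<bar> \<le> b1 + (b2 * \<bar>s\<bar> + C * s\<^sup>2)"
    using b1 by (simp add: distrib_right power2_eq_square mult.assoc)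
  have "2 * \<bar>s\<bar> * 1 \<le> \<bar>s\<bar>\<^sup>2 + 1\<^sup>2" by (rule sum_squares_bound)
  then have "\<bar>s\<bar> \<le> 1 + s\<^sup>2" using abs_ge_zero[of s] unfolding power2_abs by simp
  then have "b2 * \<bar>s\<bar> \<le> b2 * (1 + s\<^sup>2)" using b2 by (intro mult_left_mono) auto
  moreover have "b1 * 1 \<le> b1 * (1 + s\<^sup>2)" using b1 by (intro mult_left_mono) auto
  moreover have "C * s\<^sup>2 \<le> C * (1 + s\<^sup>2)" using C(2) by (intro mult_left_mono) auto
  ultimately show ?thesis using 1 by (simp add: distrib_right)
qed

lemma increment_of_growth:
  fixes g :: "real \<Rightarrow> real"
  assumes g: "\<And>s. (g has_real_derivative g' s) (at s)" and D: "\<And>s. \<bar>g' s\<bar> \<le> D * (1 + s\<^sup>2)" "D \<ge> 0"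
  shows "\<bar>g p - g q\<bar> \<le> D * (1 + p\<^sup>2 + q\<^sup>2) * \<bar>p - q\<bar>"
proof (rule derivative_bound_segment[OF g])
  fix s assume "s \<in> closed_segment p q"
  then have "D * (1 + s\<^sup>2) \<le> D * (1 + p\<^sup>2 + q\<^sup>2)" using square_between D(2) by (intro mult_left_mono) auto
  then show "\<bar>g' s\<bar> \<le> D * (1 + p\<^sup>2 + q\<^sup>2)" using D(1)[of s] by linarith
qed

text \<open>The auxiliary function G s - g q * s has derivative g s - g q. The factor 2 arises
  because the square of an intermediate point is bounded by the sum of the squares of both
  endpoints, one of which is then counted twice.\<close>

lemma primitive_increment:
  fixes g G :: "real \<Rightarrow> real"
  assumes G: "\<And>s. (G has_real_derivative g s) (at s)"
    and g: "\<And>p q. \<bar>g p - g q\<bar> \<le> D * (1 + p\<^sup>2 + q\<^sup>2) * \<bar>p - q\<bar>" and D: "D \<ge> 0"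
  shows "\<bar>G p - G q - g q * (p - q)\<bar> \<le> 2 * D * (1 + p\<^sup>2 + q\<^sup>2) * (p - q)\<^sup>2"
proof -
  have "\<bar>(G p - g q * p) - (G q - g q * q)\<bar> \<le> (2 * D * (1 + p\<^sup>2 + q\<^sup>2) * \<bar>p - q\<bar>) * \<bar>p - q\<bar>"
  proof (rule derivative_bound_segment)
    show "((\<lambda>s. G s - g q * s) has_real_derivative (g s - g q)) (at s)" for s
      by (auto intro!: derivative_eq_intros G)
    fix s assume s: "s \<in> closed_segment p q"
    then have sq: "\<bar>s - q\<bar> \<le> \<bar>p - q\<bar>" by (auto simp: closed_segment_eq_real_ivl split: if_splits)
    have "D * (1 + s\<^sup>2 + q\<^sup>2) * \<bar>s - q\<bar> \<le> (2 * D * (1 + p\<^sup>2 + q\<^sup>2)) * \<bar>p - q\<bar>"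
    proof (rule mult_mono)
      have "1 + x + z \<le> 2 * (1 + y + z)" if "x \<le> y + z" "0 \<le> y" for x y z :: real
        using that by (simp add: algebra_simps)
      from this[OF square_between[OF s] zero_le_power2]
      have "1 + s\<^sup>2 + q\<^sup>2 \<le> 2 * (1 + p\<^sup>2 + q\<^sup>2)" .
      then have "D * (1 + s\<^sup>2 + q\<^sup>2) \<le> D * (2 * (1 + p\<^sup>2 + q\<^sup>2))" using D by (intro mult_left_mono)
      then show "D * (1 + s\<^sup>2 + q\<^sup>2) \<le> 2 * D * (1 + p\<^sup>2 + q\<^sup>2)" by (simp only: mult_ac)
    qed (use D sq in auto)
    then show "\<bar>g s - g q\<bar> \<le> 2 * D * (1 + p\<^sup>2 + q\<^sup>2) * \<bar>p - q\<bar>" using g[of s q] by linarith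
  qed
  moreover have "B * \<bar>p - q\<bar> * \<bar>p - q\<bar> = B * (p - q)\<^sup>2" for B
    unfolding mult.assoc by (simp add: power2_eq_square)
  moreover have "(G p - g q * p) - (G q - g q * q) = G p - G q - g q * (p - q)" by (simp add: algebra_simps)
  ultimately show ?thesis by (simp only:)
qed

text \<open>Used for measurability: a Riemann sum involves only finitely many values of
  \<open>g\<close>, so composing the primitive with a measurable function becomes a limit of
  measurable functions. The error is K / N^2 on each of the N cells.\<close>

lemma Riemann_sum_primitive:
  fixes g G :: "real \<Rightarrow> real"
  assumes G: "\<And>s. (G has_real_derivative g s) (at s)" "G 0 = 0"
    and g: "\<And>p q. \<bar>g p - g q\<bar> \<le> D * (1 + p\<^sup>2 + q\<^sup>2) * \<bar>p - q\<bar>" and D: "D \<ge> 0"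
  shows "(\<lambda>n. \<Sum>i<Suc n. g (real i * w / real (Suc n)) * (w / real (Suc n))) \<longlonglongrightarrow> G w"
proof (rule LIM_zero_cancel, rule Lim_null_comparison)
  define K where "K = 2 * D * (1 + w\<^sup>2 + w\<^sup>2) * w\<^sup>2"
  show "\<forall>\<^sub>F n in sequentially. norm ((\<Sum>i<Suc n. g (real i * w / real (Suc n)) * (w / real (Suc n))) - G w) \<le> K * (1 / real (Suc n))"
  proof (intro always_eventually allI)
    fix n
    define N where "N = real (Suc n)"
    have N: "N \<ge> 1" by (simp add: N_def)
    define s where "s i = real i * w / N" for i :: nat
    have tele: "(\<Sum>i<Suc n. G (s (Suc i)) - G (s i)) = G w"
      using sum_lessThan_telescope[of "\<lambda>i. G (s i)" "Suc n"] G(2) by (simp add: s_def N_def del: of_nat_Suc sum.lessThan_Suc)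
    have step: "\<bar>G (s (Suc i)) - G (s i) - g (s i) * (w / N)\<bar> \<le> K / N\<^sup>2" if "i < Suc n" for i
    proof -
      have diff: "s (Suc i) - s i = w / N" by (simp add: s_def add_divide_distrib distrib_right)
      have bd: "(s k)\<^sup>2 \<le> w\<^sup>2" if "k \<le> Suc n" for k
      proof -
        have "\<bar>s k\<bar> = (real k / N) * \<bar>w\<bar>" using N by (simp add: s_def abs_mult)
        also have "\<dots> \<le> 1 * \<bar>w\<bar>" using that by (intro mult_right_mono) (auto simp: N_def)
        finally show ?thesis by (simp add: abs_le_square_iff)
      qed
      have "\<bar>G (s (Suc i)) - G (s i) - g (s i) * (s (Suc i) - s i)\<bar> \<le> 2 * D * (1 + (s (Suc i))\<^sup>2 + (s i)\<^sup>2) * (s (Suc i) - s i)\<^sup>2"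
        by (rule primitive_increment[OF G(1) g D])
      also have "\<dots> \<le> 2 * D * (1 + w\<^sup>2 + w\<^sup>2) * (s (Suc i) - s i)\<^sup>2"
        using bd[of i] bd[of "Suc i"] that D by (intro mult_right_mono mult_left_mono) auto
      finally show ?thesis unfolding diff by (simp add: K_def power_divide)
    qed
    have "\<bar>(\<Sum>i<Suc n. g (s i) * (w / N)) - G w\<bar> = \<bar>\<Sum>i<Suc n. G (s (Suc i)) - G (s i) - g (s i) * (w / N)\<bar>"
      unfolding tele[symmetric] sum_subtractf by (simp add: abs_minus_commute del: sum.lessThan_Suc)
    also have "\<dots> \<le> (\<Sum>i<Suc n. \<bar>G (s (Suc i)) - G (s i) - g (s i) * (w / N)\<bar>)" by (rule sum_abs)
    also have "\<dots> \<le> (\<Sum>i<Suc n. K / N\<^sup>2)" by (intro sum_mono step) auto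
    also have "\<dots> = K * (1 / N)" using N by (simp add: N_def power2_eq_square del: of_nat_Suc sum.lessThan_Suc)
    finally show "norm ((\<Sum>i<Suc n. g (real i * w / real (Suc n)) * (w / real (Suc n))) - G w) \<le> K * (1 / real (Suc n))"
      unfolding s_def N_def real_norm_def .
  qed
  have "(\<lambda>n. K * (1 / real (Suc n))) \<longlonglongrightarrow> K * 0" by (intro tendsto_intros LIMSEQ_Suc[OF lim_1_over_n])
  then show "(\<lambda>n. K * (1 / real (Suc n))) \<longlonglongrightarrow> 0" by simp
qed

section \<open>The superposition operator and its potential\<close>

locale nemytskii_setting = elliptic_form +
  fixes f F :: "real^3 \<Rightarrow> real \<Rightarrow> real" and D :: real
  assumes f_meas: "\<And>s. (\<lambda>x. f x s) \<in> borel_measurable (lebesgue_on \<Omega>)"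
    and f0: "sq_integrable (lebesgue_on \<Omega>) (\<lambda>x. f x 0)"
    and D0: "D \<ge> 0"
    and f_growth: "AE x in lebesgue_on \<Omega>. continuous_on UNIV (f x) \<and>
       (\<forall>p q. \<bar>f x p - f x q\<bar> \<le> D * (1 + p\<^sup>2 + q\<^sup>2) * \<bar>p - q\<bar>)"
    and F_primitive: "AE x in lebesgue_on \<Omega>. F x 0 = 0 \<and> (\<forall>s. (F x has_real_derivative f x s) (at s))"
begin

abbreviation "fh \<equiv> nemytskii \<Omega> f"

definition \<Phi> :: "jet \<Rightarrow> real" where "\<Phi> u = (\<integral>x. F x (val u x) \<partial>M)"

lemma f_cont_AE: "AE x in M. continuous_on UNIV (f x)"
  using f_growth by eventually_elim simp

lemma f_val_meas [measurable]: "(\<lambda>x. f x (val u x)) \<in> borel_measurable M"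
  by (rule Caratheodory_measurable[OF \<Omega>_sets f_meas f_cont_AE val_meas])

lemma F_increment: "AE x in M. \<forall>p q. \<bar>F x p - F x q - f x q * (p - q)\<bar> \<le> 2 * D * (1 + p\<^sup>2 + q\<^sup>2) * (p - q)\<^sup>2"
  using f_growth F_primitive by eventually_elim (intro allI primitive_increment D0; blast)

lemma F_val_meas [measurable]: "(\<lambda>x. F x (val u x)) \<in> borel_measurable M"
proof (rule borel_measurable_AE_limit[OF \<Omega>_sets])
  fix n
  have "(\<lambda>x. f x (real i * val u x / real (Suc n))) \<in> borel_measurable M" for i
    by (rule Caratheodory_measurable[OF \<Omega>_sets f_meas f_cont_AE]) measurable
  then show "(\<lambda>x. \<Sum>i<Suc n. f x (real i * val u x / real (Suc n)) * (val u x / real (Suc n))) \<in> borel_measurable M"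
    by (intro borel_measurable_sum borel_measurable_times) auto
next
  show "AE x in M. (\<lambda>n. \<Sum>i<Suc n. f x (real i * val u x / real (Suc n)) * (val u x / real (Suc n))) \<longlonglongrightarrow> F x (val u x)"
    using f_growth F_primitive
    by eventually_elim (rule Riemann_sum_primitive[OF _ _ _ D0]; blast)
qed

lemma sixth_power:
  assumes "u \<in> V"
  shows "integrable M (\<lambda>x. (val u x) ^ 6)" "(\<integral>x. (val u x) ^ 6 \<partial>M) \<le> 4096 * (norm u) ^ 6"
proof -
  have [measurable]: "val u \<in> borel_measurable lebesgue" by (simp add: val_def)
  have fin: "(\<integral>\<^sup>+x. ennreal ((val u x) ^ 6) \<partial>lebesgue) \<le> ennreal (4096 * (norm u) ^ 6)"
    by (rule Sobolev_H10[OF assms])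
  then have int: "integrable lebesgue (\<lambda>x. (val u x) ^ 6)"
    by (intro integrableI_bounded) (auto simp: power_abs order.strict_trans1)
  then show i: "integrable M (\<lambda>x. (val u x) ^ 6)" by (rule integrable_lebesgue_on[OF \<Omega>_sets])
  have "ennreal (\<integral>x. (val u x) ^ 6 \<partial>M) = (\<integral>\<^sup>+x. ennreal ((val u x) ^ 6) \<partial>M)"
    by (rule nn_integral_eq_integral[OF i, symmetric]) simp
  also have "\<dots> \<le> (\<integral>\<^sup>+x. ennreal ((val u x) ^ 6) \<partial>lebesgue)"
    using \<Omega>_sets by (simp add: nn_integral_restrict_space nn_integral_mono indicator_def)
  also note fin
  finally show "(\<integral>x. (val u x) ^ 6 \<partial>M) \<le> 4096 * (norm u) ^ 6" by (simp add: ennreal_le_iff)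
qed

lemma val_square_bound: "u \<in> V \<Longrightarrow> (\<integral>x. (val u x)\<^sup>2 \<partial>M) \<le> (norm u)\<^sup>2"
  by (simp add: integral_val_square Sobolev_jet_norm sum_nonneg)

lemma jet_AE_diff: "AE x in M. val (u - v) x = val u x - val v x"
proof -
  have "AE x in lebesgue. val (u - v) x = val u x - val v x" by (simp add: val_def rep_L2_diff)
  then show ?thesis by (rule AE_lebesgue_on[OF \<Omega>_sets])
qed

text \<open>The weight is quadratic and the increment linear, so the square has degree six, the
  exponent of the Sobolev inequality. Scaling by \<open>m\<close> and by \<open>e\<close> before
  applying Young's inequality makes the bound quadratic in the increment. Three squares from
  expanding the weight, two quartic terms and the factor 2 * 4096 for each of them give 12 *
  4096.\<close>

lemma weighted_increment:
  assumes pq: "p \<in> V" "q \<in> V" and m: "norm p \<le> m" "norm q \<le> m" "0 < m"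
  shows "integrable M (\<lambda>x. ((1 + (val p x)\<^sup>2 + (val q x)\<^sup>2) * val (p - q) x)\<^sup>2)"
    and "(\<integral>x. ((1 + (val p x)\<^sup>2 + (val q x)\<^sup>2) * val (p - q) x)\<^sup>2 \<partial>M) \<le> (3 + 12 * 4096 * m ^ 4) * (norm (p - q))\<^sup>2"
proof -
  define e where "e = norm (p - q)"
  have dV: "p - q \<in> V" using pq by (intro subspace_diff[OF subspace_H10])
  have young: "\<bar>s\<bar> ^ 4 * \<bar>d\<bar>\<^sup>2 \<le> \<bar>s\<bar> ^ 6 + \<bar>d\<bar> ^ 6" for s d :: real
  proof (cases "\<bar>s\<bar> \<le> \<bar>d\<bar>")
    case True
    then have "\<bar>s\<bar> ^ 4 * \<bar>d\<bar>\<^sup>2 \<le> \<bar>d\<bar> ^ 4 * \<bar>d\<bar>\<^sup>2" by (intro mult_right_mono power_mono) auto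
    also have "\<dots> = \<bar>d\<bar> ^ 6" by (simp add: power_add[symmetric])
    finally show ?thesis using zero_le_power[of "\<bar>s\<bar>" 6] by linarith
  next
    case False
    then have "\<bar>s\<bar> ^ 4 * \<bar>d\<bar>\<^sup>2 \<le> \<bar>s\<bar> ^ 4 * \<bar>s\<bar>\<^sup>2" by (intro mult_left_mono power_mono) auto
    also have "\<dots> = \<bar>s\<bar> ^ 6" by (simp add: power_add[symmetric])
    finally show ?thesis using zero_le_power[of "\<bar>d\<bar>" 6] by linarith
  qed
  have quartic: "integrable M (\<lambda>x. (val w x) ^ 4 * (val (p - q) x)\<^sup>2) \<and>
      (\<integral>x. (val w x) ^ 4 * (val (p - q) x)\<^sup>2 \<partial>M) \<le> 2 * 4096 * m ^ 4 * e\<^sup>2" if w: "w \<in> V" "norm w \<le> m" for w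
  proof (cases "e = 0")
    \<comment> \<open>Scaling by \<open>e\<close> is impossible here. The chosen representative of
      the zero class vanishes only almost everywhere, so this case needs an argument.\<close>
    case True
    then have "val (p - q) = val 0" by (simp add: e_def)
    moreover have "AE x in M. val 0 x = 0"
      by (rule AE_lebesgue_on[OF \<Omega>_sets]) (simp add: val_def rep_L2_zero)
    ultimately have AE: "AE x in M. 0 = (val w x) ^ 4 * (val (p - q) x)\<^sup>2" by (auto elim!: eventually_mono)
    have "integrable M (\<lambda>x. (val w x) ^ 4 * (val (p - q) x)\<^sup>2)"
      by (rule Bochner_Integration.integrable_cong_AE[THEN iffD1, OF _ _ AE]) auto
    moreover have "(\<integral>x. (val w x) ^ 4 * (val (p - q) x)\<^sup>2 \<partial>M) = (\<integral>x. 0 \<partial>M)"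
      by (rule integral_cong_AE) (use AE in \<open>auto elim!: eventually_mono\<close>)
    ultimately show ?thesis using True by simp
  next
    case False
    then have e: "e > 0" by (simp add: e_def)
    have ptw: "(val w x) ^ 4 * (val (p - q) x)\<^sup>2 \<le> m ^ 4 * e\<^sup>2 * ((val w x) ^ 6 / m ^ 6 + (val (p - q) x) ^ 6 / e ^ 6)" for x
    proof -
      have "(m ^ 4 * e\<^sup>2) * (\<bar>val w x / m\<bar> ^ 4 * \<bar>val (p - q) x / e\<bar>\<^sup>2) \<le> (m ^ 4 * e\<^sup>2) * (\<bar>val w x / m\<bar> ^ 6 + \<bar>val (p - q) x / e\<bar> ^ 6)"
        using m e by (intro mult_left_mono young) auto
      moreover have "(m ^ 4 * e\<^sup>2) * (\<bar>val w x / m\<bar> ^ 4 * \<bar>val (p - q) x / e\<bar>\<^sup>2) = (val w x) ^ 4 * (val (p - q) x)\<^sup>2"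
        using m e by (simp add: power_divide power_abs)
      moreover have "\<bar>val w x / m\<bar> ^ 6 + \<bar>val (p - q) x / e\<bar> ^ 6 = (val w x) ^ 6 / m ^ 6 + (val (p - q) x) ^ 6 / e ^ 6"
        by (simp add: power_divide power_abs)
      ultimately show ?thesis by (simp only:)
    qed
    have int: "integrable M (\<lambda>x. m ^ 4 * e\<^sup>2 * ((val w x) ^ 6 / m ^ 6 + (val (p - q) x) ^ 6 / e ^ 6))"
      by (intro integrable_mult_right Bochner_Integration.integrable_add integrable_divide sixth_power w dV)
    have i: "integrable M (\<lambda>x. (val w x) ^ 4 * (val (p - q) x)\<^sup>2)"
    proof (rule Bochner_Integration.integrable_bound[OF int])
      show "AE x in M. norm ((val w x) ^ 4 * (val (p - q) x)\<^sup>2) \<le> norm (m ^ 4 * e\<^sup>2 * ((val w x) ^ 6 / m ^ 6 + (val (p - q) x) ^ 6 / e ^ 6))"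
      proof (intro AE_I2)
        fix x
        have "0 \<le> (val w x) ^ 4 * (val (p - q) x)\<^sup>2" by simp
        then show "norm ((val w x) ^ 4 * (val (p - q) x)\<^sup>2) \<le> norm (m ^ 4 * e\<^sup>2 * ((val w x) ^ 6 / m ^ 6 + (val (p - q) x) ^ 6 / e ^ 6))"
          using ptw[of x] unfolding real_norm_def by linarith
      qed
    qed measurable
    have "(\<integral>x. (val w x) ^ 4 * (val (p - q) x)\<^sup>2 \<partial>M) \<le> (\<integral>x. m ^ 4 * e\<^sup>2 * ((val w x) ^ 6 / m ^ 6 + (val (p - q) x) ^ 6 / e ^ 6) \<partial>M)"
      by (intro integral_mono i int ptw)
    also have "\<dots> = m ^ 4 * e\<^sup>2 * ((\<integral>x. (val w x) ^ 6 \<partial>M) / m ^ 6 + (\<integral>x. (val (p - q) x) ^ 6 \<partial>M) / e ^ 6)"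
      using sixth_power(1)[OF w(1)] sixth_power(1)[OF dV] by simp
    also have "\<dots> \<le> m ^ 4 * e\<^sup>2 * (4096 + 4096)"
    proof (intro mult_left_mono add_mono)
      have "(\<integral>x. (val w x) ^ 6 \<partial>M) \<le> 4096 * (norm w) ^ 6" by (rule sixth_power[OF w(1)])
      also have "\<dots> \<le> 4096 * m ^ 6" using w(2) by (intro mult_left_mono power_mono) auto
      finally show "(\<integral>x. (val w x) ^ 6 \<partial>M) / m ^ 6 \<le> 4096" using m by (simp add: divide_le_eq)
      have "(\<integral>x. (val (p - q) x) ^ 6 \<partial>M) \<le> 4096 * e ^ 6" unfolding e_def by (rule sixth_power[OF dV])
      then show "(\<integral>x. (val (p - q) x) ^ 6 \<partial>M) / e ^ 6 \<le> 4096" using e by (simp add: divide_le_eq)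
    qed simp
    finally show ?thesis using i by simp
  qed
  have expand: "((1 + s + t) * d)\<^sup>2 \<le> 3 * d\<^sup>2 + 3 * (s\<^sup>2 * d\<^sup>2) + 3 * (t\<^sup>2 * d\<^sup>2)" for s t d :: real
  proof -
    have "2 * s \<le> 1 + s\<^sup>2" "2 * t \<le> 1 + t\<^sup>2" "2 * s * t \<le> s\<^sup>2 + t\<^sup>2"
      using sum_squares_bound[of 1 s] sum_squares_bound[of 1 t] sum_squares_bound[of s t] by auto
    then have "(1 + s + t)\<^sup>2 \<le> 3 + 3 * s\<^sup>2 + 3 * t\<^sup>2" by (simp add: power2_eq_square algebra_simps)
    then have "(1 + s + t)\<^sup>2 * d\<^sup>2 \<le> (3 + 3 * s\<^sup>2 + 3 * t\<^sup>2) * d\<^sup>2" by (intro mult_right_mono) auto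
    then show ?thesis unfolding power_mult_distrib[of "1 + s + t"] by (simp only: distrib_right mult.assoc)
  qed
  have ptw: "((1 + (val p x)\<^sup>2 + (val q x)\<^sup>2) * val (p - q) x)\<^sup>2 \<le>
      3 * (val (p - q) x)\<^sup>2 + 3 * ((val p x) ^ 4 * (val (p - q) x)\<^sup>2) + 3 * ((val q x) ^ 4 * (val (p - q) x)\<^sup>2)" for x
    using expand[of "(val p x)\<^sup>2" "(val q x)\<^sup>2" "val (p - q) x"] by (simp add: power_mult[symmetric])
  have int: "integrable M (\<lambda>x. 3 * (val (p - q) x)\<^sup>2 + 3 * ((val p x) ^ 4 * (val (p - q) x)\<^sup>2) + 3 * ((val q x) ^ 4 * (val (p - q) x)\<^sup>2))"
    using quartic[OF pq(1) m(1)] quartic[OF pq(2) m(2)] val_square_integrable[of "p - q"]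
    by (intro Bochner_Integration.integrable_add integrable_mult_right) auto
  show i: "integrable M (\<lambda>x. ((1 + (val p x)\<^sup>2 + (val q x)\<^sup>2) * val (p - q) x)\<^sup>2)"
  proof (rule Bochner_Integration.integrable_bound[OF int])
    show "AE x in M. norm (((1 + (val p x)\<^sup>2 + (val q x)\<^sup>2) * val (p - q) x)\<^sup>2) \<le>
      norm (3 * (val (p - q) x)\<^sup>2 + 3 * ((val p x) ^ 4 * (val (p - q) x)\<^sup>2) + 3 * ((val q x) ^ 4 * (val (p - q) x)\<^sup>2))"
    proof (intro AE_I2)
      fix x
      show "norm (((1 + (val p x)\<^sup>2 + (val q x)\<^sup>2) * val (p - q) x)\<^sup>2) \<le>
        norm (3 * (val (p - q) x)\<^sup>2 + 3 * ((val p x) ^ 4 * (val (p - q) x)\<^sup>2) + 3 * ((val q x) ^ 4 * (val (p - q) x)\<^sup>2))"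
        using ptw[of x] zero_le_power2[of "(1 + (val p x)\<^sup>2 + (val q x)\<^sup>2) * val (p - q) x"]
        unfolding real_norm_def by linarith
    qed
  qed measurable
  have "(\<integral>x. ((1 + (val p x)\<^sup>2 + (val q x)\<^sup>2) * val (p - q) x)\<^sup>2 \<partial>M) \<le>
    (\<integral>x. 3 * (val (p - q) x)\<^sup>2 + 3 * ((val p x) ^ 4 * (val (p - q) x)\<^sup>2) + 3 * ((val q x) ^ 4 * (val (p - q) x)\<^sup>2) \<partial>M)"
    by (intro integral_mono i int ptw)
  also have "\<dots> = 3 * (\<integral>x. (val (p - q) x)\<^sup>2 \<partial>M) + 3 * (\<integral>x. (val p x) ^ 4 * (val (p - q) x)\<^sup>2 \<partial>M)
      + 3 * (\<integral>x. (val q x) ^ 4 * (val (p - q) x)\<^sup>2 \<partial>M)"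
    using quartic[OF pq(1) m(1)] quartic[OF pq(2) m(2)] val_square_integrable[of "p - q"] by simp
  also have "\<dots> \<le> 3 * e\<^sup>2 + 3 * (2 * 4096 * m ^ 4 * e\<^sup>2) + 3 * (2 * 4096 * m ^ 4 * e\<^sup>2)"
    using quartic[OF pq(1) m(1)] quartic[OF pq(2) m(2)] val_square_bound[OF dV]
    unfolding e_def by (intro add_mono mult_left_mono) auto
  also have "\<dots> = (3 + 12 * 4096 * m ^ 4) * (norm (p - q))\<^sup>2" by (simp add: e_def distrib_right)
  finally show "(\<integral>x. ((1 + (val p x)\<^sup>2 + (val q x)\<^sup>2) * val (p - q) x)\<^sup>2 \<partial>M) \<le> (3 + 12 * 4096 * m ^ 4) * (norm (p - q))\<^sup>2" .
qed

lemma weighted_increment_sq_integrable: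
  assumes "p \<in> V" "q \<in> V"
  shows "sq_integrable M (\<lambda>x. (1 + (val p x)\<^sup>2 + (val q x)\<^sup>2) * val (p - q) x)"
  unfolding sq_integrable_def
proof
  show "integrable M (\<lambda>x. ((1 + (val p x)\<^sup>2 + (val q x)\<^sup>2) * val (p - q) x)\<^sup>2)"
    by (rule weighted_increment(1)[OF assms, of "1 + norm p + norm q"]) (auto simp: add_pos_nonneg)
qed measurable

lemma f_increment_AE:
  "AE x in M. \<bar>f x (val p x) - f x (val q x)\<bar> \<le> D * \<bar>(1 + (val p x)\<^sup>2 + (val q x)\<^sup>2) * val (p - q) x\<bar>"
  using f_growth jet_AE_diff[of p q]
proof eventually_elim
  case (elim x)
  have "\<bar>1 + (val p x)\<^sup>2 + (val q x)\<^sup>2\<bar> = 1 + (val p x)\<^sup>2 + (val q x)\<^sup>2" by (simp add: add_nonneg_nonneg)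
  then show ?case using elim by (simp add: abs_mult mult.assoc)
qed

lemma f_val_sq_integrable: assumes u: "u \<in> V" shows "sq_integrable M (\<lambda>x. f x (val u x))"
proof -
  have 0: "0 \<in> V" by (rule subspace_0[OF subspace_H10])
  \<comment> \<open>The growth estimate compares two jets; the zero jet stands in for the constant
    0, with which its representative agrees almost everywhere.\<close>
  have z: "AE x in M. val 0 x = 0"
    by (rule AE_lebesgue_on[OF \<Omega>_sets]) (simp add: val_def rep_L2_zero)
  have "sq_integrable M (\<lambda>x. f x (val u x) - f x (val 0 x))"
    unfolding sq_integrable_def
  proof
    have "integrable M (\<lambda>x. D\<^sup>2 * ((1 + (val u x)\<^sup>2 + (val 0 x)\<^sup>2) * val (u - 0) x)\<^sup>2)"
      using weighted_increment_sq_integrable[OF u 0] by (simp add: sq_integrable_def)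
    then show "integrable M (\<lambda>x. (f x (val u x) - f x (val 0 x))\<^sup>2)"
    proof (rule Bochner_Integration.integrable_bound)
      show "AE x in M. norm ((f x (val u x) - f x (val 0 x))\<^sup>2) \<le> norm (D\<^sup>2 * ((1 + (val u x)\<^sup>2 + (val 0 x)\<^sup>2) * val (u - 0) x)\<^sup>2)"
        using f_increment_AE[of u 0]
      proof eventually_elim
        case (elim x)
        have "\<bar>f x (val u x) - f x (val 0 x)\<bar>\<^sup>2 \<le> (D * \<bar>(1 + (val u x)\<^sup>2 + (val 0 x)\<^sup>2) * val (u - 0) x\<bar>)\<^sup>2"
          using elim by (intro power_mono) auto
        then show ?case unfolding power_mult_distrib power2_abs by simp
      qed
    qed measurable
  qed measurable
  then have "sq_integrable M (\<lambda>x. (f x (val u x) - f x (val 0 x)) + f x 0)" using f0 by (rule sq_integrable_add)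
  then have "integrable M (\<lambda>x. ((f x (val u x) - f x (val 0 x)) + f x 0)\<^sup>2)" by (simp add: sq_integrable_def)
  then have "integrable M (\<lambda>x. (f x (val u x))\<^sup>2)"
    using z f_meas[of 0] by (subst (asm) Bochner_Integration.integrable_cong_AE) (auto elim!: eventually_mono)
  then show ?thesis by (simp add: sq_integrable_def)
qed

lemma
  assumes u: "u \<in> V"
  shows rep_nemytskii: "AE x in M. rep_L2 (fh u) x = f x (val u x)"
    and nemytskii_in_L2_on: "fh u \<in> L2_on \<Omega>"
proof -
  note sq = sq_integrable_extend[OF \<Omega>_sets f_val_sq_integrable[OF u]]
  have AE: "AE x in lebesgue. rep_L2 (fh u) x = (if x \<in> \<Omega> then f x (val u x) else 0)"
    unfolding nemytskii_def by (rule rep_abs_L2[OF sq])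
  show "AE x in M. rep_L2 (fh u) x = f x (val u x)"
    using AE \<Omega>_sets by (subst AE_restrict_space_iff) (auto elim!: eventually_mono)
  show "fh u \<in> L2_on \<Omega>" unfolding nemytskii_def by (rule abs_L2_in_L2_on[OF sq]) simp
qed

lemma nemytskii_Lipschitz:
  assumes pq: "p \<in> V" "q \<in> V" and m: "norm p \<le> m" "norm q \<le> m" "0 < m"
  shows "(norm (fh p - fh q))\<^sup>2 \<le> D\<^sup>2 * (3 + 12 * 4096 * m ^ 4) * (norm (p - q))\<^sup>2"
proof -
  have in_on: "fh p - fh q \<in> L2_on \<Omega>"
    using nemytskii_in_L2_on pq by (intro subspace_diff[OF subspace_L2_on])
  have "(norm (fh p - fh q))\<^sup>2 = (\<integral>x. (rep_L2 (fh p - fh q) x)\<^sup>2 \<partial>M)"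
    by (rule norm_L2_on[OF \<Omega>_sets in_on, symmetric])
  also have "\<dots> \<le> (\<integral>x. D\<^sup>2 * ((1 + (val p x)\<^sup>2 + (val q x)\<^sup>2) * val (p - q) x)\<^sup>2 \<partial>M)"
  proof (rule integral_mono_AE)
    show "integrable M (\<lambda>x. (rep_L2 (fh p - fh q) x)\<^sup>2)"
      by (intro integrable_lebesgue_on \<Omega>_sets rep_L2_square_integrable)
    show "integrable M (\<lambda>x. D\<^sup>2 * ((1 + (val p x)\<^sup>2 + (val q x)\<^sup>2) * val (p - q) x)\<^sup>2)"
      using weighted_increment(1)[OF pq m] by simp
    show "AE x in M. (rep_L2 (fh p - fh q) x)\<^sup>2 \<le> D\<^sup>2 * ((1 + (val p x)\<^sup>2 + (val q x)\<^sup>2) * val (p - q) x)\<^sup>2"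
      using rep_nemytskii[OF pq(1)] rep_nemytskii[OF pq(2)] AE_lebesgue_on[OF \<Omega>_sets rep_L2_diff[of "fh p" "fh q"]] f_increment_AE[of p q]
    proof eventually_elim
      case (elim x)
      have "\<bar>f x (val p x) - f x (val q x)\<bar>\<^sup>2 \<le> (D * \<bar>(1 + (val p x)\<^sup>2 + (val q x)\<^sup>2) * val (p - q) x\<bar>)\<^sup>2"
        using elim by (intro power_mono) auto
      then show ?case using elim unfolding power_mult_distrib power2_abs by simp
    qed
  qed
  also have "\<dots> = D\<^sup>2 * (\<integral>x. ((1 + (val p x)\<^sup>2 + (val q x)\<^sup>2) * val (p - q) x)\<^sup>2 \<partial>M)" by simp
  also have "\<dots> \<le> D\<^sup>2 * ((3 + 12 * 4096 * m ^ 4) * (norm (p - q))\<^sup>2)"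
    by (intro mult_left_mono weighted_increment(2)[OF pq m]) simp
  finally show ?thesis by (simp add: mult.assoc)
qed

lemma F_val_bound:
  "AE x in M. \<bar>F x (val u x)\<bar> \<le> (f x 0)\<^sup>2 + (1 + 4 * D) * (val u x)\<^sup>2 + 2 * D * (val u x) ^ 6"
  using F_increment F_primitive
proof eventually_elim
  case (elim x)
  define w where "w = val u x"
  have "\<bar>F x w - F x 0 - f x 0 * (w - 0)\<bar> \<le> 2 * D * (1 + w\<^sup>2 + 0\<^sup>2) * (w - 0)\<^sup>2" using elim by blast
  then have 1: "\<bar>F x w\<bar> \<le> \<bar>f x 0\<bar> * \<bar>w\<bar> + 2 * D * ((1 + w\<^sup>2) * w\<^sup>2)"
    using elim unfolding abs_mult[symmetric] by (simp add: mult.assoc)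
  have "2 * \<bar>f x 0\<bar> * \<bar>w\<bar> \<le> \<bar>f x 0\<bar>\<^sup>2 + \<bar>w\<bar>\<^sup>2" by (rule sum_squares_bound)
  moreover have "0 \<le> \<bar>f x 0\<bar> * \<bar>w\<bar>" by simp
  ultimately have 2: "\<bar>f x 0\<bar> * \<bar>w\<bar> \<le> (f x 0)\<^sup>2 + w\<^sup>2" unfolding power2_abs by linarith
  \<comment> \<open>The fourth power is interpolated between the second and the sixth, whose
    integrals over the domain are controlled.\<close>
  have "0 \<le> w\<^sup>2 * (1 - w\<^sup>2)\<^sup>2" by simp
  also have "w\<^sup>2 * (1 - w\<^sup>2)\<^sup>2 = w\<^sup>2 + w ^ 6 - 2 * w ^ 4" by (simp add: algebra_simps eval_nat_numeral)
  finally have "w ^ 4 \<le> w\<^sup>2 + w ^ 6" using zero_le_even_power[of 4 w]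
    unfolding diff_ge_0_iff_ge by (metis even_numeral mult_2 add_increasing2 order_trans order_refl)
  moreover have "(1 + w\<^sup>2) * w\<^sup>2 = w\<^sup>2 + w ^ 4" by (simp add: distrib_right power_add[symmetric])
  ultimately have "(1 + w\<^sup>2) * w\<^sup>2 \<le> 2 * w\<^sup>2 + w ^ 6" by linarith
  then have "2 * D * ((1 + w\<^sup>2) * w\<^sup>2) \<le> 2 * D * (2 * w\<^sup>2 + w ^ 6)" using D0 by (intro mult_left_mono) auto
  with 1 2 show ?case unfolding w_def[symmetric] by (simp add: algebra_simps)
qed

lemma F_bound_integrable:
  "u \<in> V \<Longrightarrow> integrable M (\<lambda>x. (f x 0)\<^sup>2 + (1 + 4 * D) * (val u x)\<^sup>2 + 2 * D * (val u x) ^ 6)"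
  using f0 val_square_integrable sixth_power(1)
  by (intro Bochner_Integration.integrable_add integrable_mult_right) (auto simp: sq_integrable_def)

lemma F_val_integrable: assumes "u \<in> V" shows "integrable M (\<lambda>x. F x (val u x))"
proof (rule Bochner_Integration.integrable_bound[OF F_bound_integrable[OF assms]])
  show "AE x in M. norm (F x (val u x)) \<le> norm ((f x 0)\<^sup>2 + (1 + 4 * D) * (val u x)\<^sup>2 + 2 * D * (val u x) ^ 6)"
    using F_val_bound[of u] by eventually_elim (unfold real_norm_def, linarith)
qed measurable

lemma \<Phi>_bounded_on_balls:
  assumes u: "u \<in> V" "norm u \<le> m"
  shows "\<bar>\<Phi> u\<bar> \<le> (\<integral>x. (f x 0)\<^sup>2 \<partial>M) + (1 + 4 * D) * m\<^sup>2 + 2 * D * (4096 * m ^ 6)"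
proof -
  have "\<bar>\<Phi> u\<bar> \<le> (\<integral>x. \<bar>F x (val u x)\<bar> \<partial>M)" unfolding \<Phi>_def by (rule integral_abs_bound)
  also have "\<dots> \<le> (\<integral>x. (f x 0)\<^sup>2 + (1 + 4 * D) * (val u x)\<^sup>2 + 2 * D * (val u x) ^ 6 \<partial>M)"
    by (intro integral_mono_AE F_val_bound F_bound_integrable u integrable_abs F_val_integrable)
  also have "\<dots> = (\<integral>x. (f x 0)\<^sup>2 \<partial>M) + (1 + 4 * D) * (\<integral>x. (val u x)\<^sup>2 \<partial>M) + 2 * D * (\<integral>x. (val u x) ^ 6 \<partial>M)"
    using f0 val_square_integrable sixth_power(1)[OF u(1)] by (simp add: sq_integrable_def)
  also have "\<dots> \<le> (\<integral>x. (f x 0)\<^sup>2 \<partial>M) + (1 + 4 * D) * m\<^sup>2 + 2 * D * (4096 * m ^ 6)"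
  proof (intro add_mono mult_left_mono order_refl)
    show "(\<integral>x. (val u x)\<^sup>2 \<partial>M) \<le> m\<^sup>2"
      using val_square_bound[OF u(1)] power_mono[OF u(2), of 2] by simp
    have "(norm u) ^ 6 \<le> m ^ 6" using u(2) by (intro power_mono) auto
    then show "(\<integral>x. (val u x) ^ 6 \<partial>M) \<le> 4096 * m ^ 6" using sixth_power(2)[OF u(1)] by linarith
  qed (use D0 in auto)
  finally show ?thesis .
qed

text \<open>The pointwise remainder is the weighted increment times the increment. Cauchy-Schwarz
  puts the first factor into the Sobolev norm and leaves the second in the Lebesgue norm, which is
  the mixed remainder required of a gradient system.\<close>

lemma \<Phi>_increment:
  assumes pq: "p \<in> V" "q \<in> V" and m: "norm p \<le> m" "norm q \<le> m" "0 < m"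
  shows "\<bar>\<Phi> p - \<Phi> q - fh q \<bullet> (fst p - fst q)\<bar> \<le>
    2 * D * sqrt (3 + 12 * 4096 * m ^ 4) * norm (p - q) * norm (fst p - fst q)"
proof -
  define k where "k x = (1 + (val p x)\<^sup>2 + (val q x)\<^sup>2) * val (p - q) x" for x
  have dV: "p - q \<in> V" using pq by (intro subspace_diff[OF subspace_H10])
  have k_sq: "sq_integrable M k" unfolding k_def by (rule weighted_increment_sq_integrable[OF pq])
  have d_sq: "sq_integrable M (val (p - q))" unfolding sq_integrable_def by (intro conjI val_meas val_square_integrable)
  have fd: "integrable M (\<lambda>x. f x (val q x) * val (p - q) x)"
    by (rule sq_integrable_mult[OF f_val_sq_integrable[OF pq(2)] d_sq])
  have "fh q \<bullet> (fst p - fst q) = (\<integral>x. rep_L2 (fh q) x * rep_L2 (fst (p - q)) x \<partial>M)"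
    using inner_L2_on[OF \<Omega>_sets nemytskii_in_L2_on[OF pq(2)]] by simp
  also have "\<dots> = (\<integral>x. f x (val q x) * val (p - q) x \<partial>M)"
  proof (rule integral_cong_AE)
    show "(\<lambda>x. rep_L2 (fh q) x * rep_L2 (fst (p - q)) x) \<in> borel_measurable M"
      by (intro borel_measurable_times measurable_lebesgue_on) simp_all
    show "(\<lambda>x. f x (val q x) * val (p - q) x) \<in> borel_measurable M" by measurable
    show "AE x in M. rep_L2 (fh q) x * rep_L2 (fst (p - q)) x = f x (val q x) * val (p - q) x"
      using rep_nemytskii[OF pq(2)] by eventually_elim (simp add: val_def)
  qed
  finally have "\<Phi> p - \<Phi> q - fh q \<bullet> (fst p - fst q) = (\<integral>x. F x (val p x) - F x (val q x) - f x (val q x) * val (p - q) x \<partial>M)"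
    unfolding \<Phi>_def using F_val_integrable[OF pq(1)] F_val_integrable[OF pq(2)] fd by simp
  also have "\<bar>\<dots>\<bar> \<le> (\<integral>x. \<bar>F x (val p x) - F x (val q x) - f x (val q x) * val (p - q) x\<bar> \<partial>M)"
    by (rule integral_abs_bound)
  also have "\<dots> \<le> (\<integral>x. 2 * D * \<bar>k x * val (p - q) x\<bar> \<partial>M)"
  proof (rule integral_mono_AE)
    show "integrable M (\<lambda>x. \<bar>F x (val p x) - F x (val q x) - f x (val q x) * val (p - q) x\<bar>)"
      by (intro integrable_abs Bochner_Integration.integrable_diff F_val_integrable pq fd)
    show "integrable M (\<lambda>x. 2 * D * \<bar>k x * val (p - q) x\<bar>)"
      by (intro integrable_mult_right integrable_abs sq_integrable_mult k_sq d_sq)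
    show "AE x in M. \<bar>F x (val p x) - F x (val q x) - f x (val q x) * val (p - q) x\<bar> \<le> 2 * D * \<bar>k x * val (p - q) x\<bar>"
      using F_increment jet_AE_diff[of p q]
    proof eventually_elim
      case (elim x)
      have "k x * val (p - q) x = (1 + (val p x)\<^sup>2 + (val q x)\<^sup>2) * (val p x - val q x)\<^sup>2"
        using elim by (simp add: k_def power2_eq_square mult.assoc)
      moreover have "0 \<le> (1 + (val p x)\<^sup>2 + (val q x)\<^sup>2) * (val p x - val q x)\<^sup>2" by simp
      ultimately show ?case using elim by (simp add: mult.assoc)
    qed
  qed
  also have "\<dots> = 2 * D * (\<integral>x. \<bar>k x * val (p - q) x\<bar> \<partial>M)" by simp
  also have "\<dots> \<le> 2 * D * (sqrt (\<integral>x. (k x)\<^sup>2 \<partial>M) * sqrt (\<integral>x. (val (p - q) x)\<^sup>2 \<partial>M))"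
    using D0 by (intro mult_left_mono Cauchy_Schwarz_integral k_sq d_sq) auto
  also have "\<dots> \<le> 2 * D * ((sqrt (3 + 12 * 4096 * m ^ 4) * norm (p - q)) * norm (fst p - fst q))"
  proof (intro mult_left_mono mult_mono)
    have "sqrt (\<integral>x. (k x)\<^sup>2 \<partial>M) \<le> sqrt ((3 + 12 * 4096 * m ^ 4) * (norm (p - q))\<^sup>2)"
      unfolding k_def by (intro real_sqrt_le_mono weighted_increment(2)[OF pq m])
    then show "sqrt (\<integral>x. (k x)\<^sup>2 \<partial>M) \<le> sqrt (3 + 12 * 4096 * m ^ 4) * norm (p - q)"
      by (simp add: real_sqrt_mult)
    show "sqrt (\<integral>x. (val (p - q) x)\<^sup>2 \<partial>M) \<le> norm (fst p - fst q)"
      by (simp add: integral_val_square[OF dV])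
  qed (use D0 m in auto)
  finally show ?thesis by (simp add: mult.assoc)
qed

end

section \<open>Semiflows as weak solutions\<close>

context nemytskii_setting
begin

text \<open>One coercivity constant is fixed by choice, so that it can be a parameter when the
  abstract system is instantiated.\<close>

definition c0 :: real where "c0 = (SOME c. c > 0 \<and> (\<forall>u\<in>V. c * (norm u)\<^sup>2 \<le> scal u u))"

lemma c0: "c0 > 0" "u \<in> V \<Longrightarrow> c0 * (norm u)\<^sup>2 \<le> scal u u"
proof -
  have "\<exists>c. c > 0 \<and> (\<forall>u\<in>V. c * (norm u)\<^sup>2 \<le> scal u u)" using scal_coercive by metis
  from someI_ex[OF this] show "c0 > 0" "u \<in> V \<Longrightarrow> c0 * (norm u)\<^sup>2 \<le> scal u u"
    unfolding c0_def[symmetric] by auto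
qed

lemma norm_le_form: "u \<in> V \<Longrightarrow> (norm u)\<^sup>2 \<le> form u u / c0"
  using c0(2)[of u] c0(1) by (simp add: form_eq field_simps)

lemma norm_bound_of_form: "\<exists>m>0. \<forall>u\<in>V. form u u \<le> B \<longrightarrow> norm u \<le> m"
proof (intro exI[of _ "sqrt (\<bar>B\<bar> / c0) + 1"] conjI ballI impI)
  show "0 < sqrt (\<bar>B\<bar> / c0) + 1" using c0(1) by (simp add: add_nonneg_pos)
  fix u assume u: "u \<in> V" "form u u \<le> B"
  have "(norm u)\<^sup>2 \<le> \<bar>B\<bar> / c0"
  proof -
    have "form u u / c0 \<le> \<bar>B\<bar> / c0" using u(2) c0(1) by (intro divide_right_mono) auto
    then show ?thesis using norm_le_form[OF u(1)] by linarith
  qed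
  then have "norm u \<le> sqrt (\<bar>B\<bar> / c0)" by (rule real_le_rsqrt)
  then show "norm u \<le> sqrt (\<bar>B\<bar> / c0) + 1" by simp
qed

sublocale G: gradient_system V fst form c0 fh \<Phi>
proof (intro gradient_system.intro energy_space.intro energy_space_axioms.intro gradient_system_axioms.intro)
  show "closed_subspace V" by (rule V.closed_subspace_axioms)
  show "bounded_linear (fst :: jet \<Rightarrow> L2)" by (rule bounded_linear_fst)
  show "bounded_bilinear form" by (rule bounded_bilinear_form)
  show "form x y = form y x" for x y by (rule form_sym)
  show "c0 > 0" by (rule c0)
  show "c0 * (norm x)\<^sup>2 \<le> form x x" if "x \<in> V" for x using c0(2)[OF that] that by (simp add: form_eq)
  fix B :: real
  obtain m where m: "m > 0" "\<And>u. u \<in> V \<Longrightarrow> form u u \<le> B \<Longrightarrow> norm u \<le> m"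
    using norm_bound_of_form by blast
  show "\<exists>l. \<forall>p\<in>V. \<forall>q\<in>V. form p p \<le> B \<longrightarrow> form q q \<le> B \<longrightarrow> (norm (fh p - fh q))\<^sup>2 \<le> l * form (p - q) (p - q)"
  proof (intro exI ballI impI)
    fix p q assume pq: "p \<in> V" "q \<in> V" "form p p \<le> B" "form q q \<le> B"
    have "(norm (fh p - fh q))\<^sup>2 \<le> D\<^sup>2 * (3 + 12 * 4096 * m ^ 4) * (norm (p - q))\<^sup>2"
      using pq m by (intro nemytskii_Lipschitz) auto
    also have "\<dots> \<le> D\<^sup>2 * (3 + 12 * 4096 * m ^ 4) * (form (p - q) (p - q) / c0)"
      using pq m(1) by (intro mult_left_mono norm_le_form subspace_diff[OF subspace_H10] mult_nonneg_nonneg) auto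
    finally show "(norm (fh p - fh q))\<^sup>2 \<le> (D\<^sup>2 * (3 + 12 * 4096 * m ^ 4) / c0) * form (p - q) (p - q)" by simp
  qed
  show "\<exists>K. \<forall>p\<in>V. form p p \<le> B \<longrightarrow> \<bar>\<Phi> p\<bar> \<le> K"
    using \<Phi>_bounded_on_balls m(2) by blast
  show "\<exists>K. \<forall>p\<in>V. \<forall>q\<in>V. form p p \<le> B \<longrightarrow> form q q \<le> B \<longrightarrow>
      \<bar>\<Phi> p - \<Phi> q - fh q \<bullet> (fst p - fst q)\<bar> \<le> K * norm (p - q) * norm (fst p - fst q)"
    using \<Phi>_increment m by blast
qed

end

section \<open>From mild solutions to weak solutions\<close>

locale attractor_setting = nemytskii_setting \<Omega> A a0 a1 \<beta> lam1 f F D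
  for \<Omega> A a0 a1 \<beta> lam1 f F D +
  fixes T :: "real \<Rightarrow> real \<Rightarrow> jet \<times> L2 \<Rightarrow> jet \<times> L2"
    and S :: "real \<Rightarrow> L2 \<Rightarrow> L2"
    and \<pi> :: "real \<Rightarrow> real \<Rightarrow> jet \<times> L2 \<Rightarrow> jet \<times> L2"
    and \<sigma> :: "real \<Rightarrow> jet \<Rightarrow> jet"
    and \<A> :: "real \<Rightarrow> (jet \<times> L2) set" and \<A>' :: "jet set"
    and R :: real
  assumes genT: "\<And>\<epsilon>. \<epsilon> \<in> {0<..1} \<Longrightarrow> generates (Z0 \<Omega>) (wave_graph \<Omega> A \<beta> \<epsilon>) (T \<epsilon>)"
    and genS: "generates (L2_on \<Omega>) (parabolic_graph \<Omega> A \<beta>) S"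
    and flow\<pi>: "\<And>\<epsilon>. \<epsilon> \<in> {0<..1} \<Longrightarrow> generates_semiflow (Z0 \<Omega>) (wave_mild \<Omega> f \<epsilon> (T \<epsilon>)) (\<pi> \<epsilon>)"
    and attr: "\<And>\<epsilon>. \<epsilon> \<in> {0<..1} \<Longrightarrow> compact_global_attractor (Z0 \<Omega>) (\<pi> \<epsilon>) (\<A> \<epsilon>)"
    and R: "R > 0"
    and attr_bound: "\<And>\<epsilon> u v. \<epsilon> \<in> {0<..1} \<Longrightarrow> (u, v) \<in> \<A> \<epsilon> \<Longrightarrow>
           (norm_H10 \<Omega> A \<beta> u)\<^sup>2 + \<epsilon> * (norm v)\<^sup>2 \<le> R"
    and flow\<sigma>: "generates_semiflow V (parabolic_mild \<Omega> f S) \<sigma>"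
    and attr': "compact_global_attractor V \<sigma> \<A>'"
    and attr'_dom: "\<A>' \<subseteq> dom_op \<Omega> A \<beta>"
    and attr'_compact: "compactin (dom_topology \<Omega> A \<beta>) \<A>'"
    and attr_0: "\<A> 0 = (\<lambda>u. (u, - elliptic_op \<Omega> A \<beta> u + nemytskii \<Omega> f u)) ` \<A>'"
begin

abbreviation "domA \<equiv> dom_op \<Omega> A \<beta>"
abbreviation "op \<equiv> elliptic_op \<Omega> A \<beta>"

lemma subspace_Z0: "subspace (Z0 \<Omega>)"
  unfolding Z0_def by (intro subspace_Times subspace_H10 subspace_L2_on)

lemma closed_Z0: "closed (Z0 \<Omega>)"
  unfolding Z0_def by (intro closed_Times closed_H10 closed_L2_on)

lemma wave_semigroup: "\<epsilon> \<in> {0<..1} \<Longrightarrow> C0_semigroup (Z0 \<Omega>) (wave_graph \<Omega> A \<beta> \<epsilon>) (T \<epsilon>)"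
  by unfold_locales (rule subspace_Z0 closed_Z0 genT | assumption)+

sublocale P: C0_semigroup "L2_on \<Omega>" "parabolic_graph \<Omega> A \<beta>" S
  by unfold_locales (rule subspace_L2_on closed_L2_on genS)+

text \<open>Inherited from the generation hypothesis: the domain of the generator of
  \<open>S\<close> is dense and consists of Sobolev functions.\<close>

lemma V_dense: "L2_on \<Omega> \<subseteq> closure (fst ` V)"
proof -
  have "fst ` parabolic_graph \<Omega> A \<beta> \<subseteq> fst ` V"
    by (force simp: parabolic_graph_def dom_op_def)
  then show ?thesis using P.domain_dense closure_mono by blast
qed

text \<open>Density in the jet norm, which the parabolic semigroup on the Lebesgue space would not
  provide. It is read off from the first components of the generator domain of one wave semigroup,
  with \<epsilon> = 1.\<close>

lemma domA_dense: "V \<subseteq> closure domA"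
proof
  fix b assume b: "b \<in> V"
  have "(b, 0) \<in> Z0 \<Omega>" using b subspace_0[OF subspace_L2_on] by (simp add: Z0_def)
  then have "(b, 0) \<in> closure (fst ` wave_graph \<Omega> A \<beta> 1)"
    using C0_semigroup.domain_dense[OF wave_semigroup, of 1] by auto
  then obtain w where w: "\<And>n. w n \<in> fst ` wave_graph \<Omega> A \<beta> 1" "w \<longlonglongrightarrow> (b, 0)"
    unfolding closure_sequential by blast
  have "fst (w n) \<in> domA" for n using w(1)[of n] by (auto simp: wave_graph_def)
  moreover have "(\<lambda>n. fst (w n)) \<longlonglongrightarrow> fst (b, 0::L2)" by (intro tendsto_fst w)
  ultimately show "b \<in> closure domA" unfolding closure_sequential by (intro exI[of _ "\<lambda>n. fst (w n)"]) auto
qed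

text \<open>The norm by duality: \<open>h\<close> itself is approximated by admissible test
  elements.\<close>

lemma inner_le_of_dense:
  assumes h: "h \<in> L2_on \<Omega>" and le: "\<And>v. v \<in> V \<Longrightarrow> h \<bullet> fst v \<le> k * norm (fst v)" and "k \<ge> 0"
  shows "norm h \<le> k"
proof -
  obtain w where w: "\<And>n. w n \<in> fst ` V" "w \<longlonglongrightarrow> h"
    using V_dense h unfolding closure_sequential[of h] by (metis closure_sequential subsetD)
  have "h \<bullet> h \<le> k * norm h"
  proof (rule LIMSEQ_le)
    show "(\<lambda>n. h \<bullet> w n) \<longlonglongrightarrow> h \<bullet> h" "(\<lambda>n. k * norm (w n)) \<longlonglongrightarrow> k * norm h" by (intro tendsto_intros w)+
    have "h \<bullet> w n \<le> k * norm (w n)" for n using w(1)[of n] le by auto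
    then show "\<exists>N. \<forall>n\<ge>N. h \<bullet> w n \<le> k * norm (w n)" by blast
  qed
  then have "norm h * norm h \<le> k * norm h" by (simp add: power2_norm_eq_inner[symmetric] power2_eq_square)
  then show ?thesis using \<open>k \<ge> 0\<close> by (cases "h = 0") auto
qed

text \<open>Density of \<open>V\<close> makes the representing element unique, so the definite
  description in \<open>elliptic_op\<close> has its intended value on the domain.\<close>

lemma
  assumes u: "u \<in> domA"
  shows op_in: "op u \<in> L2_on \<Omega>" and op_form: "v \<in> V \<Longrightarrow> form u v = op u \<bullet> fst v"
    and domA_V: "u \<in> V"
proof -
  show uV: "u \<in> V" using u by (simp add: dom_op_def)
  obtain h where h: "h \<in> L2_on \<Omega>" "\<forall>v\<in>V. scal u v = h \<bullet> fst v" using u by (auto simp: dom_op_def)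
  have "\<exists>!h. h \<in> L2_on \<Omega> \<and> (\<forall>v\<in>V. scal u v = h \<bullet> fst v)"
  proof (rule ex1I[of _ h])
    fix h' assume h': "h' \<in> L2_on \<Omega> \<and> (\<forall>v\<in>V. scal u v = h' \<bullet> fst v)"
    have "norm (h' - h) \<le> 0"
    proof (rule inner_le_of_dense)
      show "h' - h \<in> L2_on \<Omega>" using h h' by (intro subspace_diff[OF subspace_L2_on]) auto
      show "(h' - h) \<bullet> fst v \<le> 0 * norm (fst v)" if "v \<in> V" for v
        using h h' that by (simp add: inner_diff_left)
    qed simp
    then show "h' = h" by simp
  qed (use h in blast)
  from theI'[OF this] have *: "op u \<in> L2_on \<Omega> \<and> (\<forall>v\<in>V. scal u v = op u \<bullet> fst v)"
    unfolding elliptic_op_def .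
  then show "op u \<in> L2_on \<Omega>" "v \<in> V \<Longrightarrow> form u v = op u \<bullet> fst v" using uV by (auto simp: form_eq)
qed

text \<open>Two applications of the principle for mild solutions. Both functionals are chosen so
  that, after the generator, they extend boundedly to the phase space: the first component gives the
  velocity, and in \<epsilon> v + u, paired with a test element, the operator appears only through
  the bounded form.\<close>

lemma wave_weak:
  assumes \<epsilon>: "\<epsilon> \<in> {0<..1}" and x: "x \<in> Z0 \<Omega>"
  shows "G.weak_wave \<epsilon> (\<lambda>t. fst (\<pi> \<epsilon> t x)) (\<lambda>t. snd (\<pi> \<epsilon> t x)) (\<lambda>t. fh (fst (\<pi> \<epsilon> t x)))"
proof -
  interpret W: C0_semigroup "Z0 \<Omega>" "wave_graph \<Omega> A \<beta> \<epsilon>" "T \<epsilon>" by (rule wave_semigroup[OF \<epsilon>])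
  have flow: "global_semiflow (Z0 \<Omega>) (\<pi> \<epsilon>)"
    and sol: "\<And>x. x \<in> Z0 \<Omega> \<Longrightarrow> wave_mild \<Omega> f \<epsilon> (T \<epsilon>) x (\<lambda>t. \<pi> \<epsilon> t x)"
    using flow\<pi>[OF \<epsilon>] by (auto simp: generates_semiflow_def)
  have inZ: "\<pi> \<epsilon> t x \<in> Z0 \<Omega>" if "0 \<le> t" for t using flow that x by (auto simp: global_semiflow_def)
  have plus: "\<pi> \<epsilon> (s + t) x = \<pi> \<epsilon> s (\<pi> \<epsilon> t x)" if "0 \<le> s" "0 \<le> t" for s t
    using flow that x by (auto simp: global_semiflow_def)
  define z where "z t = \<pi> \<epsilon> t x" for t
  define h where "h t = ((0::jet), (1 / \<epsilon>) *\<^sub>R fh (fst (z t)))" for t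
  have zc: "continuous_on {0..} z" using sol[OF x] by (simp add: wave_mild_def z_def[abs_def])
  have zZ: "z t \<in> Z0 \<Omega>" if "0 \<le> t" for t unfolding z_def by (rule inZ[OF that])
  have zV: "fst (z t) \<in> V" "snd (z t) \<in> L2_on \<Omega>" if "0 \<le> t" for t
    using zZ[OF that] by (auto simp: Z0_def)
  have fc: "continuous_on {0..} (\<lambda>t. fh (fst (z t)))"
    by (rule G.f_curve_continuous) (auto intro!: continuous_intros zc zV)
  have hc: "continuous_on {0..} h" unfolding h_def by (intro continuous_intros fc)
  have hZ: "h t \<in> Z0 \<Omega>" if "0 \<le> t" for t
    unfolding h_def Z0_def
    using subspace_0[OF subspace_H10] subspace_scale[OF subspace_L2_on nemytskii_in_L2_on[OF zV(1)[OF that]]]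
    by simp
  \<comment> \<open>Restarting at time \<open>t\<close> is legitimate because the semiflow solves
    the mild equation from each of its own states.\<close>
  have mild: "((\<lambda>p. T \<epsilon> (k - p) (h (t + p))) has_integral (z (t + k) - T \<epsilon> k (z t))) {0..k}"
    if "0 \<le> t" "0 \<le> k" for t k
  proof -
    have "((\<lambda>p. T \<epsilon> (k - p) (0, (1 / \<epsilon>) *\<^sub>R fh (fst (\<pi> \<epsilon> p (\<pi> \<epsilon> t x))))) has_integral
        (\<pi> \<epsilon> k (\<pi> \<epsilon> t x) - T \<epsilon> k (\<pi> \<epsilon> t x))) {0..k}"
      using sol[OF inZ[OF that(1)]] that(2) unfolding wave_mild_def by blast
    moreover have "\<pi> \<epsilon> k (\<pi> \<epsilon> t x) = z (t + k)"
      using plus[OF that(2,1)] by (simp add: z_def add.commute)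
    moreover have "T \<epsilon> (k - p) (0, (1 / \<epsilon>) *\<^sub>R fh (fst (\<pi> \<epsilon> p (\<pi> \<epsilon> t x)))) = T \<epsilon> (k - p) (h (t + p))"
      if "p \<in> {0..k}" for p
      using plus[of p t] that \<open>0 \<le> t\<close> by (simp add: h_def z_def add.commute)
    ultimately show ?thesis using has_integral_eq by (metis (no_types, lifting) z_def)
  qed
  have d1: "((\<lambda>s. fst (fst (z s))) has_vector_derivative snd (z t)) (at t within {0..})" if "0 \<le> t" for t
  proof -
    have "((\<lambda>s. fst (fst (z s))) has_vector_derivative (snd (z t) + fst (fst (h t)))) (at t within {0..})"
    proof (rule W.mild_solution_weak[OF _ _ _ zc zZ hc hZ mild that])
      show "bounded_linear (\<lambda>x. fst (fst x) :: L2)" by (intro bounded_linear_fst_comp bounded_linear_fst)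
      show "bounded_linear (snd :: jet \<times> L2 \<Rightarrow> L2)" by (rule bounded_linear_snd)
      show "fst (fst y) = snd x" if "(x, y) \<in> wave_graph \<Omega> A \<beta> \<epsilon>" for x y
        using that by (auto simp: wave_graph_def)
    qed
    then show ?thesis by (simp add: h_def)
  qed
  have d2: "((\<lambda>s. (\<epsilon> *\<^sub>R snd (z s) + fst (fst (z s))) \<bullet> fst b) has_vector_derivative
      (- form (fst (z t)) b + fh (fst (z t)) \<bullet> fst b)) (at t within {0..})" if b: "b \<in> V" and t: "0 \<le> t" for b t
  proof -
    have "((\<lambda>s. (\<epsilon> *\<^sub>R snd (z s) + fst (fst (z s))) \<bullet> fst b) has_vector_derivative
      (- form (fst (z t)) b + (\<epsilon> *\<^sub>R snd (h t) + fst (fst (h t))) \<bullet> fst b)) (at t within {0..})"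
    proof (rule W.mild_solution_weak[OF _ _ _ zc zZ hc hZ mild t])
      show "bounded_linear (\<lambda>x :: jet \<times> L2. (\<epsilon> *\<^sub>R snd x + fst (fst x)) \<bullet> fst b)"
        by (intro bounded_linear_inner_left_comp bounded_linear_add bounded_linear_const_scaleR
            bounded_linear_fst_comp bounded_linear_fst bounded_linear_snd)
      show "bounded_linear (\<lambda>x :: jet \<times> L2. - form (fst x) b)"
        by (intro bounded_linear_minus bounded_linear_compose[OF bounded_bilinear.bounded_linear_left[OF bounded_bilinear_form] bounded_linear_fst])
      show "(\<epsilon> *\<^sub>R snd y + fst (fst y)) \<bullet> fst b = - form (fst x) b" if xy: "(x, y) \<in> wave_graph \<Omega> A \<beta> \<epsilon>" for x y
      proof -
        obtain u v where uv: "u \<in> domA" "v \<in> V" "x = (u, fst v)" "y = (v, - ((1 / \<epsilon>) *\<^sub>R (fst v + op u)))"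
          using xy by (auto simp: wave_graph_def)
        have "\<epsilon> *\<^sub>R snd y + fst (fst y) = - op u" using \<epsilon> by (simp add: uv)
        then show ?thesis using op_form[OF uv(1) b] by (simp add: uv)
      qed
    qed
    moreover have "(\<epsilon> *\<^sub>R snd (h t) + fst (fst (h t))) = fh (fst (z t))" using \<epsilon> by (simp add: h_def)
    ultimately show ?thesis by simp
  qed
  have "G.weak_wave \<epsilon> (\<lambda>t. fst (z t)) (\<lambda>t. snd (z t)) (\<lambda>t. fh (fst (z t)))"
    unfolding G.weak_wave_def
    using d1 d2 zV fc zc by (auto simp: has_real_derivative_iff_has_vector_derivative intro!: continuous_intros)
  then show ?thesis by (simp add: z_def)
qed

text \<open>The mild formula lives in the Lebesgue space, where the form is not bounded. So the test
  element is first taken from the domain of the operator, which by symmetry can be moved onto it.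
  General test elements are reached by density after integrating in time, because the integrated
  identity, unlike a derivative, passes to the limit pointwise.\<close>

lemma parabolic_weak:
  assumes x: "x \<in> V"
  shows "G.weak_parabolic (\<lambda>t. \<sigma> t x)"
proof -
  have flow: "global_semiflow V \<sigma>"
    and sol: "\<And>x. x \<in> V \<Longrightarrow> parabolic_mild \<Omega> f S x (\<lambda>t. \<sigma> t x)"
    using flow\<sigma> by (auto simp: generates_semiflow_def)
  have inV: "\<sigma> t x \<in> V" if "0 \<le> t" for t using flow that x by (auto simp: global_semiflow_def)
  have plus: "\<sigma> (s + t) x = \<sigma> s (\<sigma> t x)" if "0 \<le> s" "0 \<le> t" for s t
    using flow that x by (auto simp: global_semiflow_def)
  define u where "u t = \<sigma> t x" for t
  have uc: "continuous_on {0..} u" using sol[OF x] by (simp add: parabolic_mild_def u_def[abs_def])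
  have uV: "u t \<in> V" if "0 \<le> t" for t unfolding u_def by (rule inV[OF that])
  have fc: "continuous_on {0..} (\<lambda>t. fh (u t))" by (rule G.f_curve_continuous[OF uc uV])
  have fV: "fh (u t) \<in> L2_on \<Omega>" if "0 \<le> t" for t by (rule nemytskii_in_L2_on[OF uV[OF that]])
  have mild: "((\<lambda>p. S (k - p) (fh (u (t + p)))) has_integral (fst (u (t + k)) - S k (fst (u t)))) {0..k}"
    if "0 \<le> t" "0 \<le> k" for t k
  proof -
    have "((\<lambda>p. S (k - p) (fh (\<sigma> p (\<sigma> t x)))) has_integral (fst (\<sigma> k (\<sigma> t x)) - S k (fst (\<sigma> t x)))) {0..k}"
      using sol[OF inV[OF that(1)]] that(2) unfolding parabolic_mild_def by blast
    moreover have "\<sigma> k (\<sigma> t x) = u (t + k)"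
      using plus[OF that(2,1)] by (simp add: u_def add.commute)
    moreover have "S (k - p) (fh (\<sigma> p (\<sigma> t x))) = S (k - p) (fh (u (t + p)))" if "p \<in> {0..k}" for p
      using plus[of p t] that \<open>0 \<le> t\<close> by (simp add: u_def add.commute)
    ultimately show ?thesis using has_integral_eq by (metis (no_types, lifting) u_def)
  qed
  define U where "U t = integral {0..t} u" for t
  define \<Gamma> where "\<Gamma> t = integral {0..t} (\<lambda>t. fh (u t))" for t
  have U: "(U has_vector_derivative u t) (at t within {0..})" if "0 \<le> t" for t
    unfolding U_def by (rule integral_derivative_atLeast[OF uc that])
  have \<Gamma>: "(\<Gamma> has_vector_derivative fh (u t)) (at t within {0..})" if "0 \<le> t" for t
    unfolding \<Gamma>_def by (rule integral_derivative_atLeast[OF fc that])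
  have dform: "((\<lambda>s. form (U s) b) has_vector_derivative form (u t) b) (at t within {0..})" if "0 \<le> t" for b t
    by (rule bounded_linear.has_vector_derivative[OF bounded_bilinear.bounded_linear_left[OF bounded_bilinear_form] U[OF that]])
  have d\<Gamma>: "((\<lambda>s. \<Gamma> s \<bullet> fst b) has_vector_derivative fh (u t) \<bullet> fst b) (at t within {0..})" if "0 \<le> t" for b :: jet and t
    by (rule bounded_linear.has_vector_derivative[OF bounded_linear_inner_left \<Gamma>[OF that]])
  have dom: "fst (u t) \<bullet> fst b = fst (u 0) \<bullet> fst b - form (U t) b + \<Gamma> t \<bullet> fst b" if b: "b \<in> domA" and t: "0 \<le> t" for b t
  proof -
    define Y where "Y s = fst (u s) \<bullet> fst b + form (U s) b - \<Gamma> s \<bullet> fst b" for s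
    have "Y t = Y 0"
    proof (rule constant_of_derivative[OF _ t])
      fix r :: real assume r: "0 \<le> r"
      have "((\<lambda>s. fst (u s) \<bullet> fst b) has_vector_derivative (- (fst (u r) \<bullet> op b) + fh (u r) \<bullet> fst b)) (at r within {0..})"
      proof (rule P.mild_solution_weak[OF _ _ _ _ _ fc fV mild r])
        show "continuous_on {0..} (\<lambda>s. fst (u s))" by (intro continuous_intros uc)
        show "fst (u t) \<in> L2_on \<Omega>" if "0 \<le> t" for t by (rule H10_in_L2_on[OF uV[OF that]])
        show "bounded_linear (\<lambda>y. - (y \<bullet> op b))" by (intro bounded_linear_minus bounded_linear_inner_left)
        show "y \<bullet> fst b = - (w \<bullet> op b)" if "(w, y) \<in> parabolic_graph \<Omega> A \<beta>" for w y
        proof -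
          obtain p where p: "p \<in> domA" "w = fst p" "y = - op p" using \<open>(w, y) \<in> _\<close> by (auto simp: parabolic_graph_def)
          have "op p \<bullet> fst b = op b \<bullet> fst p"
            using op_form[OF p(1) domA_V[OF b]] op_form[OF b domA_V[OF p(1)]] form_sym[of p b] by simp
          then show ?thesis by (simp add: p inner_commute)
        qed
      qed (rule bounded_linear_inner_left)
      moreover have "fst (u r) \<bullet> op b = form (u r) b"
        using op_form[OF b uV[OF r]] by (simp add: inner_commute form_sym[of _ b])
      ultimately have "(Y has_vector_derivative (- form (u r) b + fh (u r) \<bullet> fst b) + form (u r) b - fh (u r) \<bullet> fst b) (at r within {0..})"
        unfolding Y_def by (intro has_vector_derivative_diff has_vector_derivative_add dform d\<Gamma> r) simp
      then show "(Y has_vector_derivative 0) (at r within {0..})" by simp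
    qed
    then show ?thesis by (simp add: Y_def U_def \<Gamma>_def bounded_bilinear.zero_left[OF bounded_bilinear_form])
  qed
  have all: "fst (u t) \<bullet> fst b = fst (u 0) \<bullet> fst b - form (U t) b + \<Gamma> t \<bullet> fst b" if b: "b \<in> V" and t: "0 \<le> t" for b t
  proof -
    obtain w where w: "\<And>n. w n \<in> domA" "w \<longlonglongrightarrow> b"
      using domA_dense b unfolding closure_sequential[of b] by (metis closure_sequential subsetD)
    have l1: "(\<lambda>n. fst (u t) \<bullet> fst (w n)) \<longlonglongrightarrow> fst (u t) \<bullet> fst b" by (intro tendsto_intros w)
    have "(\<lambda>n. fst (u 0) \<bullet> fst (w n) - form (U t) (w n) + \<Gamma> t \<bullet> fst (w n)) \<longlonglongrightarrow>
        fst (u 0) \<bullet> fst b - form (U t) b + \<Gamma> t \<bullet> fst b"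
      by (intro tendsto_intros w bounded_bilinear.tendsto[OF bounded_bilinear_form])
    then have "(\<lambda>n. fst (u t) \<bullet> fst (w n)) \<longlonglongrightarrow> fst (u 0) \<bullet> fst b - form (U t) b + \<Gamma> t \<bullet> fst b"
      by (simp only: dom[OF w(1) t])
    then show ?thesis by (rule LIMSEQ_unique[OF l1])
  qed
  have "((\<lambda>s. fst (u s) \<bullet> fst b) has_vector_derivative (- form (u t) b + fh (u t) \<bullet> fst b)) (at t within {0..})"
    if b: "b \<in> V" and t: "0 \<le> t" for b t
  proof (rule has_vector_derivative_transform)
    show "t \<in> {0..}" using t by simp
    show "fst (u s) \<bullet> fst b = fst (u 0) \<bullet> fst b - form (U s) b + \<Gamma> s \<bullet> fst b" if "s \<in> {0..}" for s
      by (rule all[OF b]) (use that in simp)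
    have "((\<lambda>s. fst (u 0) \<bullet> fst b - form (U s) b + \<Gamma> s \<bullet> fst b) has_vector_derivative (0 - form (u t) b + fh (u t) \<bullet> fst b)) (at t within {0..})"
      by (intro has_vector_derivative_diff has_vector_derivative_add has_vector_derivative_const dform d\<Gamma> t)
    then show "((\<lambda>s. fst (u 0) \<bullet> fst b - form (U s) b + \<Gamma> s \<bullet> fst b) has_vector_derivative (- form (u t) b + fh (u t) \<bullet> fst b)) (at t within {0..})" by simp
  qed
  then have "G.weak_parabolic u"
    unfolding G.weak_parabolic_def using uc uV by (auto simp: has_real_derivative_iff_has_vector_derivative)
  then show ?thesis by (simp add: u_def[abs_def])
qed

section \<open>Orbits in the attractors\<close>

definition orbits :: "real \<Rightarrow> ((real \<Rightarrow> jet) \<times> (real \<Rightarrow> L2)) set" where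
  "orbits \<epsilon> = (\<lambda>x. (\<lambda>t. fst (\<pi> \<epsilon> t x), \<lambda>t. snd (\<pi> \<epsilon> t x))) ` \<A> \<epsilon>"

lemma attractorD:
  assumes "\<epsilon> \<in> {0<..1}"
  shows "\<A> \<epsilon> \<subseteq> Z0 \<Omega>" "0 \<le> t \<Longrightarrow> \<pi> \<epsilon> t ` \<A> \<epsilon> = \<A> \<epsilon>"
    "\<lbrakk>0 \<le> s; 0 \<le> t; x \<in> \<A> \<epsilon>\<rbrakk> \<Longrightarrow> \<pi> \<epsilon> (s + t) x = \<pi> \<epsilon> s (\<pi> \<epsilon> t x)" "x \<in> \<A> \<epsilon> \<Longrightarrow> \<pi> \<epsilon> 0 x = x"
    "\<A> \<epsilon> \<noteq> {}"
proof -
  show sub: "\<A> \<epsilon> \<subseteq> Z0 \<Omega>" and "0 \<le> t \<Longrightarrow> \<pi> \<epsilon> t ` \<A> \<epsilon> = \<A> \<epsilon>"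
    using attr[OF assms] by (auto simp: compact_global_attractor_def)
  show "\<lbrakk>0 \<le> s; 0 \<le> t; x \<in> \<A> \<epsilon>\<rbrakk> \<Longrightarrow> \<pi> \<epsilon> (s + t) x = \<pi> \<epsilon> s (\<pi> \<epsilon> t x)" "x \<in> \<A> \<epsilon> \<Longrightarrow> \<pi> \<epsilon> 0 x = x"
    using flow\<pi>[OF assms] sub by (auto simp: generates_semiflow_def global_semiflow_def)
  \<comment> \<open>Attraction of a single point forces the attractor to be nonempty.\<close>
  have "\<forall>\<^sub>F t in at_top. \<forall>x\<in>{0}. \<exists>k\<in>\<A> \<epsilon>. dist (\<pi> \<epsilon> t x) k < 1"
    using attr[OF assms, unfolded compact_global_attractor_def, THEN conjunct2, THEN conjunct2, THEN conjunct2,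
      rule_format, of "{0}" 1] subspace_0[OF subspace_Z0] by simp
  then show "\<A> \<epsilon> \<noteq> {}" unfolding eventually_at_top_linorder by blast
qed

text \<open>Invariance is an equality of sets: every point of the attractor is the image, after any
  given time, of another point of the attractor, whose orbit is the required extension into the
  past.\<close>

lemma orbits_complete: assumes \<epsilon>: "\<epsilon> \<in> {0<..1}" shows "G.complete_orbits \<epsilon> R (orbits \<epsilon>)"
  unfolding G.complete_orbits_def orbits_def
proof (rule ballI, clarify, intro conjI allI impI)
  fix x assume x: "x \<in> \<A> \<epsilon>"
  note A = attractorD[OF \<epsilon>]
  show "G.weak_wave \<epsilon> (\<lambda>t. fst (\<pi> \<epsilon> t x)) (\<lambda>t. snd (\<pi> \<epsilon> t x)) (\<lambda>t. fh (fst (\<pi> \<epsilon> t x)))"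
    using x A(1) by (intro wave_weak \<epsilon>) auto
  show "form (fst (\<pi> \<epsilon> t x)) (fst (\<pi> \<epsilon> t x)) + \<epsilon> * (norm (snd (\<pi> \<epsilon> t x)))\<^sup>2 \<le> R" if "0 \<le> t" for t
  proof -
    have *: "\<pi> \<epsilon> t x \<in> \<A> \<epsilon>" using A(2)[OF that] x by blast
    then have "fst (\<pi> \<epsilon> t x) \<in> V" using A(1) by (auto simp: Z0_def)
    then show ?thesis using attr_bound[OF \<epsilon>, of "fst (\<pi> \<epsilon> t x)" "snd (\<pi> \<epsilon> t x)"] * by (simp add: norm_H10_form)
  qed
  fix \<tau> :: real assume \<tau>: "0 \<le> \<tau>"
  obtain x' where x': "x' \<in> \<A> \<epsilon>" "x = \<pi> \<epsilon> \<tau> x'" using A(2)[OF \<tau>] x by blast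
  have "\<pi> \<epsilon> (\<tau> + t) x' = \<pi> \<epsilon> t x" if "0 \<le> t" for t
    using A(3)[OF that \<tau> x'(1)] x'(2) by (simp add: add.commute)
  then show "\<exists>(u', v')\<in>(\<lambda>x. (\<lambda>t. fst (\<pi> \<epsilon> t x), \<lambda>t. snd (\<pi> \<epsilon> t x))) ` \<A> \<epsilon>.
      \<forall>t\<ge>0. u' (\<tau> + t) = fst (\<pi> \<epsilon> t x) \<and> v' (\<tau> + t) = snd (\<pi> \<epsilon> t x)"
    using x'(1) by (intro bexI[OF _ imageI[OF x'(1)]]) auto
qed

end

section \<open>Upper semicontinuity\<close>

context attractor_setting
begin

text \<open>The velocity of the parabolic flow as a function of the state; on \<open>\<A>'\<close>
  it is the second component of \<open>\<A> 0\<close>.\<close>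

definition Gop :: "jet \<Rightarrow> L2" where "Gop u = - op u + fh u"

lemma parabolic_attractorD:
  shows "\<A>' \<subseteq> V" "0 \<le> t \<Longrightarrow> k \<in> \<A>' \<Longrightarrow> \<sigma> t k \<in> \<A>'" "\<A>' \<noteq> {}" "k \<in> V \<Longrightarrow> \<sigma> 0 k = k"
    "continuous_on ({0..} \<times> V) (\<lambda>(t, x). \<sigma> t x)"
    "\<lbrakk>B \<subseteq> V; bounded B; \<delta> > 0\<rbrakk> \<Longrightarrow> \<forall>\<^sub>F t in at_top. \<forall>x\<in>B. \<exists>k\<in>\<A>'. dist (\<sigma> t x) k < \<delta>"
proof -
  show "\<A>' \<subseteq> V" using attr' by (simp add: compact_global_attractor_def)
  show "\<sigma> t k \<in> \<A>'" if "0 \<le> t" "k \<in> \<A>'" using attr' that unfolding compact_global_attractor_def by blast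
  show "k \<in> V \<Longrightarrow> \<sigma> 0 k = k" "continuous_on ({0..} \<times> V) (\<lambda>(t, x). \<sigma> t x)"
    using flow\<sigma> by (auto simp: generates_semiflow_def global_semiflow_def)
  show attracts: "\<lbrakk>B \<subseteq> V; bounded B; \<delta> > 0\<rbrakk> \<Longrightarrow> \<forall>\<^sub>F t in at_top. \<forall>x\<in>B. \<exists>k\<in>\<A>'. dist (\<sigma> t x) k < \<delta>" for B and \<delta> :: real
    using attr'[unfolded compact_global_attractor_def, THEN conjunct2, THEN conjunct2, THEN conjunct2] by blast
  have "\<forall>\<^sub>F t in at_top. \<forall>x\<in>{0}. \<exists>k\<in>\<A>'. dist (\<sigma> t x) k < 1"
    by (rule attracts) (use subspace_0[OF subspace_H10] in auto)
  then show "\<A>' \<noteq> {}" unfolding eventually_at_top_linorder by blast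
qed

lemma form_upper: obtains C where "C > 0" "\<And>u. u \<in> V \<Longrightarrow> form u u \<le> C * (norm u)\<^sup>2"
proof -
  obtain K where K: "K \<ge> 0" "\<And>u. u \<in> V \<Longrightarrow> scal u u \<le> K * (norm u)\<^sup>2" using scal_upper by blast
  show thesis
  proof (rule that[of "K + 1"])
    fix u assume u: "u \<in> V"
    have "form u u \<le> K * (norm u)\<^sup>2" using K(2)[OF u] u by (simp add: form_eq)
    also have "\<dots> \<le> (K + 1) * (norm u)\<^sup>2" by (intro mult_right_mono) auto
    finally show "form u u \<le> (K + 1) * (norm u)\<^sup>2" .
  qed (use K in simp)
qed

text \<open>The first regularity bound makes \<open>\<epsilon> *\<^sub>R v\<close> Lipschitz with
  constant sqrt (\<epsilon> K), so the squared constant in the abstract comparison is \<epsilon>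
  K.\<close>

lemma wave_parabolic_comparison:
  assumes "L \<ge> 0"
  obtains \<Lambda> \<epsilon>0 K where "\<Lambda> \<ge> 1" "0 < \<epsilon>0" "\<epsilon>0 \<le> 1" "K \<ge> 0"
    "\<And>\<epsilon> x y t. 0 < \<epsilon> \<Longrightarrow> \<epsilon> \<le> \<epsilon>0 \<Longrightarrow> x \<in> \<A> \<epsilon> \<Longrightarrow> y \<in> V \<Longrightarrow> \<Lambda> * (form (fst x - y) (fst x - y) + \<epsilon> * K) < 1 \<Longrightarrow>
       0 \<le> t \<Longrightarrow> t \<le> L \<Longrightarrow> form (fst (\<pi> \<epsilon> t x) - \<sigma> t y) (fst (\<pi> \<epsilon> t x) - \<sigma> t y) \<le> \<Lambda> * (form (fst x - y) (fst x - y) + \<epsilon> * K)"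
    "\<And>\<epsilon> x h. 0 < \<epsilon> \<Longrightarrow> \<epsilon> \<le> \<epsilon>0 \<Longrightarrow> x \<in> \<A> \<epsilon> \<Longrightarrow> 0 \<le> h \<Longrightarrow> h \<le> 1 \<Longrightarrow> (norm (snd (\<pi> \<epsilon> h x) - snd x))\<^sup>2 \<le> K * h"
proof -
  obtain \<epsilon>0 K where \<epsilon>0: "\<epsilon>0 > 0" and K: "K \<ge> 0" and
    reg1: "\<And>\<epsilon> Orb u v t h. 0 < \<epsilon> \<Longrightarrow> \<epsilon> \<le> \<epsilon>0 \<Longrightarrow> G.complete_orbits \<epsilon> R Orb \<Longrightarrow> (u, v) \<in> Orb \<Longrightarrow> 0 \<le> t \<Longrightarrow> 0 \<le> h \<Longrightarrow>
       \<epsilon> * (norm (v (t + h) - v t))\<^sup>2 \<le> K * h\<^sup>2" and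
    reg2: "\<And>\<epsilon> Orb u v t h. 0 < \<epsilon> \<Longrightarrow> \<epsilon> \<le> \<epsilon>0 \<Longrightarrow> G.complete_orbits \<epsilon> R Orb \<Longrightarrow> (u, v) \<in> Orb \<Longrightarrow> 0 \<le> t \<Longrightarrow> 0 \<le> h \<Longrightarrow> h \<le> 1 \<Longrightarrow>
       (norm (v (t + h) - v t))\<^sup>2 \<le> K * h"
    using G.orbit_regularity[OF R] by blast
  obtain \<Lambda> where \<Lambda>: "\<Lambda> \<ge> 1" and
    comp: "\<And>\<epsilon> \<kappa> u v u' t. G.weak_wave \<epsilon> u v (\<lambda>t. fh (u t)) \<Longrightarrow> (\<And>t. 0 \<le> t \<Longrightarrow> form (u t) (u t) \<le> R) \<Longrightarrow>
       (\<And>s t. 0 \<le> s \<Longrightarrow> s \<le> t \<Longrightarrow> norm (\<epsilon> *\<^sub>R v t - \<epsilon> *\<^sub>R v s) \<le> \<kappa> * (t - s)) \<Longrightarrow> G.weak_parabolic u' \<Longrightarrow>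
       \<Lambda> * (form (u 0 - u' 0) (u 0 - u' 0) + \<kappa>\<^sup>2) < 1 \<Longrightarrow> 0 \<le> t \<Longrightarrow> t \<le> L \<Longrightarrow>
       form (u t - u' t) (u t - u' t) \<le> \<Lambda> * (form (u 0 - u' 0) (u 0 - u' 0) + \<kappa>\<^sup>2)"
    using G.comparison[OF assms, of R] by blast
  show thesis
  proof (rule that[OF \<Lambda> _ _ K, of "min \<epsilon>0 1"])
    fix \<epsilon> x assume e: "0 < \<epsilon>" "\<epsilon> \<le> min \<epsilon>0 1" and x: "x \<in> \<A> \<epsilon>"
    have \<epsilon>: "\<epsilon> \<in> {0<..1}" "\<epsilon> \<le> \<epsilon>0" using e by auto
    note A = attractorD[OF \<epsilon>(1)]
    define u where "u = (\<lambda>t. fst (\<pi> \<epsilon> t x))"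
    define v where "v = (\<lambda>t. snd (\<pi> \<epsilon> t x))"
    have orb: "(u, v) \<in> orbits \<epsilon>" using x by (auto simp: orbits_def u_def v_def)
    note co = orbits_complete[OF \<epsilon>(1)]
    have ww: "G.weak_wave \<epsilon> u v (\<lambda>t. fh (u t))" and bd: "\<And>t. 0 \<le> t \<Longrightarrow> form (u t) (u t) + \<epsilon> * (norm (v t))\<^sup>2 \<le> R"
      using co orb unfolding G.complete_orbits_def by auto
    have u0: "u 0 = fst x" and v0: "v 0 = snd x" using A(4)[OF x] by (simp_all add: u_def v_def)
    have \<kappa>: "norm (\<epsilon> *\<^sub>R v t - \<epsilon> *\<^sub>R v s) \<le> sqrt (\<epsilon> * K) * (t - s)" if "0 \<le> s" "s \<le> t" for s t
    proof (rule power2_le_imp_le)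
      have "(norm (\<epsilon> *\<^sub>R v t - \<epsilon> *\<^sub>R v s))\<^sup>2 = \<epsilon> * (\<epsilon> * (norm (v t - v s))\<^sup>2)"
        using e(1) by (simp add: scaleR_diff_right[symmetric] power_mult_distrib power2_eq_square)
      also have "\<dots> \<le> \<epsilon> * (K * (t - s)\<^sup>2)"
        using reg1[OF e(1) \<epsilon>(2) co orb that(1), of "t - s"] that e(1) by (intro mult_left_mono) auto
      also have "\<dots> = (sqrt (\<epsilon> * K) * (t - s))\<^sup>2" using e(1) K by (simp add: power_mult_distrib)
      finally show "(norm (\<epsilon> *\<^sub>R v t - \<epsilon> *\<^sub>R v s))\<^sup>2 \<le> (sqrt (\<epsilon> * K) * (t - s))\<^sup>2" .
      show "0 \<le> sqrt (\<epsilon> * K) * (t - s)" using e(1) K that by simp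
    qed
    have sq: "(sqrt (\<epsilon> * K))\<^sup>2 = \<epsilon> * K" using e(1) K by simp
    have aR: "form (u t) (u t) \<le> R" if "0 \<le> t" for t
      using bd[OF that] mult_nonneg_nonneg[OF less_imp_le[OF e(1)] zero_le_power2[of "norm (v t)"]] by linarith
    { fix y t assume y: "y \<in> V" and small: "\<Lambda> * (form (fst x - y) (fst x - y) + \<epsilon> * K) < 1" and t: "0 \<le> t" "t \<le> L"
      show "form (fst (\<pi> \<epsilon> t x) - \<sigma> t y) (fst (\<pi> \<epsilon> t x) - \<sigma> t y) \<le> \<Lambda> * (form (fst x - y) (fst x - y) + \<epsilon> * K)"
        using comp[OF ww aR \<kappa> parabolic_weak[OF y] _ t, unfolded sq] small
        by (simp add: u0 parabolic_attractorD(4)[OF y]) (simp add: u_def) }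
    fix h :: real assume h: "0 \<le> h" "h \<le> 1"
    show "(norm (snd (\<pi> \<epsilon> h x) - snd x))\<^sup>2 \<le> K * h"
      using reg2[OF e(1) \<epsilon>(2) co orb order_refl h] v0 by (simp add: v_def)
  qed (use \<epsilon>0 in auto)
qed

text \<open>The parabolic orbit starts at the first component of a point of the wave attractor, so
  the initial difference is 0 and only the term with \<epsilon> K remains. The time \<open>L\<close>
  is that in which the whole energy ball is attracted; it depends on \<open>\<delta>\<close> but not
  on \<epsilon>, which is chosen small afterwards.\<close>

lemma wave_attractor_near_parabolic:
  assumes "\<delta> > 0"
  obtains \<epsilon>1 where "0 < \<epsilon>1" "\<epsilon>1 \<le> 1"
    "\<And>\<epsilon> x. 0 < \<epsilon> \<Longrightarrow> \<epsilon> < \<epsilon>1 \<Longrightarrow> x \<in> \<A> \<epsilon> \<Longrightarrow> \<exists>k\<in>\<A>'. form (fst x - k) (fst x - k) < \<delta>"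
proof -
  obtain C where C: "C > 0" "\<And>u. u \<in> V \<Longrightarrow> form u u \<le> C * (norm u)\<^sup>2" using form_upper by blast
  define B where "B = {u \<in> V. form u u \<le> R}"
  obtain m where m: "\<And>u. u \<in> V \<Longrightarrow> form u u \<le> R \<Longrightarrow> norm u \<le> m" using norm_bound_of_form[of R] by blast
  \<comment> \<open>In the energy norm the distance to \<open>\<A>'\<close> then contributes
    \<delta> / 8.\<close>
  define \<rho> where "\<rho> = sqrt (\<delta> / (8 * C))"
  have \<rho>: "\<rho> > 0" "\<rho>\<^sup>2 = \<delta> / (8 * C)" using assms C(1) by (auto simp: \<rho>_def)
  have "B \<subseteq> V" "bounded B" using m by (auto simp: B_def bounded_iff)
  then obtain L0 where L0: "\<And>t. t \<ge> L0 \<Longrightarrow> \<forall>x\<in>B. \<exists>k\<in>\<A>'. dist (\<sigma> t x) k < \<rho>"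
    using parabolic_attractorD(6)[OF _ _ \<rho>(1)] unfolding eventually_at_top_linorder by blast
  define L where "L = max L0 0"
  have L: "L \<ge> 0" and near: "\<And>x. x \<in> B \<Longrightarrow> \<exists>k\<in>\<A>'. dist (\<sigma> L x) k < \<rho>" using L0[of L] by (auto simp: L_def)
  obtain \<Lambda> \<epsilon>0 K where *: "\<Lambda> \<ge> 1" "0 < \<epsilon>0" "\<epsilon>0 \<le> 1" "K \<ge> 0"
    "\<And>\<epsilon> x y t. 0 < \<epsilon> \<Longrightarrow> \<epsilon> \<le> \<epsilon>0 \<Longrightarrow> x \<in> \<A> \<epsilon> \<Longrightarrow> y \<in> V \<Longrightarrow> \<Lambda> * (form (fst x - y) (fst x - y) + \<epsilon> * K) < 1 \<Longrightarrow>
       0 \<le> t \<Longrightarrow> t \<le> L \<Longrightarrow> form (fst (\<pi> \<epsilon> t x) - \<sigma> t y) (fst (\<pi> \<epsilon> t x) - \<sigma> t y) \<le> \<Lambda> * (form (fst x - y) (fst x - y) + \<epsilon> * K)"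
    using wave_parabolic_comparison[OF L] by metis
  \<comment> \<open>The bound 1 is the smallness condition of the comparison. Twice \<delta> / 4
    plus twice \<delta> / 8 stays below \<delta>.\<close>
  define q where "q = min 1 (\<delta> / 4)"
  define \<epsilon>1 where "\<epsilon>1 = min \<epsilon>0 (q / (\<Lambda> * (K + 1)))"
  have q: "q > 0" using assms by (simp add: q_def)
  have pos: "\<Lambda> * (K + 1) > 0" using *(1,4) by simp
  show thesis
  proof (rule that[of \<epsilon>1])
    show "0 < \<epsilon>1" using *(2) q pos by (simp add: \<epsilon>1_def)
    show "\<epsilon>1 \<le> 1" using *(3) by (simp add: \<epsilon>1_def)
    fix \<epsilon> x assume e: "0 < \<epsilon>" "\<epsilon> < \<epsilon>1" and x: "x \<in> \<A> \<epsilon>"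
    have \<epsilon>: "\<epsilon> \<in> {0<..1}" "\<epsilon> \<le> \<epsilon>0" using e *(3) by (auto simp: \<epsilon>1_def)
    note A = attractorD[OF \<epsilon>(1)]
    obtain x' where x': "x' \<in> \<A> \<epsilon>" "x = \<pi> \<epsilon> L x'" using A(2)[OF L] x by blast
    have V': "fst x' \<in> V" "fst x \<in> V" using A(1) x' x by (auto simp: Z0_def)
    have "form (fst x') (fst x') \<le> R"
      using attr_bound[OF \<epsilon>(1), of "fst x'" "snd x'"] x'(1) norm_H10_form[OF V'(1)]
        mult_nonneg_nonneg[OF less_imp_le[OF e(1)] zero_le_power2[of "norm (snd x')"]] by simp
    then have "fst x' \<in> B" using V' by (simp add: B_def)
    from near[OF this] obtain k where k: "k \<in> \<A>'" "dist (\<sigma> L (fst x')) k < \<rho>" by blast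
    have "\<epsilon> < q / (\<Lambda> * (K + 1))" using e by (simp add: \<epsilon>1_def)
    then have "\<epsilon> * (\<Lambda> * (K + 1)) < q" using pos by (simp add: pos_less_divide_eq)
    moreover have "\<Lambda> * (\<epsilon> * K) \<le> \<epsilon> * (\<Lambda> * (K + 1))" using e(1) *(1) by (simp add: algebra_simps)
    ultimately have small: "\<Lambda> * (\<epsilon> * K) < q" by linarith
    define y where "y = \<sigma> L (fst x')"
    have yV: "y \<in> V" unfolding y_def using parabolic_weak[OF V'(1)] L by (simp add: G.weak_parabolic_def)
    have kV: "k \<in> V" using k parabolic_attractorD(1) by blast
    have z: "form 0 0 = 0" by (simp add: bounded_bilinear.zero_left[OF bounded_bilinear_form])
    have 1: "form (fst x - y) (fst x - y) < \<delta> / 4"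
      using *(5)[OF e(1) \<epsilon>(2) x'(1) V'(1) _ L order_refl] small x'(2) by (simp add: z y_def q_def)
    have "form (y - k) (y - k) \<le> C * (norm (y - k))\<^sup>2" by (intro C subspace_diff[OF subspace_H10] yV kV)
    also have "\<dots> \<le> C * \<rho>\<^sup>2" using k(2) C(1) by (intro mult_left_mono power_mono) (auto simp: y_def dist_norm)
    also have "\<dots> = \<delta> / 8" using C(1) by (simp add: \<rho>(2))
    finally have 2: "form (y - k) (y - k) \<le> \<delta> / 8" .
    have "form ((fst x - y) - (k - y)) ((fst x - y) - (k - y)) \<le> 2 * form (fst x - y) (fst x - y) + 2 * form (k - y) (k - y)"
      by (intro G.a_diff_le subspace_diff[OF subspace_H10] yV kV V')
    moreover have "form (k - y) (k - y) = form (y - k) (y - k)"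
      using bounded_bilinear.minus_left[OF bounded_bilinear_form, of "y - k" "k - y"]
        bounded_bilinear.minus_right[OF bounded_bilinear_form, of "y - k" "y - k"] by simp
    ultimately have "form (fst x - k) (fst x - k) < \<delta>" using 1 2 assms by simp
    then show "\<exists>k\<in>\<A>'. form (fst x - k) (fst x - k) < \<delta>" using k(1) by blast
  qed
qed

text \<open>Coercivity makes the metric of the domain stronger than the jet norm; in particular it
  separates points.\<close>

lemma op_diff_bound:
  assumes "u \<in> domA" "v \<in> domA" shows "c0 * norm (u - v) \<le> norm (op u - op v)"
proof (cases "u = v")
  case False
  have dV: "u - v \<in> V" using assms domA_V by (intro subspace_diff[OF subspace_H10])
  have "c0 * (norm (u - v))\<^sup>2 \<le> form (u - v) (u - v)" using c0(2)[OF dV] dV by (simp add: form_eq)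
  also have "\<dots> = (op u - op v) \<bullet> fst (u - v)"
    using op_form[OF assms(1) dV] op_form[OF assms(2) dV]
    by (simp add: bounded_bilinear.diff_left[OF bounded_bilinear_form] inner_diff_left)
  also have "\<dots> \<le> norm (op u - op v) * norm (fst (u - v))" by (rule norm_cauchy_schwarz)
  also have "\<dots> \<le> norm (op u - op v) * norm (u - v)"
    using norm_fst_le[of "fst (u - v)" "snd (u - v)", unfolded prod.collapse] by (rule mult_left_mono) simp
  finally have "(c0 * norm (u - v)) * norm (u - v) \<le> norm (op u - op v) * norm (u - v)"
    by (simp add: power2_eq_square mult.assoc)
  then show ?thesis using False by simp
qed simp

lemma attractor_sequence_limit:
  fixes s :: "nat \<Rightarrow> jet"
  assumes "range s \<subseteq> \<A>'"
  obtains l r where "l \<in> \<A>'" "strict_mono r" "(\<lambda>n. op (s (r n))) \<longlonglongrightarrow> op l" "(\<lambda>n. s (r n)) \<longlonglongrightarrow> l"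
proof -
  have M: "Metric_space domA (\<lambda>u v. norm (op u - op v))"
  proof
    fix x y z
    show "norm (op x - op y) = norm (op y - op x)" by (rule norm_minus_commute)
    show "norm (op x - op z) \<le> norm (op x - op y) + norm (op y - op z)"
      using norm_triangle_ineq[of "op x - op y" "op y - op z"] by simp
    assume xy: "x \<in> domA" "y \<in> domA"
    show "norm (op x - op y) = 0 \<longleftrightarrow> x = y"
    proof
      assume "norm (op x - op y) = 0"
      then have "c0 * norm (x - y) \<le> 0" using op_diff_bound[OF xy] by simp
      then show "x = y" using c0(1) by (simp add: mult_le_0_iff)
    qed simp
  qed simp
  have "compactin (Metric_space.mtopology domA (\<lambda>u v. norm (op u - op v))) \<A>'"
    using attr'_compact by (simp add: dom_topology_def)
  then obtain l r where lr: "l \<in> \<A>'" "strict_mono r"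
    "limitin (Metric_space.mtopology domA (\<lambda>u v. norm (op u - op v))) (s \<circ> r) l sequentially"
    using assms unfolding Metric_space.compactin_sequentially[OF M] by blast
  have dom: "s n \<in> domA" "l \<in> domA" for n using assms lr(1) attr'_dom by auto
  have opl: "(\<lambda>n. op (s (r n))) \<longlonglongrightarrow> op l"
  proof (rule tendstoI)
    fix e :: real assume "e > 0"
    then have "\<forall>\<^sub>F n in sequentially. (s \<circ> r) n \<in> domA \<and> norm (op ((s \<circ> r) n) - op l) < e"
      using lr(3) unfolding Metric_space.limitin_metric[OF M] by blast
    then show "\<forall>\<^sub>F n in sequentially. dist (op (s (r n))) (op l) < e"
      by (rule eventually_mono) (simp add: dist_norm)
  qed
  have "(\<lambda>n. s (r n) - l) \<longlonglongrightarrow> 0"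
  proof (rule Lim_null_comparison)
    show "\<forall>\<^sub>F n in sequentially. norm (s (r n) - l) \<le> norm (op (s (r n)) - op l) / c0"
      using op_diff_bound[OF dom(1) dom(2)] c0(1)
      by (intro always_eventually allI) (simp add: pos_le_divide_eq mult.commute)
    have "(\<lambda>n. norm (op (s (r n)) - op l) / c0) \<longlonglongrightarrow> norm (op l - op l) / c0"
      by (intro tendsto_intros opl) (use c0(1) in simp)
    then show "(\<lambda>n. norm (op (s (r n)) - op l) / c0) \<longlonglongrightarrow> 0" by simp
  qed
  then have "(\<lambda>n. s (r n)) \<longlonglongrightarrow> l" by (simp add: LIM_zero_iff)
  then show thesis using that lr opl by blast
qed

text \<open>Otherwise there are points of \<open>\<A>'\<close> and times tending to 0 with a
  velocity jump above \<open>\<alpha>\<close>. Both the points and their images lie in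
  \<open>\<A>'\<close>, so along a subsequence both converge in the domain of the operator. The
  semiflow is known to be continuous only in the Sobolev topology, but this already identifies the
  two limits, and then the jumps tend to 0.\<close>

lemma Gop_modulus:
  assumes "\<alpha> > 0"
  obtains h where "0 < h" "h \<le> 1" "\<And>k s. k \<in> \<A>' \<Longrightarrow> 0 \<le> s \<Longrightarrow> s \<le> h \<Longrightarrow> norm (Gop (\<sigma> s k) - Gop k) \<le> \<alpha>"
proof (rule ccontr)
  assume neg: "\<not> thesis"
  have "\<exists>k s. k \<in> \<A>' \<and> 0 \<le> s \<and> s \<le> 1 / real (Suc n) \<and> \<alpha> < norm (Gop (\<sigma> s k) - Gop k)" for n
    using neg that[of "1 / real (Suc n)"] by (force simp: not_le)
  then obtain k s where ks: "\<And>n. k n \<in> \<A>'" "\<And>n. 0 \<le> s n" "\<And>n. s n \<le> 1 / real (Suc n)"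
    "\<And>n. \<alpha> < norm (Gop (\<sigma> (s n) (k n)) - Gop (k n))" by metis
  have s0: "s \<longlonglongrightarrow> 0"
    by (rule tendsto_sandwich[of "\<lambda>_. 0" _ _ "\<lambda>n. 1 / real (Suc n)"])
       (auto intro!: always_eventually ks LIMSEQ_Suc lim_1_over_n simp del: of_nat_Suc)
  obtain l r where lr: "l \<in> \<A>'" "strict_mono r" "(\<lambda>n. op (k (r n))) \<longlonglongrightarrow> op l" "(\<lambda>n. k (r n)) \<longlonglongrightarrow> l"
    using attractor_sequence_limit[of k] ks(1) by blast
  have "range (\<lambda>n. \<sigma> (s (r n)) (k (r n))) \<subseteq> \<A>'" using parabolic_attractorD(2) ks by blast
  then obtain l' r' where lr': "l' \<in> \<A>'" "strict_mono r'"
    "(\<lambda>n. op (\<sigma> (s (r (r' n))) (k (r (r' n))))) \<longlonglongrightarrow> op l'" "(\<lambda>n. \<sigma> (s (r (r' n))) (k (r (r' n)))) \<longlonglongrightarrow> l'"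
    by (rule attractor_sequence_limit)
  have AV: "\<And>x. x \<in> \<A>' \<Longrightarrow> x \<in> V" using parabolic_attractorD(1) by blast
  have s0': "(\<lambda>n. s (r (r' n))) \<longlonglongrightarrow> 0"
    using LIMSEQ_subseq_LIMSEQ[OF LIMSEQ_subseq_LIMSEQ[OF s0 lr(2)] lr'(2)] by (simp add: o_def)
  have k': "(\<lambda>n. k (r (r' n))) \<longlonglongrightarrow> l" using LIMSEQ_subseq_LIMSEQ[OF lr(4) lr'(2)] by (simp add: o_def)
  have opk': "(\<lambda>n. op (k (r (r' n)))) \<longlonglongrightarrow> op l" using LIMSEQ_subseq_LIMSEQ[OF lr(3) lr'(2)] by (simp add: o_def)
  have "(\<lambda>n. (\<lambda>(t, x). \<sigma> t x) (s (r (r' n)), k (r (r' n)))) \<longlonglongrightarrow> (\<lambda>(t, x). \<sigma> t x) (0, l)"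
    by (rule continuous_on_tendsto_compose[OF parabolic_attractorD(5)])
       (use ks lr(1) AV in \<open>auto intro!: tendsto_Pair s0' k'\<close>)
  then have "(\<lambda>n. \<sigma> (s (r (r' n))) (k (r (r' n)))) \<longlonglongrightarrow> l"
    using parabolic_attractorD(4)[OF AV[OF lr(1)]] by simp
  then have l': "l' = l" using lr'(4) LIMSEQ_unique by blast
  have fl: "(\<lambda>n. fh (w n)) \<longlonglongrightarrow> fh l" if "w \<longlonglongrightarrow> l" "\<And>n. w n \<in> V" for w
    by (rule continuous_on_tendsto_compose[OF G.f_continuous that(1)]) (use that(2) AV[OF lr(1)] in auto)
  have "(\<lambda>n. norm (Gop (\<sigma> (s (r (r' n))) (k (r (r' n)))) - Gop (k (r (r' n))))) \<longlonglongrightarrow> norm (Gop l - Gop l)"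
    unfolding Gop_def
    by (intro tendsto_intros lr'(3)[unfolded l'] opk' fl lr'(4)[unfolded l'] k' AV parabolic_attractorD(2) ks)
  then have "\<forall>\<^sub>F n in sequentially. norm (Gop (\<sigma> (s (r (r' n))) (k (r (r' n)))) - Gop (k (r (r' n)))) < \<alpha>"
    by (rule order_tendstoD(2)) (use assms in simp)
  then obtain n where "norm (Gop (\<sigma> (s (r (r' n))) (k (r (r' n)))) - Gop (k (r (r' n)))) < \<alpha>"
    unfolding eventually_sequentially by blast
  then show False using ks(4)[of "r (r' n)"] by linarith
qed

text \<open>Tested with a fixed element of \<open>V\<close>, the flow has derivative
  \<open>Gop\<close>, whose deviation from its initial value is at most \<open>\<alpha>\<close>; the
  norm of the increment is then recovered by duality.\<close>

lemma parabolic_increment: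
  assumes k: "k \<in> \<A>'" and h: "0 \<le> h" and mod: "\<And>s. 0 \<le> s \<Longrightarrow> s \<le> h \<Longrightarrow> norm (Gop (\<sigma> s k) - Gop k) \<le> \<alpha>"
  shows "norm (fst (\<sigma> h k) - fst k - h *\<^sub>R Gop k) \<le> \<alpha> * h"
proof (rule inner_le_of_dense)
  have AV: "\<And>x. x \<in> \<A>' \<Longrightarrow> x \<in> V" and Adom: "\<And>x. x \<in> \<A>' \<Longrightarrow> x \<in> domA"
    using parabolic_attractorD(1) attr'_dom by auto
  have inA: "\<sigma> s k \<in> \<A>'" if "0 \<le> s" for s using parabolic_attractorD(2)[OF that k] .
  have GL: "Gop k \<in> L2_on \<Omega>"
    unfolding Gop_def using op_in[OF Adom[OF k]] nemytskii_in_L2_on[OF AV[OF k]]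
    by (intro subspace_add[OF subspace_L2_on] subspace_neg[OF subspace_L2_on])
  show "fst (\<sigma> h k) - fst k - h *\<^sub>R Gop k \<in> L2_on \<Omega>"
    using H10_in_L2_on(1)[OF AV[OF inA[OF h]]] H10_in_L2_on(1)[OF AV[OF k]] GL
    by (intro subspace_diff[OF subspace_L2_on] subspace_scale[OF subspace_L2_on])
  have \<alpha>: "0 \<le> \<alpha>" using mod[of 0] h norm_ge_zero order_trans by blast
  then show "0 \<le> \<alpha> * h" using h by simp
  fix b assume b: "b \<in> V"
  have d: "((\<lambda>s. fst (\<sigma> s k) \<bullet> fst b) has_vector_derivative (Gop (\<sigma> s k) \<bullet> fst b)) (at s within {0..})" if "0 \<le> s" for s
  proof -
    have "((\<lambda>s. fst (\<sigma> s k) \<bullet> fst b) has_vector_derivative (- form (\<sigma> s k) b + fh (\<sigma> s k) \<bullet> fst b)) (at s within {0..})"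
      using parabolic_weak[OF AV[OF k]] b that
      by (simp add: G.weak_parabolic_def has_real_derivative_iff_has_vector_derivative)
    then show ?thesis using op_form[OF Adom[OF inA[OF that]] b] by (simp add: Gop_def inner_diff_left)
  qed
  have "norm (fst (\<sigma> h k) \<bullet> fst b - fst (\<sigma> 0 k) \<bullet> fst b - (h - 0) *\<^sub>R (Gop k \<bullet> fst b)) \<le> (\<alpha> * norm (fst b)) * (h - 0)"
  proof (rule increment_bound[OF d order_refl h])
    fix r assume r: "0 \<le> r" "r \<le> h"
    have "norm (Gop (\<sigma> r k) \<bullet> fst b - Gop k \<bullet> fst b) = \<bar>(Gop (\<sigma> r k) - Gop k) \<bullet> fst b\<bar>" by (simp add: inner_diff_left)
    also have "\<dots> \<le> norm (Gop (\<sigma> r k) - Gop k) * norm (fst b)" by (rule Cauchy_Schwarz_ineq2)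
    also have "\<dots> \<le> \<alpha> * norm (fst b)" by (intro mult_right_mono mod r) simp
    finally show "norm (Gop (\<sigma> r k) \<bullet> fst b - Gop k \<bullet> fst b) \<le> \<alpha> * norm (fst b)" .
  qed
  then have "\<bar>(fst (\<sigma> h k) - fst k - h *\<^sub>R Gop k) \<bullet> fst b\<bar> \<le> \<alpha> * norm (fst b) * h"
    using parabolic_attractorD(4)[OF AV[OF k]] by (simp add: inner_diff_left)
  then show "(fst (\<sigma> h k) - fst k - h *\<^sub>R Gop k) \<bullet> fst b \<le> \<alpha> * h * norm (fst b)" by (simp add: mult_ac)
qed

text \<open>The order of the choices matters. The quotient step \<open>h\<close> is fixed first,
  from the Hoelder bound on the wave side and the compactness bound on the parabolic side, both
  independent of \<epsilon>. Only then is the distance of the two flows made small compared with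
  \<open>h\<close>, which compensates for the division by \<open>h\<close>.\<close>

lemma wave_attractor_near_A0:
  assumes \<eta>: "\<eta> > 0"
  obtains \<epsilon>1 where "0 < \<epsilon>1" "\<epsilon>1 \<le> 1"
    "\<And>\<epsilon> x. 0 < \<epsilon> \<Longrightarrow> \<epsilon> < \<epsilon>1 \<Longrightarrow> x \<in> \<A> \<epsilon> \<Longrightarrow> \<exists>z\<in>\<A> 0. norm_Z0 \<Omega> A \<beta> (x - z) \<le> \<eta>"
proof -
  \<comment> \<open>The velocity error will be 3 \<alpha>, that is, \<eta> / 2.\<close>
  define \<alpha> where "\<alpha> = \<eta> / 6"
  have \<alpha>: "\<alpha> > 0" using \<eta> by (simp add: \<alpha>_def)
  obtain \<Lambda> \<epsilon>0 K where \<Lambda>: "\<Lambda> \<ge> 1" and \<epsilon>0: "0 < \<epsilon>0" "\<epsilon>0 \<le> 1" and K: "K \<ge> 0" and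
    comp: "\<And>\<epsilon> x y t. 0 < \<epsilon> \<Longrightarrow> \<epsilon> \<le> \<epsilon>0 \<Longrightarrow> x \<in> \<A> \<epsilon> \<Longrightarrow> y \<in> V \<Longrightarrow> \<Lambda> * (form (fst x - y) (fst x - y) + \<epsilon> * K) < 1 \<Longrightarrow>
       0 \<le> t \<Longrightarrow> t \<le> 1 \<Longrightarrow> form (fst (\<pi> \<epsilon> t x) - \<sigma> t y) (fst (\<pi> \<epsilon> t x) - \<sigma> t y) \<le> \<Lambda> * (form (fst x - y) (fst x - y) + \<epsilon> * K)" and
    Hoelder: "\<And>\<epsilon> x h. 0 < \<epsilon> \<Longrightarrow> \<epsilon> \<le> \<epsilon>0 \<Longrightarrow> x \<in> \<A> \<epsilon> \<Longrightarrow> 0 \<le> h \<Longrightarrow> h \<le> 1 \<Longrightarrow> (norm (snd (\<pi> \<epsilon> h x) - snd x))\<^sup>2 \<le> K * h"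
    using wave_parabolic_comparison[of 1] by (metis zero_le_one)
  obtain h1 where h1: "0 < h1" "h1 \<le> 1" "\<And>k s. k \<in> \<A>' \<Longrightarrow> 0 \<le> s \<Longrightarrow> s \<le> h1 \<Longrightarrow> norm (Gop (\<sigma> s k) - Gop k) \<le> \<alpha>"
    using Gop_modulus[OF \<alpha>] by blast
  \<comment> \<open>With K h at most \<alpha>^2, the Hoelder bound keeps the wave velocity within
    \<alpha> of its initial value up to time h.\<close>
  define h where "h = min h1 (\<alpha>\<^sup>2 / (K + 1))"
  have h: "0 < h" "h \<le> h1" "h \<le> 1" using h1 \<alpha> K by (auto simp: h_def)
  have Kh: "K * h \<le> \<alpha>\<^sup>2"
  proof -
    have "K * h \<le> (K + 1) * (\<alpha>\<^sup>2 / (K + 1))" using K h(1) by (intro mult_mono) (auto simp: h_def)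
    then show ?thesis using K by simp
  qed
  obtain Cj where Cj: "Cj \<ge> 0" "\<And>p. p \<in> V \<Longrightarrow> (norm (fst p))\<^sup>2 \<le> Cj * form p p" using G.j_bound by blast
  \<comment> \<open>An energy of at most q makes the Lebesgue norm at most h \<alpha> / 2; the cap
    1/2 keeps the comparison below its threshold 1.\<close>
  define q where "q = min ((h * \<alpha> / 2)\<^sup>2 / (Cj + 1)) (1 / 2)"
  have q: "q > 0" using h \<alpha> Cj(1) by (auto simp: q_def)
  have q2: "q \<le> 1/2" unfolding q_def by (rule min.cobounded2)
  have small_norm: "norm (fst p) \<le> h * \<alpha> / 2" if "p \<in> V" "form p p \<le> q" for p
  proof (rule power2_le_imp_le)
    have "(norm (fst p))\<^sup>2 \<le> Cj * form p p" by (rule Cj(2)[OF that(1)])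
    also have "\<dots> \<le> (Cj + 1) * ((h * \<alpha> / 2)\<^sup>2 / (Cj + 1))"
      using that(2) Cj(1) G.a_nonneg[OF that(1)] by (intro mult_mono) (auto simp: q_def)
    finally show "(norm (fst p))\<^sup>2 \<le> (h * \<alpha> / 2)\<^sup>2" using Cj(1) by simp
    show "0 \<le> h * \<alpha> / 2" using h \<alpha> by simp
  qed
  \<comment> \<open>The first entry is the share of the first component in the final error. The
    second leaves room for the factor \<Lambda> and for the term with \<epsilon> K.\<close>
  define \<delta> where "\<delta> = min (\<eta>\<^sup>2 / 4) (q / (2 * \<Lambda>))"
  have \<delta>: "\<delta> > 0" using \<eta> q \<Lambda> by (simp add: \<delta>_def)
  obtain \<epsilon>2 where \<epsilon>2: "0 < \<epsilon>2" "\<epsilon>2 \<le> 1"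
    "\<And>\<epsilon> x. 0 < \<epsilon> \<Longrightarrow> \<epsilon> < \<epsilon>2 \<Longrightarrow> x \<in> \<A> \<epsilon> \<Longrightarrow> \<exists>k\<in>\<A>'. form (fst x - k) (fst x - k) < \<delta>"
    using wave_attractor_near_parabolic[OF \<delta>] by blast
  define \<epsilon>1 where "\<epsilon>1 = Min {\<epsilon>2, \<epsilon>0, q / (4 * \<Lambda> * (K + 1))}"
  have pos: "4 * \<Lambda> * (K + 1) > 0" using \<Lambda> K by simp
  show thesis
  proof (rule that[of \<epsilon>1])
    show "0 < \<epsilon>1" using \<epsilon>2 \<epsilon>0 q pos by (simp add: \<epsilon>1_def)
    show "\<epsilon>1 \<le> 1" using \<epsilon>0 by (simp add: \<epsilon>1_def)
    fix \<epsilon> x assume e: "0 < \<epsilon>" "\<epsilon> < \<epsilon>1" and x: "x \<in> \<A> \<epsilon>"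
    have e2: "\<epsilon> < \<epsilon>2" "\<epsilon> \<le> \<epsilon>0" "\<epsilon> < q / (4 * \<Lambda> * (K + 1))" using e by (auto simp: \<epsilon>1_def)
    have \<epsilon>: "\<epsilon> \<in> {0<..1}" using e(1) e2(2) \<epsilon>0 by auto
    note A = attractorD[OF \<epsilon>]
    obtain k where k: "k \<in> \<A>'" "form (fst x - k) (fst x - k) < \<delta>" using \<epsilon>2(3)[OF e(1) e2(1) x] by blast
    have V: "fst x \<in> V" "k \<in> V" using A(1) x k parabolic_attractorD(1) by (auto simp: Z0_def)
    have "\<epsilon> * (4 * \<Lambda> * (K + 1)) < q" using e2(3) pos by (simp only: pos_less_divide_eq)
    moreover have "4 * (\<Lambda> * (\<epsilon> * K)) \<le> \<epsilon> * (4 * \<Lambda> * (K + 1))" using e(1) \<Lambda> by (simp add: algebra_simps)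
    ultimately have s1: "4 * (\<Lambda> * (\<epsilon> * K)) < q" by linarith
    have "form (fst x - k) (fst x - k) \<le> q / (2 * \<Lambda>)" using k(2) by (simp add: \<delta>_def)
    then have "\<Lambda> * form (fst x - k) (fst x - k) \<le> \<Lambda> * (q / (2 * \<Lambda>))" using \<Lambda> by (intro mult_left_mono) auto
    then have s2: "\<Lambda> * form (fst x - k) (fst x - k) \<le> q / 2" using \<Lambda> by simp
    have s3: "\<Lambda> * (form (fst x - k) (fst x - k) + \<epsilon> * K) \<le> q"
      using s1 s2 q by (simp add: distrib_left)
    have zh: "form (fst (\<pi> \<epsilon> h x) - \<sigma> h k) (fst (\<pi> \<epsilon> h x) - \<sigma> h k) \<le> q"
      using comp[OF e(1) e2(2) x V(2) _ less_imp_le[OF h(1)] h(3)] s3 q q2 by linarith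
    have z0: "form (fst x - k) (fst x - k) \<le> q"
    proof -
      have "1 * form (fst x - k) (fst x - k) \<le> \<Lambda> * form (fst x - k) (fst x - k)"
        using \<Lambda> G.a_nonneg[OF subspace_diff[OF subspace_H10 V]] by (intro mult_right_mono) auto
      then show ?thesis using s2 q by linarith
    qed
    have ww: "G.weak_wave \<epsilon> (\<lambda>t. fst (\<pi> \<epsilon> t x)) (\<lambda>t. snd (\<pi> \<epsilon> t x)) (\<lambda>t. fh (fst (\<pi> \<epsilon> t x)))"
      using x A(1) by (intro wave_weak \<epsilon>) auto
    have uV: "fst (\<pi> \<epsilon> h x) \<in> V" "\<sigma> h k \<in> V"
      using ww parabolic_weak[OF V(2)] h(1) by (auto simp: G.weak_wave_def G.weak_parabolic_def)
    have du: "((\<lambda>s. fst (fst (\<pi> \<epsilon> s x))) has_vector_derivative snd (\<pi> \<epsilon> t x)) (at t within {0..})" if "0 \<le> t" for t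
      using ww that by (simp add: G.weak_wave_def)
    have a: "norm (fst (fst (\<pi> \<epsilon> h x)) - fst (fst (\<pi> \<epsilon> 0 x)) - (h - 0) *\<^sub>R snd x) \<le> \<alpha> * (h - 0)"
    proof (rule increment_bound[OF du order_refl less_imp_le[OF h(1)]])
      fix r assume r: "0 \<le> r" "r \<le> h"
      have "(norm (snd (\<pi> \<epsilon> r x) - snd x))\<^sup>2 \<le> K * r" using r h by (intro Hoelder e e2 x) auto
      also have "\<dots> \<le> \<alpha>\<^sup>2" using Kh mult_left_mono[OF r(2) K] by linarith
      finally show "norm (snd (\<pi> \<epsilon> r x) - snd x) \<le> \<alpha>" by (rule power2_le_imp_le) (use \<alpha> in simp)
    qed
    have b: "norm (fst (\<sigma> h k) - fst k - h *\<^sub>R Gop k) \<le> \<alpha> * h"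
      using h h1(3)[OF k(1)] by (intro parabolic_increment[OF k(1)]) auto
    have c: "norm (fst (fst (\<pi> \<epsilon> h x) - \<sigma> h k)) \<le> h * \<alpha> / 2" "norm (fst (fst x - k)) \<le> h * \<alpha> / 2"
      by (intro small_norm subspace_diff[OF subspace_H10] uV V zh z0)+
    \<comment> \<open>\<open>d1\<close> and \<open>d2\<close> are the errors of the two difference
      quotients, multiplied by h and thus at most \<alpha> h each; \<open>d3\<close> and
      \<open>d4\<close> are the distances of the two flows at times h and 0, at most h \<alpha> / 2
      each.\<close>
    define d1 d2 d3 d4 where "d1 = fst (fst (\<pi> \<epsilon> h x)) - fst (fst x) - h *\<^sub>R snd x"
      and "d2 = fst (\<sigma> h k) - fst k - h *\<^sub>R Gop k" and "d3 = fst (fst (\<pi> \<epsilon> h x) - \<sigma> h k)" and "d4 = fst (fst x - k)"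
    have "h *\<^sub>R (snd x - Gop k) = d2 - d1 + (d3 - d4)"
      by (simp add: d1_def d2_def d3_def d4_def scaleR_diff_right)
    then have "norm (h *\<^sub>R (snd x - Gop k)) \<le> (norm d2 + norm d1) + (norm d3 + norm d4)"
      using norm_triangle_ineq[of "d2 - d1" "d3 - d4"] norm_triangle_ineq4[of d2 d1] norm_triangle_ineq4[of d3 d4] by simp
    also have "\<dots> \<le> (\<alpha> * h + \<alpha> * h) + (h * \<alpha> / 2 + h * \<alpha> / 2)"
      using a b c A(4)[OF x] by (intro add_mono) (auto simp: d1_def d2_def d3_def d4_def)
    also have "\<dots> = h * (3 * \<alpha>)" by simp
    finally have v: "norm (snd x - Gop k) \<le> \<eta> / 2" using h(1) by (simp add: \<alpha>_def)
    have "norm_Z0 \<Omega> A \<beta> (x - (k, Gop k)) = sqrt (form (fst x - k) (fst x - k) + (norm (snd x - Gop k))\<^sup>2)"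
      unfolding norm_Z0_def fst_diff snd_diff fst_conv snd_conv norm_H10_form[OF subspace_diff[OF subspace_H10 V]] ..
    also have "\<dots> \<le> sqrt (\<eta>\<^sup>2)"
    proof (rule real_sqrt_le_mono)
      have "(norm (snd x - Gop k))\<^sup>2 \<le> (\<eta> / 2)\<^sup>2" using v by (intro power_mono) auto
      then have "form (fst x - k) (fst x - k) + (norm (snd x - Gop k))\<^sup>2 \<le> \<eta>\<^sup>2 / 4 + (\<eta> / 2)\<^sup>2"
        using k(2) by (intro add_mono) (auto simp: \<delta>_def)
      also have "\<dots> \<le> \<eta>\<^sup>2" by (simp add: power_divide)
      finally show "form (fst x - k) (fst x - k) + (norm (snd x - Gop k))\<^sup>2 \<le> \<eta>\<^sup>2" .
    qed
    also have "\<dots> = \<eta>" using \<eta> by simp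
    finally have "norm_Z0 \<Omega> A \<beta> (x - (k, Gop k)) \<le> \<eta>" .
    moreover have "(k, Gop k) \<in> \<A> 0" using k(1) by (auto simp: attr_0 Gop_def)
    ultimately show "\<exists>z\<in>\<A> 0. norm_Z0 \<Omega> A \<beta> (x - z) \<le> \<eta>" by blast
  qed
qed

text \<open>Suprema and infima of reals are informative only for nonempty sets bounded on the
  relevant side; what is added here to the preceding estimate is that both attractors are nonempty
  and the distances bounded.\<close>

lemma upper_semicontinuous:
  "((\<lambda>\<epsilon>. SUP y\<in>\<A> \<epsilon>. INF z\<in>\<A> 0. norm_Z0 \<Omega> A \<beta> (y - z)) \<longlongrightarrow> 0) (at_right 0)"
proof (rule tendstoI)
  fix \<eta> :: real assume \<eta>: "\<eta> > 0"
  obtain \<epsilon>1 where \<epsilon>1: "0 < \<epsilon>1" "\<epsilon>1 \<le> 1"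
    "\<And>\<epsilon> x. 0 < \<epsilon> \<Longrightarrow> \<epsilon> < \<epsilon>1 \<Longrightarrow> x \<in> \<A> \<epsilon> \<Longrightarrow> \<exists>z\<in>\<A> 0. norm_Z0 \<Omega> A \<beta> (x - z) \<le> \<eta> / 2"
    using wave_attractor_near_A0[of "\<eta> / 2"] \<eta> by auto
  have bdd: "bdd_below ((\<lambda>z. norm_Z0 \<Omega> A \<beta> (y - z)) ` \<A> 0)" for y
    by (rule bdd_belowI2[of _ 0]) (simp add: norm_Z0_def)
  have ne0: "\<A> 0 \<noteq> {}" using parabolic_attractorD(3) by (simp add: attr_0)
  show "\<forall>\<^sub>F \<epsilon> in at_right 0. dist (SUP y\<in>\<A> \<epsilon>. INF z\<in>\<A> 0. norm_Z0 \<Omega> A \<beta> (y - z)) 0 < \<eta>"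
    unfolding eventually_at_right_field
  proof (intro exI[of _ \<epsilon>1] conjI allI impI \<epsilon>1(1))
    fix \<epsilon> assume e: "0 < \<epsilon>" "\<epsilon> < \<epsilon>1"
    have ne: "\<A> \<epsilon> \<noteq> {}" using attractorD(5)[of \<epsilon>] e \<epsilon>1(2) by simp
    define I where "I y = (INF z\<in>\<A> 0. norm_Z0 \<Omega> A \<beta> (y - z))" for y
    have I0: "0 \<le> I y" for y
      unfolding I_def by (rule cINF_greatest[OF ne0]) (simp add: norm_Z0_def)
    have I1: "I y \<le> \<eta> / 2" if y: "y \<in> \<A> \<epsilon>" for y
    proof -
      obtain z where z: "z \<in> \<A> 0" "norm_Z0 \<Omega> A \<beta> (y - z) \<le> \<eta> / 2" using \<epsilon>1(3)[OF e y] by blast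
      show ?thesis unfolding I_def by (rule cINF_lower2[OF bdd z])
    qed
    have "(SUP y\<in>\<A> \<epsilon>. I y) \<le> \<eta> / 2" by (rule cSUP_least[OF ne I1])
    moreover have "0 \<le> (SUP y\<in>\<A> \<epsilon>. I y)"
    proof -
      obtain y where y: "y \<in> \<A> \<epsilon>" using ne by blast
      have "bdd_above (I ` \<A> \<epsilon>)" by (rule bdd_aboveI2[OF I1])
      from cSUP_upper2[OF this y I0] show ?thesis .
    qed
    ultimately show "dist (SUP y\<in>\<A> \<epsilon>. INF z\<in>\<A> 0. norm_Z0 \<Omega> A \<beta> (y - z)) 0 < \<eta>"
      using \<eta> unfolding I_def by (simp add: dist_real_def)
  qed
qed

end

section \<open>Deduction of the theorem\<close>

lemma has_real_derivative_primitive: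
  fixes g G :: "real \<Rightarrow> real"
  assumes g: "continuous_on UNIV g" and G: "\<And>u. G u = (LBINT s=0..u. g s)"
  shows "(G has_real_derivative g s) (at s)"
proof -
  \<comment> \<open>A symmetric interval that contains 0 and has \<open>s\<close> in its interior;
    the oriented integral covers negative arguments as well.\<close>
  define N where "N = \<bar>s\<bar> + 1"
  have N: "-N \<le> 0" "0 \<le> N" "-N \<le> s" "s \<le> N" and interior: "s \<in> interior {-N..N}" by (auto simp: N_def)
  have "((\<lambda>u. LBINT y=ereal 0..u. g y) has_vector_derivative g s) (at s within {-N..N})"
    by (rule interval_integral_FTC2[OF N(1,2) continuous_on_subset[OF g] N(3,4)]) simp
  then show ?thesis
    by (simp add: at_within_interior[OF interior] has_real_derivative_iff_has_vector_derivative zero_ereal_def G[abs_def])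
qed

theorem theorem5p3:
  fixes \<Omega> :: "(real^3) set"
    and A :: "real^3 \<Rightarrow> real^3^3" and a0 a1 :: real
    and \<beta> :: "real^3 \<Rightarrow> real" and lam1 :: real
    and f :: "real^3 \<Rightarrow> real \<Rightarrow> real" and F :: "real^3 \<Rightarrow> real \<Rightarrow> real"
    and C \<mu> :: real and c :: "real^3 \<Rightarrow> real"
    and T :: "real \<Rightarrow> real \<Rightarrow> jet \<times> L2 \<Rightarrow> jet \<times> L2"
    and S :: "real \<Rightarrow> L2 \<Rightarrow> L2"
    and \<pi> :: "real \<Rightarrow> real \<Rightarrow> jet \<times> L2 \<Rightarrow> jet \<times> L2"
    and \<sigma> :: "real \<Rightarrow> jet \<Rightarrow> jet"
    and \<A> :: "real \<Rightarrow> (jet \<times> L2) set" and \<A>' :: "jet set"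
    and R :: real
  assumes "open \<Omega>"
    \<comment> \<open>coefficients\<close>
    and "a0 > 0" and "a1 > 0"
    and "\<And>i j. ess_bounded (lebesgue_on \<Omega>) (\<lambda>x. A x $ i $ j)"
    and "\<And>i j. AE x in lebesgue_on \<Omega>. A x $ i $ j = A x $ j $ i"
    and "AE x in lebesgue_on \<Omega>. \<forall>\<xi>::real^3.
           a0 * (norm \<xi>)\<^sup>2 \<le> (\<Sum>i\<in>UNIV. \<Sum>j\<in>UNIV. A x $ i $ j * \<xi> $ i * \<xi> $ j) \<and>
           (\<Sum>i\<in>UNIV. \<Sum>j\<in>UNIV. A x $ i $ j * \<xi> $ i * \<xi> $ j) \<le> a1 * (norm \<xi>)\<^sup>2"
    and "\<beta> \<in> borel_measurable (lebesgue_on \<Omega>)"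
    and "\<And>\<nu>. \<nu> > 0 \<Longrightarrow> \<exists>C\<^sub>\<nu>>0. \<forall>u\<in>H10 \<Omega>.
           (\<integral>\<^sup>+x. ennreal (\<bar>\<beta> x\<bar> * (val u x)\<^sup>2) \<partial>lebesgue_on \<Omega>) \<le>
           ennreal (\<nu> * (\<integral>x. (norm (grad u x))\<^sup>2 \<partial>lebesgue_on \<Omega>) +
                    C\<^sub>\<nu> * (\<integral>x. (val u x)\<^sup>2 \<partial>lebesgue_on \<Omega>))"
    and "lam1 > 0"
    and "\<And>u. u \<in> H10 \<Omega> \<Longrightarrow>
           (\<integral>x. (A x *v grad u x) \<bullet> grad u x \<partial>lebesgue_on \<Omega>) +
           (\<integral>x. \<beta> x * (val u x)\<^sup>2 \<partial>lebesgue_on \<Omega>) \<ge>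
           lam1 * (\<integral>x. (val u x)\<^sup>2 \<partial>lebesgue_on \<Omega>)"
    \<comment> \<open>nonlinearity\<close>
    and "\<And>u. (\<lambda>x. f x u) \<in> borel_measurable (lebesgue_on \<Omega>)"
    and "sq_integrable (lebesgue_on \<Omega>) (\<lambda>x. f x 0)"
    and "AE x in lebesgue_on \<Omega>. C2 (f x)"
    and "ess_bounded (lebesgue_on \<Omega>) (\<lambda>x. deriv (f x) 0)"
    and "ess_bounded (lebesgue_on \<Omega>) (\<lambda>x. deriv (deriv (f x)) 0)"
    and "C > 0"
    and "AE x in lebesgue_on \<Omega>. \<forall>u1 u2.
           \<bar>deriv (deriv (f x)) u1 - deriv (deriv (f x)) u2\<bar> \<le> C * \<bar>u1 - u2\<bar>"
    and "\<And>x u. F x u = (LBINT s=0..u. f x s)"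
    and "\<mu> > 0"
    and "sq_integrable (lebesgue_on \<Omega>) c"
    and "AE x in lebesgue_on \<Omega>. \<forall>u. f x u * u - \<mu> * F x u \<le> c x \<and> F x u \<le> c x"
    \<comment> \<open>the semigroups\<close>
    and "\<And>\<epsilon>. \<epsilon> \<in> {0<..1} \<Longrightarrow> generates (Z0 \<Omega>) (wave_graph \<Omega> A \<beta> \<epsilon>) (T \<epsilon>)"
    and "generates (L2_on \<Omega>) (parabolic_graph \<Omega> A \<beta>) S"
    \<comment> \<open>the semiflows and their attractors\<close>
    and "\<And>\<epsilon>. \<epsilon> \<in> {0<..1} \<Longrightarrow> generates_semiflow (Z0 \<Omega>) (wave_mild \<Omega> f \<epsilon> (T \<epsilon>)) (\<pi> \<epsilon>)"
    and "\<And>\<epsilon>. \<epsilon> \<in> {0<..1} \<Longrightarrow> compact_global_attractor (Z0 \<Omega>) (\<pi> \<epsilon>) (\<A> \<epsilon>)"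
    and "R > 0"
    and "\<And>\<epsilon> u v. \<epsilon> \<in> {0<..1} \<Longrightarrow> (u, v) \<in> \<A> \<epsilon> \<Longrightarrow>
           (norm_H10 \<Omega> A \<beta> u)\<^sup>2 + \<epsilon> * (norm v)\<^sup>2 \<le> R"
    and "generates_semiflow (H10 \<Omega>) (parabolic_mild \<Omega> f S) \<sigma>"
    and "compact_global_attractor (H10 \<Omega>) \<sigma> \<A>'"
    and "\<A>' \<subseteq> dom_op \<Omega> A \<beta>"
    and "compactin (dom_topology \<Omega> A \<beta>) \<A>'"
    and "\<A> 0 = (\<lambda>u. (u, - elliptic_op \<Omega> A \<beta> u + nemytskii \<Omega> f u)) ` \<A>'"
  shows "((\<lambda>\<epsilon>. SUP y\<in>\<A> \<epsilon>. INF z\<in>\<A> 0. norm_Z0 \<Omega> A \<beta> (y - z)) \<longlongrightarrow> 0) (at_right 0)"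
proof -
  obtain b1 b2 where b: "AE x in lebesgue_on \<Omega>. \<bar>deriv (f x) 0\<bar> \<le> b1"
      "AE x in lebesgue_on \<Omega>. \<bar>deriv (deriv (f x)) 0\<bar> \<le> b2"
    using assms(14,15) unfolding ess_bounded_def by blast
  \<comment> \<open>The factor in the quadratic growth bound for the first derivative; absolute
    values guard against negative essential bounds.\<close>
  define D where "D = \<bar>b1\<bar> + \<bar>b2\<bar> + C"
  have D: "D \<ge> 0" using \<open>C > 0\<close> by (simp add: D_def)
  have df: "(f x has_real_derivative deriv (f x) s) (at s)" if "C2 (f x)" for x s
    using that by (auto simp: C2_def DERIV_deriv_iff_field_differentiable)
  have cont: "continuous_on UNIV (f x)" if "C2 (f x)" for x
    using DERIV_isCont[OF df[OF that]] by (simp add: continuous_on_eq_continuous_at)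
  have growth: "AE x in lebesgue_on \<Omega>. continuous_on UNIV (f x) \<and>
      (\<forall>p q. \<bar>f x p - f x q\<bar> \<le> D * (1 + p\<^sup>2 + q\<^sup>2) * \<bar>p - q\<bar>)"
    using assms(13,17) b
  proof eventually_elim
    case (elim x)
    have "\<bar>deriv (f x) s\<bar> \<le> D * (1 + s\<^sup>2)" for s
      unfolding D_def by (rule derivative_growth[OF elim(1)]) (use elim \<open>C > 0\<close> in auto)
    then show ?case using increment_of_growth[OF df[OF elim(1)] _ D] cont[OF elim(1)] by blast
  qed
  have "AE x in lebesgue_on \<Omega>. F x 0 = 0 \<and> (\<forall>s. (F x has_real_derivative f x s) (at s))"
    using assms(13)
  proof eventually_elim
    case (elim x)
    show ?case
      using has_real_derivative_primitive[OF cont[OF elim], of "F x"] assms(18)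
      by (simp add: zero_ereal_def)
  qed
  then interpret attractor_setting \<Omega> A a0 a1 \<beta> lam1 f F D T S \<pi> \<sigma> \<A> \<A>' R
    using assms D growth by unfold_locales
  show ?thesis by (rule upper_semicontinuous)
qed

end
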